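(* Let $\Gamma$ be a finitely generated group that has a finite-dimensional linear representation with infinite image, i.e. there exist a field $F$, an integer $n\geq1$ and a homomorphism $\Gamma\to\operatorname{GL}_n(F)$ with infinite image. Then $$\kappa_{\mathrm u}(\Gamma)=\tau_{\mathrm u}(\Gamma)=0.$$ In particular, $\tau_{\mathrm u}(\operatorname{Aut}(F_n))=\kappa_{\mathrm u}(\operatorname{Aut}(F_n))=0$ for every $n\geq 4$, where $F_n$ denotes the free group of rank $n$.
   Context: For a finitely generated group $\Gamma$ and a finite generating set $S$ of $\Gamma$, the Kazhdan constant is $$\kappa(\Gamma,S)=\inf_{\pi}\ \inf_{\substack{\xi\in\mathcal H\\ \|\xi\|=1}}\ \max_{s\in S}\|\pi(s)\xi-\xi\|,$$ where the first infimum is over all unitary representations $\pi:\Gamma\to\mathcal U(\mathcal H)$ on Hilbert spaces with $\mathcal H^\Gamma=\{0\}$ (no nonzero $\Gamma$-invariant vectors). The constant $\tau(\Gamma,S)$ is defined by the same formula, with the first infimum restricted to such representations $\pi$ having finite image. Set $$\kappa_{\mathrm u}(\Gamma)=\inf_{S}\kappa(\Gamma,S),\qquad \tau_{\mathrm u}(\Gamma)=\inf_S\tau(\Gamma,S),$$ both infima over all finite generating sets $S$ of $\Gamma$. *)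

theory Defs
  imports
    "HOL-Algebra.Algebra"
    "HOL-Analysis.Abstract_Metric_Spaces"
    "HOL-Library.Extended_Nonnegative_Real"
    "Jordan_Normal_Form.Matrix"
begin

section \<open>Complex Hilbert spaces\<close>

text \<open>
  HOL-Algebra's modules carry the ring operations \<open>mult\<close> and \<open>one\<close> as part of the record; these two
  fields play no role here. The inner product is linear in its first argument.
\<close>

record 'h hilbert = "(complex, 'h) module" +
  h_inner :: "'h \<Rightarrow> 'h \<Rightarrow> complex"

definition complex_field :: "complex ring" where
  "complex_field = \<lparr>carrier = UNIV, monoid.mult = (*), one = 1, ring.zero = 0, add = (+)\<rparr>"

definition h_norm :: "'h hilbert \<Rightarrow> 'h \<Rightarrow> real" where
  "h_norm H x = sqrt (Re (h_inner H x x))"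

locale complex_hilbert_space = Module.module complex_field H for H :: "'h hilbert" (structure) +
  assumes h_inner_add:
      "\<lbrakk>x \<in> carrier H; y \<in> carrier H; z \<in> carrier H\<rbrakk>
        \<Longrightarrow> h_inner H (x \<oplus> y) z = h_inner H x z + h_inner H y z"
    and h_inner_smult:
      "\<lbrakk>x \<in> carrier H; y \<in> carrier H\<rbrakk> \<Longrightarrow> h_inner H (c \<odot> x) y = c * h_inner H x y"
    and h_inner_cnj:
      "\<lbrakk>x \<in> carrier H; y \<in> carrier H\<rbrakk> \<Longrightarrow> h_inner H y x = cnj (h_inner H x y)"
    and h_inner_pos:
      "\<lbrakk>x \<in> carrier H; x \<noteq> \<zero>\<rbrakk> \<Longrightarrow> 0 < Re (h_inner H x x)"
    and complete:
      "Metric_space.mcomplete (carrier H) (\<lambda>x y. h_norm H (x \<ominus> y))"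

text \<open>
  As in \<^const>\<open>BijGroup\<close>, operators are functions that are extensional on the carrier, so that
  distinct elements of the unitary group are distinct maps on the space.
\<close>

definition unitary_group :: "'h hilbert \<Rightarrow> ('h \<Rightarrow> 'h) monoid" where
  "unitary_group H = BijGroup (carrier H)
    \<lparr>carrier := {U \<in> Bij (carrier H).
        (\<forall>x\<in>carrier H. \<forall>y\<in>carrier H. U (x \<oplus>\<^bsub>H\<^esub> y) = U x \<oplus>\<^bsub>H\<^esub> U y) \<and>
        (\<forall>c. \<forall>x\<in>carrier H. U (c \<odot>\<^bsub>H\<^esub> x) = c \<odot>\<^bsub>H\<^esub> U x) \<and>
        (\<forall>x\<in>carrier H. \<forall>y\<in>carrier H. h_inner H (U x) (U y) = h_inner H x y)}\<rparr>"

section \<open>Kazhdan constants\<close>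

definition invariant_vectors ::
    "('g, 'm) monoid_scheme \<Rightarrow> 'h hilbert \<Rightarrow> ('g \<Rightarrow> 'h \<Rightarrow> 'h) \<Rightarrow> 'h set" where
  "invariant_vectors G H \<pi> = {x \<in> carrier H. \<forall>g\<in>carrier G. \<pi> g x = x}"

text \<open>
  A definition cannot range over the Hilbert spaces of all types, so the type \<open>'h\<close> in which the
  underlying sets of the Hilbert spaces live is a parameter of the constants.
  For countable groups the value does not depend on \<open>'h\<close> once \<open>'h\<close> has at least the cardinality of
  the continuum: one may replace a representation by the closed linear span of the orbit of
  \<open>\<xi>\<close>, which is separable, has no nonzero invariant vectors if the representation has none, and has
  finite image if the representation has. Every type of the form \<open>'i \<Rightarrow> complex\<close> is large enough,
  and with \<open>'i\<close> arbitrary these types cover Hilbert spaces of every cardinality.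
\<close>

definition reps_without_invariants ::
    "'h itself \<Rightarrow> ('g, 'm) monoid_scheme \<Rightarrow> ('h hilbert \<times> ('g \<Rightarrow> 'h \<Rightarrow> 'h)) set" where
  "reps_without_invariants _ G =
    {(H, \<pi>). complex_hilbert_space H \<and> \<pi> \<in> hom G (unitary_group H) \<and>
             invariant_vectors G H \<pi> = {\<zero>\<^bsub>H\<^esub>}}"

definition finite_reps_without_invariants ::
    "'h itself \<Rightarrow> ('g, 'm) monoid_scheme \<Rightarrow> ('h hilbert \<times> ('g \<Rightarrow> 'h \<Rightarrow> 'h)) set" where
  "finite_reps_without_invariants h G =
    {(H, \<pi>) \<in> reps_without_invariants h G. finite (\<pi> ` carrier G)}"

text \<open>
  The infima are taken in \<^typ>\<open>ennreal\<close>, where the infimum of the empty set is \<open>\<infinity>\<close>.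
\<close>

definition min_displacement ::
    "('h hilbert \<times> ('g \<Rightarrow> 'h \<Rightarrow> 'h)) set \<Rightarrow> 'g set \<Rightarrow> ennreal" where
  "min_displacement R S =
    (INF (H, \<pi>)\<in>R. INF \<xi>\<in>{\<xi> \<in> carrier H. h_norm H \<xi> = 1}.
       SUP s\<in>S. ennreal (h_norm H (\<pi> s \<xi> \<ominus>\<^bsub>H\<^esub> \<xi>)))"

definition kazhdan_const :: "'h itself \<Rightarrow> ('g, 'm) monoid_scheme \<Rightarrow> 'g set \<Rightarrow> ennreal" where
  "kazhdan_const h G S = min_displacement (reps_without_invariants h G) S"

definition tau_const :: "'h itself \<Rightarrow> ('g, 'm) monoid_scheme \<Rightarrow> 'g set \<Rightarrow> ennreal" where
  "tau_const h G S = min_displacement (finite_reps_without_invariants h G) S"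

definition finite_generating_sets :: "('g, 'm) monoid_scheme \<Rightarrow> 'g set set" where
  "finite_generating_sets G = {S. finite S \<and> S \<subseteq> carrier G \<and> generate G S = carrier G}"

definition uniform_kazhdan_const :: "'h itself \<Rightarrow> ('g, 'm) monoid_scheme \<Rightarrow> ennreal" where
  "uniform_kazhdan_const h G = (INF S\<in>finite_generating_sets G. kazhdan_const h G S)"

definition uniform_tau_const :: "'h itself \<Rightarrow> ('g, 'm) monoid_scheme \<Rightarrow> ennreal" where
  "uniform_tau_const h G = (INF S\<in>finite_generating_sets G. tau_const h G S)"

section \<open>General linear groups\<close>

definition GL :: "'f::field itself \<Rightarrow> nat \<Rightarrow> 'f mat monoid" where
  "GL f n = units_of (ring_mat f n ())"

section \<open>Free groups\<close>

text \<open>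
  The free group of rank \<open>n\<close> as the group of reduced words: the letter \<open>(i, True)\<close> is the
  \<open>i\<close>-th basis element and \<open>(i, False)\<close> its inverse.
\<close>

definition inv_letter :: "nat \<times> bool \<Rightarrow> nat \<times> bool" where
  "inv_letter x = (fst x, \<not> snd x)"

fun reduced :: "(nat \<times> bool) list \<Rightarrow> bool" where
  "reduced (x # y # w) \<longleftrightarrow> y \<noteq> inv_letter x \<and> reduced (y # w)"
| "reduced _ \<longleftrightarrow> True"

fun push :: "nat \<times> bool \<Rightarrow> (nat \<times> bool) list \<Rightarrow> (nat \<times> bool) list" where
  "push x [] = [x]"
| "push x (y # w) = (if y = inv_letter x then w else x # y # w)"

definition free_group :: "nat \<Rightarrow> (nat \<times> bool) list monoid" where
  "free_group n =
    \<lparr>carrier = {w. reduced w \<and> fst ` set w \<subseteq> {..<n}}, monoid.mult = foldr push, one = []\<rparr>"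

lemma inv_letter_simps [simp]:
  "inv_letter (inv_letter x) = x" "fst (inv_letter x) = fst x"
  "inv_letter x \<noteq> x" "x \<noteq> inv_letter x"
  by (auto simp: inv_letter_def prod_eq_iff)

lemma reduced_tl: "reduced (x # w) \<Longrightarrow> reduced w"
  by (cases w) auto

lemma reduced_push: "reduced w \<Longrightarrow> reduced (push x w)"
  by (cases w) (auto dest: reduced_tl)

lemma reduced_foldr_push: "reduced w \<Longrightarrow> reduced (foldr push u w)"
  by (induction u) (auto intro: reduced_push)

lemma push_inv_letter: "reduced w \<Longrightarrow> push (inv_letter x) (push x w) = w"
  by (cases w; cases "tl w") auto

lemma push_inv_letter': "reduced w \<Longrightarrow> push x (push (inv_letter x) w) = w"
  using push_inv_letter[of w "inv_letter x"] by simp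

lemma push_reduced: "reduced (x # w) \<Longrightarrow> push x w = x # w"
  by (cases w) auto

lemma foldr_push_Nil: "reduced w \<Longrightarrow> foldr push w [] = w"
proof (induction w)
  case (Cons x w)
  then show ?case using push_reduced[of x w] reduced_tl[of x w] by simp
qed simp

lemma foldr_push_push:
  assumes "reduced w" shows "foldr push (push x v) w = push x (foldr push v w)"
  using assms by (cases v) (auto simp: push_inv_letter' reduced_foldr_push)

lemma foldr_push_assoc:
  "reduced w \<Longrightarrow> foldr push (foldr push u v) w = foldr push u (foldr push v w)"
  by (induction u) (auto simp: foldr_push_push)

lemma set_push: "fst ` set (push x w) \<subseteq> insert (fst x) (fst ` set w)"
  by (cases w) auto

lemma set_foldr_push: "fst ` set (foldr push u v) \<subseteq> fst ` set u \<union> fst ` set v"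
proof (induction u)
  case (Cons a u)
  then have "fst ` set (push a (foldr push u v)) \<subseteq> insert (fst a) (fst ` set u \<union> fst ` set v)"
    using set_push[of a "foldr push u v"] by blast
  then show ?case by simp
qed simp

lemma foldr_push_left_inverse:
  assumes "reduced w" shows "foldr push (rev (map inv_letter u)) (foldr push u w) = w"
  using assms
  by (induction u arbitrary: w) (auto simp: push_inv_letter reduced_foldr_push)

lemma group_free_group: "group (free_group n)"
proof (rule groupI)
  fix u v w
  assume uvw: "u \<in> carrier (free_group n)" "v \<in> carrier (free_group n)" "w \<in> carrier (free_group n)"
  show "u \<otimes>\<^bsub>free_group n\<^esub> v \<in> carrier (free_group n)"
    using uvw subset_trans[OF set_foldr_push[of u v], of "{..<n}"]
    by (simp add: free_group_def reduced_foldr_push)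
  show "u \<otimes>\<^bsub>free_group n\<^esub> v \<otimes>\<^bsub>free_group n\<^esub> w = u \<otimes>\<^bsub>free_group n\<^esub> (v \<otimes>\<^bsub>free_group n\<^esub> w)"
    using uvw by (auto simp: free_group_def foldr_push_assoc)
next
  fix w
  assume w: "w \<in> carrier (free_group n)"
  let ?v = "foldr push (rev (map inv_letter w)) []"
  have "fst ` set ?v \<subseteq> fst ` set w"
    using set_foldr_push[of "rev (map inv_letter w)" "[]"] by (auto simp: image_image)
  then have "?v \<in> carrier (free_group n)"
    using w by (auto simp: free_group_def reduced_foldr_push)
  moreover have "?v \<otimes>\<^bsub>free_group n\<^esub> w = \<one>\<^bsub>free_group n\<^esub>"
  proof -
    have "foldr push ?v w = foldr push (rev (map inv_letter w)) (foldr push [] w)"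
      using w by (subst foldr_push_assoc) (auto simp: free_group_def)
    also have "\<dots> = foldr push (rev (map inv_letter w)) (foldr push w [])"
      using w by (simp add: free_group_def foldr_push_Nil)
    also have "\<dots> = []"
      by (rule foldr_push_left_inverse) simp
    finally show ?thesis by (simp add: free_group_def)
  qed
  ultimately show "\<exists>v\<in>carrier (free_group n). v \<otimes>\<^bsub>free_group n\<^esub> w = \<one>\<^bsub>free_group n\<^esub>"
    by blast
qed (auto simp: free_group_def foldr_push_Nil)

lemma free_group_universal:
  fixes K (structure)
  assumes "group K" and f: "f \<in> {..<n} \<rightarrow> carrier K"
  shows "\<exists>\<phi>\<in>hom (free_group n) K. \<forall>i<n. \<phi> [(i, True)] = f i"
proof -
  interpret K: group K by fact
  define l where "l x = (if snd x then f (fst x) else inv (f (fst x)))" for x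
  define \<phi> where "\<phi> w = foldr (\<lambda>x a. l x \<otimes> a) w \<one>" for w
  have l: "l x \<in> carrier K" if "fst x < n" for x
    using f that by (auto simp: l_def)
  have linv: "l x \<otimes> l (inv_letter x) = \<one>" if "fst x < n" for x
    using f that by (auto simp: l_def inv_letter_def Pi_iff)
  have closed: "\<phi> w \<in> carrier K" if "fst ` set w \<subseteq> {..<n}" for w
    using that by (induction w) (auto simp: \<phi>_def l)
  have push: "\<phi> (push x w) = l x \<otimes> \<phi> w" if "fst ` set (x # w) \<subseteq> {..<n}" for x w
  proof (cases w)
    case (Cons y v)
    have "l x \<otimes> (l (inv_letter x) \<otimes> \<phi> v) = \<phi> v"
      using that Cons closed[of v] l[of x] l[of "inv_letter x"] linv[of x]
      by (simp add: K.m_assoc[symmetric])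
    then show ?thesis using Cons by (auto simp: \<phi>_def)
  qed (auto simp: \<phi>_def)
  have "\<phi> (foldr push u v) = \<phi> u \<otimes> \<phi> v"
    if "fst ` set u \<subseteq> {..<n}" "fst ` set v \<subseteq> {..<n}" for u v
    using that(1)
  proof (induction u)
    case Nil
    then show ?case using closed[OF that(2)] by (simp add: \<phi>_def)
  next
    case (Cons x u)
    have "\<phi> (push x (foldr push u v)) = l x \<otimes> \<phi> (foldr push u v)"
      using Cons.prems that(2) subset_trans[OF set_foldr_push[of u v], of "{..<n}"]
      by (intro push) simp
    also have "\<dots> = (l x \<otimes> \<phi> u) \<otimes> \<phi> v"
      using Cons closed[OF that(2)] closed[of u] l[of x] by (simp add: K.m_assoc)
    finally show ?case by (simp add: \<phi>_def)
  qed
  then have "\<phi> \<in> hom (free_group n) K"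
    by (auto simp: hom_def free_group_def closed)
  moreover have "\<phi> [(i, True)] = f i" if "i < n" for i
    using l[of "(i, True)"] that by (simp add: \<phi>_def l_def)
  ultimately show ?thesis by blast
qed

lemma free_group_generated:
  "generate (free_group n) ((\<lambda>i. [(i, True)]) ` {..<n}) = carrier (free_group n)"
proof
  interpret group "free_group n" by (rule group_free_group)
  let ?B = "(\<lambda>i. [(i, True)]) ` {..<n}"
  have B: "?B \<subseteq> carrier (free_group n)"
    by (auto simp: free_group_def)
  then show "generate (free_group n) ?B \<subseteq> carrier (free_group n)"
    by (rule generate_incl)
  have letter: "[x] \<in> generate (free_group n) ?B" if x: "fst x < n" for x
  proof (cases "snd x")
    case True
    then have "[x] \<in> ?B" using x by (cases x) auto
    then show ?thesis by (rule generate.incl)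
  next
    case False
    have "inv\<^bsub>free_group n\<^esub> [(fst x, True)] = [x]"
      using x False by (intro inv_equality) (cases x; auto simp: free_group_def inv_letter_def)+
    moreover have "[(fst x, True)] \<in> ?B" using x by auto
    ultimately show ?thesis using generate.inv[of "[(fst x, True)]" ?B "free_group n"] by simp
  qed
  show "carrier (free_group n) \<subseteq> generate (free_group n) ?B"
  proof
    fix w
    assume "w \<in> carrier (free_group n)"
    then show "w \<in> generate (free_group n) ?B"
    proof (induction w)
      case Nil
      then show ?case using generate.one[of "free_group n" ?B] by (simp add: free_group_def)
    next
      case (Cons x w)
      then have "w \<in> generate (free_group n) ?B" "fst x < n" "reduced (x # w)"
        by (auto simp: free_group_def dest: reduced_tl)
      then show ?case
        using generate.eng[OF letter[of x], of w]
        by (simp add: free_group_def push_reduced)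
    qed
  qed
qed

end

theory Submission
  imports
    Defs
    "HOL-Algebra.Algebraic_Closure_Type"
    "HOL-Analysis.L2_Norm"
    "HOL-Computational_Algebra.Polynomial"
    "HOL-Computational_Algebra.Primes"
    "HOL-Number_Theory.Cong"
    "Jordan_Normal_Form.Determinant"
begin

text \<open>
  Call a proper subgroup \<open>H\<close> of finite index a supplement of the finite-index normal subgroup \<open>D\<close> if
  \<open>G = D H\<close>. If every \<open>D\<close> has a supplement, then for every \<open>m\<close> there are proper subgroups
  \<open>H\<^sub>1, \<dots>, H\<^sub>m\<close> of finite index that are independent: \<open>G\<close> acts transitively on the product of the
  coset spaces \<open>G/H\<^sub>k\<close>. Then \<open>G\<close> has a finite generating set each of whose members lies in all but at
  most one of the \<open>H\<^sub>k\<close>. A unit vector spread evenly over the \<open>m\<close> quasi-regular representations on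
  \<open>\<ell>\<^sup>2\<^sub>0(G/H\<^sub>k)\<close> is moved by at most \<open>2/\<surd>m\<close> by these generators, so both constants vanish.

  A supplement of \<open>D\<close> exists as soon as, for some prime \<open>p\<close> not dividing the index of \<open>D\<close>, an element
  of \<open>D\<close> has \<open>p\<close>-power order but is nontrivial in some finite quotient of \<open>G\<close>. For linear groups
  such quotients are congruence quotients over a finitely generated ring \<open>A\<close> containing the matrix
  entries. In characteristic 0 the kernels are pro-\<open>p\<close> for almost all residue characteristics
  \<open>p\<close>. In characteristic \<open>p\<close>, an eigenvalue \<open>\<lambda>\<close> of an element of \<open>D\<close> that is transcendental over the
  prime field can be made congruent to a primitive \<open>l\<close>-th root of unity for a new prime \<open>l\<close>. If there
  is no such eigenvalue, then a subgroup of finite index consists of unipotent elements,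
  and by an argument of Kolchin's type it has finite image.

  The automorphism group of a free group is finitely generated by Nielsen reduction, and its action
  on the abelianisation is a linear representation with infinite image.
\<close>

text \<open>The obstacle is that one prime is not enough. In a pro-\<open>p\<close> group generated
  by \<open>r\<close> elements all maximal open subgroups contain the Frattini subgroup, so at most
  \<open>r\<close> of them are independent; ever more independent subgroups require ever new primes.
  In characteristic 0 the residue characteristic can be varied. In characteristic \<open>p\<close>
  every congruence kernel is pro-\<open>p\<close> for the same \<open>p\<close>, so new primes have
  to come from orders of eigenvalues in residue rings. Since the prime of a supplement does not
  divide the index of \<open>D\<close>, a Sylow subgroup of the image of \<open>D\<close> is one of
  the whole finite quotient; this is what yields the supplement.

  Residue rings come from filtrations that imitate the powers of an ideal and are lifted through one
  generator of \<open>A\<close> at a time. The induction rests on a form of generic freeness: for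
  each nonzero \<open>f\<close> upstairs there is a nonzero \<open>b\<close> downstairs such that
  every filtration with \<open>b\<close> invertible modulo \<open>I 1\<close> lifts to one with
  \<open>f\<close> invertible. In characteristic 0 it is used for \<open>f = 1\<close>; in the
  unipotent case \<open>f\<close> is a coefficient that is to be shown zero.\<close>

no_notation Multiset.subset_mset (infix "<#" 50)
hide_const (open) Divisibility.prime Polynomial.order Polynomial.smult

section \<open>Finite groups\<close>

lemma (in group) cauchy:
  assumes fin: "finite (carrier G)" and q: "prime (q::nat)" "q dvd order G"
  shows "\<exists>x\<in>carrier G. x \<noteq> \<one> \<and> x [^] q = \<one>"
proof -
  obtain m' where "order G = q ^ 1 * m'"
    using q(2) by (auto simp: dvd_def)
  then obtain H where H: "subgroup H G" "card H = q"
    using sylow_thm[of q G 1 m'] q(1) fin is_group by auto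
  have "H \<noteq> {\<one>}"
    using H(2) q(1) by auto
  then obtain x where x: "x \<in> H" "x \<noteq> \<one>"
    using subgroup.one_closed[OF H(1)] by blast
  have xG: "x \<in> carrier G"
    using subgroup.mem_carrier[OF H(1)] x(1) .
  interpret K: group "G\<lparr>carrier := H\<rparr>"
    using subgroup.subgroup_is_group[OF H(1)] is_group by blast
  have "x [^]\<^bsub>G\<lparr>carrier := H\<rparr>\<^esub> q = \<one>"
    using K.pow_order_eq_1[of x] x(1) H(2) by (simp add: Coset.order_def)
  then have "x [^] q = \<one>"
    by (metis nat_pow_consistent)
  then show ?thesis using x(2) xG by blast
qed

lemma (in group) pow_coprime_eq_one:
  assumes "x \<in> carrier G" "x [^] (m::nat) = \<one>" "x [^] (n::nat) = \<one>" "coprime m n"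
  shows "x = \<one>"
proof -
  have "ord x dvd m" "ord x dvd n"
    using assms pow_eq_id by blast+
  then have "ord x = 1"
    using assms(4) by (metis coprime_common_divisor_nat)
  then show ?thesis
    using ord_eq_1 assms(1) by blast
qed

text \<open>By Cauchy's theorem another prime \<open>q\<close> dividing the order would give an
  element of order \<open>q\<close>, whose \<open>p\<close>-power powers are never 1.\<close>

lemma (in group) order_prime_power:
  assumes fin: "finite (carrier G)" and p: "prime (p::nat)"
    and ex: "\<And>x. x \<in> carrier G \<Longrightarrow> \<exists>k::nat. x [^] (p ^ k) = \<one>"
  shows "\<exists>a. order G = p ^ a"
proof -
  have "order G \<noteq> 0"
    using fin order_gt_0_iff_finite by auto
  then obtain m where m: "order G = p ^ multiplicity p (order G) * m" "\<not> p dvd m"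
    using multiplicity_decompose'[of "order G" p] p by (metis not_prime_unit)
  have "m = 1"
  proof (rule ccontr)
    assume "m \<noteq> 1"
    then obtain q where q: "prime q" "q dvd m"
      using prime_factor_nat by blast
    then obtain x where x: "x \<in> carrier G" "x \<noteq> \<one>" "x [^] q = \<one>"
      using cauchy[OF fin q(1)] q(2) m(1) by (metis dvd_mult)
    obtain k where k: "x [^] (p ^ k) = \<one>"
      using ex x(1) by blast
    have "coprime q (p ^ k)"
      by (metis coprime_power_right_iff m(2) p primes_coprime q(1) q(2))
    then show False
      using pow_coprime_eq_one[OF x(1,3) k] x(2) by blast
  qed
  then show ?thesis using m by auto
qed

section \<open>Counting fixed points modulo \<open>p\<close>, and Sylow conjugacy\<close>

text \<open>Only the image of \<open>G\<close> in the symmetric group of the finite set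
  \<open>Y\<close> matters: it is finite and all its elements have \<open>p\<close>-power order, so
  it is a \<open>p\<close>-group and orbits have \<open>p\<close>-power length. Thus
  \<open>G\<close> may be infinite; the lemma is applied to cosets, conjugation, integer
  translations and linear maps.\<close>

lemma fixed_points_cong:
  fixes G (structure)
  assumes "group G" and fin: "finite Y" and p: "prime (p::nat)"
    and Y: "\<And>g x. g \<in> carrier G \<Longrightarrow> x \<in> Y \<Longrightarrow> f g x \<in> Y"
    and mult: "\<And>g h x. g \<in> carrier G \<Longrightarrow> h \<in> carrier G \<Longrightarrow> x \<in> Y \<Longrightarrow> f (g \<otimes>\<^bsub>G\<^esub> h) x = f g (f h x)"
    and one: "\<And>x. x \<in> Y \<Longrightarrow> f \<one>\<^bsub>G\<^esub> x = x"
    and pow: "\<And>g. g \<in> carrier G \<Longrightarrow> \<exists>k. \<forall>x\<in>Y. f (g [^]\<^bsub>G\<^esub> (p ^ k)) x = x"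
  shows "[card Y = card {x \<in> Y. \<forall>g\<in>carrier G. f g x = x}] (mod p)"
proof -
  interpret group G by fact
  interpret B: group "BijGroup Y" by (rule group_BijGroup)
  define \<phi> where "\<phi> g = (\<lambda>x\<in>Y. f g x)" for g
  have inv1: "f (inv g) (f g x) = x" if "g \<in> carrier G" "x \<in> Y" for g x
    using that mult[of "inv g" g x] one by simp
  have inv2: "f g (f (inv g) x) = x" if "g \<in> carrier G" "x \<in> Y" for g x
    using that mult[of g "inv g" x] one by simp
  have Bij: "\<phi> g \<in> Bij Y" if g: "g \<in> carrier G" for g
  proof -
    have "bij_betw (\<phi> g) Y Y"
      by (rule bij_betw_byWitness[where f'="f (inv g)"])
        (use g Y inv1 inv2 in \<open>auto simp: \<phi>_def\<close>)
    then show ?thesis by (simp add: Bij_def \<phi>_def)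
  qed
  have hom: "\<phi> \<in> hom G (BijGroup Y)"
  proof (rule homI)
    fix g h assume gh: "g \<in> carrier G" "h \<in> carrier G"
    then have "\<phi> (g \<otimes> h) = compose Y (\<phi> g) (\<phi> h)"
      by (auto simp: \<phi>_def compose_def mult Y fun_eq_iff)
    then show "\<phi> (g \<otimes> h) = \<phi> g \<otimes>\<^bsub>BijGroup Y\<^esub> \<phi> h"
      using gh Bij by (simp add: BijGroup_def)
  qed (auto simp: BijGroup_def Bij)
  interpret h: group_hom G "BijGroup Y" \<phi>
    using hom by unfold_locales
  define K where "K = BijGroup Y\<lparr>carrier := \<phi> ` carrier G\<rparr>"
  have sub: "subgroup (\<phi> ` carrier G) (BijGroup Y)"
    by (rule h.img_is_subgroup)
  interpret K: group K
    unfolding K_def by (rule subgroup.subgroup_is_group[OF sub B.is_group])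
  have cK: "carrier K = \<phi> ` carrier G" by (simp add: K_def)
  have "Bij Y \<subseteq> Y \<rightarrow>\<^sub>E Y"
    by (auto simp: Bij_def bij_betw_def PiE_def)
  then have "finite (Bij Y)"
    using finite_subset finite_PiE[OF fin, of "\<lambda>_. Y"] fin by blast
  then have finK: "finite (carrier K)"
    using Bij by (auto simp: cK intro: finite_subset)
  have oneB: "\<one>\<^bsub>BijGroup Y\<^esub> = (\<lambda>x\<in>Y. x)" by (simp add: BijGroup_def)
  have "\<exists>a. order K = p ^ a"
  proof (rule K.order_prime_power[OF finK p])
    fix u assume "u \<in> carrier K"
    then obtain g where g: "g \<in> carrier G" "u = \<phi> g" by (auto simp: cK)
    obtain k where k: "\<forall>x\<in>Y. f (g [^] (p ^ k)) x = x" using pow g(1) by blast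
    have "u [^]\<^bsub>K\<^esub> (p ^ k) = u [^]\<^bsub>BijGroup Y\<^esub> (p ^ k)"
      unfolding K_def by (metis B.nat_pow_consistent)
    also have "\<dots> = \<phi> (g [^] (p ^ k))" using g by (simp add: h.hom_nat_pow)
    also have "\<dots> = \<one>\<^bsub>K\<^esub>" using k by (auto simp: \<phi>_def K_def oneB fun_eq_iff)
    finally show "\<exists>k. u [^]\<^bsub>K\<^esub> (p ^ k) = \<one>\<^bsub>K\<^esub>" by blast
  qed
  then obtain a where a: "order K = p ^ a" by blast
  have "id \<in> hom K (BijGroup Y)"
    using subgroup.subset[OF sub] by (auto simp: hom_def K_def)
  then interpret A: group_action K Y id
    by (intro group_action.intro group_hom.intro group_hom_axioms.intro K.is_group B.is_group)
  define Fx where "Fx = {x \<in> Y. \<forall>g\<in>carrier G. f g x = x}"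
  let ?O = "orbits K Y id"
  have orb: "orbit K id x = (\<lambda>g. f g x) ` carrier G" if "x \<in> Y" for x
    using that unfolding orbit_def cK \<phi>_def by (auto simp: image_def) (metis restrict_apply')
  have fo: "finite ?O" "\<And>Ob. Ob \<in> ?O \<Longrightarrow> finite Ob"
    using fin A.orbits_coverture finite_UnionD[of ?O] by (auto intro: finite_subset)
  have "card Y = (\<Sum>Ob\<in>?O. card Ob)"
    using A.disjoint_sum[OF fin, of "\<lambda>_. 1::nat"] by simp
  also have "[\<dots> = (\<Sum>Ob\<in>?O. if card Ob = 1 then 1 else 0)] (mod p)"
  proof (rule cong_sum)
    fix Ob assume "Ob \<in> ?O"
    then obtain x where "x \<in> Y" "Ob = orbit K id x" by (auto simp: orbits_def)
    then have "card Ob dvd p ^ a"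
      using A.orbit_stabilizer_theorem[of x] a by (metis dvd_triv_left)
    then obtain b where "card Ob = p ^ b" using divides_primepow_nat[OF p] by blast
    then show "[card Ob = (if card Ob = 1 then 1 else 0)] (mod p)"
      by (cases b) (auto simp: cong_0_iff)
  qed
  also have "(\<Sum>Ob\<in>?O. if card Ob = 1 then 1 else 0) = card {Ob \<in> ?O. card Ob = 1}"
    using fo(1) by (simp add: sum.If_cases Int_def)
  also have "{Ob \<in> ?O. card Ob = 1} = (\<lambda>x. {x}) ` Fx"
  proof (intro equalityI subsetI)
    fix Ob assume "Ob \<in> {Ob \<in> ?O. card Ob = 1}"
    then obtain x where x: "x \<in> Y" "Ob = orbit K id x" "card Ob = 1" by (auto simp: orbits_def)
    then have "x \<in> Ob" using orb one one_closed by force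
    then have Ob: "Ob = {x}" using x(3) by (metis card_1_singletonE singletonD)
    then have "x \<in> Fx" using x orb[of x] by (auto simp: Fx_def)
    then show "Ob \<in> (\<lambda>x. {x}) ` Fx" using Ob by blast
  next
    fix Ob assume "Ob \<in> (\<lambda>x. {x}) ` Fx"
    then obtain x where x: "x \<in> Fx" "Ob = {x}" by blast
    then have "Ob = orbit K id x" "x \<in> Y"
      using orb[of x] one_closed one by (auto simp: Fx_def)
    moreover have "card Ob = 1" using x(2) by simp
    ultimately show "Ob \<in> {Ob \<in> ?O. card Ob = 1}" by (auto simp: orbits_def)
  qed
  also have "card ((\<lambda>x. {x}) ` Fx) = card Fx" by (simp add: card_image)
  finally show ?thesis by (simp add: Fx_def)
qed

text \<open>\<open>R\<close> acts by left multiplication on the left cosets of \<open>P\<close> in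
  \<open>D\<close>. Their number is prime to \<open>p\<close>, so some coset \<open>d <# P\<close>
  is fixed, and this says that conjugation by \<open>inv d\<close> carries \<open>R\<close> into
  \<open>P\<close>.\<close>

lemma (in group) conj_sylow_subset:
  assumes fin: "finite (carrier G)" and p: "prime (p::nat)"
    and P: "subgroup P G" and D: "subgroup D G" "P \<subseteq> D" "\<not> p dvd card D div card P"
    and R: "subgroup R G" "R \<subseteq> D" "card R = p ^ a"
  shows "\<exists>d\<in>D. \<forall>r\<in>R. inv d \<otimes> r \<otimes> d \<in> P"
proof -
  interpret P: subgroup P G by fact
  interpret D: subgroup D G by fact
  interpret R: subgroup R G by fact
  define Y where "Y = (\<lambda>d. d <# P) ` D"
  interpret RG: group "G\<lparr>carrier := R\<rparr>" by (rule R.subgroup_is_group[OF is_group])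
  interpret DG: group "G\<lparr>carrier := D\<rparr>" by (rule D.subgroup_is_group[OF is_group])
  have finD: "finite D" using fin D.subset finite_subset by blast
  have finP: "finite P" using D(2) finD finite_subset by blast
  have memc: "x <# P = y <# P \<longleftrightarrow> inv y \<otimes> x \<in> P" if "x \<in> carrier G" "y \<in> carrier G" for x y
  proof
    assume "x <# P = y <# P"
    moreover have "x \<in> x <# P" using that P.one_closed by (auto simp: l_coset_def intro!: bexI[of _ \<one>])
    ultimately obtain h where "h \<in> P" "x = y \<otimes> h" by (auto simp: l_coset_def)
    then show "inv y \<otimes> x \<in> P" using that by (simp add: inv_solve_left' m_assoc[symmetric])
  next
    assume "inv y \<otimes> x \<in> P"
    then have "x \<in> y <# P" using P.lcos_module_rev[OF is_group] that by blast
    then show "x <# P = y <# P" using l_repr_independence[OF _ _ P] that by auto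
  qed
  have cardX: "card Y * card P = card D"
  proof -
    have sub: "\<And>C. C \<in> Y \<Longrightarrow> C \<subseteq> D"
      using D(2) by (auto simp: Y_def l_coset_def)
    have "card P * card Y = card (\<Union>Y)"
    proof (rule card_partition)
      show "finite Y" using finD by (simp add: Y_def)
      show "finite (\<Union>Y)" using sub finD by (meson Union_least finite_subset)
      show "card C = card P" if "C \<in> Y" for C
      proof -
        from that obtain d where d: "d \<in> D" "C = d <# P" by (auto simp: Y_def)
        then have "C = (\<lambda>h. d \<otimes> h) ` P" by (auto simp: l_coset_def)
        moreover have "inj_on (\<lambda>h. d \<otimes> h) P" 
          using d by (intro inj_onI) (metis D.mem_carrier P.mem_carrier l_cancel)
        ultimately show ?thesis by (simp add: card_image)
      qed
      show "C \<inter> C' = {}" if "C \<in> Y" "C' \<in> Y" "C \<noteq> C'" for C C'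
      proof (rule ccontr)
        from that obtain x y where xy: "x \<in> D" "y \<in> D" "C = x <# P" "C' = y <# P"
          by (auto simp: Y_def)
        assume "C \<inter> C' \<noteq> {}"
        then obtain z where z: "z \<in> C" "z \<in> C'" by blast
        then have "z <# P = x <# P" "z <# P = y <# P"
          using xy l_repr_independence[OF _ _ P] D.mem_carrier by metis+
        then show False using that(3) xy by simp
      qed
    qed
    also have "\<Union>Y = D"
    proof
      show "\<Union>Y \<subseteq> D" using sub by blast
      show "D \<subseteq> \<Union>Y"
      proof
        fix d assume "d \<in> D"
        moreover have "d \<in> d <# P" using \<open>d \<in> D\<close> P.one_closed
          by (auto simp: l_coset_def intro!: bexI[of _ \<one>])
        ultimately show "d \<in> \<Union>Y" by (auto simp: Y_def)
      qed
    qed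
    finally show ?thesis by (simp add: mult.commute)
  qed
  have "card P \<noteq> 0" using finP P.one_closed by (metis card_0_eq empty_iff)
  then have npX: "\<not> p dvd card Y" using D(3) cardX by (metis nonzero_mult_div_cancel_right)
  have act: "r <# (d <# P) = (r \<otimes> d) <# P" if "r \<in> R" "d \<in> D" for r d
    using lcos_m_assoc[OF P.subset] that R.mem_carrier D.mem_carrier by blast
  have "[card Y = card {C \<in> Y. \<forall>r\<in>carrier (G\<lparr>carrier := R\<rparr>). r <# C = C}] (mod p)"
  proof (rule fixed_points_cong[where f = "\<lambda>r C. r <# C"])
    show "group (G\<lparr>carrier := R\<rparr>)" by unfold_locales
    show "finite Y" using finD by (simp add: Y_def)
    show "r <# C \<in> Y" if "r \<in> carrier (G\<lparr>carrier := R\<rparr>)" "C \<in> Y" for r C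
      using that act R(2) D.m_closed by (auto simp: Y_def)
    show "(g \<otimes>\<^bsub>G\<lparr>carrier := R\<rparr>\<^esub> h) <# x = g <# (h <# x)"
      if "g \<in> carrier (G\<lparr>carrier := R\<rparr>)" "h \<in> carrier (G\<lparr>carrier := R\<rparr>)" "x \<in> Y" for g h x
      using that lcos_m_assoc[of x g h] R.mem_carrier l_coset_subset_G[OF P.subset] D.mem_carrier
      by (auto simp: Y_def)
    show "\<one>\<^bsub>G\<lparr>carrier := R\<rparr>\<^esub> <# x = x" if "x \<in> Y" for x
      using that lcos_mult_one[of x] l_coset_subset_G[OF P.subset] D.mem_carrier by (auto simp: Y_def)
    show "\<exists>k. \<forall>x\<in>Y. g [^]\<^bsub>G\<lparr>carrier := R\<rparr>\<^esub> (p ^ k) <# x = x"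
      if "g \<in> carrier (G\<lparr>carrier := R\<rparr>)" for g
    proof -
      have "g [^]\<^bsub>G\<lparr>carrier := R\<rparr>\<^esub> (p ^ a) = \<one>"
        using RG.pow_order_eq_1[OF that] R(3) by (simp add: Coset.order_def)
      then show ?thesis
        using lcos_mult_one l_coset_subset_G[OF P.subset] D.mem_carrier by (auto simp: Y_def intro!: exI[of _ a])
    qed
  qed fact
  then have "[card Y = card {C \<in> Y. \<forall>r\<in>R. r <# C = C}] (mod p)"
    by simp
  then have "card {C \<in> Y. \<forall>r\<in>R. r <# C = C} \<noteq> 0"
    using npX by (metis cong_0_iff)
  then obtain d where d: "d \<in> D" "\<forall>r\<in>R. r <# (d <# P) = d <# P"
    by (auto simp: Y_def card_eq_0_iff)
  have "inv d \<otimes> r \<otimes> d \<in> P" if r: "r \<in> R" for r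
    using d r act[OF r d(1)] memc[of "r \<otimes> d" d] by (simp add: m_assoc)
  then show ?thesis using d(1) by blast
qed

lemma (in group) inv_cancel:
  assumes "x \<in> carrier G" "y \<in> carrier G"
  shows "inv x \<otimes> (x \<otimes> y) = y" "x \<otimes> (inv x \<otimes> y) = y"
  using assms by (simp_all add: m_assoc[symmetric])

text \<open>Conjugation by \<open>n\<close> is an injective self-map of a finite set, hence
  onto.\<close>

lemma (in group) normalizing_inv_closed:
  assumes P: "P \<subseteq> carrier G" "finite P" and n: "n \<in> carrier G" "\<And>r. r \<in> P \<Longrightarrow> n \<otimes> r \<otimes> inv n \<in> P"
    and r: "r \<in> P"
  shows "inv n \<otimes> r \<otimes> n \<in> P"
proof -
  let ?c = "\<lambda>r. n \<otimes> r \<otimes> inv n"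
  have "inj_on ?c P"
    using P(1) n(1) by (intro inj_onI) (simp add: subsetD)
  then have "?c ` P = P"
    using n(2) P(2) by (intro endo_inj_surj) auto
  then obtain s where s: "s \<in> P" "r = ?c s" using r by blast
  have "s \<in> carrier G" using s(1) P(1) by blast
  then have "inv n \<otimes> r \<otimes> n = s"
    unfolding s(2) using n(1) inv_cancel by (simp add: m_assoc)
  then show ?thesis using s(1) by simp
qed

text \<open>A prime \<open>p\<close> dividing the order of the quotient would give by Cauchy an
  element of order \<open>p\<close>, but \<open>N\<close> is an exponent prime to \<open>p\<close>.
  An exponent is used in place of the index because it passes to homomorphic images at once.\<close>

lemma (in group) rcosets_not_dvd:
  assumes fin: "finite (rcosets D)" and D: "D \<lhd> G" and p: "prime (p::nat)"
    and N: "\<And>g. g \<in> carrier G \<Longrightarrow> g [^] (N::nat) \<in> D" "\<not> p dvd N"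
  shows "\<not> p dvd card (rcosets D)"
proof
  interpret D: normal D G by fact
  interpret Q: group "G Mod D" by (rule D.factorgroup_is_group)
  interpret h: group_hom G "G Mod D" "\<lambda>x. D #> x"
    using D.r_coset_hom_Mod by unfold_locales
  assume "p dvd card (rcosets D)"
  then obtain C where C: "C \<in> carrier (G Mod D)" "C \<noteq> \<one>\<^bsub>G Mod D\<^esub>" "C [^]\<^bsub>G Mod D\<^esub> p = \<one>\<^bsub>G Mod D\<^esub>"
    using Q.cauchy[OF _ p] fin by (auto simp: Coset.order_def FactGroup_def)
  then obtain g where g: "g \<in> carrier G" "C = D #> g"
    by (auto simp: carrier_FactGroup)
  have "C [^]\<^bsub>G Mod D\<^esub> N = D #> (g [^] N)"
    using g h.hom_nat_pow by simp
  also have "\<dots> = \<one>\<^bsub>G Mod D\<^esub>"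
    using N(1)[OF g(1)] by (simp add: D.rcos_const)
  finally have "C [^]\<^bsub>G Mod D\<^esub> N = \<one>\<^bsub>G Mod D\<^esub>" .
  moreover have "coprime p N" using p N(2) by (simp add: prime_imp_coprime)
  ultimately show False using Q.pow_coprime_eq_one[OF C(1,3)] C(2) by blast
qed

section \<open>Supplements in finite groups\<close>

text \<open>The abelian case of the Schur-Zassenhaus theorem. As in the transfer, the deviations of
  a transversal from equivariance are multiplied over all cosets; commutativity of \<open>P\<close>
  makes the order of the factors irrelevant. On \<open>P\<close> the resulting
  \<open>\<beta>\<close> is the power map with exponent the index of \<open>P\<close>, a bijection
  by coprimality.\<close>

lemma (in group) supplement_abelian_sylow:
  assumes fin: "finite (carrier G)" and P: "P \<lhd> G" and ab: "\<And>x y. x \<in> P \<Longrightarrow> y \<in> P \<Longrightarrow> x \<otimes> y = y \<otimes> x"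
    and cop: "coprime (card (rcosets P)) (card P)" and nt: "P \<noteq> {\<one>}"
  shows "\<exists>H. subgroup H G \<and> H \<noteq> carrier G \<and> (\<forall>g\<in>carrier G. \<exists>d\<in>P. \<exists>h\<in>H. g = d \<otimes> h)"
proof -
  interpret P: normal P G by fact
  let ?P = "G\<lparr>carrier := P\<rparr>"
  interpret PG: comm_group ?P
    by (rule group.group_comm_groupI[OF P.subgroup_is_group[OF is_group]]) (simp add: ab)
  have mult[simp]: "x \<otimes>\<^bsub>?P\<^esub> y = x \<otimes> y" "\<one>\<^bsub>?P\<^esub> = \<one>" "carrier ?P = P" for x y by simp_all
  define L where "L = rcosets P"
  define q where "q = card L"
  have finL: "finite L" using fin by (auto simp: L_def RCOSETS_def)
  have L: "L = (\<lambda>x. x <# P) ` carrier G"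
    using P.coset_eq by (auto simp: L_def RCOSETS_def)
  define r where "r C = (SOME x. x \<in> C)" for C :: "'a set"
  have r: "r C \<in> carrier G" "r C <# P = C" if "C \<in> L" for C
  proof -
    from that obtain x where x: "x \<in> carrier G" "C = x <# P" by (auto simp: L)
    have "x \<in> C" using x P.one_closed by (auto simp: l_coset_def intro!: bexI[of _ \<one>])
    then have rC: "r C \<in> C" unfolding r_def by (rule someI)
    then show "r C \<in> carrier G" using x l_coset_subset_G[OF P.subset] by blast
    show "r C <# P = C" using rC x l_repr_independence[OF _ _ P.is_subgroup] by blast
  qed
  have actL: "g <# C \<in> L" if "g \<in> carrier G" "C \<in> L" for g C
    using that by (auto simp: L lcos_m_assoc[OF P.subset])
  have act_mult: "(g \<otimes> h) <# C = g <# (h <# C)" if "g \<in> carrier G" "h \<in> carrier G" "C \<in> L" for g h C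
    using that l_coset_subset_G[OF P.subset] by (auto simp: L lcos_m_assoc)
  have act_one: "\<one> <# C = C" if "C \<in> L" for C
    using that l_coset_subset_G[OF P.subset] by (auto simp: L lcos_mult_one)
  \<comment> \<open>\<open>e g C\<close> is the element of \<open>P\<close> by which left
    multiplication by \<open>g\<close> misses the chosen representative of
    \<open>g <# C\<close>.\<close>
  define e where "e g C = g \<otimes> r C \<otimes> inv (r (g <# C))" for g C
  have eP: "e g C \<in> P" if g: "g \<in> carrier G" "C \<in> L" for g C
  proof -
    have 1: "(g \<otimes> r C) <# P = g <# C" using r[OF g(2)] g(1) lcos_m_assoc[OF P.subset] by metis
    have 2: "P #> (g \<otimes> r C) = P #> r (g <# C)"
      using 1 r[OF actL[OF g]] r(1)[OF g(2)] g(1) P.coset_eq by simp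
    have "g \<otimes> r C \<in> P #> r (g <# C)"
      unfolding 2[symmetric] using rcos_self[OF _ P.is_subgroup] r(1)[OF g(2)] g(1) by blast
    then show ?thesis unfolding e_def
      using P.rcos_module_imp[OF is_group r(1)[OF actL[OF g]]] by blast
  qed
  define \<beta> where "\<beta> g = finprod ?P (e g) L" for g
  have \<beta>P: "\<beta> g \<in> P" if "g \<in> carrier G" for g
    unfolding \<beta>_def using PG.finprod_closed[of "e g" L] eP[OF that] by simp
  have conj: "finprod ?P (\<lambda>C. g \<otimes> f C \<otimes> inv g) A = g \<otimes> finprod ?P f A \<otimes> inv g"
    if g: "g \<in> carrier G" and f: "f \<in> A \<rightarrow> P" and A: "finite A" for g f A
    using A f
  proof (induction A)
    case empty
    then show ?case using g by simp
  next
    case (insert C A)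
    have c: "f C \<in> P" "f \<in> A \<rightarrow> P" "finprod ?P f A \<in> P"
      using insert.prems PG.finprod_closed[of f A] by auto
    have c': "f C \<in> carrier G" "finprod ?P f A \<in> carrier G" using c by auto
    have "finprod ?P (\<lambda>C. g \<otimes> f C \<otimes> inv g) (insert C A)
        = (g \<otimes> f C \<otimes> inv g) \<otimes> finprod ?P (\<lambda>C. g \<otimes> f C \<otimes> inv g) A"
      using insert.hyps insert.prems g P.inv_op_closed2 by (subst PG.finprod_insert) auto
    also have "\<dots> = (g \<otimes> f C \<otimes> inv g) \<otimes> (g \<otimes> finprod ?P f A \<otimes> inv g)"
      using insert c by simp
    also have "\<dots> = g \<otimes> (f C \<otimes> finprod ?P f A) \<otimes> inv g"
    proof -
      show ?thesis using g c' by (simp add: m_assoc inv_cancel)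
    qed
    also have "f C \<otimes> finprod ?P f A = finprod ?P f (insert C A)"
      using insert.hyps insert.prems by (subst PG.finprod_insert) auto
    finally show ?case .
  qed
  \<comment> \<open>The cocycle rule for \<open>e\<close>, multiplied over \<open>L\<close>:
    conjugation by \<open>g\<close> passes through the product, and
    \<open>C \<mapsto> h <# C\<close> only permutes the factors.\<close>
  have \<beta>_mult: "\<beta> (g \<otimes> h) = (g \<otimes> \<beta> h \<otimes> inv g) \<otimes> \<beta> g" if g: "g \<in> carrier G" and h: "h \<in> carrier G" for g h
  proof -
    have "e (g \<otimes> h) C = (g \<otimes> e h C \<otimes> inv g) \<otimes> e g (h <# C)" if C: "C \<in> L" for C
    proof -
      have a: "r C \<in> carrier G" "r (h <# C) \<in> carrier G" "r (g <# (h <# C)) \<in> carrier G"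
        using r actL g h C by auto
      show ?thesis
        unfolding e_def act_mult[OF g h C] using a g h inv_cancel by (simp add: m_assoc)
    qed
    then have "\<beta> (g \<otimes> h) = finprod ?P (\<lambda>C. (g \<otimes> e h C \<otimes> inv g) \<otimes>\<^bsub>?P\<^esub> e g (h <# C)) L"
      unfolding \<beta>_def using g h eP actL P.inv_op_closed2
      by (intro PG.finprod_cong') auto
    also have "\<dots> = finprod ?P (\<lambda>C. g \<otimes> e h C \<otimes> inv g) L \<otimes> finprod ?P (\<lambda>C. e g (h <# C)) L"
      using g h eP actL P.inv_op_closed2 by (subst PG.finprod_multf) auto
    also have "finprod ?P (\<lambda>C. g \<otimes> e h C \<otimes> inv g) L = g \<otimes> \<beta> h \<otimes> inv g"
      unfolding \<beta>_def using conj[OF g _ finL] eP[OF h] by simp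
    also have "finprod ?P (\<lambda>C. e g (h <# C)) L = \<beta> g"
    proof -
      have inj: "inj_on (\<lambda>C. h <# C) L"
      proof (rule inj_on_inverseI[where g="\<lambda>C. inv h <# C"])
        show "inv h <# (h <# C) = C" if "C \<in> L" for C
          using act_mult[of "inv h" h C] h act_one that by simp
      qed
      have im: "(\<lambda>C. h <# C) ` L = L"
        using inj finL actL[OF h] by (intro endo_inj_surj) auto
      have "finprod ?P (e g) ((\<lambda>C. h <# C) ` L) = finprod ?P (\<lambda>C. e g (h <# C)) L"
        using inj im eP[OF g] by (intro PG.finprod_reindex) auto
      then show ?thesis by (simp add: im \<beta>_def)
    qed
    finally show ?thesis .
  qed
  \<comment> \<open>By normality \<open>d\<close> fixes every coset, so all \<open>q\<close> factors
    equal \<open>d\<close>.\<close>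
  have \<beta>_P: "\<beta> d = d [^] q" if d: "d \<in> P" for d
  proof -
    have "e d C = d" if C: "C \<in> L" for C
    proof -
      from C obtain x where x: "x \<in> carrier G" "C = x <# P" by (auto simp: L)
      have dG: "d \<in> carrier G" using d by simp
      have "d <# C = P #> (d \<otimes> x)"
        unfolding x(2) lcos_m_assoc[OF P.subset dG x(1)] using P.coset_eq dG x(1) by simp
      also have "\<dots> = (P #> d) #> x" by (rule coset_mult_assoc[OF P.subset dG x(1), symmetric])
      also have "\<dots> = C" using P.rcos_const[OF is_group d] P.coset_eq x by simp
      finally show ?thesis using d r[OF C] by (simp add: e_def m_assoc)
    qed
    then have "\<beta> d = finprod ?P (\<lambda>_. d) L"
      unfolding \<beta>_def using d by (intro PG.finprod_cong') auto
    also have "\<dots> = d [^]\<^bsub>?P\<^esub> q"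
      using PG.finprod_const[of d L] d by (simp add: q_def)
    finally show ?thesis by (metis nat_pow_consistent)
  qed
  have cardP: "d [^] card P = \<one>" if "d \<in> P" for d
    using PG.pow_order_eq_1[of d] that nat_pow_consistent by (simp add: Coset.order_def)
  define H where "H = {g \<in> carrier G. \<beta> g = \<one>}"
  have b1: "\<beta> \<one> = \<one>" using \<beta>_P[OF P.one_closed] by simp
  have "subgroup H G"
  proof (rule subgroupI)
    show "H \<noteq> {}" using b1 by (auto simp: H_def)
    show "inv a \<in> H" if "a \<in> H" for a
      using that \<beta>_mult[of "inv a" a] b1 \<beta>P[of "inv a"] by (auto simp: H_def)
    show "a \<otimes> b \<in> H" if "a \<in> H" "b \<in> H" for a b
      using that \<beta>_mult[of a b] by (auto simp: H_def)
  qed (auto simp: H_def)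
  moreover have "H \<noteq> carrier G"
  proof
    assume H: "H = carrier G"
    obtain y where y: "y \<in> P" "y \<noteq> \<one>" using nt P.one_closed by blast
    have "\<beta> y = \<one>" using H P.mem_carrier[OF y(1)] by (auto simp: H_def)
    then have "y [^] q = \<one>" using \<beta>_P[OF y(1)] by simp
    then show False
      using pow_coprime_eq_one[OF P.mem_carrier[OF y(1)] _ cardP[OF y(1)]] cop y(2)
      by (auto simp: q_def L_def)
  qed
  moreover have "\<exists>d\<in>P. \<exists>h\<in>H. g = d \<otimes> h" if g: "g \<in> carrier G" for g
  proof -
    \<comment> \<open>\<open>u\<close> inverts \<open>q\<close> modulo the order of
      \<open>P\<close>, so \<open>d = w [^] u\<close> satisfies \<open>\<beta> d = w\<close>, and
      multiplication by \<open>d\<close> moves \<open>g\<close> into \<open>H\<close>.\<close>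
    obtain u where u: "[q * u = 1] (mod card P)"
      using cong_solve_coprime_nat[of q "card P"] cop by (auto simp: q_def L_def)
    define w where "w = inv (\<beta> g)"
    have w: "w \<in> P" using \<beta>P[OF g] by (simp add: w_def)
    define d where "d = w [^] u"
    have d: "d \<in> P" unfolding d_def using w PG.nat_pow_closed[of w u] nat_pow_consistent by simp
    have "d [^] q = w [^] (q * u)"
      using w by (simp add: d_def nat_pow_pow mult.commute)
    also have "\<dots> = w [^] (1::nat)"
    proof -
      obtain t t' where t: "q * u + card P * t = 1 + card P * t'"
      proof -
        obtain k1 k2 where "k1 * card P + 1 = k2 * card P + q * u"
          using u unfolding cong_iff_lin_nat by (auto simp: add.commute)
        then show ?thesis using that[of k2 k1] by (simp add: algebra_simps)
      qed
      have "w [^] (q * u) = w [^] (q * u + card P * t)"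
        using w cardP[OF w] by (simp add: nat_pow_mult[symmetric] nat_pow_pow[symmetric])
      also have "\<dots> = w [^] (1 + card P * t')" by (simp only: t)
      also have "\<dots> = w [^] (1::nat)"
        using w cardP[OF w] by (simp add: nat_pow_mult[symmetric] nat_pow_pow[symmetric] del: nat_pow_Suc)
      finally show ?thesis .
    qed
    finally have "\<beta> d = w" using \<beta>_P[OF d] w by simp
    moreover have "d \<otimes> \<beta> g \<otimes> inv d = \<beta> g"
      using ab[OF d \<beta>P[OF g]] \<beta>P[OF g] d by (simp add: m_assoc)
    ultimately have "\<beta> (d \<otimes> g) = \<one>"
      using \<beta>_mult[of d g] d g \<beta>P[OF g] by (simp add: w_def)
    then have "d \<otimes> g \<in> H" using d g by (simp add: H_def)
    moreover have "g = inv d \<otimes> (d \<otimes> g)" using d g by (simp add: m_assoc[symmetric])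
    ultimately show ?thesis using d by blast
  qed
  ultimately show ?thesis by blast
qed

text \<open>When the Sylow subgroup \<open>P\<close> of \<open>D\<close> is not normal, Frattini's argument gives the supplement
  \<open>N(P)\<close>. When it is normal, minimality forces it to equal its centre, and averaging a transversal
  gives a crossed homomorphism \<open>G \<rightarrow> P\<close> whose restriction to \<open>P\<close> is a power map coprime to \<open>p\<close>; its
  kernel is the supplement.\<close>

lemma (in group) supplement_minimal:
  assumes fin: "finite (carrier G)" and D: "D \<lhd> G" and p: "prime (p::nat)"
    and npi: "\<not> p dvd card (rcosets D)"
    and x: "x \<in> D" "x \<noteq> \<one>" "x [^] (p ^ k) = \<one>"
    and min: "\<And>K y j. K \<lhd> G \<Longrightarrow> K \<subseteq> D \<Longrightarrow> K \<noteq> {\<one>} \<Longrightarrow> y \<in> D \<Longrightarrow> y [^] (p ^ j) \<in> K \<Longrightarrow> y \<in> K"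
  shows "\<exists>H. subgroup H G \<and> H \<noteq> carrier G \<and> (\<forall>g\<in>carrier G. \<exists>d\<in>D. \<exists>h\<in>H. g = d \<otimes> h)"
proof -
  interpret D: normal D G by fact
  let ?D = "G\<lparr>carrier := D\<rparr>"
  interpret DG: group ?D by (rule D.subgroup_is_group[OF is_group])
  have finD: "finite D" using fin D.subset finite_subset by blast
  have "card D \<noteq> 0" using finD D.one_closed by (metis card_0_eq empty_iff)
  then obtain m where m: "card D = p ^ multiplicity p (card D) * m" "\<not> p dvd m"
    using multiplicity_decompose'[of "card D" p] p by (metis not_prime_unit)
  define a where "a = multiplicity p (card D)"
  have "\<exists>P. subgroup P ?D \<and> card P = p ^ a"
    using sylow_thm[OF p DG.is_group, of a m] m(1) finD by (simp add: Coset.order_def a_def)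
  then obtain P where P': "subgroup P ?D" and cP: "card P = p ^ a" by blast
  have P: "subgroup P G" using incl_subgroup[OF D.is_subgroup P'] .
  interpret P: subgroup P G by (rule P)
  have PD: "P \<subseteq> D" using subgroup.subset[OF P'] by simp
  have finP: "finite P" using PD finD finite_subset by blast
  have xG: "x \<in> carrier G" using x(1) by simp
  \<comment> \<open>The element \<open>x\<close> of \<open>p\<close>-power order forces
    \<open>p\<close> to divide the order of \<open>D\<close>.\<close>
  have a0: "a \<noteq> 0"
  proof
    assume "a = 0"
    then have "\<not> p dvd card D" using m by (simp add: a_def)
    then have "coprime (p ^ k) (card D)" using p by (simp add: prime_imp_coprime)
    moreover have "x [^] card D = \<one>"
      using DG.pow_order_eq_1[of x] x(1) nat_pow_consistent by (simp add: Coset.order_def)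
    ultimately show False using pow_coprime_eq_one[OF xG x(3)] x(2) by blast
  qed
  have "card D div card P = m"
  proof -
    have "card D = p ^ a * m" using m(1) by (simp only: a_def)
    then show ?thesis using p by (simp add: cP prime_gt_0_nat)
  qed
  then have nd: "\<not> p dvd card D div card P" using m(2) by simp
  \<comment> \<open>The conjugate of \<open>P\<close> by \<open>g\<close> is a subgroup of
    \<open>D\<close> of the same order, so some \<open>d\<close> in \<open>D\<close> carries it back
    into \<open>P\<close>; then \<open>inv d \<otimes> g\<close> normalises
    \<open>P\<close>.\<close>
  have frattini: "\<exists>d\<in>D. \<forall>r\<in>P. (inv d \<otimes> g) \<otimes> r \<otimes> inv (inv d \<otimes> g) \<in> P" if g: "g \<in> carrier G" for g
  proof -
    let ?R = "(\<lambda>r. g \<otimes> r \<otimes> inv g) ` P"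
    have R: "subgroup ?R G"
    proof (rule subgroupI)
      show "?R \<noteq> {}" using P.one_closed by blast
      show "inv b \<in> ?R" if b: "b \<in> ?R" for b
      proof -
        obtain r where "r \<in> P" "b = g \<otimes> r \<otimes> inv g" using b by blast
        then show ?thesis using g by (auto simp: inv_mult_group m_assoc intro!: image_eqI[of _ _ "inv r"])
      qed
      show "b \<otimes> c \<in> ?R" if b: "b \<in> ?R" "c \<in> ?R" for b c
      proof -
        obtain r s where rs: "r \<in> P" "b = g \<otimes> r \<otimes> inv g" "s \<in> P" "c = g \<otimes> s \<otimes> inv g" using b by blast
        have "inv g \<otimes> (g \<otimes> y) = y" if "y \<in> carrier G" for y
          using g that by (simp add: m_assoc[symmetric])
        then show ?thesis using g rs by (auto simp: m_assoc intro!: image_eqI[of _ _ "r \<otimes> s"])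
      qed
    qed (use g in auto)
    have "inj_on (\<lambda>r. g \<otimes> r \<otimes> inv g) P"
      using g by (intro inj_onI) (simp add: m_assoc)
    then have "card ?R = p ^ a" using cP by (simp add: card_image)
    moreover have "?R \<subseteq> D" using PD D.inv_op_closed2[OF g] by blast
    ultimately obtain d where d: "d \<in> D" "\<forall>r\<in>?R. inv d \<otimes> r \<otimes> d \<in> P"
      using conj_sylow_subset[OF fin p P D.is_subgroup PD nd R] by blast
    have "(inv d \<otimes> g) \<otimes> r \<otimes> inv (inv d \<otimes> g) \<in> P" if r: "r \<in> P" for r
    proof -
      have "inv d \<otimes> (g \<otimes> r \<otimes> inv g) \<otimes> d \<in> P" using d(2) r by blast
      then show ?thesis using d(1) g r by (simp add: inv_mult_group m_assoc)
    qed
    then show ?thesis using d(1) by blast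
  qed
  define N where "N = {n \<in> carrier G. \<forall>r\<in>P. n \<otimes> r \<otimes> inv n \<in> P}"
  have N: "subgroup N G"
  proof (rule subgroupI)
    show "N \<noteq> {}" using P.subset by (auto simp: N_def intro!: exI[of _ \<one>])
    show "inv b \<in> N" if "b \<in> N" for b
      using that normalizing_inv_closed[OF P.subset finP, of b] by (auto simp: N_def)
    show "b \<otimes> c \<in> N" if bc: "b \<in> N" "c \<in> N" for b c
    proof -
      have "b \<otimes> (c \<otimes> r \<otimes> inv c) \<otimes> inv b \<in> P" if "r \<in> P" for r
        using bc that by (auto simp: N_def)
      then show ?thesis using bc by (auto simp: N_def inv_mult_group m_assoc)
    qed
  qed (auto simp: N_def)
  show ?thesis
  proof (cases "N = carrier G")
    case False
    have "\<exists>d\<in>D. \<exists>h\<in>N. g = d \<otimes> h" if g: "g \<in> carrier G" for g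
    proof -
      obtain d where d: "d \<in> D" "\<forall>r\<in>P. (inv d \<otimes> g) \<otimes> r \<otimes> inv (inv d \<otimes> g) \<in> P"
        using frattini[OF g] by blast
      then have "inv d \<otimes> g \<in> N" using g by (simp add: N_def)
      moreover have "g = d \<otimes> (inv d \<otimes> g)" using d g by (simp add: m_assoc[symmetric])
      ultimately show ?thesis using d(1) by blast
    qed
    then show ?thesis using N False by blast
  next
    case True
    have conjP: "g \<otimes> r \<otimes> inv g \<in> P" if "g \<in> carrier G" "r \<in> P" for g r
      using True that by (auto simp: N_def)
    have Pn: "P \<lhd> G" using P conjP by (simp add: normal_inv_iff)
    let ?P = "G\<lparr>carrier := P\<rparr>"
    interpret PG: group ?P by (rule P.subgroup_is_group[OF is_group])
    have powP: "r [^] (p ^ a) = \<one>" if "r \<in> P" for r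
      using PG.pow_order_eq_1[of r] that cP nat_pow_consistent by (simp add: Coset.order_def)
    define Z where "Z = {z \<in> P. \<forall>y\<in>P. z \<otimes> y = y \<otimes> z}"
    have ZI: "g \<otimes> z \<otimes> inv g \<in> Z" if g: "g \<in> carrier G" and z: "z \<in> Z" for g z
    proof -
      have "(g \<otimes> z \<otimes> inv g) \<otimes> y = y \<otimes> (g \<otimes> z \<otimes> inv g)" if y: "y \<in> P" for y
      proof -
        have zG: "z \<in> carrier G" using z by (auto simp: Z_def)
        have c: "inv g \<otimes> (g \<otimes> w) = w" "g \<otimes> (inv g \<otimes> w) = w" if "w \<in> carrier G" for w
          using g that by (simp_all add: m_assoc[symmetric])
        have "inv g \<otimes> y \<otimes> g \<in> P" using conjP[of "inv g" y] g y by simp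
        then have "z \<otimes> (inv g \<otimes> y \<otimes> g) = (inv g \<otimes> y \<otimes> g) \<otimes> z" using z by (simp add: Z_def)
        then have "g \<otimes> (z \<otimes> (inv g \<otimes> y \<otimes> g)) \<otimes> inv g = g \<otimes> ((inv g \<otimes> y \<otimes> g) \<otimes> z) \<otimes> inv g" by simp
        then show ?thesis using g y zG c by (simp add: m_assoc)
      qed
      then show ?thesis using conjP[OF g] z by (auto simp: Z_def)
    qed
    have Zs: "subgroup Z G"
    proof (rule subgroupI)
      show "Z \<noteq> {}" by (auto simp: Z_def intro!: exI[of _ \<one>])
      show "inv b \<in> Z" if b: "b \<in> Z" for b
      proof -
        have "inv b \<otimes> y = y \<otimes> inv b" if "y \<in> P" for y
        proof -
          have G: "b \<in> carrier G" "y \<in> carrier G" and c: "b \<otimes> y = y \<otimes> b"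
            using b that by (auto simp: Z_def)
          have "inv b \<otimes> (b \<otimes> y) \<otimes> inv b = inv b \<otimes> (y \<otimes> b) \<otimes> inv b" by (simp add: c)
          moreover have "inv b \<otimes> (b \<otimes> y) = y" using G by (simp add: m_assoc[symmetric])
          moreover have "inv b \<otimes> (y \<otimes> b) \<otimes> inv b = inv b \<otimes> y" using G by (simp add: m_assoc)
          ultimately show ?thesis by simp
        qed
        then show ?thesis using b by (auto simp: Z_def)
      qed
      show "b \<otimes> c \<in> Z" if "b \<in> Z" "c \<in> Z" for b c
      proof -
        have G: "b \<in> P" "c \<in> P" and bc: "\<And>y. y \<in> P \<Longrightarrow> b \<otimes> y = y \<otimes> b" "\<And>y. y \<in> P \<Longrightarrow> c \<otimes> y = y \<otimes> c"
          using that unfolding Z_def by blast+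
        have "(b \<otimes> c) \<otimes> y = y \<otimes> (b \<otimes> c)" if y: "y \<in> P" for y
        proof -
          have "(b \<otimes> c) \<otimes> y = b \<otimes> (y \<otimes> c)" using G y by (simp only: m_assoc P.mem_carrier bc(2)[OF y])
          also have "\<dots> = (b \<otimes> y) \<otimes> c" using G y by (simp only: m_assoc P.mem_carrier)
          also have "\<dots> = y \<otimes> (b \<otimes> c)" using G y by (simp only: m_assoc P.mem_carrier bc(1)[OF y])
          finally show ?thesis .
        qed
        then show ?thesis using G by (simp add: Z_def)
      qed
    qed (auto simp: Z_def)
    have Z: "Z \<lhd> G" using Zs ZI by (simp add: normal_inv_iff)
    \<comment> \<open>The centre is the fixed point set of conjugation of \<open>P\<close> on
      itself, so its order is congruent to that of \<open>P\<close> modulo \<open>p\<close>.\<close>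
    have "Z \<noteq> {\<one>}"
    proof
      assume Z1: "Z = {\<one>}"
      have "[card P = card {r \<in> P. \<forall>g\<in>carrier ?P. g \<otimes> r \<otimes> inv g = r}] (mod p)"
      proof (rule fixed_points_cong[where f = "\<lambda>g r. g \<otimes> r \<otimes> inv g"])
        show "\<exists>k. \<forall>r\<in>P. (g [^]\<^bsub>?P\<^esub> (p ^ k)) \<otimes> r \<otimes> inv (g [^]\<^bsub>?P\<^esub> (p ^ k)) = r"
          if "g \<in> carrier ?P" for g
          using that powP[of g] nat_pow_consistent[symmetric] by (auto intro!: exI[of _ a])
      qed (use PG.is_group finP p in \<open>auto simp: inv_mult_group m_assoc\<close>)
      also have "{r \<in> P. \<forall>g\<in>carrier ?P. g \<otimes> r \<otimes> inv g = r} = Z"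
      proof -
        have "g \<otimes> r \<otimes> inv g = r \<longleftrightarrow> r \<otimes> g = g \<otimes> r" if "g \<in> P" "r \<in> P" for g r
          using inv_solve_right'[of r "g \<otimes> r" g] that by auto
        then show ?thesis by (auto simp: Z_def)
      qed
      finally have "[p ^ a = 1] (mod p)" using cP Z1 by simp
      moreover have "[p ^ a = 0] (mod p)" using a0 by (simp add: cong_0_iff)
      ultimately have "[1 = 0] (mod p)" using cong_trans cong_sym by blast
      then show False using p by (simp add: cong_0_iff)
    qed
    have ZD: "Z \<subseteq> D" using PD by (auto simp: Z_def)
    \<comment> \<open>Minimality is applied to \<open>K = Z\<close> with exponent \<open>a\<close>:
      every element of \<open>P\<close> has a \<open>p\<close>-power power 1, which lies in
      \<open>Z\<close>.\<close>
    have "P \<subseteq> Z"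
    proof
      fix y assume y: "y \<in> P"
      show "y \<in> Z"
        using min[OF Z ZD \<open>Z \<noteq> {\<one>}\<close>, of y a] y PD powP[OF y] subgroup.one_closed[OF Zs] by auto
    qed
    then have ab: "x \<otimes> y = y \<otimes> x" if "x \<in> P" "y \<in> P" for x y
      using that by (auto simp: Z_def)
    \<comment> \<open>The index of \<open>P\<close> is the index of \<open>D\<close> times the part
      \<open>m\<close> of the order of \<open>D\<close> prime to \<open>p\<close>; \<open>p\<close>
      divides neither factor.\<close>
    have "card (rcosets P) * p ^ a = card (rcosets D) * card D"
      using lagrange[OF P] lagrange[OF D.is_subgroup] cP by simp
    then have "card (rcosets P) = card (rcosets D) * m"
    proof -
      have "card D = p ^ a * m" using m(1) by (simp only: a_def)
      then have "card (rcosets P) * p ^ a = (card (rcosets D) * m) * p ^ a"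
        using \<open>card (rcosets P) * p ^ a = card (rcosets D) * card D\<close> by (simp only: ac_simps)
      then show ?thesis using p by (simp add: prime_gt_0_nat)
    qed
    then have "\<not> p dvd card (rcosets P)"
      using npi m(2) p by (simp add: prime_dvd_mult_iff)
    then have cop: "coprime (card (rcosets P)) (card P)"
      using p cP by (simp add: prime_imp_coprime coprime_commute)
    have P1: "P \<noteq> {\<one>}"
    proof
      assume "P = {\<one>}"
      then have "p ^ a = 1" using cP by simp
      then show False using a0 p by (simp add: nat_power_eq_Suc_0_iff)
    qed
    have "\<exists>H. subgroup H G \<and> H \<noteq> carrier G \<and> (\<forall>g\<in>carrier G. \<exists>d\<in>P. \<exists>h\<in>H. g = d \<otimes> h)"
      by (rule supplement_abelian_sylow[OF fin Pn _ cop P1]) (rule ab)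
    then obtain H where H: "subgroup H G" "H \<noteq> carrier G"
        "\<forall>g\<in>carrier G. \<exists>d\<in>P. \<exists>h\<in>H. g = d \<otimes> h"
      by (elim exE conjE)
    show ?thesis
    proof (intro exI conjI ballI)
      fix g assume "g \<in> carrier G"
      with H(3) have "\<exists>d\<in>P. \<exists>h\<in>H. g = d \<otimes> h" by (rule bspec)
      then obtain d h where d: "d \<in> P" "h \<in> H" "g = d \<otimes> h" by (elim bexE)
      from d(1) PD have "d \<in> D" by (rule rev_subsetD)
      from d(3,2) have "\<exists>h\<in>H. g = d \<otimes> h" by (rule bexI)
      from this \<open>d \<in> D\<close> show "\<exists>d\<in>D. \<exists>h\<in>H. g = d \<otimes> h" by (rule bexI)
    qed (fact H)+
  qed
qed

text \<open>The map \<open>M #> x \<mapsto> M' #> x\<close> is onto, but identifies the cosets of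
  \<open>\<one>\<close> and of an element of \<open>M'\<close> outside \<open>M\<close>.\<close>

lemma (in group) rcosets_card_less:
  assumes M: "subgroup M G" and M': "subgroup M' G" and sub: "M \<subset> M'" and fin: "finite (rcosets M)"
  shows "finite (rcosets M') \<and> card (rcosets M') < card (rcosets M)"
proof -
  define F where "F C = (\<Union>c\<in>C. M' #> c)" for C
  have F: "F (M #> x) = M' #> x" if x: "x \<in> carrier G" for x
  proof -
    have "M' #> c = M' #> x" if "c \<in> M #> x" for c
    proof -
      have "c \<in> M' #> x" using that sub by (auto simp: r_coset_def)
      then show ?thesis using repr_independence[OF _ x M'] by simp
    qed
    moreover have "x \<in> M #> x" using rcos_self[OF x M] .
    ultimately show ?thesis unfolding F_def by blast
  qed
  have "F ` (rcosets M) = (\<lambda>x. F (M #> x)) ` carrier G"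
    unfolding RCOSETS_def by blast
  also have "\<dots> = (\<lambda>x. M' #> x) ` carrier G"
    by (rule image_cong[OF refl F])
  finally have im: "rcosets M' = F ` (rcosets M)" unfolding RCOSETS_def by blast
  obtain y where y: "y \<in> M'" "y \<notin> M" using sub by blast
  have yG: "y \<in> carrier G" using y(1) subgroup.mem_carrier[OF M'] by blast
  have "\<not> inj_on F (rcosets M)"
  proof
    assume "inj_on F (rcosets M)"
    moreover have "F (M #> y) = F (M #> \<one>)"
      using F[OF yG] F[OF one_closed] subgroup.rcos_const[OF M' is_group y(1)] subgroup.subset[OF M'] by simp
    moreover have "M #> y \<in> rcosets M" "M #> \<one> \<in> rcosets M"
      using rcosetsI[OF subgroup.subset[OF M]] yG one_closed by blast+
    ultimately have "M #> y = M #> \<one>" by (meson inj_onD)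
    then have "y \<in> M" using rcos_self[OF yG M] subgroup.subset[OF M] by simp
    then show False using y(2) by blast
  qed
  then have "card (F ` (rcosets M)) \<noteq> card (rcosets M)"
    using eq_card_imp_inj_on[OF fin] by blast
  then show ?thesis
    unfolding im using card_image_le[OF fin, of F] fin by auto
qed

lemma (in group) pow_index_mem:
  assumes D: "D \<lhd> G" and g: "g \<in> carrier G" and fin: "finite (rcosets D)"
  shows "g [^] card (rcosets D) \<in> D"
proof -
  interpret D: normal D G by fact
  interpret Q: group "G Mod D" by (rule D.factorgroup_is_group)
  interpret h: group_hom G "G Mod D" "\<lambda>x. D #> x"
    using D.r_coset_hom_Mod by unfold_locales
  have "D #> (g [^] card (rcosets D)) = (D #> g) [^]\<^bsub>G Mod D\<^esub> card (rcosets D)"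
    using g h.hom_nat_pow by simp
  also have "\<dots> = D"
  proof -
    have "order (G Mod D) = card (rcosets D)" by (simp add: Coset.order_def FactGroup_def)
    moreover have "D #> g \<in> carrier (G Mod D)" using g by (auto simp: carrier_FactGroup)
    ultimately show ?thesis using Q.pow_order_eq_1[of "D #> g"] by simp
  qed
  finally have "D #> (g [^] card (rcosets D)) = D" .
  then show ?thesis
    using rcos_self[OF nat_pow_closed[OF g] D.is_subgroup, of "card (rcosets D)"] by simp
qed

section \<open>Supplements of finite-index normal subgroups\<close>

text \<open>Among the normal subgroups modulo which some element of \<open>D\<close> is nontrivial
  of \<open>p\<close>-power order, one of least index is chosen. A strictly larger normal subgroup
  has smaller index and hence absorbs all such elements; this is the minimality required in the
  finite quotient. The \<open>M\<close> of the conclusion is therefore in general not the given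
  one.\<close>

lemma (in group) coprime_supplement:
  assumes D: "D \<lhd> G" and finD: "finite (rcosets D)" and p: "prime (p::nat)" and np: "\<not> p dvd card (rcosets D)"
    and M: "M \<lhd> G" "finite (rcosets M)" and x: "x \<in> D" "x [^] (p ^ k) \<in> M" "x \<notin> M"
  shows "\<exists>H M. M \<lhd> G \<and> finite (rcosets M) \<and> M \<subseteq> H \<and> subgroup H G \<and> H \<noteq> carrier G \<and>
    (\<forall>g\<in>carrier G. \<exists>d\<in>D. \<exists>h\<in>H. g = d \<otimes> h)"
proof -
  define Bad where "Bad M \<longleftrightarrow> M \<lhd> G \<and> finite (rcosets M) \<and> (\<exists>x\<in>D. \<exists>k. x [^] (p ^ k) \<in> M \<and> x \<notin> M)" for M
  have "Bad M" using M x by (auto simp: Bad_def)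
  then have "\<exists>M. Bad M \<and> (\<forall>M'. Bad M' \<longrightarrow> card (rcosets M) \<le> card (rcosets M'))"
    by (rule ex_has_least_nat)
  then obtain M where BM: "Bad M" and least: "\<forall>M'. Bad M' \<longrightarrow> card (rcosets M) \<le> card (rcosets M')"
    by (elim exE conjE)
  obtain x k where x: "x \<in> D" "x [^] (p ^ k) \<in> M" "x \<notin> M" and M: "M \<lhd> G" "finite (rcosets M)"
    using BM by (auto simp: Bad_def)
  interpret D: normal D G by fact
  interpret M: normal M G by fact
  let ?Q = "G Mod M"
  interpret Q: group ?Q by (rule M.factorgroup_is_group)
  define \<phi> where "\<phi> x = M #> x" for x
  interpret h: group_hom G ?Q \<phi>
    using M.r_coset_hom_Mod by unfold_locales (simp add: \<phi>_def[abs_def])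
  have surj: "\<phi> ` carrier G = carrier ?Q" by (simp add: \<phi>_def[abs_def] carrier_FactGroup)
  have finQ: "finite (carrier ?Q)" using M(2) by (simp add: FactGroup_def)
  have \<phi>1: "\<phi> g = \<one>\<^bsub>?Q\<^esub> \<longleftrightarrow> g \<in> M" if "g \<in> carrier G" for g
    using that M.rcos_const[OF is_group] rcos_self[OF that M.is_subgroup] by (auto simp: \<phi>_def)
  have DQ: "(\<phi> ` D) \<lhd> ?Q"
    by (rule D.surj_hom_normal_subgroup[OF h.group_hom_axioms surj])
  interpret DQ: normal "\<phi> ` D" ?Q by (rule DQ)
  have "\<exists>H. subgroup H ?Q \<and> H \<noteq> carrier ?Q \<and> (\<forall>g\<in>carrier ?Q. \<exists>d\<in>\<phi> ` D. \<exists>h\<in>H. g = d \<otimes>\<^bsub>?Q\<^esub> h)"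
  proof (rule Q.supplement_minimal[OF finQ DQ p, where x = "\<phi> x" and k = k])
    show "\<not> p dvd card (rcosets\<^bsub>?Q\<^esub> (\<phi> ` D))"
    proof (rule Q.rcosets_not_dvd[OF _ DQ p _ np])
      show "finite (rcosets\<^bsub>?Q\<^esub> (\<phi> ` D))" using finQ by (auto simp: RCOSETS_def)
      show "g [^]\<^bsub>?Q\<^esub> card (rcosets D) \<in> \<phi> ` D" if "g \<in> carrier ?Q" for g
      proof -
        from that have "g \<in> \<phi> ` carrier G" by (simp only: surj)
        then obtain y where "g = \<phi> y" "y \<in> carrier G" by (rule imageE)
        then have "g [^]\<^bsub>?Q\<^esub> card (rcosets D) = \<phi> (y [^] card (rcosets D))"
          by (simp add: h.hom_nat_pow)
        then show ?thesis using pow_index_mem[OF D _ finD, of y] \<open>y \<in> carrier G\<close> by (metis imageI)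
      qed
    qed
    show "\<phi> x \<in> \<phi> ` D" using x(1) by blast
    show "\<phi> x \<noteq> \<one>\<^bsub>?Q\<^esub>" using \<phi>1 x by simp
    show "\<phi> x [^]\<^bsub>?Q\<^esub> (p ^ k) = \<one>\<^bsub>?Q\<^esub>"
      using \<phi>1[of "x [^] (p ^ k)"] x by (simp add: h.hom_nat_pow)
    show "y \<in> K" if K: "K \<lhd> ?Q" "K \<subseteq> \<phi> ` D" "K \<noteq> {\<one>\<^bsub>?Q\<^esub>}" and y: "y \<in> \<phi> ` D" "y [^]\<^bsub>?Q\<^esub> (p ^ j) \<in> K" for K y j
    proof (rule ccontr)
      assume yK: "y \<notin> K"
      interpret K: normal K ?Q by fact
      \<comment> \<open>If \<open>y\<close> were outside \<open>K\<close>, the preimage of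
        \<open>K\<close> would be a bad subgroup of smaller index than \<open>M\<close>.\<close>
      define M' where "M' = {g \<in> carrier G. \<phi> g \<in> K}"
      have M': "M' \<lhd> G"
      proof -
        have "subgroup M' G"
        proof (rule subgroupI)
          show "M' \<noteq> {}"
    proof -
      have "\<one> \<in> M'" using K.one_closed h.hom_one by (simp add: M'_def)
      then show ?thesis by blast
    qed
        next
      show "inv x \<in> M'" if "x \<in> M'" for x
        using that K.m_inv_closed[of "\<phi> x"] by (simp add: M'_def)
      show "x \<otimes> y \<in> M'" if "x \<in> M'" "y \<in> M'" for x y
        using that K.m_closed[of "\<phi> x" "\<phi> y"] by (simp add: M'_def)
    qed (auto simp: M'_def)
        moreover have "g \<otimes> b \<otimes> inv g \<in> M'" if "g \<in> carrier G" "b \<in> M'" for g b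
          using that K.inv_op_closed2[of "\<phi> g" "\<phi> b"] by (auto simp: M'_def)
        ultimately show ?thesis by (simp add: normal_inv_iff)
      qed
      have "M \<subseteq> M'"
      proof
        fix y assume y: "y \<in> M"
        then have "\<phi> y \<in> K" using \<phi>1[OF M.mem_carrier[OF y]] K.one_closed by metis
        then show "y \<in> M'" using M.mem_carrier[OF y] by (simp add: M'_def)
      qed
      moreover have "M \<noteq> M'"
      proof
        assume eq: "M = M'"
        obtain c where c: "c \<in> K" "c \<noteq> \<one>\<^bsub>?Q\<^esub>" using K(3) K.one_closed by blast
        then obtain b where "b \<in> D" "c = \<phi> b" using K(2) by blast
        then have "b \<in> M'" using c by (simp add: M'_def)
        then have "b \<in> M" using eq by simp
        then show False using \<phi>1[OF M.mem_carrier] c(2) \<open>c = \<phi> b\<close> by blast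
      qed
      ultimately have less: "finite (rcosets M') \<and> card (rcosets M') < card (rcosets M)"
        using rcosets_card_less[OF M.is_subgroup normal_imp_subgroup[OF M'] _ M(2)] by blast
      obtain d where d: "d \<in> D" "y = \<phi> d" using y(1) by blast
      have "d [^] (p ^ j) \<in> M'" using y(2) d by (simp add: M'_def h.hom_nat_pow)
      moreover have "d \<notin> M'" using yK d by (simp add: M'_def)
      ultimately have "Bad M'" using M' less d(1) by (auto simp: Bad_def)
      then show False using spec[OF least, of M'] less by simp
    qed
  qed
  then obtain H where H: "subgroup H ?Q" "H \<noteq> carrier ?Q" "\<And>g. g \<in> carrier ?Q \<Longrightarrow> \<exists>d\<in>\<phi> ` D. \<exists>h\<in>H. g = d \<otimes>\<^bsub>?Q\<^esub> h"
    by blast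
  interpret H: subgroup H ?Q by fact
  define H' where "H' = {g \<in> carrier G. \<phi> g \<in> H}"
  have H's: "subgroup H' G"
  proof (rule subgroupI)
    show "H' \<noteq> {}"
    proof -
      have "\<one> \<in> H'" using H.one_closed h.hom_one by (simp add: H'_def)
      then show ?thesis by blast
    qed
  next
      show "inv x \<in> H'" if "x \<in> H'" for x
        using that H.m_inv_closed[of "\<phi> x"] by (simp add: H'_def)
      show "x \<otimes> y \<in> H'" if "x \<in> H'" "y \<in> H'" for x y
        using that H.m_closed[of "\<phi> x" "\<phi> y"] by (simp add: H'_def)
    qed (auto simp: H'_def)
  have MH': "M \<subseteq> H'"
  proof
    fix y assume y: "y \<in> M"
    then have "\<phi> y \<in> H" using \<phi>1[OF M.mem_carrier[OF y]] H.one_closed by metis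
    then show "y \<in> H'" using M.mem_carrier[OF y] by (simp add: H'_def)
  qed
  have H'p: "H' \<noteq> carrier G"
  proof
    assume "H' = carrier G"
    then have "carrier ?Q \<subseteq> H" unfolding surj[symmetric] by (auto simp: H'_def)
    then show False using H(2) H.subset by blast
  qed
  have DH': "\<exists>d\<in>D. \<exists>h\<in>H'. g = d \<otimes> h" if g: "g \<in> carrier G" for g
  proof -
    obtain d h where d: "d \<in> D" "h \<in> H" "\<phi> g = \<phi> d \<otimes>\<^bsub>?Q\<^esub> h"
      using H(3)[OF h.hom_closed[OF g]] by blast
    have hQ: "h \<in> carrier ?Q" using d(2) by simp
    have "\<phi> (inv d \<otimes> g) = inv\<^bsub>?Q\<^esub> \<phi> d \<otimes>\<^bsub>?Q\<^esub> (\<phi> d \<otimes>\<^bsub>?Q\<^esub> h)" using d g by simp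
    also have "\<dots> = h" using Q.inv_cancel(1)[OF h.hom_closed[OF D.mem_carrier[OF d(1)]] hQ] .
    finally have "inv d \<otimes> g \<in> H'" using d g by (simp add: H'_def)
    moreover have "g = d \<otimes> (inv d \<otimes> g)" using d g by (simp add: m_assoc[symmetric])
    ultimately show ?thesis using d(1) by blast
  qed
  show ?thesis
  proof (rule exI[of _ H'], rule exI[of _ M], intro conjI ballI)
    show "\<exists>d\<in>D. \<exists>h\<in>H'. g = d \<otimes> h" if "g \<in> carrier G" for g by (rule DH'[OF that])
  qed (fact M H's MH' H'p)+
qed

section \<open>Independent families of subgroups and adapted generators\<close>

lemma (in group) finite_rcosets_Int:
  assumes A: "subgroup A G" "finite (rcosets A)" and B: "subgroup B G" "finite (rcosets B)"
  shows "finite (rcosets (A \<inter> B))"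
proof -
  have AB: "subgroup (A \<inter> B) G" using subgroups_Inter_pair[OF A(1) B(1)] .
  have "(A \<inter> B) #> x = (A #> x) \<inter> (B #> x)" if x: "x \<in> carrier G" for x
  proof
    show "(A \<inter> B) #> x \<subseteq> (A #> x) \<inter> (B #> x)" by (auto simp: r_coset_def)
    show "(A #> x) \<inter> (B #> x) \<subseteq> (A \<inter> B) #> x"
    proof
      fix y assume "y \<in> (A #> x) \<inter> (B #> x)"
      then obtain a b where ab: "a \<in> A" "b \<in> B" "y = a \<otimes> x" "y = b \<otimes> x"
        by (auto simp: r_coset_def)
      have "a \<in> carrier G" "b \<in> carrier G"
        using ab subgroup.mem_carrier[OF A(1)] subgroup.mem_carrier[OF B(1)] by simp_all
      then have "a = b" using ab x by simp
      then show "y \<in> (A \<inter> B) #> x" using ab by (auto simp: r_coset_def)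
    qed
  qed
  then have "rcosets (A \<inter> B) \<subseteq> (\<lambda>(C, C'). C \<inter> C') ` ((rcosets A) \<times> (rcosets B))"
    unfolding RCOSETS_def by (force simp: image_iff)
  then show ?thesis using A(2) B(2) by (meson finite_SigmaI finite_imageI finite_subset)
qed

lemma (in group) finite_rcosets_mono:
  assumes "subgroup M G" "subgroup H G" "M \<subseteq> H" "finite (rcosets M)"
  shows "finite (rcosets H)"
  using rcosets_card_less[OF assms(1,2) _ assms(4)] assms(3,4) by (cases "M = H") auto

text \<open>The normal subgroup \<open>M\<close> inside \<open>H\<close> is part of the data because
  it is intersected with \<open>D\<close> to give the next normal subgroup when independent
  subgroups are constructed one after another.\<close>

definition has_supplements :: "('g, 'm) monoid_scheme \<Rightarrow> bool" where
  "has_supplements G \<longleftrightarrow> (\<forall>D. D \<lhd> G \<and> finite (rcosets\<^bsub>G\<^esub> D) \<longrightarrow>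
    (\<exists>H M. M \<lhd> G \<and> finite (rcosets\<^bsub>G\<^esub> M) \<and> M \<subseteq> H \<and> subgroup H G \<and> H \<noteq> carrier G \<and>
      (\<forall>g\<in>carrier G. \<exists>d\<in>D. \<exists>h\<in>H. g = d \<otimes>\<^bsub>G\<^esub> h)))"

text \<open>The last conjunct is transitivity on the product of coset spaces: the cosets of the
  \<open>c k\<close> have a common element. Given a solution \<open>g\<close> for the first
  \<open>m\<close> subgroups and a supplement \<open>K\<close> of \<open>D\<close>, one writes
  \<open>g \<otimes> inv (c m) = d \<otimes> h\<close>; passing to \<open>inv d \<otimes> g\<close>
  solves the new condition and keeps the old ones, since \<open>D\<close> lies in every
  \<open>H k\<close>.\<close>

lemma (in group) independent_subgroups:
  fixes m :: nat
  assumes sup: "has_supplements G"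
  shows "\<exists>H D. D \<lhd> G \<and> finite (rcosets D) \<and>
    (\<forall>k<m. subgroup (H k) G \<and> H k \<noteq> carrier G \<and> finite (rcosets (H k)) \<and> D \<subseteq> H k) \<and>
    (\<forall>c. (\<forall>k<m. c k \<in> carrier G) \<longrightarrow> (\<exists>g\<in>carrier G. \<forall>k<m. g \<otimes> inv (c k) \<in> H k))"
proof (induction m)
  case 0
  have "carrier G \<lhd> G"
    using subgroup_self by (simp add: normal_inv_iff)
  moreover have "rcosets (carrier G) = {carrier G}"
    using subgroup.rcos_const[OF subgroup_self is_group] by (auto simp: RCOSETS_def)
  ultimately show ?case by (auto intro!: exI[of _ "carrier G"] bexI[of _ \<one>])
next
  case (Suc m)
  then obtain H D where D: "D \<lhd> G" "finite (rcosets D)"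
    and H: "\<forall>k<m. subgroup (H k) G \<and> H k \<noteq> carrier G \<and> finite (rcosets (H k)) \<and> D \<subseteq> H k"
    and ind: "\<forall>c. (\<forall>k<m. c k \<in> carrier G) \<longrightarrow> (\<exists>g\<in>carrier G. \<forall>k<m. g \<otimes> inv (c k) \<in> H k)"
    by (elim exE conjE)
  obtain K M where M: "M \<lhd> G" "finite (rcosets M)" "M \<subseteq> K" and K: "subgroup K G" "K \<noteq> carrier G"
    and DK: "\<forall>g\<in>carrier G. \<exists>d\<in>D. \<exists>h\<in>K. g = d \<otimes> h"
    using sup D unfolding has_supplements_def by meson
  define H' where "H' = H(m := K)"
  have sD: "subgroup D G" and sM: "subgroup M G" using D(1) M(1) normal_imp_subgroup by auto
  have "D \<inter> M \<lhd> G" using normal_subgroup_intersect[OF D(1) M(1)] .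
  moreover have "finite (rcosets (D \<inter> M))" using finite_rcosets_Int[OF sD D(2) sM M(2)] .
  moreover have "\<forall>k<Suc m. subgroup (H' k) G \<and> H' k \<noteq> carrier G \<and> finite (rcosets (H' k)) \<and> D \<inter> M \<subseteq> H' k"
    using H K M(3) finite_rcosets_mono[OF sM K(1) M(3,2)] by (auto simp: H'_def less_Suc_eq)
  moreover have "\<exists>g\<in>carrier G. \<forall>k<Suc m. g \<otimes> inv (c k) \<in> H' k" if c: "\<forall>k<Suc m. c k \<in> carrier G" for c
  proof -
    have "\<forall>k<m. c k \<in> carrier G" using c by simp
    with spec[OF ind, of c] have "\<exists>g\<in>carrier G. \<forall>k<m. g \<otimes> inv (c k) \<in> H k" by (rule mp)
    then obtain g where g: "g \<in> carrier G" "\<forall>k<m. g \<otimes> inv (c k) \<in> H k" by (elim bexE)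
    have cm: "c m \<in> carrier G" using c by simp
    then have "g \<otimes> inv (c m) \<in> carrier G" using g by simp
    then obtain d h where dh: "d \<in> D" "h \<in> K" "g \<otimes> inv (c m) = d \<otimes> h" using DK by metis
    have dG: "d \<in> carrier G" "h \<in> carrier G"
      using subgroup.mem_carrier[OF sD dh(1)] subgroup.mem_carrier[OF K(1) dh(2)] by auto
    have "(inv d \<otimes> g) \<otimes> inv (c k) \<in> H' k" if k: "k < Suc m" for k
    proof (cases "k = m")
      case True
      have "(inv d \<otimes> g) \<otimes> inv (c m) = inv d \<otimes> (d \<otimes> h)"
        using dh(3) dG g(1) cm by (simp add: m_assoc)
      also have "\<dots> = h" using dG by (simp add: inv_cancel)
      finally show ?thesis using True dh(2) by (simp add: H'_def)
    next
      case False
      then have k: "k < m" using k by simp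
      have s: "subgroup (H k) G" "d \<in> H k" using H k dh(1) by auto
      have ck: "c k \<in> carrier G" using c k by simp
      have "inv d \<otimes> (g \<otimes> inv (c k)) \<in> H k"
        using subgroup.m_closed[OF s(1) subgroup.m_inv_closed[OF s]] g(2) k by simp
      then show ?thesis using False dG g(1) ck by (simp add: H'_def m_assoc)
    qed
    then show ?thesis using dG g(1) by (intro bexI[of _ "inv d \<otimes> g"]) auto
  qed
  ultimately show ?case by (intro exI[of _ H'] exI[of _ "D \<inter> M"] conjI) auto
qed

text \<open>An element lying in the first \<open>j\<close> subgroups is corrected, one coordinate at a time, by elements
  that move only that coordinate.\<close>

lemma (in group) generate_independent:
  fixes m :: nat
  assumes H: "\<And>k. k < m \<Longrightarrow> subgroup (H k) G"
    and ind: "\<And>c. (\<forall>k<m. c k \<in> carrier G) \<Longrightarrow> (\<exists>g\<in>carrier G. \<forall>k<m. g \<otimes> inv (c k) \<in> H k)"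
  shows "generate G {g \<in> carrier G. \<exists>j. \<forall>k<m. k \<noteq> j \<longrightarrow> g \<in> H k} = carrier G"
    (is "generate G ?T = _")
proof
  show "generate G ?T \<subseteq> carrier G" by (rule generate_incl) auto
  \<comment> \<open>\<open>i\<close> counts the last coordinates about which nothing is known:
    \<open>i = 0\<close> means membership in every \<open>H k\<close>, and \<open>i = m\<close> is
    no condition.\<close>
  have "g \<in> generate G ?T" if "i \<le> m" "g \<in> carrier G" "\<forall>k<m-i. g \<in> H k" for i g
    using that
  proof (induction i arbitrary: g)
    case 0
    then show ?case by (intro generate.incl) auto
  next
    case (Suc i)
    define j where "j = m - Suc i"
    have j: "j < m" "m - i = Suc j" using Suc.prems(1) by (auto simp: j_def)
    \<comment> \<open>This choice yields an \<open>n\<close> in the coset of \<open>g\<close> at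
      coordinate \<open>j\<close> and in \<open>H k\<close> at every other coordinate.\<close>
    define c where "c k = (if k = j then g else \<one>)" for k
    have "\<forall>k<m. c k \<in> carrier G" using Suc.prems(2) by (simp add: c_def)
    then have "\<exists>n\<in>carrier G. \<forall>k<m. n \<otimes> inv (c k) \<in> H k" by (rule ind)
    then obtain n where n: "n \<in> carrier G" "\<forall>k<m. n \<otimes> inv (c k) \<in> H k" by (elim bexE)
    have nj: "n \<otimes> inv g \<in> H j" using n(2) j(1) by (auto simp: c_def)
    have nk: "n \<in> H k" if k: "k < m" "k \<noteq> j" for k
    proof -
      have "n \<otimes> inv (c k) \<in> H k" by (rule n(2)[rule_format, OF k(1)])
      then show ?thesis using n(1) k(2) unfolding c_def by simp
    qed
    have "n \<in> ?T" using n(1) nk by (intro CollectI conjI exI[of _ j]) auto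
    then have gn: "n \<in> generate G ?T" by (rule generate.incl)
    have "inv (n \<otimes> inv g) \<in> H j" using subgroup.m_inv_closed[OF H[OF j(1)] nj] .
    then have j': "g \<otimes> inv n \<in> H j" using n(1) Suc.prems(2) by (simp add: inv_mult_group)
    have "g \<otimes> inv n \<in> H k" if k: "k < m - i" for k
    proof (cases "k = j")
      case False
      then have k: "k < j" "k < m" using k j by auto
      show ?thesis
        using subgroup.m_closed[OF H[OF k(2)] _ subgroup.m_inv_closed[OF H[OF k(2)] nk[OF k(2) False]]]
          Suc.prems(3) k(1) by (simp add: j_def)
    qed (use j' in simp)
    then have "g \<otimes> inv n \<in> generate G ?T"
      using Suc.IH[of "g \<otimes> inv n"] Suc.prems n(1) by simp
    then have "(g \<otimes> inv n) \<otimes> n \<in> generate G ?T" using gn by (rule generate.eng)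
    then show ?case using n(1) Suc.prems(2) by (simp add: m_assoc)
  qed
  from this[of m] show "carrier G \<subseteq> generate G ?T" by auto
qed

lemma (in group) generate_finite_support:
  assumes "T \<subseteq> carrier G" "x \<in> generate G T"
  shows "\<exists>S. finite S \<and> S \<subseteq> T \<and> x \<in> generate G S"
  using assms(2)
proof induction
  case one
  then show ?case using generate.one by blast
next
  case (incl h)
  then show ?case by (intro exI[of _ "{h}"]) (auto intro: generate.incl)
next
  case (inv h)
  then show ?case by (intro exI[of _ "{h}"]) (auto intro: generate.inv)
next
  case (eng h1 h2)
  then obtain S1 S2 where S: "finite S1" "S1 \<subseteq> T" "h1 \<in> generate G S1" "finite S2" "S2 \<subseteq> T" "h2 \<in> generate G S2"
    by auto
  have "h1 \<in> generate G (S1 \<union> S2)" "h2 \<in> generate G (S1 \<union> S2)"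
    using S(3,6) mono_generate[of S1 "S1 \<union> S2"] mono_generate[of S2 "S1 \<union> S2"] by auto
  then show ?case using S by (intro exI[of _ "S1 \<union> S2"]) (auto intro: generate.eng)
qed

text \<open>Each of finitely many given generators is a word in finitely many elements of
  \<open>T\<close>.\<close>

lemma (in group) finite_generating_subset:
  assumes T: "T \<subseteq> carrier G" "generate G T = carrier G" and fg: "finite_generating_sets G \<noteq> {}"
  shows "\<exists>S \<in> finite_generating_sets G. S \<subseteq> T"
proof -
  obtain S0 where S0: "finite S0" "S0 \<subseteq> carrier G" "generate G S0 = carrier G"
    using fg by (auto simp: finite_generating_sets_def)
  have "\<forall>s\<in>S0. \<exists>S. finite S \<and> S \<subseteq> T \<and> s \<in> generate G S"
    using generate_finite_support[OF T(1)] T(2) S0(2) by blast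
  then have "\<exists>F. \<forall>s\<in>S0. finite (F s) \<and> F s \<subseteq> T \<and> s \<in> generate G (F s)"
    by (rule bchoice)
  then obtain F where F: "\<forall>s\<in>S0. finite (F s) \<and> F s \<subseteq> T \<and> s \<in> generate G (F s)"
    by (elim exE)
  define S where "S = (\<Union>s\<in>S0. F s)"
  have S: "finite S" "S \<subseteq> T" using S0(1) F by (auto simp: S_def)
  have "S0 \<subseteq> generate G S"
  proof
    fix s assume s: "s \<in> S0"
    have "F s \<subseteq> S" using s by (auto simp: S_def)
    then have "generate G (F s) \<subseteq> generate G S" by (rule mono_generate)
    then show "s \<in> generate G S" using bspec[OF F s] by (meson subsetD)
  qed
  then have "generate G S0 \<subseteq> generate G S"
    using generate_subgroup_incl generate_is_subgroup S(2) T(1) by (meson subset_trans)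
  then have "generate G S = carrier G"
    using S0(3) generate_incl[of S] S(2) T(1) by blast
  then show ?thesis using S T(1) by (auto simp: finite_generating_sets_def)
qed

section \<open>Almost invariant vectors\<close>

text \<open>Representations have to live in the prescribed type \<open>'h\<close>. An infinite type
  is equipotent with its square, so an encoded function and one further complex value can again be
  encoded by a single element.\<close>

lemma inj_finite_support_functions:
  assumes "finite Y" and c: "inj (c :: complex \<Rightarrow> 'h)"
  shows "\<exists>j :: ('x \<Rightarrow> complex) \<Rightarrow> 'h. inj_on j {f. \<forall>x. x \<notin> Y \<longrightarrow> f x = 0}"
  using assms(1)
proof induction
  case empty
  show ?case by (auto simp: inj_on_def fun_eq_iff)
next
  case (insert x Y)
  then obtain j :: "('x \<Rightarrow> complex) \<Rightarrow> 'h" where j: "inj_on j {f. \<forall>x. x \<notin> Y \<longrightarrow> f x = 0}" by blast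
  have "infinite (UNIV :: 'h set)"
    using c finite_imageD[of c UNIV] infinite_UNIV_char_0[where 'a=complex] finite_subset[OF subset_UNIV, of "range c"] by blast
  then obtain p :: "'h \<times> 'h \<Rightarrow> 'h" where "bij_betw p (UNIV \<times> UNIV) UNIV"
    using card_of_Times_same_infinite card_of_ordIso by blast
  then have p: "inj p" by (simp add: bij_betw_def)
  define j' where "j' f = p (c (f x), j (f(x := 0)))" for f
  have "inj_on j' {f. \<forall>y. y \<notin> insert x Y \<longrightarrow> f y = 0}"
  proof (rule inj_onI)
    fix f g assume fg: "f \<in> {f. \<forall>y. y \<notin> insert x Y \<longrightarrow> f y = 0}" "g \<in> {f. \<forall>y. y \<notin> insert x Y \<longrightarrow> f y = 0}" "j' f = j' g"
    then have "f x = g x" "j (f(x := 0)) = j (g(x := 0))"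
      using p c by (auto simp: j'_def inj_eq)
    moreover have "f(x := 0) \<in> {f. \<forall>x. x \<notin> Y \<longrightarrow> f x = 0}" "g(x := 0) \<in> {f. \<forall>x. x \<notin> Y \<longrightarrow> f x = 0}"
      using fg by auto
    ultimately have "f(x := 0) = g(x := 0)" using j by (meson inj_onD)
    then show "f = g" using \<open>f x = g x\<close> by (metis fun_upd_triv fun_upd_upd)
  qed
  then show ?case by blast
qed

section \<open>Function spaces as Hilbert spaces inside a given type\<close>

lemma cring_complex_field: "cring complex_field"
  by (rule cringI[OF abelian_groupI comm_monoidI])
    (auto simp: complex_field_def algebra_simps intro: exI[of _ "- x" for x])

text \<open>A space \<open>W\<close> of functions on a finite set is carried into the type
  \<open>'h\<close> along the injection \<open>j\<close>. Closure under pointwise limits gives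
  completeness, because convergence in the norm is coordinatewise on \<open>Y\<close>.\<close>

locale function_hilbert =
  fixes Y :: "'x set" and W :: "('x \<Rightarrow> complex) set" and j :: "('x \<Rightarrow> complex) \<Rightarrow> 'h"
  assumes finY: "finite Y"
    and supp: "f \<in> W \<Longrightarrow> x \<notin> Y \<Longrightarrow> f x = 0"
    and zeroW: "(\<lambda>_. 0) \<in> W"
    and addW: "f \<in> W \<Longrightarrow> g \<in> W \<Longrightarrow> (\<lambda>x. f x + g x) \<in> W"
    and smultW: "f \<in> W \<Longrightarrow> (\<lambda>x. c * f x) \<in> W"
    and limW: "(\<And>n. F n \<in> W) \<Longrightarrow> (\<And>x. (\<lambda>n. F n x) \<longlonglongrightarrow> f x) \<Longrightarrow> f \<in> W"
    and injj: "inj_on j W"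
begin

text \<open>The retraction \<open>r\<close> is total so that the distance is a metric on the whole type.\<close>

definition r :: "'h \<Rightarrow> 'x \<Rightarrow> complex" where
  "r a = (if a \<in> j ` W then inv_into W j a else (\<lambda>_. 0))"

definition space :: "'h hilbert" where
  "space = \<lparr>carrier = j ` W, monoid.mult = (\<lambda>_ _. j (\<lambda>_. 0)), one = j (\<lambda>_. 0), ring.zero = j (\<lambda>_. 0),
    add = (\<lambda>a b. j (\<lambda>x. r a x + r b x)), smult = (\<lambda>c a. j (\<lambda>x. c * r a x)),
    h_inner = (\<lambda>a b. \<Sum>x\<in>Y. r a x * cnj (r b x))\<rparr>"

lemma rW: "r a \<in> W"
  by (auto simp: r_def zeroW inv_into_into)

lemma rj: "f \<in> W \<Longrightarrow> r (j f) = f"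
  by (simp add: r_def inv_into_f_f[OF injj])

lemma jr: "a \<in> j ` W \<Longrightarrow> j (r a) = a"
  by (simp add: r_def f_inv_into_f)

lemma minusW: "f \<in> W \<Longrightarrow> (\<lambda>x. - f x) \<in> W"
  using smultW[of f "-1"] by simp

lemma sel: "carrier space = j ` W" "\<zero>\<^bsub>space\<^esub> = j (\<lambda>_. 0)" "a \<oplus>\<^bsub>space\<^esub> b = j (\<lambda>x. r a x + r b x)"
  "c \<odot>\<^bsub>space\<^esub> a = j (\<lambda>x. c * r a x)" "h_inner space a b = (\<Sum>x\<in>Y. r a x * cnj (r b x))"
  by (simp_all add: space_def)

lemma abelian_group_space: "abelian_group space"
proof (rule abelian_groupI)
  show "\<exists>y\<in>carrier space. y \<oplus>\<^bsub>space\<^esub> x = \<zero>\<^bsub>space\<^esub>" for x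
    by (rule bexI[of _ "j (\<lambda>t. - r x t)"]) (simp_all add: sel rj rW minusW)
qed (auto simp: sel rj rW addW zeroW algebra_simps)

lemma module_space: "Module.module complex_field space"
  by (rule moduleI[OF cring_complex_field abelian_group_space])
    (auto simp: sel rj rW addW smultW complex_field_def algebra_simps)

lemma a_inv: "\<ominus>\<^bsub>space\<^esub> b = j (\<lambda>x. - r b x)"
proof -
  have "(THE y. y \<in> j ` W \<and> j (\<lambda>x. r b x + r y x) = j (\<lambda>_. 0) \<and> j (\<lambda>x. r y x + r b x) = j (\<lambda>_. 0)) = j (\<lambda>x. - r b x)"
  proof (rule the_equality)
    fix y assume y: "y \<in> j ` W \<and> j (\<lambda>x. r b x + r y x) = j (\<lambda>_. 0) \<and> j (\<lambda>x. r y x + r b x) = j (\<lambda>_. 0)"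
    then have "(\<lambda>x. r b x + r y x) = (\<lambda>_. 0)"
      using inj_onD[OF injj _ addW[OF rW rW] zeroW] by simp
    then have "r y = (\<lambda>x. - r b x)" by (auto simp: fun_eq_iff add_eq_0_iff)
    then show "y = j (\<lambda>x. - r b x)" using y jr by metis
  qed (simp add: rj rW minusW)
  then show ?thesis by (simp add: a_inv_def m_inv_def sel)
qed

lemma diff: "a \<ominus>\<^bsub>space\<^esub> b = j (\<lambda>x. r a x - r b x)"
  by (simp add: a_minus_def sel a_inv rj rW minusW)

lemma diffW: "f \<in> W \<Longrightarrow> g \<in> W \<Longrightarrow> (\<lambda>x. f x - g x) \<in> W"
  using addW[OF _ minusW, of f g] by simp

lemma norm_j: "f \<in> W \<Longrightarrow> h_norm space (j f) = L2_set (\<lambda>x. cmod (f x)) Y"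
  by (simp add: h_norm_def L2_set_def sel rj cmod_power2 flip: power2_eq_square)

lemma dist: "h_norm space (a \<ominus>\<^bsub>space\<^esub> b) = L2_set (\<lambda>x. cmod (r a x - r b x)) Y"
  by (simp add: diff norm_j diffW rW)

lemma Metric: "Metric_space (carrier space) (\<lambda>x y. h_norm space (x \<ominus>\<^bsub>space\<^esub> y))"
proof
  show "h_norm space (x \<ominus>\<^bsub>space\<^esub> y) = h_norm space (y \<ominus>\<^bsub>space\<^esub> x)" for x y
    by (simp add: dist norm_minus_commute)
  show "(h_norm space (x \<ominus>\<^bsub>space\<^esub> y) = 0) = (x = y)" if "x \<in> carrier space" "y \<in> carrier space" for x y
  proof
    assume "h_norm space (x \<ominus>\<^bsub>space\<^esub> y) = 0"
    then have "\<forall>t\<in>Y. r x t = r y t" by (simp add: dist L2_set_eq_0_iff[OF finY])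
    then have "r x = r y" using supp[OF rW] by (metis ext)
    then show "x = y" using that jr by (metis sel(1))
  qed (simp add: dist L2_set_def)
  show "h_norm space (x \<ominus>\<^bsub>space\<^esub> z) \<le> h_norm space (x \<ominus>\<^bsub>space\<^esub> y) + h_norm space (y \<ominus>\<^bsub>space\<^esub> z)" for x y z
  proof -
    have "L2_set (\<lambda>t. cmod (r x t - r z t)) Y \<le> L2_set (\<lambda>t. cmod (r x t - r y t) + cmod (r y t - r z t)) Y"
      by (rule L2_set_mono) (use norm_triangle_ineq[of "r x t - r y t" "r y t - r z t" for t] in \<open>simp_all add: algebra_simps\<close>)
    also have "\<dots> \<le> L2_set (\<lambda>t. cmod (r x t - r y t)) Y + L2_set (\<lambda>t. cmod (r y t - r z t)) Y"
      by (rule L2_set_triangle_ineq)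
    finally show ?thesis by (simp add: dist)
  qed
qed (simp add: dist)

lemma complete_space: "Metric_space.mcomplete (carrier space) (\<lambda>x y. h_norm space (x \<ominus>\<^bsub>space\<^esub> y))"
proof -
  interpret Metric_space "carrier space" "\<lambda>x y. h_norm space (x \<ominus>\<^bsub>space\<^esub> y)" by (rule Metric)
  have "\<exists>x. limitin mtopology \<sigma> x sequentially" if \<sigma>: "MCauchy \<sigma>" for \<sigma>
  proof -
    have \<sigma>c: "\<And>n. \<sigma> n \<in> carrier space" using \<sigma> by (auto simp: MCauchy_def)
    have "\<exists>l. (\<lambda>n. r (\<sigma> n) x) \<longlonglongrightarrow> l" for x
    proof (cases "x \<in> Y")
      case True
      have le: "cmod (r a x - r b x) \<le> h_norm space (a \<ominus>\<^bsub>space\<^esub> b)" for a b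
        unfolding dist by (rule member_le_L2_set[OF finY True])
      have "Cauchy (\<lambda>n. r (\<sigma> n) x)"
      proof (rule CauchyI)
        fix e :: real assume "e > 0"
        then obtain N where "\<And>n m. N \<le> n \<Longrightarrow> N \<le> m \<Longrightarrow> h_norm space (\<sigma> n \<ominus>\<^bsub>space\<^esub> \<sigma> m) < e"
          using \<sigma> unfolding MCauchy_def by meson
        then have "\<forall>m\<ge>N. \<forall>n\<ge>N. norm (r (\<sigma> m) x - r (\<sigma> n) x) < e"
          using le order_le_less_trans by blast
        then show "\<exists>M. \<forall>m\<ge>M. \<forall>n\<ge>M. norm (r (\<sigma> m) x - r (\<sigma> n) x) < e" ..
      qed
      then show ?thesis by (simp add: Cauchy_convergent_iff convergent_def)
    next
      case False
      then have "r (\<sigma> n) x = 0" for n using supp[OF rW] by blast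
      then show ?thesis by (auto intro!: exI[of _ 0])
    qed
    then obtain f where f: "\<And>x. (\<lambda>n. r (\<sigma> n) x) \<longlonglongrightarrow> f x" by metis
    then have fW: "f \<in> W" using limW[of "\<lambda>n. r (\<sigma> n)" f] rW by blast
    have "(\<lambda>n. L2_set (\<lambda>x. cmod (r (\<sigma> n) x - r (j f) x)) Y) \<longlonglongrightarrow> sqrt (\<Sum>x\<in>Y. (cmod (f x - r (j f) x))\<^sup>2)"
      unfolding L2_set_def by (intro tendsto_intros f)
    then have lim: "(\<lambda>n. h_norm space (\<sigma> n \<ominus>\<^bsub>space\<^esub> j f)) \<longlonglongrightarrow> 0"
      by (simp add: dist rj fW)
    have "\<exists>N. \<forall>n\<ge>N. \<sigma> n \<in> carrier space \<and> h_norm space (\<sigma> n \<ominus>\<^bsub>space\<^esub> j f) < e" if "e > 0" for e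
      using order_tendstoD(2)[OF lim that] \<sigma>c by (auto simp: eventually_sequentially)
    moreover have "j f \<in> carrier space" using fW by (simp add: sel)
    ultimately show ?thesis unfolding limit_metric_sequentially by blast
  qed
  then show ?thesis unfolding mcomplete_def by blast
qed

lemma hilbert: "complex_hilbert_space space"
proof (intro complex_hilbert_space.intro complex_hilbert_space_axioms.intro module_space complete_space)
  show "0 < Re (h_inner space x x)" if "x \<in> carrier space" "x \<noteq> \<zero>\<^bsub>space\<^esub>" for x
  proof -
    have "r x \<noteq> (\<lambda>_. 0)" using that jr by (metis sel(1,2))
    then obtain t where t: "r x t \<noteq> 0" by auto
    then have "t \<in> Y" using supp[OF rW] by blast
    then have "0 < (\<Sum>t\<in>Y. (cmod (r x t))\<^sup>2)" using t finY by (intro sum_pos2[of _ t]) auto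
    then show ?thesis by (simp add: sel cmod_power2 flip: power2_eq_square)
  qed
qed (auto simp: sel rj rW addW smultW algebra_simps sum.distrib sum_distrib_left)

end

section \<open>Permutation representations on function spaces\<close>

text \<open>\<open>act\<close> is a right action, as on right cosets; composing functions with it
  gives the left action \<open>trans\<close>.\<close>

locale function_rep = function_hilbert Y W j + group G
  for Y :: "'x set" and W and j :: "('x \<Rightarrow> complex) \<Rightarrow> 'h" and G :: "('g, 'm) monoid_scheme" (structure) +
  fixes act :: "'g \<Rightarrow> 'x \<Rightarrow> 'x"
  assumes actY: "g \<in> carrier G \<Longrightarrow> x \<in> Y \<Longrightarrow> act g x \<in> Y"
    and act_mult: "g \<in> carrier G \<Longrightarrow> h \<in> carrier G \<Longrightarrow> x \<in> Y \<Longrightarrow> act (g \<otimes> h) x = act h (act g x)"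
    and act_one: "x \<in> Y \<Longrightarrow> act \<one> x = x"
    and actW: "g \<in> carrier G \<Longrightarrow> f \<in> W \<Longrightarrow> (\<lambda>x. if x \<in> Y then f (act g x) else 0) \<in> W"
    and no_invariants: "f \<in> W \<Longrightarrow> (\<And>g x. g \<in> carrier G \<Longrightarrow> x \<in> Y \<Longrightarrow> f (act g x) = f x) \<Longrightarrow> f = (\<lambda>_. 0)"
begin

definition trans :: "'g \<Rightarrow> ('x \<Rightarrow> complex) \<Rightarrow> 'x \<Rightarrow> complex" where
  "trans g f = (\<lambda>x. if x \<in> Y then f (act g x) else 0)"

definition \<pi> :: "'g \<Rightarrow> 'h \<Rightarrow> 'h" where
  "\<pi> g = (\<lambda>a\<in>j ` W. j (trans g (r a)))"

lemma transW: "g \<in> carrier G \<Longrightarrow> f \<in> W \<Longrightarrow> trans g f \<in> W"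
  unfolding trans_def by (rule actW)

lemma \<pi>_j: "f \<in> W \<Longrightarrow> \<pi> g (j f) = j (trans g f)"
  by (simp add: \<pi>_def rj)

lemma trans_mult: "g \<in> carrier G \<Longrightarrow> h \<in> carrier G \<Longrightarrow> trans (g \<otimes> h) f = trans g (trans h f)"
  by (auto simp: trans_def fun_eq_iff actY act_mult)

lemma trans_one: "f \<in> W \<Longrightarrow> trans \<one> f = f"
  by (auto simp: trans_def fun_eq_iff act_one supp)

lemma bij_act: "g \<in> carrier G \<Longrightarrow> bij_betw (act g) Y Y"
  by (rule bij_betw_byWitness[where f' = "act (inv g)"])
    (auto simp: actY act_one simp flip: act_mult)

lemma \<pi>_Bij: "g \<in> carrier G \<Longrightarrow> \<pi> g \<in> Bij (j ` W)"
proof -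
  assume g: "g \<in> carrier G"
  have 1: "\<pi> h (j f) = j (trans h f)" "trans h f \<in> W" if "h \<in> carrier G" "f \<in> W" for h f
    using that by (simp_all add: \<pi>_j transW)
  have "trans (inv g) (trans g f) = f" "trans g (trans (inv g) f) = f" if "f \<in> W" for f
    using g that trans_mult[of g "inv g" f] trans_mult[of "inv g" g f] trans_one[OF that] by simp_all
  then have "bij_betw (\<pi> g) (j ` W) (j ` W)"
    using g by (intro bij_betw_byWitness[where f' = "\<pi> (inv g)"]) (auto simp: 1)
  then show ?thesis by (simp add: Bij_def \<pi>_def)
qed

lemma \<pi>_unitary: "g \<in> carrier G \<Longrightarrow> \<pi> g \<in> carrier (unitary_group space)"
proof -
  assume g: "g \<in> carrier G"
  have "(\<Sum>x\<in>Y. trans g f x * cnj (trans g f' x)) = (\<Sum>x\<in>Y. f x * cnj (f' x))" for f f'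
  proof -
    have "(\<Sum>x\<in>Y. trans g f x * cnj (trans g f' x)) = (\<Sum>x\<in>Y. f (act g x) * cnj (f' (act g x)))"
      by (simp add: trans_def)
    also have "\<dots> = (\<Sum>x\<in>Y. f x * cnj (f' x))"
      using sum.reindex_bij_betw[OF bij_act[OF g], of "\<lambda>x. f x * cnj (f' x)"] .
    finally show ?thesis .
  qed
  moreover have "trans g (\<lambda>x. f x + f' x) = (\<lambda>x. trans g f x + trans g f' x)"
    "trans g (\<lambda>x. c * f x) = (\<lambda>x. c * trans g f x)" for f f' c
    by (auto simp: trans_def fun_eq_iff)
  ultimately show ?thesis
    using \<pi>_Bij[OF g] g by (auto simp: unitary_group_def sel \<pi>_j rj transW addW smultW)
qed

lemma \<pi>_hom: "\<pi> \<in> hom G (unitary_group space)"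
proof (rule homI)
  fix g h assume gh: "g \<in> carrier G" "h \<in> carrier G"
  have "\<pi> (g \<otimes> h) = compose (j ` W) (\<pi> g) (\<pi> h)"
  proof
    fix a
    show "\<pi> (g \<otimes> h) a = compose (j ` W) (\<pi> g) (\<pi> h) a"
    proof (cases "a \<in> j ` W")
      case True
      then obtain f where "f \<in> W" "a = j f" by auto
      then show ?thesis using gh by (simp add: compose_def \<pi>_j transW trans_mult)
    qed (simp add: compose_def \<pi>_def)
  qed
  then show "\<pi> (g \<otimes> h) = \<pi> g \<otimes>\<^bsub>unitary_group space\<^esub> \<pi> h"
    using gh \<pi>_Bij by (simp add: unitary_group_def BijGroup_def sel)
qed (rule \<pi>_unitary)

lemma finite_rep: "(space, \<pi>) \<in> finite_reps_without_invariants TYPE('h) G"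
proof -
  have "invariant_vectors G space \<pi> = {\<zero>\<^bsub>space\<^esub>}"
  proof (intro equalityI subsetI)
    fix a assume "a \<in> invariant_vectors G space \<pi>"
    then have a: "a \<in> j ` W" "\<And>g. g \<in> carrier G \<Longrightarrow> \<pi> g a = a" by (auto simp: invariant_vectors_def sel)
    then obtain f where f: "f \<in> W" "a = j f" by auto
    have "trans g f = f" if "g \<in> carrier G" for g
      using a(2)[OF that] f inj_onD[OF injj _ transW[OF that f(1)] f(1)] by (simp add: \<pi>_j)
    then have "f (act g x) = f x" if "g \<in> carrier G" "x \<in> Y" for g x
      using that by (metis trans_def)
    then have "f = (\<lambda>_. 0)" by (rule no_invariants[OF f(1)])
    then show "a \<in> {\<zero>\<^bsub>space\<^esub>}" using f by (simp add: sel)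
  next
    fix a assume "a \<in> {\<zero>\<^bsub>space\<^esub>}"
    moreover have "trans g (\<lambda>_. 0) = (\<lambda>_. 0)" for g by (auto simp: trans_def)
    ultimately show "a \<in> invariant_vectors G space \<pi>"
      by (auto simp: invariant_vectors_def sel zeroW \<pi>_j)
  qed
  moreover have "finite (\<pi> ` carrier G)"
  proof -
    \<comment> \<open>The operator depends only on the permutation of the finite set
      \<open>Y\<close> induced by \<open>g\<close>.\<close>
    have "\<pi> g = (\<lambda>F. \<lambda>a\<in>j ` W. j (\<lambda>x. if x \<in> Y then r a (F x) else 0)) (restrict (act g) Y)" for g
      by (auto simp: \<pi>_def trans_def fun_eq_iff intro!: arg_cong[where f = j])
    then have "\<pi> ` carrier G \<subseteq> (\<lambda>F. \<lambda>a\<in>j ` W. j (\<lambda>x. if x \<in> Y then r a (F x) else 0)) ` (Y \<rightarrow>\<^sub>E Y)"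
      using actY by (intro image_subsetI image_eqI) auto
    then show ?thesis using finite_PiE[OF finY, of "\<lambda>_. Y"] finY by (meson finite_imageI finite_subset)
  qed
  ultimately show ?thesis
    by (simp add: finite_reps_without_invariants_def reps_without_invariants_def hilbert \<pi>_hom)
qed

lemma displacement:
  "f \<in> W \<Longrightarrow> g \<in> carrier G \<Longrightarrow>
    h_norm space (\<pi> g (j f) \<ominus>\<^bsub>space\<^esub> j f) = L2_set (\<lambda>x. cmod (f (act g x) - f x)) Y"
  unfolding dist by (simp add: \<pi>_j rj transW) (simp add: trans_def cong: L2_set_cong_simp)

end

section \<open>Quasi-regular representations and the displacement estimate\<close>

lemma (in group) bij_betw_rcosets_mult:
  assumes H: "subgroup H G" and g: "g \<in> carrier G"
  shows "bij_betw (\<lambda>C. C #> g) (rcosets H) (rcosets H)"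
proof (rule bij_betw_byWitness[where f' = "\<lambda>C. C #> inv g"])
  have sub: "C \<subseteq> carrier G" if "C \<in> rcosets H" for C
    using rcosets_part_G[OF H] that by blast
  show "\<forall>C\<in>rcosets H. C #> g #> inv g = C"
    using g sub by (simp add: coset_mult_assoc)
  show "\<forall>C\<in>rcosets H. C #> inv g #> g = C"
    using g sub by (simp add: coset_mult_assoc)
  have mem: "C #> h \<in> rcosets H" if "C \<in> rcosets H" "h \<in> carrier G" for C h
  proof -
    obtain x where "x \<in> carrier G" "C = H #> x" using \<open>C \<in> rcosets H\<close> by (auto simp: RCOSETS_def)
    then show ?thesis
      using that(2) by (simp add: coset_mult_assoc[OF subgroup.subset[OF H]] rcosetsI[OF subgroup.subset[OF H]])
  qed
  show "(\<lambda>C. C #> g) ` (rcosets H) \<subseteq> rcosets H" using mem g by blast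
  show "(\<lambda>C. C #> inv g) ` (rcosets H) \<subseteq> rcosets H" using mem g by blast
qed

text \<open>The representation is the sum of the spaces of functions of total 0 on the coset spaces
  of the \<open>H k\<close>, and the vector has squared norm \<open>1 / m\<close> in each summand.
  An element lying in every \<open>H k\<close> but one moves a single component, by at most
  \<open>4 / m\<close> in squared norm.\<close>

lemma (in group) almost_invariant_vector:
  fixes H :: "nat \<Rightarrow> 'a set"
  assumes H: "\<And>k. k < m \<Longrightarrow> subgroup (H k) G" "\<And>k. k < m \<Longrightarrow> H k \<noteq> carrier G"
      "\<And>k. k < m \<Longrightarrow> finite (rcosets (H k))" and m: "m \<noteq> 0"
  shows "\<exists>(Hil, \<pi>) \<in> finite_reps_without_invariants TYPE('i \<Rightarrow> complex) G.
    \<exists>\<xi>\<in>carrier Hil. h_norm Hil \<xi> = 1 \<and> (\<forall>s\<in>{g \<in> carrier G. \<exists>l. \<forall>k<m. k \<noteq> l \<longrightarrow> g \<in> H k}.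
      h_norm Hil (\<pi> s \<xi> \<ominus>\<^bsub>Hil\<^esub> \<xi>) \<le> 2 / sqrt m)"
proof -
  define Y where "Y = Sigma {..<m} (\<lambda>k. rcosets (H k))"
  define W where "W = {f :: nat \<times> 'a set \<Rightarrow> complex. (\<forall>y. y \<notin> Y \<longrightarrow> f y = 0) \<and>
    (\<forall>k<m. (\<Sum>C\<in>rcosets (H k). f (k, C)) = 0)}"
  define act where "act g = (\<lambda>(k :: nat, C). (k, C #> g))" for g
  have finY: "finite Y" unfolding Y_def by (intro finite_SigmaI) (simp_all add: H(3))
  have Wsupp: "f y = 0" if "f \<in> W" "y \<notin> Y" for f y using that unfolding W_def by blast
  have WI: "f \<in> W" if "\<And>y. y \<notin> Y \<Longrightarrow> f y = 0" "\<And>k. k < m \<Longrightarrow> (\<Sum>C\<in>rcosets (H k). f (k, C)) = 0" for f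
    using that unfolding W_def by blast
  have "inj (\<lambda>z :: complex. (\<lambda>_ :: 'i. z))" by (auto simp: inj_def fun_eq_iff)
  then obtain j :: "(nat \<times> 'a set \<Rightarrow> complex) \<Rightarrow> 'i \<Rightarrow> complex"
    where "inj_on j {f. \<forall>x. x \<notin> Y \<longrightarrow> f x = 0}"
    using inj_finite_support_functions[OF finY] by blast
  then have j: "inj_on j W" by (rule inj_on_subset) (auto simp: W_def)
  have bij: "bij_betw (\<lambda>C. C #> g) (rcosets (H k)) (rcosets (H k))" if "k < m" "g \<in> carrier G" for k g
    using bij_betw_rcosets_mult[OF H(1)] that .
  have mem: "C #> g \<in> rcosets (H k)" if "k < m" "g \<in> carrier G" "C \<in> rcosets (H k)" for k g C
    using bij[OF that(1,2)] that(3) by (auto simp: bij_betw_def)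
  have sub: "C \<subseteq> carrier G" if "k < m" "C \<in> rcosets (H k)" for k C
    using rcosets_part_G[OF H(1)[OF that(1)]] that(2) by blast
  have Hin: "H k \<in> rcosets (H k)" if "k < m" for k
    using subgroup.subgroup_in_rcosets[OF H(1)[OF that] is_group] .
  interpret F: function_rep Y W j G act
  proof
    show "f \<in> W" if F: "\<And>n. F n \<in> W" "\<And>x. (\<lambda>n. F n x) \<longlonglongrightarrow> f x" for F f
    proof -
      have "f y = 0" if "y \<notin> Y" for y
        using F(2)[of y] Wsupp[OF F(1) that] by (simp add: LIMSEQ_const_iff)
      moreover have "(\<Sum>C\<in>rcosets (H k). f (k, C)) = 0" if "k < m" for k
      proof -
        have "(\<lambda>n. \<Sum>C\<in>rcosets (H k). F n (k, C)) \<longlonglongrightarrow> (\<Sum>C\<in>rcosets (H k). f (k, C))"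
          by (intro tendsto_sum F(2))
        moreover have "(\<lambda>n. \<Sum>C\<in>rcosets (H k). F n (k, C)) = (\<lambda>_. 0)"
          using F(1) that by (simp add: W_def)
        ultimately show ?thesis by (simp add: LIMSEQ_const_iff)
      qed
      ultimately show ?thesis by (rule WI)
    qed
    show "act g x \<in> Y" if "g \<in> carrier G" "x \<in> Y" for g x
      using that mem by (auto simp: act_def Y_def)
    show "act (g \<otimes> h) x = act h (act g x)" if "g \<in> carrier G" "h \<in> carrier G" "x \<in> Y" for g h x
      using that sub by (auto simp: act_def Y_def coset_mult_assoc)
    show "act \<one> x = x" if "x \<in> Y" for x
      using that sub by (auto simp: act_def Y_def)
    show "(\<lambda>x. if x \<in> Y then f (act g x) else 0) \<in> W" if g: "g \<in> carrier G" and f: "f \<in> W" for g f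
    proof -
      have "(\<Sum>C\<in>rcosets (H k). if (k, C) \<in> Y then f (act g (k, C)) else 0) = 0" if k: "k < m" for k
      proof -
        have "(\<Sum>C\<in>rcosets (H k). if (k, C) \<in> Y then f (act g (k, C)) else 0)
            = (\<Sum>C\<in>rcosets (H k). f (k, C #> g))"
          using k by (intro sum.cong) (auto simp: Y_def act_def)
        also have "\<dots> = (\<Sum>C\<in>rcosets (H k). f (k, C))"
          using sum.reindex_bij_betw[OF bij[OF k g], of "\<lambda>C. f (k, C)"] .
        finally show ?thesis using f k by (simp add: W_def)
      qed
      then show ?thesis by (simp add: W_def)
    qed
    show "f = (\<lambda>_. 0)" if f: "f \<in> W" and inv: "\<And>g x. g \<in> carrier G \<Longrightarrow> x \<in> Y \<Longrightarrow> f (act g x) = f x" for f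
    proof
      fix y
      show "f y = 0"
      proof (cases "y \<in> Y")
        case True
        then obtain k C where y: "y = (k, C)" "k < m" "C \<in> rcosets (H k)" by (auto simp: Y_def)
        \<comment> \<open>\<open>G\<close> is transitive on the cosets of \<open>H k\<close>, so an
          invariant function is constant on each block; the sum condition then makes it
          zero.\<close>
        have c: "f (k, C') = f (k, H k)" if "C' \<in> rcosets (H k)" for C'
        proof -
          obtain x where x: "x \<in> carrier G" "C' = H k #> x" using \<open>C' \<in> rcosets (H k)\<close> by (auto simp: RCOSETS_def)
          have "(k, H k) \<in> Y" using y(2) Hin by (auto simp: Y_def)
          then show ?thesis using inv[OF x(1)] x(2) by (force simp: act_def)
        qed
        have "0 = (\<Sum>C\<in>rcosets (H k). f (k, C))" using f y(2) by (simp add: W_def)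
        also have "\<dots> = of_nat (card (rcosets (H k))) * f (k, H k)" using c by simp
        finally have "f (k, H k) = 0" using H(3)[OF y(2)] y(3) by auto
        then show ?thesis using c[OF y(3)] y(1) by simp
      qed (rule Wsupp[OF f])
    qed
  qed (use finY j in \<open>auto simp: W_def sum.distrib sum_distrib_left[symmetric]\<close>)
  define N where "N k = real (card (rcosets (H k)))" for k
  have N: "N k \<ge> 2" if "k < m" for k
  proof -
    have "card (rcosets (H k)) \<noteq> 0" using H(3)[OF that] Hin[OF that] by auto
    moreover have "card (rcosets (H k)) \<noteq> 1"
    proof
      assume "card (rcosets (H k)) = 1"
      then have "rcosets (H k) = {H k}" using Hin[OF that] by (metis card_1_singletonE singletonD)
      then show False using rcosets_part_G[OF H(1)[OF that]] H(2)[OF that] by simp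
    qed
    ultimately show ?thesis by (simp add: N_def)
  qed
  \<comment> \<open>The indicator of \<open>H k\<close> minus its mean has squared norm
    \<open>1 - 1 / N k\<close>, which \<open>c k\<close> rescales to \<open>1 / m\<close>.
    Properness of \<open>H k\<close> gives \<open>N k \<ge> 2\<close>, hence the bound
    \<open>2 / m\<close> for the square of \<open>c k\<close>.\<close>
  define c where "c k = 1 / sqrt (m * (1 - 1 / N k))" for k
  have c2: "(c k)\<^sup>2 * (1 - 1 / N k) = 1 / m" "(c k)\<^sup>2 \<le> 2 / m" if "k < m" for k
  proof -
    have n: "1 - 1 / N k \<ge> 1 / 2" using N[OF that] by (simp add: field_simps)
    then have sq: "(c k)\<^sup>2 = 1 / (m * (1 - 1 / N k))" by (simp add: c_def power_divide)
    have "1 / (m * a) * a = 1 / m" if "a \<noteq> 0" for a :: real using that by simp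
    then show "(c k)\<^sup>2 * (1 - 1 / N k) = 1 / m" unfolding sq using n by (metis half_gt_zero_iff less_numeral_extra(1,3) linorder_not_le)
    then have "1 / m \<ge> (c k)\<^sup>2 * (1 / 2)" using mult_left_mono[OF n, of "(c k)\<^sup>2"] by simp
    then show "(c k)\<^sup>2 \<le> 2 / m" by simp
  qed
  define \<delta> where "\<delta> k C = (if C = H k then 1 else 0 :: real)" for k C
  have s\<delta>: "(\<Sum>C\<in>rcosets (H k). \<delta> k C) = 1" if "k < m" for k
    using H(3)[OF that] Hin[OF that] by (simp add: \<delta>_def)
  have \<delta>2: "(\<delta> k C)\<^sup>2 = \<delta> k C" for k C by (simp add: \<delta>_def)
  define u where "u = (\<lambda>(k, C). c k * (\<delta> k C - 1 / N k))"
  define v where "v x = (if x \<in> Y then complex_of_real (u x) else 0)" for x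
  have vW: "v \<in> W"
  proof -
    have "(\<Sum>C\<in>rcosets (H k). v (k, C)) = 0" if k: "k < m" for k
    proof -
      have "(\<Sum>C\<in>rcosets (H k). v (k, C)) = complex_of_real (\<Sum>C\<in>rcosets (H k). u (k, C))"
        unfolding of_real_sum using k by (intro sum.cong) (auto simp: v_def Y_def)
      also have "(\<Sum>C\<in>rcosets (H k). u (k, C)) = c k * ((\<Sum>C\<in>rcosets (H k). \<delta> k C) - N k * (1 / N k))"
        by (simp add: u_def N_def sum_subtractf flip: sum_distrib_left)
      also have "\<dots> = 0" using N[OF k] s\<delta>[OF k] by simp
      finally show ?thesis by simp
    qed
    then show ?thesis by (auto simp: W_def v_def)
  qed
  have sumY: "(\<Sum>x\<in>Y. h x) = (\<Sum>k<m. \<Sum>C\<in>rcosets (H k). h (k, C))" for h :: "nat \<times> 'a set \<Rightarrow> real"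
    unfolding Y_def using H(3) by (subst sum.Sigma) auto
  have norm: "h_norm F.space (j v) = 1"
  proof -
    have "(\<Sum>x\<in>Y. (cmod (v x))\<^sup>2) = (\<Sum>x\<in>Y. (u x)\<^sup>2)"
      by (intro sum.cong) (auto simp: v_def)
    also have "\<dots> = (\<Sum>k<m. \<Sum>C\<in>rcosets (H k). (u (k, C))\<^sup>2)" by (rule sumY)
    also have "\<dots> = (\<Sum>k<m. 1 / m)"
    proof (rule sum.cong)
      fix k assume "k \<in> {..<m}"
      then have k: "k < m" by simp
      have "(\<Sum>C\<in>rcosets (H k). (u (k, C))\<^sup>2)
          = (\<Sum>C\<in>rcosets (H k). (c k)\<^sup>2 * (\<delta> k C - \<delta> k C * (2 / N k) + 1 / (N k)\<^sup>2))"
        by (simp add: u_def power_mult_distrib power2_diff \<delta>2 power_divide algebra_simps) (simp add: power2_eq_square algebra_simps)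
      also have "\<dots> = (c k)\<^sup>2 * (1 - 2 / N k + N k * (1 / (N k)\<^sup>2))"
        unfolding sum_distrib_left[symmetric] sum.distrib sum_subtractf sum_distrib_right[symmetric] s\<delta>[OF k]
        by (simp add: N_def)
      also have "1 - 2 / N k + N k * (1 / (N k)\<^sup>2) = 1 - 1 / N k"
        using N[OF k] by (simp add: field_simps power2_eq_square)
      finally show "(\<Sum>C\<in>rcosets (H k). (u (k, C))\<^sup>2) = 1 / m" using c2[OF k] by simp
    qed simp
    finally show ?thesis using m by (simp add: F.norm_j[OF vW] L2_set_def)
  qed
  have disp: "h_norm F.space (F.\<pi> s (j v) \<ominus>\<^bsub>F.space\<^esub> j v) \<le> 2 / sqrt m"
    if s: "s \<in> carrier G" and l: "\<forall>k<m. k \<noteq> l \<longrightarrow> s \<in> H k" for s l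
  proof -
    let ?d = "\<lambda>k C. (c k)\<^sup>2 * (\<delta> k (C #> s) - \<delta> k C)\<^sup>2"
    have "(\<Sum>x\<in>Y. (cmod (v (act s x) - v x))\<^sup>2) = (\<Sum>x\<in>Y. (\<lambda>(k, C). ?d k C) x)"
    proof (rule sum.cong)
      fix x assume "x \<in> Y"
      then obtain k C where x: "x = (k, C)" "k < m" "C \<in> rcosets (H k)" by (auto simp: Y_def)
      have "v (act s x) - v x = complex_of_real (c k * (\<delta> k (C #> s) - \<delta> k C))"
        using x mem[OF x(2) s x(3)] by (simp add: v_def Y_def act_def u_def algebra_simps)
      then show "(cmod (v (act s x) - v x))\<^sup>2 = (\<lambda>(k, C). ?d k C) x"
        by (simp only: norm_of_real x(1) power2_abs power_mult_distrib prod.case)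
    qed simp
    also have "\<dots> = (\<Sum>k<m. \<Sum>C\<in>rcosets (H k). ?d k C)" using sumY by simp
    also have "\<dots> \<le> (\<Sum>k<m. if k = l then 4 / m else 0)"
    proof (rule sum_mono)
      fix k assume "k \<in> {..<m}"
      then have k: "k < m" by simp
      show "(\<Sum>C\<in>rcosets (H k). ?d k C) \<le> (if k = l then 4 / m else 0)"
      proof (cases "k = l")
        case False
        then have sH: "s \<in> H k" using l k by blast
        have "\<delta> k (C #> s) = \<delta> k C" if C: "C \<in> rcosets (H k)" for C
        proof -
          have Hs: "H k #> s = H k" using subgroup.rcos_const[OF H(1)[OF k] is_group sH] .
          have "inj_on (\<lambda>C. C #> s) (rcosets (H k))" using bij[OF k s] by (simp add: bij_betw_def)
          then have "C #> s = H k #> s \<longleftrightarrow> C = H k" using C Hin[OF k] by (rule inj_on_eq_iff)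
          then show ?thesis by (simp add: \<delta>_def Hs)
        qed
        then show ?thesis using False by simp
      next
        case True
        \<comment> \<open>For values 0 and 1 the square of a difference is at most the sum. The two
          indicators have total 2, which with the bound \<open>2 / m\<close> gives
          \<open>4 / m\<close>.\<close>
        have "(\<Sum>C\<in>rcosets (H k). ?d k C) \<le> (\<Sum>C\<in>rcosets (H k). (c k)\<^sup>2 * (\<delta> k (C #> s) + \<delta> k C))"
          by (intro sum_mono mult_left_mono) (auto simp: \<delta>_def)
        also have "\<dots> = (c k)\<^sup>2 * ((\<Sum>C\<in>rcosets (H k). \<delta> k (C #> s)) + (\<Sum>C\<in>rcosets (H k). \<delta> k C))"
          by (simp only: sum_distrib_left[symmetric] sum.distrib)
        also have "(\<Sum>C\<in>rcosets (H k). \<delta> k (C #> s)) = (\<Sum>C\<in>rcosets (H k). \<delta> k C)"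
          by (rule sum.reindex_bij_betw[OF bij[OF k s]])
        finally show ?thesis using c2(2)[OF k] s\<delta>[OF k] True by simp
      qed
    qed
    also have "\<dots> \<le> 4 / m" by (simp add: sum.delta)
    finally have "(\<Sum>x\<in>Y. (cmod (v (act s x) - v x))\<^sup>2) \<le> 4 / m" .
    then have "sqrt (\<Sum>x\<in>Y. (cmod (v (act s x) - v x))\<^sup>2) \<le> sqrt (4 / m)"
      by (rule real_sqrt_le_mono)
    also have "sqrt (4 / m) = 2 / sqrt m" by (simp add: real_sqrt_divide)
    finally show ?thesis unfolding F.displacement[OF vW s] L2_set_def .
  qed
  show ?thesis
  proof (rule bexI[OF _ F.finite_rep], unfold prod.case, rule bexI, intro conjI ballI)
    show "j v \<in> carrier F.space" using vW by (simp add: F.sel)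
    show "h_norm F.space (j v) = 1" by (rule norm)
    fix s assume "s \<in> {g \<in> carrier G. \<exists>l. \<forall>k<m. k \<noteq> l \<longrightarrow> g \<in> H k}"
    then obtain l where "s \<in> carrier G" "\<forall>k<m. k \<noteq> l \<longrightarrow> s \<in> H k" by (elim CollectE conjE exE)
    then show "h_norm F.space (F.\<pi> s (j v) \<ominus>\<^bsub>F.space\<^esub> j v) \<le> 2 / sqrt m" by (rule disp)
  qed
qed

theorem uniform_constants_zero:
  assumes "group G" and fg: "finite_generating_sets G \<noteq> {}" and sup: "has_supplements G"
  shows "uniform_kazhdan_const TYPE('i \<Rightarrow> complex) G = 0 \<and> uniform_tau_const TYPE('i \<Rightarrow> complex) G = 0"
proof -
  interpret group G by fact
  have le: "uniform_tau_const TYPE('i \<Rightarrow> complex) G \<le> ennreal (2 / sqrt (real (Suc n)))" for n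
  proof -
    define m where "m = Suc n"
    obtain H D where H: "\<forall>k<m. subgroup (H k) G \<and> H k \<noteq> carrier G \<and> finite (rcosets\<^bsub>G\<^esub> (H k)) \<and> D \<subseteq> H k"
      and ind: "\<forall>c. (\<forall>k<m. c k \<in> carrier G) \<longrightarrow> (\<exists>g\<in>carrier G. \<forall>k<m. g \<otimes>\<^bsub>G\<^esub> inv\<^bsub>G\<^esub> (c k) \<in> H k)"
      using independent_subgroups[OF sup, of m] by (elim exE conjE)
    let ?T = "{g \<in> carrier G. \<exists>l. \<forall>k<m. k \<noteq> l \<longrightarrow> g \<in> H k}"
    have "generate G ?T = carrier G"
    proof (rule generate_independent)
      show "subgroup (H k) G" if "k < m" for k using H that by simp
      show "\<exists>g\<in>carrier G. \<forall>k<m. g \<otimes>\<^bsub>G\<^esub> inv\<^bsub>G\<^esub> (c k) \<in> H k" if "\<forall>k<m. c k \<in> carrier G" for c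
        by (rule mp[OF spec[OF ind] that])
    qed
    moreover have "?T \<subseteq> carrier G" by blast
    \<comment> \<open>The finite generating set depends on \<open>m\<close>; this is where the
      infimum over generating sets enters.\<close>
    ultimately obtain S where S: "S \<in> finite_generating_sets G" "S \<subseteq> ?T"
      using finite_generating_subset[OF _ _ fg] by blast
    obtain Hil \<pi> \<xi> where R: "(Hil, \<pi>) \<in> finite_reps_without_invariants TYPE('i \<Rightarrow> complex) G"
      and \<xi>: "\<xi> \<in> carrier Hil" "h_norm Hil \<xi> = 1"
      and d: "\<forall>s\<in>?T. h_norm Hil (\<pi> s \<xi> \<ominus>\<^bsub>Hil\<^esub> \<xi>) \<le> 2 / sqrt m"
      using almost_invariant_vector[of m H, where 'i = 'i] H by (auto simp: m_def)
    have "uniform_tau_const TYPE('i \<Rightarrow> complex) G \<le> tau_const TYPE('i \<Rightarrow> complex) G S"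
      unfolding uniform_tau_const_def by (rule INF_lower[OF S(1)])
    also have "\<dots> \<le> (INF \<xi>\<in>{\<xi> \<in> carrier Hil. h_norm Hil \<xi> = 1}. SUP s\<in>S. ennreal (h_norm Hil (\<pi> s \<xi> \<ominus>\<^bsub>Hil\<^esub> \<xi>)))"
      unfolding tau_const_def min_displacement_def by (rule INF_lower2[OF R]) simp
    also have "\<dots> \<le> (SUP s\<in>S. ennreal (h_norm Hil (\<pi> s \<xi> \<ominus>\<^bsub>Hil\<^esub> \<xi>)))"
      using \<xi> by (intro INF_lower) simp
    also have "\<dots> \<le> ennreal (2 / sqrt m)"
      using d S(2) by (intro SUP_least ennreal_leI) (metis (no_types, lifting) subsetD)
    finally show ?thesis by (simp add: m_def)
  qed
  have "(\<lambda>n. 2 / sqrt (real (Suc n))) \<longlonglongrightarrow> 0"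
    by (intro tendsto_divide_0[OF tendsto_const] filterlim_at_top_imp_at_infinity
        filterlim_compose[OF sqrt_at_top] filterlim_compose[OF filterlim_real_sequentially filterlim_Suc])
  then have "(\<lambda>n. ennreal (2 / sqrt (real (Suc n)))) \<longlonglongrightarrow> ennreal 0"
    by (rule tendsto_ennrealI)
  then have "uniform_tau_const TYPE('i \<Rightarrow> complex) G \<le> ennreal 0"
    by (rule LIMSEQ_le_const) (use le in blast)
  moreover have "uniform_kazhdan_const TYPE('i \<Rightarrow> complex) G \<le> uniform_tau_const TYPE('i \<Rightarrow> complex) G"
    unfolding uniform_kazhdan_const_def uniform_tau_const_def kazhdan_const_def tau_const_def min_displacement_def
    by (intro INF_mono' INF_superset_mono) (auto simp: finite_reps_without_invariants_def)
  ultimately show ?thesis by simp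
qed

section \<open>Filtrations of finitely generated rings\<close>

hide_const (open) Polynomials.degree Polynomials.lead_coeff
hide_const (open) UnivPoly.coeff UnivPoly.monom UnivPoly.deg
hide_const (open) up_ring.coeff up_ring.monom Congruence.partition Module.smult module.smult

definition is_subring :: "'a::comm_ring_1 set \<Rightarrow> bool" where
  "is_subring R \<longleftrightarrow> 1 \<in> R \<and> (\<forall>a\<in>R. \<forall>b\<in>R. a - b \<in> R \<and> a * b \<in> R)"

lemma is_subringD:
  assumes "is_subring R"
  shows "1 \<in> R" "a \<in> R \<Longrightarrow> b \<in> R \<Longrightarrow> a - b \<in> R" "a \<in> R \<Longrightarrow> b \<in> R \<Longrightarrow> a * b \<in> R" "0 \<in> R"
    "a \<in> R \<Longrightarrow> - a \<in> R" "a \<in> R \<Longrightarrow> b \<in> R \<Longrightarrow> a + b \<in> R" "a \<in> R \<Longrightarrow> a ^ n \<in> R"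
proof -
  show 1: "1 \<in> R" and d: "a \<in> R \<Longrightarrow> b \<in> R \<Longrightarrow> a - b \<in> R" and m: "a \<in> R \<Longrightarrow> b \<in> R \<Longrightarrow> a * b \<in> R" for a b
    using assms by (auto simp: is_subring_def)
  show 0: "0 \<in> R" using d[OF 1 1] by simp
  show n: "a \<in> R \<Longrightarrow> - a \<in> R" for a using d[OF 0, of a] by simp
  show "a \<in> R \<Longrightarrow> b \<in> R \<Longrightarrow> a + b \<in> R" using d[of a "- b"] n by simp
  show "a \<in> R \<Longrightarrow> a ^ n \<in> R" using 1 m by (induction n) auto
qed

lemma sum_closed_set:
  fixes f :: "'b \<Rightarrow> 'a::comm_monoid_add"
  assumes "0 \<in> J" "\<And>a b. a \<in> J \<Longrightarrow> b \<in> J \<Longrightarrow> a + b \<in> J" "\<And>i. i \<in> A \<Longrightarrow> f i \<in> J"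
  shows "sum f A \<in> J"
  using assms(3)
  by (induction A rule: infinite_finite_induct) (auto intro: assms(1,2))

text \<open>An axiomatic substitute for the powers of an ideal with finite residue rings and zero
  intersection. Since \<open>I 0\<close> is \<open>R\<close>, the product rule makes each
  \<open>I k\<close> an ideal. \<open>R\<close> is a set inside a field, so that elements can be
  adjoined without changing the type.\<close>

locale ring_filtration =
  fixes R :: "'k::field set" and I :: "nat \<Rightarrow> 'k set"
  assumes sub: "is_subring R"
    and I0: "I 0 = R"
    and zero: "0 \<in> I k"
    and diff: "a \<in> I k \<Longrightarrow> b \<in> I k \<Longrightarrow> a - b \<in> I k"
    and mult: "a \<in> I i \<Longrightarrow> b \<in> I k \<Longrightarrow> a * b \<in> I (i + k)"
    and dec: "I (Suc k) \<subseteq> I k"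
    and finite_index: "\<exists>T. finite T \<and> (\<forall>a\<in>R. \<exists>t\<in>T. a - t \<in> I k)"
    and Inter: "(\<And>k. a \<in> I k) \<Longrightarrow> a = 0"
begin

lemma neg: "a \<in> I k \<Longrightarrow> - a \<in> I k"
  using diff[OF zero, of a k] by simp

lemma add: "a \<in> I k \<Longrightarrow> b \<in> I k \<Longrightarrow> a + b \<in> I k"
  using diff[OF _ neg, of a k b] by simp

lemma decr: "i \<le> k \<Longrightarrow> I k \<subseteq> I i"
  by (rule lift_Suc_antimono_le[of I, OF dec])

lemma IR: "a \<in> I k \<Longrightarrow> a \<in> R"
  using decr[of 0 k] I0 by auto

lemma multR: "a \<in> R \<Longrightarrow> b \<in> I k \<Longrightarrow> a * b \<in> I k" "b \<in> I k \<Longrightarrow> a \<in> R \<Longrightarrow> b * a \<in> I k"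
  using mult[of a 0 b k] I0 by (auto simp: mult.commute)

lemma sum_in: "(\<And>i. i \<in> A \<Longrightarrow> f i \<in> I k) \<Longrightarrow> sum f A \<in> I k"
  by (rule sum_closed_set) (auto intro: zero add)

lemma cong_trans: "a - b \<in> I k \<Longrightarrow> b - c \<in> I k \<Longrightarrow> a - c \<in> I k"
  using add[of "a - b" k "b - c"] by simp

lemma cong_sym: "a - b \<in> I k \<Longrightarrow> b - a \<in> I k"
  using neg[of "a - b" k] by simp

lemma cong_mult:
  assumes "a - b \<in> I k" "c - d \<in> I k" "a \<in> R" "d \<in> R"
  shows "a * c - b * d \<in> I k"
proof -
  have "a * c - b * d = a * (c - d) + (a - b) * d" by (simp add: algebra_simps)
  then show ?thesis using multR(1)[OF assms(3,2)] multR(2)[OF assms(1,4)] add by simp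
qed

lemma cong_power:
  assumes "a - b \<in> I k" "a \<in> R" "b \<in> R"
  shows "a ^ e - b ^ e \<in> I k"
proof (induction e)
  case (Suc e)
  then show ?case using cong_mult[OF assms(1) Suc assms(2)] is_subringD(7)[OF sub assms(3)] by simp
qed (simp add: zero)

lemma one_notin: "1 \<notin> I 1"
proof
  assume 1: "1 \<in> I 1"
  have "1 \<in> I k" for k
  proof (induction k)
    case (Suc k)
    then show ?case using mult[OF Suc 1] by simp
  qed (use I0 is_subringD(1)[OF sub] in simp)
  then show False using Inter[of 1] by simp
qed

text \<open>In a finite ring a cancellable element has a power equal to 1.\<close>

lemma power_cong_one:
  assumes f: "f \<in> R" and canc: "\<And>a. a \<in> R \<Longrightarrow> f * a \<in> I k \<Longrightarrow> a \<in> I k"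
  shows "\<exists>e>0. f ^ e - 1 \<in> I k"
proof -
  obtain T where T: "finite T" "\<forall>a\<in>R. \<exists>t\<in>T. a - t \<in> I k" using finite_index by blast
  have fR: "f ^ i \<in> R" for i using is_subringD(7)[OF sub f] .
  then have "\<forall>i. \<exists>t. t \<in> T \<and> f ^ i - t \<in> I k" using T(2) by blast
  then obtain \<tau> where \<tau>: "\<And>i. \<tau> i \<in> T \<and> f ^ i - \<tau> i \<in> I k" by metis
  have "\<not> inj \<tau>"
    using T(1) \<tau> by (meson finite_imageD finite_subset image_subsetI infinite_UNIV_nat)
  then obtain i l where il: "i < l" "\<tau> i = \<tau> l"
    unfolding inj_def by (metis linorder_neqE_nat)
  have "f ^ l - f ^ i \<in> I k"
    using cong_trans[of "f ^ l" "\<tau> l"] cong_sym \<tau> il(2) by metis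
  moreover have "f ^ l = f ^ i * f ^ (l - i)" using il(1) by (simp flip: power_add)
  ultimately have *: "f ^ i * (f ^ (l - i) - 1) \<in> I k" by (simp add: algebra_simps)
  have "a \<in> I k" if "f ^ i * a \<in> I k" "a \<in> R" for a i
    using that
  proof (induction i)
    case (Suc i)
    then show ?case using canc[of "f ^ i * a"] is_subringD(3)[OF sub fR] by (simp add: mult.assoc)
  qed simp
  then have "f ^ (l - i) - 1 \<in> I k"
    using * is_subringD(2)[OF sub fR is_subringD(1)[OF sub]] by blast
  then show ?thesis using il(1) by (intro exI[of _ "l - i"]) simp
qed

text \<open>In the finite ring \<open>R / I 1\<close> the units are the elements with a power equal
  to 1. In this form the property passes to every filtration that contains the given one, with no
  inverse to be transported.\<close>

definition punit :: "'k \<Rightarrow> bool" where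
  "punit f \<longleftrightarrow> (\<exists>e>0. f ^ e - 1 \<in> I 1)"

text \<open>If \<open>a\<close> lies in \<open>I i\<close> with \<open>i < k\<close>, then both
  \<open>f ^ e * a\<close> and \<open>(f ^ e - 1) * a\<close> lie in \<open>I (Suc i)\<close>, and
  so does their difference \<open>a\<close>.\<close>

lemma punit_cancel:
  assumes f: "f \<in> R" "punit f" and a: "a \<in> R" "f * a \<in> I k"
  shows "a \<in> I k"
proof -
  obtain e where e: "e > 0" "f ^ e - 1 \<in> I 1" using f(2) by (auto simp: punit_def)
  have eq: "f ^ e * a = f ^ (e - 1) * (f * a)"
    by (subst power_minus_mult[OF e(1), symmetric]) (simp only: mult.assoc)
  have fa: "f ^ e * a \<in> I k"
    unfolding eq by (rule multR(1)[OF is_subringD(7)[OF sub f(1)] a(2)])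
  have "a \<in> I i" if "i \<le> k" for i
    using that
  proof (induction i)
    case (Suc i)
    have "f ^ e * a \<in> I (Suc i)" using fa decr[OF Suc.prems] by blast
    moreover have "(f ^ e - 1) * a \<in> I (Suc i)" using mult[OF e(2)] Suc by force
    ultimately show ?case using diff[of "f ^ e * a" "Suc i" "(f ^ e - 1) * a"] by (simp add: algebra_simps)
  qed (use a I0 in simp)
  then show ?thesis by simp
qed

lemma punit_inverse:
  assumes "f \<in> R" "punit f"
  shows "\<exists>d\<in>R. f * d - 1 \<in> I k"
proof -
  obtain e where "e > 0" "f ^ e - 1 \<in> I k"
    using power_cong_one[OF assms(1) punit_cancel[OF assms]] by blast
  then show ?thesis
    using is_subringD(7)[OF sub assms(1), of "e - 1"]
    by (intro bexI[of _ "f ^ (e - 1)"]) (auto simp flip: power_Suc)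
qed

text \<open>A factor of a unit is cancellable modulo \<open>I 1\<close>, hence a unit of the finite
  residue ring.\<close>

lemma punit_factor:
  assumes "f \<in> R" "g \<in> R" "punit (f * g)"
  shows "punit f"
  unfolding punit_def
proof (rule power_cong_one[OF assms(1)])
  fix a assume a: "a \<in> R" "f * a \<in> I 1"
  have "(f * g) * a \<in> I 1" using multR(1)[OF assms(2) a(2)] by (simp add: ac_simps)
  then show "a \<in> I 1" using punit_cancel[OF is_subringD(3)[OF sub assms(1,2)] assms(3) a(1)] by blast
qed

end

lemma ring_filtration_restrict:
  assumes "ring_filtration A' I" and A: "is_subring A" "A \<subseteq> A'"
  shows "ring_filtration A (\<lambda>k. I k \<inter> A)"
proof -
  interpret ring_filtration A' I by fact
  show ?thesis
  proof
    show "\<exists>T. finite T \<and> (\<forall>a\<in>A. \<exists>t\<in>T. a - t \<in> I k \<inter> A)" for k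
    proof -
      obtain T where T: "finite T" "\<forall>a\<in>A'. \<exists>t\<in>T. a - t \<in> I k" using finite_index by blast
      \<comment> \<open>The representatives in \<open>T\<close> need not lie in \<open>A\<close>;
        each class met by \<open>A\<close> gets one that does.\<close>
      define g where "g t = (SOME a. a \<in> A \<and> a - t \<in> I k)" for t
      have "\<exists>t\<in>g ` T. a - t \<in> I k \<inter> A" if a: "a \<in> A" for a
      proof -
        obtain t where t: "t \<in> T" "a - t \<in> I k" using T(2) a A(2) by blast
        then have g: "g t \<in> A \<and> g t - t \<in> I k"
          unfolding g_def using a by (intro someI[where P = "\<lambda>a. a \<in> A \<and> a - t \<in> I k"]) blast
        then have "a - g t \<in> I k" using cong_trans[OF t(2) cong_sym] by blast
        then show ?thesis using t(1) g is_subringD(2)[OF A(1) a] by blast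
      qed
      then show ?thesis using T(1) by blast
    qed
    show "a = 0" if "\<And>k. a \<in> I k \<inter> A" for a using Inter[of a] that by blast
    show "I (Suc k) \<inter> A \<subseteq> I k \<inter> A" for k using dec[of k] by blast
  qed (use A I0 zero diff mult is_subringD[OF A(1)] in auto)
qed

section \<open>Simple ring extensions and fraction-free division\<close>

definition adj :: "'k::field set \<Rightarrow> 'k \<Rightarrow> 'k set" where
  "adj R x = {poly q x | q. \<forall>i. coeff q i \<in> R}"

text \<open>Coefficient conditions may depend on the degree, so that powers of \<open>x\<close> can be counted in the
  filtration; \<open>c\<close> is inverted.\<close>

definition ext :: "'k::field \<Rightarrow> 'k \<Rightarrow> (nat \<Rightarrow> 'k set) \<Rightarrow> 'k set" where
  "ext c x J = {poly q x / c ^ N | q N. \<forall>i. coeff q i \<in> J i}"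

lemma ext_1: "ext 1 x (\<lambda>_. R) = adj R x"
  by (simp add: ext_def adj_def)

lemma adj_subset_ext: "adj R x \<subseteq> ext c x (\<lambda>_. R)"
proof
  fix u assume "u \<in> adj R x"
  then obtain q where "u = poly q x / c ^ 0" "\<forall>i. coeff q i \<in> R" by (auto simp: adj_def)
  then show "u \<in> ext c x (\<lambda>_. R)" unfolding ext_def by blast
qed

lemma ext_mult:
  assumes "u \<in> ext c x J" "v \<in> ext c x J'"
    and JJ: "\<And>i l a b. a \<in> J i \<Longrightarrow> b \<in> J' l \<Longrightarrow> a * b \<in> J'' (i + l)"
    and J'': "\<And>i. 0 \<in> J'' i" "\<And>i a b. a \<in> J'' i \<Longrightarrow> b \<in> J'' i \<Longrightarrow> a + b \<in> J'' i"
  shows "u * v \<in> ext c x J''"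
proof -
  obtain p N q N' where p: "u = poly p x / c ^ N" "\<And>i. coeff p i \<in> J i"
    and q: "v = poly q x / c ^ N'" "\<And>i. coeff q i \<in> J' i"
    using assms(1,2) by (auto simp: ext_def)
  have "coeff (p * q) n \<in> J'' n" for n
    unfolding coeff_mult
  proof (rule sum_closed_set)
    show "coeff p i * coeff q (n - i) \<in> J'' n" if "i \<in> {..n}" for i
      using JJ[OF p(2)[of i] q(2)[of "n - i"]] that by simp
  qed (use J'' in auto)
  moreover have "u * v = poly (p * q) x / c ^ (N + N')"
    by (simp add: p q power_add)
  ultimately show ?thesis unfolding ext_def by blast
qed

lemma ext_diff:
  assumes "u \<in> ext c x J" "v \<in> ext c x J" and c: "c \<noteq> 0"
    and J: "\<And>i a. a \<in> J i \<Longrightarrow> c * a \<in> J i" "\<And>i a b. a \<in> J i \<Longrightarrow> b \<in> J i \<Longrightarrow> a - b \<in> J i"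
  shows "u - v \<in> ext c x J"
proof -
  obtain p N q N' where p: "u = poly p x / c ^ N" "\<And>i. coeff p i \<in> J i"
    and q: "v = poly q x / c ^ N'" "\<And>i. coeff q i \<in> J i"
    using assms(1,2) by (auto simp: ext_def)
  have cn: "c ^ n * a \<in> J i" if "a \<in> J i" for n a i
    using that J(1) by (induction n) (auto simp: mult.assoc)
  have "coeff (Polynomial.smult (c ^ N') p - Polynomial.smult (c ^ N) q) i \<in> J i" for i
    using p(2) q(2) cn J(2) by simp
  moreover have "u - v = poly (Polynomial.smult (c ^ N') p - Polynomial.smult (c ^ N) q) x / c ^ (N + N')"
    using c by (simp add: p q power_add field_simps)
  ultimately show ?thesis unfolding ext_def by blast
qed

text \<open>Common part of two constructions: in the transcendental case \<open>c = 1\<close> and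
  the condition on the \<open>i\<close>-th coefficient weakens with \<open>i\<close>; in the
  algebraic case \<open>c\<close> is a leading coefficient and the condition is the same in all
  degrees. Finite index and zero intersection have different reasons in the two cases and stay as
  hypotheses.\<close>

lemma (in ring_filtration) ext_filtration:
  assumes c: "c \<in> R" "c \<noteq> 0"
    and J0: "\<And>i. J 0 i = R" and Jz: "\<And>k i. 0 \<in> J k i"
    and Jd: "\<And>k i a b. a \<in> J k i \<Longrightarrow> b \<in> J k i \<Longrightarrow> a - b \<in> J k i"
    and Jm: "\<And>k l i m a b. a \<in> J k i \<Longrightarrow> b \<in> J l m \<Longrightarrow> a * b \<in> J (k + l) (i + m)"
    and Jdec: "\<And>k i. J (Suc k) i \<subseteq> J k i"
    and fin: "\<And>k. \<exists>T. finite T \<and> (\<forall>a\<in>ext c x (\<lambda>_. R). \<exists>t\<in>T. a - t \<in> ext c x (J k))"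
    and Int: "\<And>a. (\<And>k. a \<in> ext c x (J k)) \<Longrightarrow> a = 0"
  shows "ring_filtration (ext c x (\<lambda>_. R)) (\<lambda>k. ext c x (J k))"
proof -
  have J0': "J 0 = (\<lambda>_. R)" using J0 by auto
  have Ja: "a + b \<in> J k i" if "a \<in> J k i" "b \<in> J k i" for a b k i
    using Jd[OF that(1) Jd[OF Jz that(2)]] by simp
  have Jc: "c * a \<in> J k i" if "a \<in> J k i" for a k i
    using Jm[of c 0 0 a k i] that c(1) J0 by simp
  have d: "a - b \<in> ext c x (J k)" if "a \<in> ext c x (J k)" "b \<in> ext c x (J k)" for a b k
    by (rule ext_diff[OF that c(2)]) (auto intro: Jc Jd)
  have m: "a * b \<in> ext c x (J (k + l))" if "a \<in> ext c x (J k)" "b \<in> ext c x (J l)" for a b k l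
    by (rule ext_mult[OF that]) (auto intro: Jm Jz Ja)
  have "1 \<in> ext c x (\<lambda>_. R)"
    unfolding ext_def
    by (rule CollectI, rule exI[of _ 1], rule exI[of _ 0]) (auto simp: coeff_1 is_subringD[OF sub])
  then have sub': "is_subring (ext c x (\<lambda>_. R))"
    using d[of _ 0] m[of _ 0 _ 0] by (simp add: is_subring_def J0')
  show ?thesis
  proof
    show "0 \<in> ext c x (J k)" for k
      unfolding ext_def by (rule CollectI, rule exI[of _ 0], rule exI[of _ 0]) (simp add: Jz)
    show "ext c x (J (Suc k)) \<subseteq> ext c x (J k)" for k
      using Jdec unfolding ext_def by blast
  qed (use J0' sub' d m fin Int in auto)
qed

lemma adj_subring: "is_subring R \<Longrightarrow> is_subring (adj R x)"
proof -
  assume R: "is_subring R"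
  have "1 \<in> adj R x" unfolding adj_def
    by (rule CollectI, rule exI[of _ 1]) (auto simp: coeff_1 is_subringD[OF R])
  moreover have "u - v \<in> adj R x" if "u \<in> adj R x" "v \<in> adj R x" for u v
    using ext_diff[of u 1 x "\<lambda>_. R" v] that is_subringD[OF R] by (simp add: ext_1)
  moreover have "u * v \<in> adj R x" if "u \<in> adj R x" "v \<in> adj R x" for u v
    using ext_mult[of u 1 x "\<lambda>_. R" v "\<lambda>_. R" "\<lambda>_. R"] that is_subringD[OF R] by (simp add: ext_1)
  ultimately show ?thesis by (simp add: is_subring_def)
qed

lemma adj_superset: "is_subring R \<Longrightarrow> R \<subseteq> adj R x"
proof
  fix a assume "is_subring R" "a \<in> R"
  then show "a \<in> adj R x" unfolding adj_def
    by (intro CollectI exI[of _ "[:a:]"]) (auto simp: coeff_pCons is_subringD split: nat.split)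
qed

lemma adj_gen: "is_subring R \<Longrightarrow> x \<in> adj R x"
  unfolding adj_def
  by (rule CollectI, rule exI[of _ "[:0, 1:]"]) (auto simp: coeff_pCons is_subringD split: nat.split)

lemma adj_least: "is_subring S \<Longrightarrow> R \<subseteq> S \<Longrightarrow> x \<in> S \<Longrightarrow> adj R x \<subseteq> S"
proof
  fix u assume S: "is_subring S" "R \<subseteq> S" "x \<in> S" and "u \<in> adj R x"
  then obtain q where q: "u = poly q x" "\<forall>i. coeff q i \<in> R" by (auto simp: adj_def)
  show "u \<in> S" unfolding q(1) poly_altdef
  proof (rule sum_closed_set)
    show "coeff q i * x ^ i \<in> S" for i
      using is_subringD(3,7)[OF S(1)] S(2,3) q(2) by blast
  qed (use is_subringD[OF S(1)] in auto)
qed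

lemma coeff_mult_in:
  assumes R: "is_subring R" and "\<And>i. coeff p i \<in> R" "\<And>i. coeff q i \<in> R"
  shows "coeff (p * q) n \<in> R"
  unfolding coeff_mult by (rule sum_closed_set) (use assms is_subringD[OF R] in auto)

text \<open>Every reduction step multiplies by the leading coefficient of \<open>q\<close> in place
  of dividing by it, so quotient and remainder keep their coefficients in \<open>R\<close>.\<close>

lemma pseudo_division:
  fixes p q :: "'k::field poly"
  assumes R: "is_subring R" and q: "q \<noteq> 0" "\<And>i. coeff q i \<in> R" and p: "\<And>i. coeff p i \<in> R"
  shows "\<exists>m s t. Polynomial.smult (lead_coeff q ^ m) p = q * s + t \<and> (t = 0 \<or> degree t < degree q) \<and>
    (\<forall>i. coeff s i \<in> R) \<and> (\<forall>i. coeff t i \<in> R)"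
  using p
proof (induction "degree p" arbitrary: p rule: less_induct)
  case less
  note closed = is_subringD[OF R]
  show ?case
  proof (cases "p = 0 \<or> degree p < degree q")
    case True
    then show ?thesis
      by (intro exI[of _ 0] exI[of _ 0] exI[of _ p]) (use less.prems closed in auto)
  next
    case False
    then have p0: "p \<noteq> 0" and deg: "degree q \<le> degree p" by auto
    define l where "l = lead_coeff q"
    define e where "e = degree p - degree q"
    define u where "u = Polynomial.monom (lead_coeff p) e"
    define p' where "p' = Polynomial.smult l p - q * u"
    have lR: "l \<in> R" and l0: "l \<noteq> 0" using q by (auto simp: l_def)
    have uR: "coeff u i \<in> R" for i using less.prems closed by (simp add: u_def)
    have p'R: "coeff p' i \<in> R" for i
      using coeff_mult_in[OF R q(2) uR] less.prems closed lR by (simp add: p'_def)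
    have du: "degree u = e" "lead_coeff u = lead_coeff p" using p0 by (auto simp: u_def degree_monom_eq)
    have "degree (q * u) = degree p" using q(1) p0 deg du by (simp add: degree_mult_eq e_def u_def monom_eq_0_iff)
    moreover have "lead_coeff (q * u) = l * lead_coeff p" using du by (simp add: lead_coeff_mult l_def)
    ultimately have c: "coeff p' (degree p) = 0" by (simp add: p'_def)
    have "degree p' \<le> degree p"
      unfolding p'_def using \<open>degree (q * u) = degree p\<close> by (intro degree_diff_le) auto
    then have dp': "p' = 0 \<or> degree p' < degree p"
      using c by (metis leading_coeff_0_iff le_neq_implies_less)
    have "\<exists>m s t. Polynomial.smult (lead_coeff q ^ m) p' = q * s + t \<and> (t = 0 \<or> degree t < degree q) \<and>
      (\<forall>i. coeff s i \<in> R) \<and> (\<forall>i. coeff t i \<in> R)"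
    proof (cases "p' = 0")
      case True
      then show ?thesis by (intro exI[of _ 0] exI[of _ 0] exI[of _ 0]) (use closed in auto)
    next
      case False
      then show ?thesis using dp' less.hyps[of p'] p'R by blast
    qed
    then obtain m s t where st: "Polynomial.smult (l ^ m) p' = q * s + t" "t = 0 \<or> degree t < degree q"
      "\<forall>i. coeff s i \<in> R" "\<forall>i. coeff t i \<in> R" unfolding l_def by blast
    have "Polynomial.smult (l ^ Suc m) p = Polynomial.smult (l ^ m) (p' + q * u)"
      by (simp add: p'_def mult.commute)
    also have "\<dots> = q * (s + Polynomial.smult (l ^ m) u) + t"
      using st(1) by (simp add: smult_add_right algebra_simps)
    finally show ?thesis
      using st closed lR uR unfolding l_def
      by (intro exI[of _ "Suc m"] exI[of _ "s + Polynomial.smult (l ^ m) u"] exI[of _ t]) (auto simp: l_def)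
  qed
qed

definition trans_over :: "'k::field set \<Rightarrow> 'k \<Rightarrow> bool" where
  "trans_over R x \<longleftrightarrow> (\<forall>q. (\<forall>i. coeff q i \<in> R) \<and> poly q x = 0 \<longrightarrow> q = 0)"

text \<open>Least degree, but in general not monic, since \<open>R\<close> is only a ring; the
  leading coefficient will have to be inverted.\<close>

definition min_poly_over :: "'k::field set \<Rightarrow> 'k \<Rightarrow> 'k poly \<Rightarrow> bool" where
  "min_poly_over R x h \<longleftrightarrow> h \<noteq> 0 \<and> (\<forall>i. coeff h i \<in> R) \<and> poly h x = 0 \<and>
    (\<forall>q. (\<forall>i. coeff q i \<in> R) \<and> poly q x = 0 \<and> degree q < degree h \<longrightarrow> q = 0)"

lemma min_poly_exists:
  assumes "\<not> trans_over R x"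
  shows "\<exists>h. min_poly_over R x h"
proof -
  define P where "P q \<longleftrightarrow> q \<noteq> 0 \<and> (\<forall>i. coeff q i \<in> R) \<and> poly q x = 0" for q
  have "\<exists>q. P q" using assms unfolding trans_over_def P_def by blast
  then obtain q where "P q" ..
  then have "\<exists>h. P h \<and> (\<forall>q. P q \<longrightarrow> degree h \<le> degree q)" by (rule ex_has_least_nat)
  then obtain h where h: "P h" "\<forall>q. P q \<longrightarrow> degree h \<le> degree q" by (elim exE conjE)
  then show ?thesis
    unfolding min_poly_over_def P_def by (meson linorder_not_le)
qed

text \<open>A replacement for the norm. Among the nonzero multiples of \<open>f\<close>, one of the
  form \<open>poly p x\<close> with \<open>p\<close> of least degree is taken. Pseudo-division of
  \<open>p\<close> by \<open>h\<close> shows that \<open>p\<close> has smaller degree than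
  \<open>h\<close>, and pseudo-division of \<open>h\<close> by \<open>p\<close> shows that
  \<open>p\<close> is constant.\<close>

lemma adj_multiple_in_base:
  assumes R: "is_subring R" and h: "min_poly_over R x h" and f: "f \<in> adj R x" "f \<noteq> 0"
  shows "\<exists>b\<in>R. \<exists>g\<in>adj R x. b \<noteq> 0 \<and> b = f * g"
proof -
  note adj = is_subringD[OF adj_subring[OF R, of x]]
  have hD: "h \<noteq> 0" "\<And>i. coeff h i \<in> R" "poly h x = 0"
    and hmin: "\<And>q. (\<forall>i. coeff q i \<in> R) \<Longrightarrow> poly q x = 0 \<Longrightarrow> degree q < degree h \<Longrightarrow> q = 0"
    using h unfolding min_poly_over_def by blast+
  have inadj: "poly q x \<in> adj R x" if "\<forall>i. coeff q i \<in> R" for q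
    using that unfolding adj_def by blast
  have Radj: "a \<in> R \<Longrightarrow> a \<in> adj R x" for a using adj_superset[OF R] by blast
  define S where "S p \<longleftrightarrow> (\<forall>i. coeff p i \<in> R) \<and> poly p x \<noteq> 0 \<and> (\<exists>g\<in>adj R x. poly p x = f * g)" for p
  obtain q0 where "f = poly q0 x" "\<forall>i. coeff q0 i \<in> R" using f(1) by (auto simp: adj_def)
  then have "S q0" using f(2) adj(1) by (auto simp: S_def intro!: bexI[of _ 1])
  then have "\<exists>p. S p \<and> (\<forall>q. S q \<longrightarrow> degree p \<le> degree q)" by (rule ex_has_least_nat)
  then obtain p where p: "S p" and least: "\<forall>q. S q \<longrightarrow> degree p \<le> degree q" by (elim exE conjE)
  have pR: "\<And>i. coeff p i \<in> R" and px: "poly p x \<noteq> 0" using p by (auto simp: S_def)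
  obtain g where g: "g \<in> adj R x" "poly p x = f * g" using p by (auto simp: S_def)
  have p0: "p \<noteq> 0" using px by auto
  have SI: "S t" if "\<forall>i. coeff t i \<in> R" "poly t x \<noteq> 0" "poly t x = poly p x * a" "a \<in> adj R x" for t a
    using that g adj(3)[OF g(1) that(4)] unfolding S_def by (auto simp: mult.assoc)
  have lt: "degree p < degree h"
  proof (rule ccontr)
    assume nlt: "\<not> degree p < degree h"
    have "\<exists>m s t. Polynomial.smult (lead_coeff h ^ m) p = h * s + t \<and> (t = 0 \<or> degree t < degree h) \<and>
      (\<forall>i. coeff s i \<in> R) \<and> (\<forall>i. coeff t i \<in> R)"
      by (rule pseudo_division[OF R hD(1)]) (use hD pR in auto)
    then obtain m s t where d: "Polynomial.smult (lead_coeff h ^ m) p = h * s + t" "t = 0 \<or> degree t < degree h"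
      "\<forall>i. coeff t i \<in> R" by (elim exE conjE)
    have "poly t x = poly p x * lead_coeff h ^ m"
      using arg_cong[OF d(1), of "\<lambda>q. poly q x"] hD(3) by (simp add: mult.commute)
    moreover have "lead_coeff h ^ m \<in> adj R x" using hD(2) is_subringD(7)[OF R] Radj by blast
    moreover have "poly t x \<noteq> 0" using calculation(1) px hD(1) by simp
    ultimately have "S t" using SI d(3) by blast
    then have "degree p \<le> degree t" using least by blast
    then show False using d(2) nlt \<open>poly t x \<noteq> 0\<close> by auto
  qed
  have "degree p = 0"
  proof (rule ccontr)
    assume dp: "degree p \<noteq> 0"
    have "\<exists>m s t. Polynomial.smult (lead_coeff p ^ m) h = p * s + t \<and> (t = 0 \<or> degree t < degree p) \<and>
      (\<forall>i. coeff s i \<in> R) \<and> (\<forall>i. coeff t i \<in> R)"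
      by (rule pseudo_division[OF R p0]) (use hD pR in auto)
    then obtain m s t where d: "Polynomial.smult (lead_coeff p ^ m) h = p * s + t" "t = 0 \<or> degree t < degree p"
      "\<forall>i. coeff s i \<in> R" "\<forall>i. coeff t i \<in> R" by (elim exE conjE)
    have tx: "poly t x = poly p x * (- poly s x)"
      using arg_cong[OF d(1), of "\<lambda>q. poly q x"] hD(3) by (simp add: eq_neg_iff_add_eq_0 add.commute)
    \<comment> \<open>The remainder gives again a multiple of \<open>f\<close>, of smaller degree,
      so its value is 0; having lower degree than \<open>h\<close>, it vanishes. Then
      \<open>s\<close> would be a relation for \<open>x\<close> of degree below that of
      \<open>h\<close>.\<close>
    have "poly t x = 0"
    proof (rule ccontr)
      assume "poly t x \<noteq> 0"
      then have "S t" using SI[OF d(4) _ tx] inadj[OF d(3)] adj(5) by blast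
      then show False using least d(2) \<open>poly t x \<noteq> 0\<close> by fastforce
    qed
    then have "t = 0" using hmin[OF d(4)] d(2) lt by fastforce
    have sx: "poly s x = 0" using tx \<open>poly t x = 0\<close> px by simp
    have e: "Polynomial.smult (lead_coeff p ^ m) h = p * s" using d(1) \<open>t = 0\<close> by simp
    then have "s \<noteq> 0" using hD(1) p0 by auto
    then have "degree h = degree p + degree s"
      using arg_cong[OF e, of degree] p0 by (simp add: degree_mult_eq)
    then have "s = 0" using hmin[OF d(3) sx] dp by simp
    then show False using \<open>s \<noteq> 0\<close> by simp
  qed
  then obtain a where "p = [:a:]" by (rule degree_eq_zeroE)
  then have "poly p x = coeff p 0" by simp
  then show ?thesis using g px pR by (intro bexI[of _ "coeff p 0"] bexI[of _ g]) auto
qed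

lemma coeff_combination: "coeff (\<Sum>i<r. Polynomial.monom (t i) i) n = (if n < r then t n else 0)"
  by (simp add: coeff_sum if_distrib sum.delta cong: if_cong)

text \<open>Coefficients of degree \<open>r\<close> and more are left untouched: in the
  transcendental case they are subject to no condition, in the algebraic case they are zero.\<close>

lemma (in ring_filtration) finite_polys_mod:
  assumes J: "\<And>i. i < r \<Longrightarrow> \<exists>k. J i = I k"
  shows "\<exists>P. finite P \<and> (\<forall>q. (\<forall>i. coeff q i \<in> R) \<longrightarrow> (\<exists>p\<in>P. \<forall>i. (i < r \<longrightarrow> coeff (q - p) i \<in> J i) \<and>
    (\<not> i < r \<longrightarrow> coeff (q - p) i = coeff q i)))"
proof -
  have "\<forall>i. \<exists>T. i < r \<longrightarrow> finite T \<and> (\<forall>a\<in>R. \<exists>t\<in>T. a - t \<in> J i)"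
    using J finite_index by metis
  then obtain T where T: "\<And>i. i < r \<Longrightarrow> finite (T i)" "\<And>i a. i < r \<Longrightarrow> a \<in> R \<Longrightarrow> \<exists>t\<in>T i. a - t \<in> J i"
    by metis
  define P where "P = (\<lambda>t. \<Sum>i<r. Polynomial.monom (t i) i) ` (PiE {..<r} T)"
  have "finite P" unfolding P_def using T(1) by (intro finite_imageI finite_PiE) auto
  moreover have "\<exists>p\<in>P. \<forall>i. (i < r \<longrightarrow> coeff (q - p) i \<in> J i) \<and> (\<not> i < r \<longrightarrow> coeff (q - p) i = coeff q i)"
    if q: "\<forall>i. coeff q i \<in> R" for q
  proof -
    have "\<forall>i. \<exists>t. i < r \<longrightarrow> t \<in> T i \<and> coeff q i - t \<in> J i" using T(2) q by blast
    then obtain t where t: "\<And>i. i < r \<Longrightarrow> t i \<in> T i \<and> coeff q i - t i \<in> J i" by metis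
    define t' where "t' = restrict t {..<r}"
    have "t' \<in> PiE {..<r} T" using t by (auto simp: t'_def)
    then have "(\<Sum>i<r. Polynomial.monom (t' i) i) \<in> P" unfolding P_def by blast
    moreover have "\<forall>i. (i < r \<longrightarrow> coeff (q - (\<Sum>i<r. Polynomial.monom (t' i) i)) i \<in> J i) \<and>
        (\<not> i < r \<longrightarrow> coeff (q - (\<Sum>i<r. Polynomial.monom (t' i) i)) i = coeff q i)"
      using t by (simp add: coeff_combination t'_def)
    ultimately show ?thesis by blast
  qed
  ultimately show ?thesis by blast
qed

section \<open>Lifting a filtration along a simple extension\<close>

lemma trans_over_translate:
  assumes R: "is_subring R" and c: "c \<in> R" and x: "trans_over R x"
  shows "trans_over R (x - c)"
  unfolding trans_over_def
proof (intro allI impI, elim conjE)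
  fix q assume q: "\<forall>i. coeff q i \<in> R" "poly q (x - c) = 0"
  have "coeff (pcompose q [:- c, 1:]) i \<in> R" for i
    using q(1)
  proof (induction q arbitrary: i)
    case 0
    then show ?case using is_subringD(4)[OF R] by simp
  next
    case (pCons a q)
    have q: "\<forall>i. coeff q i \<in> R" and a: "a \<in> R"
      using pCons.prems coeff_pCons_Suc[of a q] coeff_pCons_0[of a q] by metis+
    have "coeff ([:- c, 1:] * pcompose q [:- c, 1:]) i \<in> R"
      by (rule coeff_mult_in[OF R _ pCons.IH[OF q]])
        (use c is_subringD[OF R] in \<open>auto simp: coeff_pCons split: nat.split\<close>)
    moreover have "coeff [:a:] i \<in> R" using a is_subringD[OF R] by (auto simp: coeff_pCons split: nat.split)
    ultimately show ?case using is_subringD(6)[OF R] by (simp add: pcompose_pCons)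
  qed
  moreover have "poly (pcompose q [:- c, 1:]) x = 0" using q(2) by (simp add: poly_pcompose)
  ultimately have "pcompose q [:- c, 1:] = 0" using x unfolding trans_over_def by blast
  then show "q = 0" by (rule pcompose_eq_0) simp
qed

lemma adj_translate:
  assumes R: "is_subring R" and c: "c \<in> R"
  shows "adj R (x - c) = adj R x"
proof
  have cx: "c \<in> adj R y" for y using adj_superset[OF R] c by blast
  have x: "x - c \<in> adj R x" using is_subringD(2)[OF adj_subring[OF R] adj_gen[OF R] cx] .
  show "adj R (x - c) \<subseteq> adj R x"
    by (rule adj_least[OF adj_subring[OF R] adj_superset[OF R] x])
  have "(x - c) + c \<in> adj R (x - c)" using is_subringD(6)[OF adj_subring[OF R] adj_gen[OF R] cx] .
  then show "adj R x \<subseteq> adj R (x - c)"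
    by (intro adj_least[OF adj_subring[OF R] adj_superset[OF R]]) simp
qed

text \<open>\<open>y\<close> is given weight 1: in \<open>I' k\<close> the coefficient of
  \<open>y ^ i\<close> has to lie in \<open>I (k - i)\<close>, with truncated subtraction, so that
  from degree \<open>k\<close> on it is arbitrary in \<open>R\<close>. Then \<open>poly Q y\<close>
  is congruent to its constant term modulo \<open>I' 1\<close>. Transcendence makes coefficients
  unique, so the intersection can be computed coefficientwise.\<close>

lemma (in ring_filtration) lift_transcendental:
  assumes y: "trans_over R y" and Q: "\<And>i. coeff Q i \<in> R" and b: "punit (coeff Q 0)"
  shows "\<exists>I'. ring_filtration (adj R y) I' \<and> (\<forall>k. I k \<subseteq> I' k) \<and> ring_filtration.punit I' (poly Q y)"
proof -
  define J where "J k i = I (k - i)" for k i :: nat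
  define I' where "I' k = ext 1 y (J k)" for k
  have memI: "poly q y \<in> I' k" if "\<And>i. coeff q i \<in> J k i" for q k
    unfolding I'_def ext_def using that by (auto intro!: exI[of _ q])
  have filt: "ring_filtration (adj R y) I'"
    unfolding I'_def[abs_def] ext_1[symmetric]
  proof (rule ext_filtration)
    show "a * b \<in> J (k + l) (i + m)" if "a \<in> J k i" "b \<in> J l m" for a b k l i m
    proof -
      have "a * b \<in> I ((k - i) + (l - m))" using mult that by (simp add: J_def)
      moreover have "(k + l) - (i + m) \<le> (k - i) + (l - m)" by simp
      ultimately show ?thesis using decr unfolding J_def by blast
    qed
    show "J (Suc k) i \<subseteq> J k i" for k i unfolding J_def by (rule decr) simp
    show "\<exists>T. finite T \<and> (\<forall>a\<in>ext 1 y (\<lambda>_. R). \<exists>t\<in>T. a - t \<in> ext 1 y (J k))" for k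
    proof -
      have Jk: "\<exists>n. J k i = I n" for i by (auto simp: J_def)
      obtain P where P: "finite P" "\<forall>q. (\<forall>i. coeff q i \<in> R) \<longrightarrow> (\<exists>p\<in>P. \<forall>i. (i < k \<longrightarrow> coeff (q - p) i \<in> J k i) \<and>
          (\<not> i < k \<longrightarrow> coeff (q - p) i = coeff q i))"
        using finite_polys_mod[of k "J k", OF Jk] by (elim exE conjE)
      have "\<exists>t\<in>(\<lambda>p. poly p y) ` P. a - t \<in> ext 1 y (J k)" if a: "a \<in> ext 1 y (\<lambda>_. R)" for a
      proof -
        obtain q where q: "a = poly q y" "\<forall>i. coeff q i \<in> R" using a unfolding ext_1 by (auto simp: adj_def)
        obtain p where p: "p \<in> P" "\<forall>i. (i < k \<longrightarrow> coeff (q - p) i \<in> J k i) \<and>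
          (\<not> i < k \<longrightarrow> coeff (q - p) i = coeff q i)"
          using mp[OF spec[OF P(2)] q(2)] by (elim bexE)
        have "coeff (q - p) i \<in> J k i" for i
        proof (cases "i < k")
          case False
          then have "J k i = R" by (simp add: J_def I0)
          then show ?thesis using p(2) False q(2) by metis
        qed (use p(2) in blast)
        then have "poly (q - p) y \<in> ext 1 y (J k)" using memI unfolding I'_def by blast
        then show ?thesis using p(1) q(1) by (intro bexI[of _ "poly p y"]) auto
      qed
      then show ?thesis using P(1) by blast
    qed
    show "a = 0" if "\<And>k. a \<in> ext 1 y (J k)" for a
    proof -
      have "\<exists>q. a = poly q y \<and> (\<forall>i. coeff q i \<in> J k i)" for k
        using that[of k] by (auto simp: ext_def)
      then obtain q where q: "\<And>k. a = poly (q k) y" "\<And>k i. coeff (q k) i \<in> J k i" by metis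
      have qR: "coeff (q k) i \<in> R" for k i using q(2) IR unfolding J_def by blast
      have eq: "q k = q 0" for k
      proof -
        have "coeff (q k - q 0) i \<in> R" for i using qR is_subringD[OF sub] by simp
        moreover have "poly (q k - q 0) y = 0" using q(1)[of k] q(1)[of 0] by simp
        ultimately have "q k - q 0 = 0" using y unfolding trans_over_def by blast
        then show ?thesis by simp
      qed
      \<comment> \<open>Coefficient \<open>i\<close> is tested at level \<open>k + i\<close>, where
        its condition is membership in \<open>I k\<close>.\<close>
      then have "coeff (q 0) i \<in> I k" for i k
        using q(2)[of "k + i" i] unfolding J_def eq[of "k + i"] by simp
      then have "q 0 = 0" using Inter by (intro poly_eqI) simp
      then show ?thesis using q(1)[of 0] by simp
    qed
  qed (use I0 zero diff is_subringD[OF sub] in \<open>auto simp: J_def\<close>)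
  interpret F: ring_filtration "adj R y" I' by (rule filt)
  have sub: "I k \<subseteq> I' k" for k
  proof
    fix a assume "a \<in> I k"
    then have "poly [:a:] y \<in> I' k" by (intro memI) (auto simp: coeff_pCons J_def zero split: nat.split)
    then show "a \<in> I' k" by simp
  qed
  have "poly (Q - [:coeff Q 0:]) y \<in> I' 1"
    by (rule memI) (use Q zero in \<open>auto simp: J_def I0 coeff_pCons split: nat.split\<close>)
  then have c: "poly Q y - coeff Q 0 \<in> I' 1" by simp
  obtain e where e: "e > 0" "coeff Q 0 ^ e - 1 \<in> I 1" using b by (auto simp: punit_def)
  have "poly Q y \<in> adj R y" using Q by (auto simp: adj_def)
  moreover have "coeff Q 0 \<in> adj R y" using adj_superset[OF ring_filtration.sub[OF ring_filtration_axioms]] Q by blast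
  ultimately have "poly Q y ^ e - coeff Q 0 ^ e \<in> I' 1" using F.cong_power[OF c] by blast
  then have "poly Q y ^ e - 1 \<in> I' 1" using F.cong_trans e(2) sub by blast
  then have "F.punit (poly Q y)" using e(1) by (auto simp: F.punit_def)
  then show ?thesis using filt sub by blast
qed

text \<open>Pseudo-division by \<open>h\<close> subtracts products of coefficients of
  \<open>h\<close> with leading coefficients of \<open>q\<close>; the latter lie in the ideal
  \<open>I k\<close>, so the level is preserved.\<close>

lemma (in ring_filtration) reduce_degree:
  assumes h: "min_poly_over R x h" and q: "\<And>i. coeff q i \<in> I k"
  shows "\<exists>N q'. (\<forall>i. coeff q' i \<in> I k) \<and> degree q' < degree h \<and> lead_coeff h ^ N * poly q x = poly q' x"
  using q
proof (induction "degree q" arbitrary: q rule: less_induct)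
  case less
  have hD: "h \<noteq> 0" "\<And>i. coeff h i \<in> R" "poly h x = 0" using h unfolding min_poly_over_def by blast+
  have dh: "degree h > 0"
  proof (rule ccontr)
    assume "\<not> degree h > 0"
    then obtain a where "h = [:a:]" using degree_eq_zeroE by auto
    then show False using hD by simp
  qed
  show ?case
  proof (cases "degree q < degree h")
    case True
    then show ?thesis using less.prems by (intro exI[of _ 0] exI[of _ q]) auto
  next
    case False
    define c where "c = lead_coeff h"
    define e where "e = degree q - degree h"
    define q1 where "q1 = Polynomial.smult c q - Polynomial.monom (lead_coeff q) e * h"
    have q0: "q \<noteq> 0" using False dh by auto
    have "coeff q1 i \<in> I k" for i
    proof -
      have "coeff (Polynomial.monom (lead_coeff q) e * h) i \<in> I k"
        using less.prems multR(2)[OF less.prems hD(2)] zero by (simp add: coeff_monom_mult)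
      moreover have "c * coeff q i \<in> I k" using multR(1) hD(2) less.prems by (simp add: c_def)
      ultimately show ?thesis using diff by (simp add: q1_def)
    qed
    note q1I = this
    have "degree (Polynomial.monom (lead_coeff q) e * h) = degree q"
      using False q0 hD(1) by (subst degree_mult_eq) (auto simp: degree_monom_eq e_def monom_eq_0_iff)
    then have le: "degree q1 \<le> degree q" unfolding q1_def by (intro degree_diff_le) auto
    have "coeff q1 (degree q) = 0"
      using False by (simp add: q1_def coeff_monom_mult e_def c_def)
    then have "degree q1 < degree q"
      using le False dh by (metis coeff_0_degree_minus_1 diff_is_0_eq' degree_0 leading_coeff_0_iff le_neq_implies_less less_le_trans linorder_not_less)
    then obtain N q' where N: "\<forall>i. coeff q' i \<in> I k" "degree q' < degree h" "lead_coeff h ^ N * poly q1 x = poly q' x"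
      using less.hyps[OF _ q1I] by blast
    have "poly q1 x = c * poly q x" by (simp add: q1_def hD(3))
    then have "lead_coeff h ^ Suc N * poly q x = poly q' x" using N(3) by (simp add: c_def mult.assoc mult.left_commute)
    then show ?thesis using N(1,2) by blast
  qed
qed

text \<open>Once the leading coefficient \<open>c\<close> of \<open>h\<close> is inverted, every
  element is, up to a power of \<open>c\<close>, a combination of the powers of \<open>x\<close>
  below the degree of \<open>h\<close>; level \<open>k\<close> is defined by coefficients in
  \<open>I k\<close>. As \<open>c\<close> is a unit modulo every \<open>I k\<close>, denominators
  harm neither the finite index nor the intersection. Finally the filtration is restricted to
  \<open>adj R x\<close>; \<open>f\<close> is a unit modulo \<open>I' 1\<close> as a factor of
  \<open>f * g\<close>.\<close>

lemma (in ring_filtration) lift_algebraic: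
  assumes h: "min_poly_over R x h" and c: "punit (lead_coeff h)"
    and f: "f \<in> adj R x" "g \<in> adj R x" "f * g \<in> R" "punit (f * g)"
  shows "\<exists>I'. ring_filtration (adj R x) I' \<and> (\<forall>k. I k \<subseteq> I' k) \<and> ring_filtration.punit I' f"
proof -
  have hD: "h \<noteq> 0" "\<And>i. coeff h i \<in> R" "poly h x = 0"
    and hmin: "\<And>q. (\<forall>i. coeff q i \<in> R) \<Longrightarrow> poly q x = 0 \<Longrightarrow> degree q < degree h \<Longrightarrow> q = 0"
    using h unfolding min_poly_over_def by blast+
  define c where "c = lead_coeff h"
  have cR: "c \<in> R" "c \<noteq> 0" and cu: "punit c" using hD assms(2) by (auto simp: c_def)
  have cnR: "c ^ n \<in> R" for n using is_subringD(7)[OF sub cR(1)] .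
  define I' where "I' k = ext c x (\<lambda>_. I k)" for k
  have memI: "poly q x / c ^ N \<in> I' k" if "\<And>i. coeff q i \<in> I k" for q N k
    unfolding I'_def ext_def using that by blast
  have c_canc: "a \<in> I k" if "c ^ n * a \<in> I k" "a \<in> R" for a n k
    using that
  proof (induction n)
    case (Suc n)
    have "c * (c ^ n * a) \<in> I k" using Suc.prems(1) by (simp add: mult.assoc)
    then have "c ^ n * a \<in> I k"
      using punit_cancel[OF cR(1) cu] is_subringD(3)[OF sub cnR Suc.prems(2)] by blast
    then show ?case using Suc by blast
  qed simp
  have red: "\<exists>N q'. (\<forall>i. coeff q' i \<in> I k) \<and> degree q' < degree h \<and> a = poly q' x / c ^ N"
    if a: "a \<in> ext c x (\<lambda>_. I k)" for a k
  proof -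
    obtain q N where q: "a = poly q x / c ^ N" "\<And>i. coeff q i \<in> I k" using a by (auto simp: ext_def)
    obtain M q' where M: "\<forall>i. coeff q' i \<in> I k" "degree q' < degree h" "c ^ M * poly q x = poly q' x"
      using reduce_degree[OF h q(2)] unfolding c_def by blast
    have "a = poly q' x / c ^ (N + M)"
      using cR(2) by (simp add: M(3)[symmetric] q(1) power_add)
    then show ?thesis using M by blast
  qed
  have filt: "ring_filtration (ext c x (\<lambda>_. R)) I'"
    unfolding I'_def[abs_def]
  proof (rule ext_filtration[OF cR])
    show "\<exists>T. finite T \<and> (\<forall>a\<in>ext c x (\<lambda>_. R). \<exists>t\<in>T. a - t \<in> ext c x (\<lambda>_. I k))" for k
    proof -
      \<comment> \<open>Modulo \<open>I k\<close> the denominator \<open>c ^ N\<close> can be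
        replaced by the factor \<open>d ^ N\<close>.\<close>
      obtain d where d: "d \<in> R" "c * d - 1 \<in> I k" using punit_inverse[OF cR(1) cu] by blast
      have Jk: "\<exists>n. (\<lambda>_. I k) i = I n" for i :: nat by auto
      obtain P where P: "finite P" "\<forall>q. (\<forall>i. coeff q i \<in> R) \<longrightarrow> (\<exists>p\<in>P. \<forall>i. (i < degree h \<longrightarrow> coeff (q - p) i \<in> I k) \<and>
          (\<not> i < degree h \<longrightarrow> coeff (q - p) i = coeff q i))"
        using finite_polys_mod[of "degree h" "\<lambda>_. I k", OF Jk] by (elim exE conjE)
      have "\<exists>t\<in>(\<lambda>p. poly p x) ` P. a - t \<in> ext c x (\<lambda>_. I k)" if a: "a \<in> ext c x (\<lambda>_. R)" for a
      proof -
        obtain N q where q: "\<forall>i. coeff q i \<in> R" "degree q < degree h" "a = poly q x / c ^ N"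
          using red[of a 0] a by (auto simp: I0)
        define s where "s = Polynomial.smult (d ^ N) q"
        have dN: "d ^ N \<in> R" using is_subringD(7)[OF sub d(1)] .
        have sR: "\<forall>i. coeff s i \<in> R" using q(1) dN is_subringD(3)[OF sub] by (simp add: s_def)
        obtain p where p: "p \<in> P" "\<forall>i. (i < degree h \<longrightarrow> coeff (s - p) i \<in> I k) \<and>
          (\<not> i < degree h \<longrightarrow> coeff (s - p) i = coeff s i)"
          using mp[OF spec[OF P(2)] sR] by (elim bexE)
        have cd: "1 - c ^ N * d ^ N \<in> I k"
        proof -
          have "(c * d) ^ N - 1 ^ N \<in> I k"
            using cong_power[OF d(2)] is_subringD[OF sub] cR d by blast
          then show ?thesis using cong_sym by (simp add: power_mult_distrib)
        qed
        have "coeff (Polynomial.smult (1 - c ^ N * d ^ N) q + Polynomial.smult (c ^ N) (s - p)) i \<in> I k" for i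
        proof -
          have "coeff (s - p) i \<in> I k"
          proof (cases "i < degree h")
            case False
            then have "coeff (s - p) i = 0" using p(2) q(2) by (simp add: s_def coeff_eq_0)
            then show ?thesis using zero by simp
          qed (use p(2) in blast)
          then show ?thesis using add multR(1)[OF cnR] multR(2)[OF cd] q(1) by simp
        qed
        note mem = memI[OF this, of N]
        have "a - poly p x = poly (Polynomial.smult (1 - c ^ N * d ^ N) q + Polynomial.smult (c ^ N) (s - p)) x / c ^ N"
          using cR(2) by (simp add: q(3) s_def field_simps)
        then have "a - poly p x \<in> ext c x (\<lambda>_. I k)" using mem unfolding I'_def by simp
        then show ?thesis using p(1) by blast
      qed
      then show ?thesis using P(1) by blast
    qed
    show "a = 0" if a: "\<And>k. a \<in> ext c x (\<lambda>_. I k)" for a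
    proof -
      obtain N q where q: "\<forall>i. coeff q i \<in> R" "degree q < degree h" "a = poly q x / c ^ N"
        using red[OF a[of 0]] I0 by auto
      have "coeff q i \<in> I k" for i k
      proof -
        \<comment> \<open>\<open>q\<close> is fixed and \<open>p\<close> comes from level
          \<open>k\<close>. Both have degree below that of \<open>h\<close>, so by minimality
          \<open>q\<close> times \<open>c ^ M\<close> equals \<open>p\<close> times
          \<open>c ^ N\<close>; cancelling \<open>c ^ M\<close> puts the coefficients of
          \<open>q\<close> into \<open>I k\<close>.\<close>
        obtain M p where p: "\<forall>i. coeff p i \<in> I k" "degree p < degree h" "a = poly p x / c ^ M"
          using red[OF a[of k]] by blast
        let ?w = "Polynomial.smult (c ^ M) q - Polynomial.smult (c ^ N) p"
        have "\<forall>i. coeff ?w i \<in> R"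
        proof
          fix i
          have "c ^ M * coeff q i \<in> R" "c ^ N * coeff p i \<in> R"
            using is_subringD(3)[OF sub cnR] q(1) p(1) IR by blast+
          then show "coeff ?w i \<in> R" using is_subringD(2)[OF sub] by simp
        qed
        moreover have "poly ?w x = 0" using q(3) p(3) cR(2) by (simp add: field_simps)
        moreover have "degree ?w < degree h"
          using q(2) p(2) by (meson degree_diff_less degree_smult_le le_less_trans)
        ultimately have "?w = 0" by (rule hmin)
        then have "c ^ M * coeff q i = c ^ N * coeff p i" by (metis coeff_smult eq_iff_diff_eq_0)
        moreover have "c ^ N * coeff p i \<in> I k" using multR(1)[OF cnR] p(1) by blast
        ultimately show ?thesis using c_canc[of M "coeff q i" k] q(1) by simp
      qed
      then have "q = 0" using Inter by (intro poly_eqI) simp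
      then show ?thesis using q(3) by simp
    qed
  qed (use I0 zero diff mult dec in auto)
  interpret F: ring_filtration "ext c x (\<lambda>_. R)" I' by (rule filt)
  have II': "I k \<subseteq> I' k" for k
  proof
    fix a assume "a \<in> I k"
    then have "poly [:a:] x / c ^ 0 \<in> I' k" by (intro memI) (auto simp: coeff_pCons zero split: nat.split)
    then show "a \<in> I' k" by simp
  qed
  have adj: "adj R x \<subseteq> ext c x (\<lambda>_. R)" by (rule adj_subset_ext)
  have "F.punit (f * g)" using f(4) II' unfolding punit_def F.punit_def by blast
  then have fu: "F.punit f"
    by (rule F.punit_factor[OF subsetD[OF adj f(1)] subsetD[OF adj f(2)]])
  have filt': "ring_filtration (adj R x) (\<lambda>k. I' k \<inter> adj R x)"
    by (rule ring_filtration_restrict[OF filt adj_subring[OF sub] adj])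
  interpret F': ring_filtration "adj R x" "\<lambda>k. I' k \<inter> adj R x" by (rule filt')
  have "F'.punit f"
  proof -
    obtain e where e: "e > 0" "f ^ e - 1 \<in> I' 1" using fu unfolding F.punit_def by (elim exE conjE)
    have "f ^ e - 1 \<in> adj R x"
      by (rule is_subringD(2)[OF F'.sub is_subringD(7)[OF F'.sub f(1)] is_subringD(1)[OF F'.sub]])
    then show ?thesis using e unfolding F'.punit_def by (intro exI[of _ e]) simp
  qed
  moreover have "I k \<subseteq> I' k \<inter> adj R x" for k using II' IR adj_superset[OF sub] by blast
  ultimately show ?thesis using filt' by blast
qed

text \<open>If \<open>x\<close> is transcendental, \<open>b\<close> is the value of the polynomial
  representing \<open>f\<close> at a point of \<open>R\<close> where it is nonzero. If
  \<open>x\<close> is algebraic, \<open>b\<close> is a multiple of \<open>f\<close> in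
  \<open>R\<close> times the leading coefficient of a minimal polynomial.\<close>

theorem lift_filtration:
  assumes R: "is_subring R" "infinite R" and f: "f \<in> adj R x" "f \<noteq> 0"
  shows "\<exists>b\<in>R. b \<noteq> 0 \<and> (\<forall>I. ring_filtration R I \<and> ring_filtration.punit I b \<longrightarrow>
    (\<exists>I'. ring_filtration (adj R x) I' \<and> (\<forall>k. I k \<subseteq> I' k) \<and> ring_filtration.punit I' f))"
proof (cases "trans_over R x")
  case True
  obtain q where q: "f = poly q x" "\<And>i. coeff q i \<in> R" using f(1) by (auto simp: adj_def)
  have "q \<noteq> 0" using q(1) f(2) by auto
  then have "finite {c. poly q c = 0}" by (rule poly_roots_finite)
  \<comment> \<open>The infinite ring \<open>R\<close> contains a non-root of \<open>q\<close>.
    After replacing \<open>x\<close> by \<open>x - c\<close>, the value at \<open>c\<close> becomes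
    the constant term.\<close>
  then obtain c where c: "c \<in> R" "poly q c \<noteq> 0" using R(2) by (metis (mono_tags, lifting) finite_subset mem_Collect_eq subsetI)
  have "f \<in> adj R (x - c)" using f(1) adj_translate[OF R(1) c(1)] by simp
  have Q: "poly (pcompose q [:c, 1:]) (x - c) = f" "coeff (pcompose q [:c, 1:]) 0 = poly q c"
    using q(1) by (simp_all add: poly_pcompose flip: poly_0_coeff_0)
  obtain p where p: "f = poly p (x - c)" "\<And>i. coeff p i \<in> R"
    using \<open>f \<in> adj R (x - c)\<close> by (auto simp: adj_def)
  have pc: "coeff p 0 \<in> R" using p(2) by blast
  have "poly p 0 = poly q c"
  proof -
    have "pcompose p [:- c, 1:] - q = 0"
    proof -
      have "\<forall>i. coeff (pcompose p [:- c, 1:] - q) i \<in> R"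
      proof
        fix i
        have "coeff (pcompose p [:- c, 1:]) i \<in> R" for i
          using p(2)
        proof (induction p arbitrary: i)
          case 0
          then show ?case using is_subringD(4)[OF R(1)] by simp
        next
          case (pCons a q)
          have q: "\<And>i. coeff q i \<in> R" and a: "a \<in> R"
            using pCons.prems coeff_pCons_Suc[of a q] coeff_pCons_0[of a q] by metis+
          have "coeff ([:- c, 1:] * pcompose q [:- c, 1:]) i \<in> R"
            by (rule coeff_mult_in[OF R(1) _ pCons.IH[OF q]])
              (use c is_subringD[OF R(1)] in \<open>auto simp: coeff_pCons split: nat.split\<close>)
          moreover have "coeff [:a:] i \<in> R" using a is_subringD[OF R(1)] by (auto simp: coeff_pCons split: nat.split)
          ultimately show ?case using is_subringD(6)[OF R(1)] by (simp add: pcompose_pCons)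
        qed
        then show "coeff (pcompose p [:- c, 1:] - q) i \<in> R" using q(2) is_subringD(2)[OF R(1)] by simp
      qed
      moreover have "poly (pcompose p [:- c, 1:] - q) x = 0" using p(1) q(1) by (simp add: poly_pcompose)
      ultimately show ?thesis using True unfolding trans_over_def by blast
    qed
    then have "q = pcompose p [:- c, 1:]" by simp
    then show ?thesis by (simp add: poly_pcompose)
  qed
  then have p0: "coeff p 0 \<noteq> 0" using c(2) by (simp add: poly_0_coeff_0)
  show ?thesis
  proof (rule bexI[OF _ pc], intro conjI allI impI p0, elim conjE)
    fix I assume "ring_filtration R I" and u: "ring_filtration.punit I (coeff p 0)"
    then interpret ring_filtration R I by simp
    show "\<exists>I'. ring_filtration (adj R x) I' \<and> (\<forall>k. I k \<subseteq> I' k) \<and> ring_filtration.punit I' f"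
      using lift_transcendental[OF trans_over_translate[OF R(1) c(1) True] p(2) u]
      unfolding adj_translate[OF R(1) c(1)] p(1) .
  qed
next
  case False
  then obtain h where h: "min_poly_over R x h" using min_poly_exists by blast
  then obtain b g where b: "b \<in> R" "g \<in> adj R x" "b \<noteq> 0" "b = f * g"
    using adj_multiple_in_base[OF R(1) h f] by blast
  have c: "lead_coeff h \<in> R" "lead_coeff h \<noteq> 0" using h unfolding min_poly_over_def by auto
  have bc: "b * lead_coeff h \<in> R" "b * lead_coeff h \<noteq> 0" using b c is_subringD(3)[OF R(1)] by auto
  show ?thesis
  proof (rule bexI[OF _ bc(1)], intro conjI allI impI bc(2), elim conjE)
    fix I assume "ring_filtration R I" and u: "ring_filtration.punit I (b * lead_coeff h)"
    then interpret ring_filtration R I by simp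
    have "punit b" using punit_factor[OF b(1) c(1) u] .
    moreover have "punit (lead_coeff h)" using punit_factor[OF c(1) b(1)] u by (simp add: mult.commute)
    ultimately show "\<exists>I'. ring_filtration (adj R x) I' \<and> (\<forall>k. I k \<subseteq> I' k) \<and> ring_filtration.punit I' f"
      using lift_algebraic[OF h _ f(1) b(2)] b(1,4) by simp
  qed
qed

primrec adj_list :: "'k::field set \<Rightarrow> 'k list \<Rightarrow> 'k set" where
  "adj_list R [] = R"
| "adj_list R (x # xs) = adj (adj_list R xs) x"

lemma adj_list_subring: "is_subring R \<Longrightarrow> is_subring (adj_list R xs)"
  by (induction xs) (auto intro: adj_subring)

lemma adj_list_superset: "is_subring R \<Longrightarrow> R \<subseteq> adj_list R xs"
proof (induction xs)
  case (Cons x xs)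
  then show ?case using adj_superset[OF adj_list_subring[OF Cons.prems], of xs x] by auto
qed simp

lemma adj_list_gen: "is_subring R \<Longrightarrow> set xs \<subseteq> adj_list R xs"
proof (induction xs)
  case (Cons x xs)
  then show ?case
    using adj_superset[OF adj_list_subring[OF Cons.prems], of xs x] adj_gen[OF adj_list_subring[OF Cons.prems], of x xs] by auto
qed simp

text \<open>The unit condition travels down the tower, from \<open>f\<close> to an element of
  \<open>R\<close>; the filtration is then lifted in the opposite direction.\<close>

theorem lift_filtration_list:
  assumes R: "is_subring R" "infinite R" and f: "f \<in> adj_list R xs" "f \<noteq> 0"
  shows "\<exists>b\<in>R. b \<noteq> 0 \<and> (\<forall>I. ring_filtration R I \<and> ring_filtration.punit I b \<longrightarrow>
    (\<exists>I'. ring_filtration (adj_list R xs) I' \<and> (\<forall>k. I k \<subseteq> I' k) \<and> ring_filtration.punit I' f))"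
  using f
proof (induction xs arbitrary: f)
  case Nil
  then show ?case by auto
next
  case (Cons x xs)
  let ?A = "adj_list R xs"
  have inf: "infinite ?A" using adj_list_superset[OF R(1)] R(2) finite_subset by blast
  obtain b where b: "b \<in> ?A" "b \<noteq> 0" and lift: "\<forall>I. ring_filtration ?A I \<and> ring_filtration.punit I b \<longrightarrow>
    (\<exists>I'. ring_filtration (adj ?A x) I' \<and> (\<forall>k. I k \<subseteq> I' k) \<and> ring_filtration.punit I' f)"
    using lift_filtration[OF adj_list_subring[OF R(1)] inf Cons.prems(1)[unfolded adj_list.simps] Cons.prems(2)] by blast
  obtain a where a: "a \<in> R" "a \<noteq> 0" and lift': "\<forall>I. ring_filtration R I \<and> ring_filtration.punit I a \<longrightarrow>
    (\<exists>I'. ring_filtration ?A I' \<and> (\<forall>k. I k \<subseteq> I' k) \<and> ring_filtration.punit I' b)"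
    using Cons.IH[OF b] by blast
  show ?case
  proof (rule bexI[OF _ a(1)], intro conjI allI impI a(2))
    fix I assume "ring_filtration R I \<and> ring_filtration.punit I a"
    then obtain I1 where I1: "ring_filtration ?A I1" "\<forall>k. I k \<subseteq> I1 k" "ring_filtration.punit I1 b"
      using lift' by blast
    then obtain I2 where "ring_filtration (adj ?A x) I2" "\<forall>k. I1 k \<subseteq> I2 k" "ring_filtration.punit I2 f"
      using lift by blast
    then show "\<exists>I'. ring_filtration (adj_list R (x # xs)) I' \<and> (\<forall>k. I k \<subseteq> I' k) \<and> ring_filtration.punit I' f"
      using I1(2) by (intro exI[of _ I2]) auto
  qed
qed

section \<open>Base filtrations: the integers in characteristic 0\<close>

abbreviation prime_ring :: "'k::field set" where "prime_ring \<equiv> range of_int"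

lemma prime_ring_subring: "is_subring (prime_ring :: 'k::field set)"
  unfolding is_subring_def
proof (intro conjI ballI)
  show "1 \<in> (prime_ring :: 'k set)" by (rule range_eqI[of _ _ 1]) simp
  fix a b :: 'k assume "a \<in> prime_ring" "b \<in> prime_ring"
  then obtain x y where "a = of_int x" "b = of_int y" by blast
  then show "a - b \<in> prime_ring" "a * b \<in> prime_ring"
    by (metis of_int_diff rangeI) (metis \<open>a = of_int x\<close> \<open>b = of_int y\<close> of_int_mult rangeI)
qed

lemma of_int_eq_0_char_0:
  assumes "CHAR('k::field) = 0" shows "of_int z = (0 :: 'k) \<longleftrightarrow> z = 0"
proof
  assume z: "of_int z = (0 :: 'k)"
  have "of_nat (nat \<bar>z\<bar>) = (0 :: 'k)"
    using z by (cases "z \<ge> 0") (simp_all add: of_nat_nat)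
  then have "nat \<bar>z\<bar> = 0" unfolding of_nat_eq_0_iff_char_dvd assms by simp
  then show "z = 0" by simp
qed simp

lemma infinite_prime_ring_char_0:
  assumes "CHAR('k::field) = 0" shows "infinite (prime_ring :: 'k set)"
proof -
  have "inj (of_int :: int \<Rightarrow> 'k)"
    by (rule injI) (metis assms of_int_eq_0_char_0 eq_iff_diff_eq_0 of_int_diff)
  then show ?thesis using finite_imageD infinite_UNIV_int by blast
qed

text \<open>This is the \<open>p\<close>-adic filtration for a prime \<open>p\<close> larger than
  \<open>N\<close> times the absolute value of \<open>b\<close>, so that \<open>p\<close> divides
  neither.\<close>

lemma int_filtration:
  fixes b :: "'k::field"
  assumes ch: "CHAR('k) = 0" and b: "b \<in> prime_ring" "b \<noteq> 0" and N: "N > (0::nat)"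
  shows "\<exists>p I. prime p \<and> \<not> p dvd N \<and> ring_filtration prime_ring I \<and> ring_filtration.punit I b \<and> of_nat p \<in> I 1"
proof -
  obtain z where z: "b = of_int z" using b(1) by blast
  then have z0: "z \<noteq> 0" using b(2) by auto
  define B where "B = N * nat \<bar>z\<bar>"
  have B0: "B > 0" using N z0 by (simp add: B_def)
  obtain p where p: "prime p" "B < p" using bigger_prime by blast
  have pB: "\<not> p dvd B" using p B0 by (simp add: nat_dvd_not_less)
  then have pN: "\<not> p dvd N" and pz: "\<not> p dvd nat \<bar>z\<bar>" by (auto simp: B_def)
  have pz: "\<not> int p dvd z" using pz by (simp add: dvd_nat_abs_iff)
  define I where "I k = {of_int (int p ^ k * w) :: 'k | w. True}" for k
  have memI: "of_int (int p ^ k * w) \<in> I k" for k w by (auto simp: I_def)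
  have oi: "of_int x = (of_int y :: 'k) \<longleftrightarrow> x = y" for x y
    by (metis ch of_int_eq_0_char_0 eq_iff_diff_eq_0 of_int_diff)
  have filt: "ring_filtration prime_ring I"
  proof
    show "is_subring (prime_ring :: 'k set)" by (rule prime_ring_subring)
    show "I 0 = prime_ring" by (auto simp: I_def)
    show "0 \<in> I k" for k using memI[of k 0] by simp
    show "a - b \<in> I k" if ab: "a \<in> I k" "b \<in> I k" for a b k
    proof -
      obtain v w where "a = of_int (int p ^ k * v)" "b = of_int (int p ^ k * w)" using ab by (auto simp: I_def)
      then have "a - b = of_int (int p ^ k * (v - w))" by (simp add: algebra_simps)
      then show ?thesis using memI by metis
    qed
    show "a * b \<in> I (i + k)" if ab: "a \<in> I i" "b \<in> I k" for a b i k
    proof -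
      obtain v w where "a = of_int (int p ^ i * v)" "b = of_int (int p ^ k * w)" using ab by (auto simp: I_def)
      then have "a * b = of_int (int p ^ (i + k) * (v * w))" by (simp add: power_add)
      then show ?thesis using memI by metis
    qed
    show "I (Suc k) \<subseteq> I k" for k
    proof
      fix a assume "a \<in> I (Suc k)"
      then obtain w where "a = of_int (int p ^ k * (int p * w))" by (auto simp: I_def ac_simps)
      then show "a \<in> I k" using memI by metis
    qed
    show "\<exists>T. finite T \<and> (\<forall>a\<in>prime_ring. \<exists>t\<in>T. a - t \<in> I k)" for k
    proof (rule exI[of _ "of_int ` {0..<int p ^ k}"], intro conjI ballI)
      fix a :: 'k assume "a \<in> prime_ring"
      then obtain x where x: "a = of_int x" by blast
      have "of_int x - of_int (x mod int p ^ k) = (of_int (int p ^ k * (x div int p ^ k)) :: 'k)"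
        by (metis mult_div_mod_eq add_diff_cancel_right' of_int_diff)
      moreover have "x mod int p ^ k \<in> {0..<int p ^ k}" using p(1) by (simp add: prime_gt_0_nat)
      ultimately show "\<exists>t\<in>of_int ` {0..<int p ^ k}. a - t \<in> I k" using x memI by (metis imageI)
    qed simp
    show "a = 0" if a: "\<And>k. a \<in> I k" for a
    proof -
      obtain x where x: "a = of_int x" using a[of 0] by (auto simp: I_def)
      have dv: "int p ^ k dvd x" for k
        using a[of k] unfolding x by (auto simp: I_def oi simp del: of_int_mult of_int_power)
      have "x = 0"
      proof (rule ccontr)
        assume x0: "x \<noteq> 0"
        have "int p ^ nat \<bar>x\<bar> \<le> \<bar>x\<bar>" using zdvd_imp_le[of "int p ^ nat \<bar>x\<bar>" "\<bar>x\<bar>"] dv x0 by simp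
        moreover have "nat \<bar>x\<bar> < p ^ nat \<bar>x\<bar>" using p(1) by (intro power_gt_expt prime_gt_Suc_0_nat)
        then have "int (nat \<bar>x\<bar>) < int (p ^ nat \<bar>x\<bar>)" by (simp only: of_nat_less_iff)
        ultimately show False by simp
      qed
      then show ?thesis using x by simp
    qed
  qed
  interpret ring_filtration "prime_ring :: 'k set" I by (rule filt)
  have "punit b" unfolding punit_def
  proof (rule power_cong_one[OF b(1)])
    fix a :: 'k assume "a \<in> prime_ring" "b * a \<in> I 1"
    then obtain x w where x: "a = of_int x" "of_int (z * x) = (of_int (int p * w) :: 'k)"
      unfolding z by (auto simp: I_def)
    then have "z * x = int p * w" by (simp only: oi)
    then have "int p dvd z * x" by simp
    then have "int p dvd x" using pz p(1) by (simp add: prime_dvd_mult_iff)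
    then obtain y where "x = int p ^ 1 * y" by auto
    then show "a \<in> I 1" using x(1) memI by metis
  qed
  moreover have "of_nat p \<in> I 1" using memI[of 1 1] by simp
  ultimately show ?thesis using filt p(1) pN by blast
qed

text \<open>Lifting is applied to \<open>f = 1\<close>, so \<open>b\<close> excludes only finitely
  many primes. As \<open>of_nat p\<close> stays in \<open>I 1\<close>, the residue ring modulo
  \<open>I 1\<close> has characteristic \<open>p\<close>.\<close>

theorem filtration_char_0:
  fixes xs :: "'k::field list"
  assumes ch: "CHAR('k) = 0" and N: "N > (0::nat)"
  shows "\<exists>p I. prime p \<and> \<not> p dvd N \<and> ring_filtration (adj_list prime_ring xs) I \<and> of_nat p \<in> I 1"
proof -
  have "\<exists>b\<in>prime_ring. b \<noteq> (0 :: 'k) \<and> (\<forall>I. ring_filtration prime_ring I \<and> ring_filtration.punit I b \<longrightarrow>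
    (\<exists>I'. ring_filtration (adj_list prime_ring xs) I' \<and> (\<forall>k. I k \<subseteq> I' k) \<and> ring_filtration.punit I' 1))"
    by (rule lift_filtration_list[OF prime_ring_subring infinite_prime_ring_char_0[OF ch]
        is_subringD(1)[OF adj_list_subring[OF prime_ring_subring]] one_neq_zero])
  then obtain b :: 'k where b: "b \<in> prime_ring" "b \<noteq> 0" and lift: "\<forall>I. ring_filtration prime_ring I \<and> ring_filtration.punit I b \<longrightarrow>
    (\<exists>I'. ring_filtration (adj_list prime_ring xs) I' \<and> (\<forall>k. I k \<subseteq> I' k) \<and> ring_filtration.punit I' 1)"
    by (elim bexE conjE)
  obtain p I where p: "prime p" "\<not> p dvd N" "ring_filtration prime_ring I" "ring_filtration.punit I b" "of_nat p \<in> I 1"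
    using int_filtration[OF ch b N] by blast
  have "\<exists>I'. ring_filtration (adj_list prime_ring xs) I' \<and> (\<forall>k. I k \<subseteq> I' k) \<and> ring_filtration.punit I' 1"
    by (rule mp[OF spec[OF lift] conjI[OF p(3,4)]])
  then obtain I' where I': "ring_filtration (adj_list prime_ring xs) I'" "\<forall>k. I k \<subseteq> I' k"
    by (elim exE conjE)
  have "of_nat p \<in> I' 1" using I'(2) p(5) by blast
  then show ?thesis using p(1,2) I'(1) by blast
qed

section \<open>Base filtrations: polynomial rings over a finite prime field\<close>

lemma finite_prime_ring_char_p:
  assumes "CHAR('k::field) > 0" shows "finite (prime_ring :: 'k set)"
proof -
  let ?p = "CHAR('k)"
  have "of_int x \<in> (of_int ` {0..<int ?p} :: 'k set)" for x :: int
  proof -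
    have "(of_int x :: 'k) = of_int (int ?p * (x div int ?p) + x mod int ?p)" by simp
    also have "\<dots> = of_int (x mod int ?p)" by (simp only: of_int_add of_int_mult) simp
    finally show ?thesis using assms by (intro image_eqI[of _ _ "x mod int ?p"]) auto
  qed
  then have "(prime_ring :: 'k set) \<subseteq> of_int ` {0..<int ?p}" by blast
  then show ?thesis using finite_subset by blast
qed

text \<open>Linear factors of \<open>g\<close> are split off one root at a time; a root of
  \<open>g\<close> is not one of \<open>\<beta>\<close>, so it is a root of
  \<open>\<alpha>\<close>.\<close>

lemma dvd_cancel_no_common_root:
  fixes g \<beta> \<alpha> :: "'k::alg_closed_field poly"
  assumes "g \<noteq> 0" "g dvd \<beta> * \<alpha>" "\<And>\<omega>. poly g \<omega> = 0 \<Longrightarrow> poly \<beta> \<omega> \<noteq> 0"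
  shows "g dvd \<alpha>"
  using assms
proof (induction "degree g" arbitrary: g \<alpha>)
  case 0
  then show ?case by (metis is_unit_iff_degree unit_imp_dvd)
next
  case (Suc d)
  then obtain \<omega> where \<omega>: "poly g \<omega> = 0"
    using alg_closed_imp_poly_has_root[of g] by auto
  then obtain g' where g': "g = [:- \<omega>, 1:] * g'" by (auto simp: poly_eq_0_iff_dvd)
  have "poly (\<beta> * \<alpha>) \<omega> = 0" using Suc.prems(2) \<omega> by (metis dvd_trans poly_eq_0_iff_dvd)
  then have "poly \<alpha> \<omega> = 0" using Suc.prems(3)[OF \<omega>] by simp
  then obtain \<alpha>' where \<alpha>': "\<alpha> = [:- \<omega>, 1:] * \<alpha>'" by (auto simp: poly_eq_0_iff_dvd)
  have g'0: "g' \<noteq> 0" using Suc.prems(1) g' by auto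
  have "degree g = Suc (degree g')" unfolding g' using g'0 by (subst degree_mult_eq) auto
  then have "d = degree g'" using Suc.hyps(2) by simp
  moreover have "g' dvd \<beta> * \<alpha>'"
  proof -
    have "[:- \<omega>, 1:] * g' dvd [:- \<omega>, 1:] * (\<beta> * \<alpha>')"
      using Suc.prems(2) unfolding g' \<alpha>' by (simp only: mult.left_commute)
    then show ?thesis by (subst (asm) dvd_mult_cancel_left) auto
  qed
  moreover have "poly \<beta> \<omega>' \<noteq> 0" if "poly g' \<omega>' = 0" for \<omega>'
    using Suc.prems(3)[of \<omega>'] that g' by simp
  ultimately have "g' dvd \<alpha>'" using Suc.hyps(1)[OF _ g'0] by blast
  then show ?case unfolding g' \<alpha>' by (rule mult_dvd_mono[OF dvd_refl])
qed

text \<open>For a prime \<open>l\<close> other than the characteristic this is the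
  \<open>l\<close>-th cyclotomic polynomial, whose roots are the primitive \<open>l\<close>-th roots
  of unity.\<close>

definition geom_poly :: "nat \<Rightarrow> 'k::field poly" where
  "geom_poly l = (\<Sum>i<l. Polynomial.monom 1 i)"

lemma coeff_geom_poly: "coeff (geom_poly l) i = (if i < l then 1 else 0)"
  unfolding geom_poly_def by (rule coeff_combination)

lemma poly_geom_poly: "poly (geom_poly l) x = (\<Sum>i<l. x ^ i)"
  by (simp add: geom_poly_def poly_sum poly_monom)

lemma geom_poly_degree:
  assumes "l > 0" shows "degree (geom_poly l :: 'k::field poly) = l - 1" "lead_coeff (geom_poly l :: 'k poly) = 1"
proof -
  have "degree (geom_poly l :: 'k poly) \<le> l - 1" using assms by (intro degree_le) (auto simp: coeff_geom_poly)
  moreover have "l - 1 \<le> degree (geom_poly l :: 'k poly)" using assms by (intro le_degree) (simp add: coeff_geom_poly)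
  ultimately show d: "degree (geom_poly l :: 'k poly) = l - 1" by simp
  show "lead_coeff (geom_poly l :: 'k poly) = 1" using assms by (simp add: d coeff_geom_poly)
qed

lemma geom_root_power: "poly (geom_poly l) \<omega> = 0 \<Longrightarrow> \<omega> ^ l = 1"
  using power_diff_1_eq[of \<omega> l] by (simp add: poly_geom_poly)

text \<open>For different primes, none of them the characteristic, these polynomials have no common
  root: it would be 1, where the value is \<open>l\<close>. As \<open>\<beta>\<close> has finitely
  many roots, only finitely many primes are bad.\<close>

lemma prime_without_common_root:
  fixes \<beta> :: "'k::field poly"
  assumes \<beta>: "\<beta> \<noteq> 0" and N: "N > (0::nat)"
  shows "\<exists>l. prime l \<and> \<not> l dvd N \<and> (\<forall>\<omega>. poly (geom_poly l) \<omega> = 0 \<longrightarrow> poly \<beta> \<omega> \<noteq> 0)"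
proof -
  define Bad where "Bad = {l. prime l \<and> of_nat l \<noteq> (0 :: 'k) \<and> (\<exists>\<omega>. poly (geom_poly l) \<omega> = 0 \<and> poly \<beta> \<omega> = 0)}"
  have "\<forall>l. \<exists>\<omega>. l \<in> Bad \<longrightarrow> poly (geom_poly l) \<omega> = 0 \<and> poly \<beta> \<omega> = 0" by (auto simp: Bad_def)
  then obtain \<omega> where \<omega>: "\<And>l. l \<in> Bad \<Longrightarrow> poly (geom_poly l) (\<omega> l) = 0 \<and> poly \<beta> (\<omega> l) = 0" by metis
  have "inj_on \<omega> Bad"
  proof (rule inj_onI, rule ccontr)
    fix l m assume lm: "l \<in> Bad" "m \<in> Bad" "\<omega> l = \<omega> m" "l \<noteq> m"
    have 1: "\<omega> l ^ l = 1" "\<omega> l ^ m = 1" using \<omega>[OF lm(1)] \<omega>[OF lm(2)] lm(3) geom_root_power by metis+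
    have "coprime l m" using lm primes_coprime by (auto simp: Bad_def)
    moreover have "l \<noteq> 0" using lm(1) by (auto simp: Bad_def prime_gt_0_nat)
    ultimately obtain x y where xy: "l * x = m * y + 1" using bezout_nat[of l m] by auto
    have "\<omega> l ^ (l * x) = 1" unfolding power_mult 1 by simp
    moreover have "\<omega> l ^ (m * y + 1) = \<omega> l" unfolding power_add power_mult 1 by simp
    ultimately have "\<omega> l = 1" using xy by simp
    then have "of_nat l = (0 :: 'k)" using \<omega>[OF lm(1)] by (simp add: poly_geom_poly)
    then show False using lm(1) by (simp add: Bad_def)
  qed
  moreover have "\<omega> ` Bad \<subseteq> {x. poly \<beta> x = 0}" using \<omega> by auto
  ultimately have "finite Bad" using poly_roots_finite[OF \<beta>] by (meson finite_imageD finite_subset)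
  moreover have "finite {l. l dvd N}" using N by simp
  moreover have "finite {l :: nat. prime l \<and> of_nat l = (0 :: 'k)}"
  proof (cases "CHAR('k) = 0")
    case False
    have "{l :: nat. prime l \<and> of_nat l = (0 :: 'k)} \<subseteq> {CHAR('k)}"
      using CHAR_not_1'[where 'a = 'k] by (auto simp: of_nat_eq_0_iff_char_dvd prime_nat_iff)
    then show ?thesis using finite_subset by blast
  next
    case True
    then have "of_nat l \<noteq> (0 :: 'k)" if "prime l" for l :: nat
      unfolding of_nat_eq_0_iff_char_dvd using that by (simp add: prime_gt_0_nat)
    then have "{l :: nat. prime l \<and> of_nat l = (0 :: 'k)} = {}" by blast
    then show ?thesis by (simp only: finite.emptyI)
  qed
  ultimately have "finite (Bad \<union> {l. l dvd N} \<union> {l :: nat. prime l \<and> of_nat l = (0 :: 'k)})" by simp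
  then obtain l where l: "prime l" "l \<notin> Bad \<union> {l. l dvd N} \<union> {l :: nat. prime l \<and> of_nat l = (0 :: 'k)}"
    using primes_infinite by (metis (mono_tags, lifting) finite_subset mem_Collect_eq subsetI)
  then show ?thesis by (auto simp: Bad_def)
qed

text \<open>The filtration consists of the multiples of the powers of the monic polynomial
  \<open>g\<close> in the polynomial ring \<open>adj prime_ring \<mu>\<close>, whose coefficient
  ring is finite. \<open>f\<close> is invertible modulo \<open>g\<close> because
  \<open>\<beta>\<close> and \<open>g\<close> have no common root in the algebraically closed
  field.\<close>

lemma poly_filtration:
  fixes \<mu> :: "'k::alg_closed_field"
  assumes ch: "CHAR('k) > 0" and \<mu>: "trans_over prime_ring \<mu>"
    and g: "\<And>i. coeff g i \<in> prime_ring" "lead_coeff g = 1" "degree g > 0"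
    and f: "f = poly \<beta> \<mu>" "\<And>i. coeff \<beta> i \<in> prime_ring"
    and root: "\<And>\<omega>. poly g \<omega> = 0 \<Longrightarrow> poly \<beta> \<omega> \<noteq> 0"
  shows "\<exists>I. ring_filtration (adj prime_ring \<mu>) I \<and> ring_filtration.punit I f \<and> poly g \<mu> \<in> I 1"
proof -
  note R = prime_ring_subring[where 'k = 'k]
  note closed = is_subringD[OF R]
  have g0: "g \<noteq> 0" using g(3) by auto
  define I where "I k = {poly (g ^ k * q) \<mu> | q. \<forall>i. coeff q i \<in> prime_ring}" for k
  have memI: "poly (g ^ k * q) \<mu> \<in> I k" if "\<And>i. coeff q i \<in> prime_ring" for k q using that by (auto simp: I_def)
  have gk: "\<forall>i. coeff (g ^ k) i \<in> prime_ring" "lead_coeff (g ^ k) = 1" for k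
  proof -
    show "lead_coeff (g ^ k) = 1" using g(2) by (simp add: lead_coeff_power)
    show "\<forall>i. coeff (g ^ k) i \<in> prime_ring"
    proof (induction k)
      case (Suc k)
      then show ?case using coeff_mult_in[OF R g(1), of "g ^ k"] by simp
    qed (use closed in \<open>auto simp: coeff_1\<close>)
  qed
  have uniq: "p = q" if "poly p \<mu> = poly q \<mu>" "\<And>i. coeff p i \<in> prime_ring" "\<And>i. coeff q i \<in> prime_ring" for p q
  proof -
    have "\<forall>i. coeff (p - q) i \<in> prime_ring" using closed(2) that by simp
    moreover have "poly (p - q) \<mu> = 0" using that(1) by simp
    ultimately have "p - q = 0" using \<mu> unfolding trans_over_def by blast
    then show ?thesis by simp
  qed
  have divide: "\<exists>s t. p = g ^ k * s + t \<and> (t = 0 \<or> degree t < degree (g ^ k)) \<and>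
      (\<forall>i. coeff s i \<in> prime_ring) \<and> (\<forall>i. coeff t i \<in> prime_ring)" if "\<And>i. coeff p i \<in> prime_ring" for p k
  proof -
    have "\<exists>m s t. Polynomial.smult (lead_coeff (g ^ k) ^ m) p = g ^ k * s + t \<and> (t = 0 \<or> degree t < degree (g ^ k)) \<and>
      (\<forall>i. coeff s i \<in> prime_ring) \<and> (\<forall>i. coeff t i \<in> prime_ring)"
      by (rule pseudo_division[OF R _ _ that]) (use g0 gk in auto)
    then show ?thesis unfolding gk(2) by simp
  qed
  have filt: "ring_filtration (adj prime_ring \<mu>) I"
  proof
    show "is_subring (adj prime_ring \<mu>)" by (rule adj_subring[OF R])
    show "I 0 = adj prime_ring \<mu>" by (simp add: I_def adj_def)
    show "0 \<in> I k" for k using memI[of 0 k] closed(4) by simp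
    show "a - b \<in> I k" if ab: "a \<in> I k" "b \<in> I k" for a b k
    proof -
      obtain q s where q: "a = poly (g ^ k * q) \<mu>" "\<forall>i. coeff q i \<in> prime_ring"
        and s: "b = poly (g ^ k * s) \<mu>" "\<forall>i. coeff s i \<in> prime_ring" using ab by (auto simp: I_def)
      have "poly (g ^ k * (q - s)) \<mu> \<in> I k" by (rule memI) (use q s closed(2) in auto)
      then show ?thesis using q s by (simp add: algebra_simps)
    qed
    show "a * b \<in> I (i + k)" if ab: "a \<in> I i" "b \<in> I k" for a b i k
    proof -
      obtain q s where q: "a = poly (g ^ i * q) \<mu>" "\<forall>i. coeff q i \<in> prime_ring"
        and s: "b = poly (g ^ k * s) \<mu>" "\<forall>i. coeff s i \<in> prime_ring" using ab by (auto simp: I_def)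
      have "poly (g ^ (i + k) * (q * s)) \<mu> \<in> I (i + k)"
        by (rule memI) (use q s coeff_mult_in[OF R] in blast)
      then show ?thesis using q s by (simp add: power_add ac_simps)
    qed
    show "I (Suc k) \<subseteq> I k" for k
    proof
      fix a assume "a \<in> I (Suc k)"
      then obtain q where q: "a = poly (g ^ k * (g * q)) \<mu>" "\<forall>i. coeff q i \<in> prime_ring"
        by (auto simp: I_def ac_simps)
      then show "a \<in> I k" using memI[of "g * q" k] coeff_mult_in[OF R g(1)] by simp
    qed
    show "\<exists>T. finite T \<and> (\<forall>a\<in>adj prime_ring \<mu>. \<exists>t\<in>T. a - t \<in> I k)" for k
    proof -
      define d where "d = degree (g ^ k)"
      define T where "T = (\<lambda>t. poly (\<Sum>i<d. Polynomial.monom (t i) i) \<mu>) ` (PiE {..<d} (\<lambda>_. prime_ring :: 'k set))"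
      have "finite T" unfolding T_def
        by (rule finite_imageI, rule finite_PiE, simp, rule finite_prime_ring_char_p[OF ch])
      moreover have "\<exists>t\<in>T. a - t \<in> I k" if a: "a \<in> adj prime_ring \<mu>" for a
      proof -
        obtain p where p: "a = poly p \<mu>" "\<forall>i. coeff p i \<in> prime_ring" using a by (auto simp: adj_def)
        obtain s t where st: "p = g ^ k * s + t" "t = 0 \<or> degree t < d" "\<forall>i. coeff s i \<in> prime_ring" "\<forall>i. coeff t i \<in> prime_ring"
          using divide[of p k] p(2) unfolding d_def by blast
        define t' where "t' = restrict (coeff t) {..<d}"
        have "t' \<in> PiE {..<d} (\<lambda>_. prime_ring)" using st(4) by (auto simp: t'_def)
        moreover have "t = (\<Sum>i<d. Polynomial.monom (t' i) i)"
          by (rule poly_eqI) (use st(2) in \<open>auto simp: coeff_combination t'_def coeff_eq_0\<close>)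
        ultimately have "poly t \<mu> \<in> T" unfolding T_def by blast
        moreover have "a - poly t \<mu> \<in> I k" using memI[of s k] st(3) p(1) st(1) by simp
        ultimately show ?thesis by blast
      qed
      ultimately show ?thesis by blast
    qed
    show "a = 0" if a: "\<And>k. a \<in> I k" for a
    proof -
      obtain q where q: "a = poly q \<mu>" "\<forall>i. coeff q i \<in> prime_ring" using a[of 0] by (auto simp: I_def)
      \<comment> \<open>The exponent \<open>Suc (degree q)\<close> is large enough that only
        \<open>q = 0\<close> is divisible by this power of \<open>g\<close>.\<close>
      obtain s where s: "a = poly (g ^ Suc (degree q) * s) \<mu>" "\<forall>i. coeff s i \<in> prime_ring"
        using a[of "Suc (degree q)"] by (auto simp: I_def)
      have e: "q = g ^ Suc (degree q) * s"
        by (rule uniq) (use q s coeff_mult_in[OF R] gk in blast)+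
      have "q = 0"
      proof (rule ccontr)
        assume q0: "q \<noteq> 0"
        then have "s \<noteq> 0" using e by auto
        then have "degree q = Suc (degree q) * degree g + degree s"
          using arg_cong[OF e, of degree] g0 by (simp add: degree_mult_eq degree_power_eq)
        moreover have "Suc (degree q) * 1 \<le> Suc (degree q) * degree g"
          using g(3) by (intro mult_le_mono2) simp
        ultimately show False by (metis Suc_n_not_le_n le_add1 le_trans mult.right_neutral)
      qed
      then show ?thesis using q(1) by simp
    qed
  qed
  interpret ring_filtration "adj prime_ring \<mu>" I by (rule filt)
  have fR: "f \<in> adj prime_ring \<mu>" using f by (auto simp: adj_def)
  have "punit f" unfolding punit_def
  proof (rule power_cong_one[OF fR])
    fix a assume a: "a \<in> adj prime_ring \<mu>" "f * a \<in> I 1"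
    obtain \<alpha> where \<alpha>: "a = poly \<alpha> \<mu>" "\<forall>i. coeff \<alpha> i \<in> prime_ring" using a(1) by (auto simp: adj_def)
    obtain q where q: "f * a = poly (g ^ 1 * q) \<mu>" "\<forall>i. coeff q i \<in> prime_ring" using a(2) by (auto simp: I_def)
    have "\<beta> * \<alpha> = g * q"
      by (rule uniq) (use f \<alpha> q g(1) coeff_mult_in[OF R] in \<open>auto\<close>)
    then have "g dvd \<alpha>" using dvd_cancel_no_common_root[OF g0 _ root] by (metis dvd_triv_left)
    obtain s t where st: "\<alpha> = g ^ 1 * s + t" "t = 0 \<or> degree t < degree (g ^ 1)" "\<forall>i. coeff s i \<in> prime_ring"
      using divide[of \<alpha> 1] \<alpha>(2) by blast
    have "g dvd t" using \<open>g dvd \<alpha>\<close> st(1) by (metis dvd_add_right_iff dvd_triv_left power_one_right)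
    then have "t = 0" using st(2) by (metis dvd_imp_degree_le linorder_not_less power_one_right)
    then show "a \<in> I 1" using memI[of s 1] st \<alpha>(1) by simp
  qed
  moreover have "poly g \<mu> \<in> I 1" using memI[of 1 1] closed by (simp add: coeff_1)
  ultimately show ?thesis using filt by blast
qed

text \<open>Modulo \<open>I 1\<close> the geometric sum vanishes, so \<open>\<mu>\<close> becomes an
  \<open>l\<close>-th root of unity. The prime \<open>l\<close> is taken with
  \<open>geom_poly l\<close> prime to the polynomial that represents \<open>b\<close>, so that
  \<open>b\<close> is a unit and the filtration lifts.\<close>

theorem filtration_char_p:
  fixes \<mu> :: "'k::alg_closed_field"
  assumes ch: "CHAR('k) > 0" and \<mu>: "trans_over prime_ring \<mu>" and N: "N > (0::nat)"
    and f: "f \<in> adj_list (adj prime_ring \<mu>) xs" "f \<noteq> 0"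
  shows "\<exists>l I. prime l \<and> \<not> l dvd N \<and> ring_filtration (adj_list (adj prime_ring \<mu>) xs) I \<and>
    ring_filtration.punit I f \<and> (\<Sum>i<l. \<mu> ^ i) \<in> I 1"
proof -
  let ?B = "adj prime_ring \<mu>"
  note R = prime_ring_subring[where 'k = 'k]
  have "infinite ?B"
  proof
    assume fin: "finite ?B"
    have "inj (\<lambda>i::nat. \<mu> ^ i)"
    proof (rule injI, rule ccontr)
      fix i m :: nat assume im: "\<mu> ^ i = \<mu> ^ m" "i \<noteq> m"
      have "\<forall>k. coeff (Polynomial.monom 1 i - Polynomial.monom 1 m :: 'k poly) k \<in> prime_ring"
        using is_subringD[OF R] by auto
      moreover have "poly (Polynomial.monom 1 i - Polynomial.monom 1 m) \<mu> = 0" using im(1) by (simp add: poly_monom)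
      ultimately have "Polynomial.monom 1 i - Polynomial.monom 1 m = (0 :: 'k poly)" using \<mu> unfolding trans_over_def by blast
      then show False using im(2) by (metis eq_iff_diff_eq_0 monom_eq_iff' zero_neq_one)
    qed
    moreover have "range (\<lambda>i::nat. \<mu> ^ i) \<subseteq> ?B"
      using is_subringD(7)[OF adj_subring[OF R] adj_gen[OF R]] by blast
    ultimately show False using fin by (meson finite_imageD finite_subset infinite_UNIV_nat)
  qed
  then obtain b where b: "b \<in> ?B" "b \<noteq> 0" and lift: "\<forall>I. ring_filtration ?B I \<and> ring_filtration.punit I b \<longrightarrow>
    (\<exists>I'. ring_filtration (adj_list ?B xs) I' \<and> (\<forall>k. I k \<subseteq> I' k) \<and> ring_filtration.punit I' f)"
    using lift_filtration_list[OF adj_subring[OF R] _ f] by blast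
  obtain \<beta> where \<beta>: "b = poly \<beta> \<mu>" "\<forall>i. coeff \<beta> i \<in> prime_ring" using b(1) by (auto simp: adj_def)
  have "\<beta> \<noteq> 0" using \<beta>(1) b(2) by auto
  then obtain l where l: "prime l" "\<not> l dvd N" "\<forall>\<omega>. poly (geom_poly l) \<omega> = 0 \<longrightarrow> poly \<beta> \<omega> \<noteq> 0"
    using prime_without_common_root[OF _ N] by blast
  have l0: "l > 0" "l - 1 > 0" using l(1) prime_gt_1_nat[of l] by auto
  have "\<exists>I. ring_filtration ?B I \<and> ring_filtration.punit I b \<and> poly (geom_poly l) \<mu> \<in> I 1"
  proof (rule poly_filtration[OF ch \<mu> _ _ _ \<beta>(1)])
    show "lead_coeff (geom_poly l :: 'k poly) = 1" by (rule geom_poly_degree(2)[OF l0(1)])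
    show "degree (geom_poly l :: 'k poly) > 0" using geom_poly_degree(1)[OF l0(1), where 'k = 'k] l0 by simp
    show "coeff (geom_poly l :: 'k poly) i \<in> prime_ring" for i
      using is_subringD(1,4)[OF R] by (simp only: coeff_geom_poly split: if_split) blast
  qed (use \<beta>(2) l(3) in blast)+
  then obtain I where I: "ring_filtration ?B I" "ring_filtration.punit I b" "poly (geom_poly l) \<mu> \<in> I 1" by blast
  have "\<exists>I'. ring_filtration (adj_list ?B xs) I' \<and> (\<forall>k. I k \<subseteq> I' k) \<and> ring_filtration.punit I' f"
    by (rule mp[OF spec[OF lift] conjI[OF I(1,2)]])
  then obtain I' where I': "ring_filtration (adj_list ?B xs) I'" "\<forall>k. I k \<subseteq> I' k" "ring_filtration.punit I' f"
    by (elim exE conjE)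
  have "(\<Sum>i<l. \<mu> ^ i) \<in> I' 1" using I'(2) I(3) unfolding poly_geom_poly by blast
  then show ?thesis using l(1,2) I'(1,3) by blast
qed

section \<open>Congruence subgroups of linear groups\<close>

text \<open>Matrices are functions of two indices because the dimension \<open>n\<close> is not part
  of a type; the conditions concern indices below \<open>n\<close>.\<close>

locale mat_rep = group G for G (structure) +
  fixes M :: "'a \<Rightarrow> nat \<Rightarrow> nat \<Rightarrow> 'k::field" and n :: nat
  assumes M_mult: "g \<in> carrier G \<Longrightarrow> h \<in> carrier G \<Longrightarrow> i < n \<Longrightarrow> j < n \<Longrightarrow>
      M (g \<otimes> h) i j = (\<Sum>l<n. M g i l * M h l j)"
    and M_one: "i < n \<Longrightarrow> j < n \<Longrightarrow> M \<one> i j = (if i = j then 1 else 0)"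
begin

definition rep_kernel :: "'a set" where
  "rep_kernel = {g \<in> carrier G. \<forall>i<n. \<forall>j<n. M g i j = M \<one> i j}"

end

locale mat_filtration = mat_rep G M n + ring_filtration A I
  for G (structure) and M :: "'a \<Rightarrow> nat \<Rightarrow> nat \<Rightarrow> 'k::field" and n and A :: "'k set" and I :: "nat \<Rightarrow> 'k set" +
  assumes entries: "g \<in> carrier G \<Longrightarrow> i < n \<Longrightarrow> j < n \<Longrightarrow> M g i j \<in> A"
begin

definition cg :: "nat \<Rightarrow> 'a \<Rightarrow> 'a \<Rightarrow> bool" where
  "cg k g h \<longleftrightarrow> (\<forall>i<n. \<forall>j<n. M g i j - M h i j \<in> I k)"

definition \<Gamma> :: "nat \<Rightarrow> 'a set" where
  "\<Gamma> k = {g \<in> carrier G. cg k g \<one>}"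

lemma cg_sym: "cg k g h \<Longrightarrow> cg k h g"
  unfolding cg_def using cong_sym by blast

lemma cg_trans: "cg k g h \<Longrightarrow> cg k h u \<Longrightarrow> cg k g u"
  unfolding cg_def
proof (intro allI impI)
  fix i j assume c: "\<forall>i<n. \<forall>j<n. M g i j - M h i j \<in> I k" "\<forall>i<n. \<forall>j<n. M h i j - M u i j \<in> I k"
    and ij: "i < n" "j < n"
  show "M g i j - M u i j \<in> I k"
    by (rule cong_trans[of _ "M h i j"]) (simp_all add: c ij)
qed

lemma cg_left:
  assumes "cg k g h" "x \<in> carrier G" "g \<in> carrier G" "h \<in> carrier G"
  shows "cg k (x \<otimes> g) (x \<otimes> h)"
  unfolding cg_def
proof (intro allI impI)
  fix i j assume ij: "i < n" "j < n"
  have "M (x \<otimes> g) i j - M (x \<otimes> h) i j = (\<Sum>l<n. M x i l * (M g l j - M h l j))"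
    using assms ij by (simp add: M_mult algebra_simps sum_subtractf)
  also have "\<dots> \<in> I k"
    using assms ij entries by (intro sum_in multR(1)) (auto simp: cg_def)
  finally show "M (x \<otimes> g) i j - M (x \<otimes> h) i j \<in> I k" .
qed

lemma cg_right:
  assumes "cg k g h" "x \<in> carrier G" "g \<in> carrier G" "h \<in> carrier G"
  shows "cg k (g \<otimes> x) (h \<otimes> x)"
  unfolding cg_def
proof (intro allI impI)
  fix i j assume ij: "i < n" "j < n"
  have "M (g \<otimes> x) i j - M (h \<otimes> x) i j = (\<Sum>l<n. (M g i l - M h i l) * M x l j)"
    using assms ij by (simp add: M_mult algebra_simps sum_subtractf)
  also have "\<dots> \<in> I k"
    using assms ij entries by (intro sum_in multR(2)) (auto simp: cg_def)
  finally show "M (g \<otimes> x) i j - M (h \<otimes> x) i j \<in> I k" .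
qed

lemma \<Gamma>_subgroup: "subgroup (\<Gamma> k) G"
proof (rule subgroupI)
  show "\<Gamma> k \<subseteq> carrier G" by (auto simp: \<Gamma>_def)
  have "\<one> \<in> \<Gamma> k" by (simp add: \<Gamma>_def cg_def zero)
  then show "\<Gamma> k \<noteq> {}" by blast
  show "inv a \<in> \<Gamma> k" if "a \<in> \<Gamma> k" for a
    using that cg_left[of k a \<one> "inv a"] cg_sym by (auto simp: \<Gamma>_def)
  show "a \<otimes> b \<in> \<Gamma> k" if ab: "a \<in> \<Gamma> k" "b \<in> \<Gamma> k" for a b
  proof -
    have c: "a \<in> carrier G" "b \<in> carrier G" "cg k a \<one>" "cg k b \<one>" using ab by (auto simp: \<Gamma>_def)
    have "cg k (a \<otimes> b) b" using cg_right[OF c(3,2,1)] c by simp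
    then have "cg k (a \<otimes> b) \<one>" by (rule cg_trans[OF _ c(4)])
    then show ?thesis using c by (simp add: \<Gamma>_def)
  qed
qed

lemma \<Gamma>_normal: "\<Gamma> k \<lhd> G"
proof -
  have "x \<otimes> g \<otimes> inv x \<in> \<Gamma> k" if x: "x \<in> carrier G" and g: "g \<in> \<Gamma> k" for x g
  proof -
    have g': "g \<in> carrier G" "cg k g \<one>" using g by (auto simp: \<Gamma>_def)
    have "cg k (x \<otimes> g) x" using cg_left[OF g'(2) x g'(1) one_closed] x by simp
    then have "cg k (x \<otimes> g \<otimes> inv x) (x \<otimes> inv x)" using x g' by (intro cg_right) auto
    then show ?thesis using x g' by (simp add: \<Gamma>_def)
  qed
  then show ?thesis using \<Gamma>_subgroup by (simp add: normal_inv_iff)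
qed

lemma \<Gamma>_finite_index: "finite (rcosets (\<Gamma> k))"
proof -
  obtain T where T: "finite T" "\<forall>a\<in>A. \<exists>t\<in>T. a - t \<in> I k" using finite_index by blast
  define \<tau> where "\<tau> a = (SOME t. t \<in> T \<and> a - t \<in> I k)" for a
  have \<tau>: "\<tau> a \<in> T" "a - \<tau> a \<in> I k" if "a \<in> A" for a
  proof -
    have "\<exists>t. t \<in> T \<and> a - t \<in> I k" using bspec[OF T(2) that] by (elim bexE) (rule exI, rule conjI)
    then have "\<tau> a \<in> T \<and> a - \<tau> a \<in> I k" unfolding \<tau>_def by (rule someI_ex)
    then show "\<tau> a \<in> T" "a - \<tau> a \<in> I k" by simp_all
  qed
  define F where "F g = (\<lambda>x\<in>{..<n} \<times> {..<n}. \<tau> (M g (fst x) (snd x)))" for g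
  have "F ` carrier G \<subseteq> PiE ({..<n} \<times> {..<n}) (\<lambda>_. T)"
    unfolding F_def by (intro image_subsetI restrict_PiE_iff[THEN iffD2] ballI \<tau>(1) entries) auto
  moreover have "finite (PiE ({..<n} \<times> {..<n}) (\<lambda>_. T))" using T(1) by (intro finite_PiE) auto
  ultimately have fin: "finite (F ` carrier G)" using finite_subset by blast
  have eq: "\<Gamma> k #> g = \<Gamma> k #> h" if g: "g \<in> carrier G" "h \<in> carrier G" and F: "F g = F h" for g h
  proof -
    have "cg k g h"
      unfolding cg_def
    proof (intro allI impI)
      fix i j assume ij: "i < n" "j < n"
      have "\<tau> (M g i j) = \<tau> (M h i j)"
        using fun_cong[OF F, of "(i, j)"] ij by (simp add: F_def)
      then show "M g i j - M h i j \<in> I k"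
        using \<tau>(2)[OF entries[OF g(1) ij]] \<tau>(2)[OF entries[OF g(2) ij]] cong_trans cong_sym by metis
    qed
    then have "cg k (g \<otimes> inv h) (h \<otimes> inv h)" using g by (intro cg_right) auto
    then have "g \<otimes> inv h \<in> \<Gamma> k" using g by (simp add: \<Gamma>_def)
    then have "g \<in> \<Gamma> k #> h"
      using subgroup.rcos_module_rev[OF \<Gamma>_subgroup is_group g(2,1)] by blast
    then show ?thesis using repr_independence[OF _ g(2) \<Gamma>_subgroup] by simp
  qed
  have "rcosets (\<Gamma> k) \<subseteq> (\<lambda>\<phi>. \<Gamma> k #> (SOME g. g \<in> carrier G \<and> F g = \<phi>)) ` (F ` carrier G)"
  proof
    fix C assume "C \<in> rcosets (\<Gamma> k)"
    then obtain g where g: "g \<in> carrier G" "C = \<Gamma> k #> g" by (auto simp: RCOSETS_def)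
    let ?h = "SOME h. h \<in> carrier G \<and> F h = F g"
    have "?h \<in> carrier G \<and> F ?h = F g" by (rule someI[where x = g]) (simp add: g(1))
    then have "C = \<Gamma> k #> ?h" using eq g by metis
    then show "C \<in> (\<lambda>\<phi>. \<Gamma> k #> (SOME g. g \<in> carrier G \<and> F g = \<phi>)) ` (F ` carrier G)"
      using g(1) by blast
  qed
  then show ?thesis using fin finite_subset by blast
qed

text \<open>With \<open>u = M x - M \<one>\<close> this is the binomial expansion to first order;
  all further terms contain products of two entries of \<open>u\<close>.\<close>

lemma \<Gamma>_power_expansion:
  assumes x: "x \<in> \<Gamma> k" and ij: "i < n" "j < n"
  shows "M (x [^] (m::nat)) i j - M \<one> i j - of_nat m * (M x i j - M \<one> i j) \<in> I (k + k)"
  using ij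
proof (induction m arbitrary: i j)
  case 0
  then show ?case by (simp add: zero)
next
  case (Suc m)
  have xG: "x \<in> carrier G" and xk: "\<And>i j. i < n \<Longrightarrow> j < n \<Longrightarrow> M x i j - M \<one> i j \<in> I k"
    using x by (auto simp: \<Gamma>_def cg_def)
  define u where "u i j = M x i j - M \<one> i j" for i j
  define e where "e i j = M (x [^] m) i j - M \<one> i j - of_nat m * u i j" for i j
  have uI: "u i j \<in> I k" if "i < n" "j < n" for i j using xk that by (simp add: u_def)
  have eI: "e i j \<in> I (k + k)" if "i < n" "j < n" for i j using Suc.IH[OF that] by (simp add: e_def u_def)
  have \<delta>1: "(\<Sum>l<n. M \<one> i l * w l) = w i" if "i < n" for i and w :: "nat \<Rightarrow> 'k"
  proof -
    have "(\<Sum>l<n. M \<one> i l * w l) = (\<Sum>l<n. if l = i then w l else 0)"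
      using that by (intro sum.cong) (auto simp: M_one)
    then show ?thesis using that by simp
  qed
  have \<delta>2: "(\<Sum>l<n. w l * M \<one> l j) = w j" if "j < n" for j and w :: "nat \<Rightarrow> 'k"
  proof -
    have "(\<Sum>l<n. w l * M \<one> l j) = (\<Sum>l<n. if l = j then w l else 0)"
      using that by (intro sum.cong) (auto simp: M_one)
    then show ?thesis using that by simp
  qed
  have "M (x [^] Suc m) i j = (\<Sum>l<n. M (x [^] m) i l * M x l j)"
    using xG Suc.prems by (simp add: M_mult)
  also have "\<dots> = (\<Sum>l<n. (M \<one> i l + of_nat m * u i l + e i l) * (M \<one> l j + u l j))"
    by (simp add: e_def u_def)
  also have "\<dots> = (\<Sum>l<n. M \<one> i l * M \<one> l j) + (\<Sum>l<n. M \<one> i l * u l j)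
      + (\<Sum>l<n. (of_nat m * u i l) * M \<one> l j) + (\<Sum>l<n. of_nat m * (u i l * u l j))
      + (\<Sum>l<n. e i l * M \<one> l j) + (\<Sum>l<n. e i l * u l j)"
    by (simp add: algebra_simps sum.distrib)
  also have "\<dots> = M \<one> i j + u i j + of_nat m * u i j + (\<Sum>l<n. of_nat m * (u i l * u l j)) + e i j + (\<Sum>l<n. e i l * u l j)"
    using Suc.prems by (simp add: \<delta>1 \<delta>2)
  finally have "M (x [^] Suc m) i j - M \<one> i j - of_nat (Suc m) * u i j
      = (\<Sum>l<n. of_nat m * (u i l * u l j)) + e i j + (\<Sum>l<n. e i l * u l j)"
    by (simp add: algebra_simps)
  also have "\<dots> \<in> I (k + k)"
  proof (intro add sum_in eI Suc.prems)
    have of_nat: "of_nat m \<in> A"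
      by (induction m) (auto intro: is_subringD[OF sub])
    fix l assume "l \<in> {..<n}"
    then have l: "l < n" by simp
    show "of_nat m * (u i l * u l j) \<in> I (k + k)"
      by (intro multR(1)[OF of_nat] mult uI Suc.prems l)
    show "e i l * u l j \<in> I (k + k)"
      by (rule multR(2)[OF eI IR[OF uI]]) (use Suc.prems l in auto)
  qed
  finally show ?case by (simp add: u_def)
qed

text \<open>The linear term has level \<open>k + 1\<close> since \<open>p\<close> has level 1, and
  the error has level \<open>2 * k\<close>, which is at least \<open>k + 1\<close>. Hence each
  element of \<open>\<Gamma> 1\<close> has \<open>p\<close>-power order modulo every
  \<open>\<Gamma> k\<close>.\<close>

lemma \<Gamma>_power:
  assumes p: "of_nat p \<in> I 1" and x: "x \<in> \<Gamma> k" and k: "k \<ge> 1"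
  shows "x [^] p \<in> \<Gamma> (Suc k)"
proof -
  have xG: "x \<in> carrier G" using x by (simp add: \<Gamma>_def)
  have "M (x [^] p) i j - M \<one> i j \<in> I (Suc k)" if ij: "i < n" "j < n" for i j
  proof -
    have "I (k + k) \<subseteq> I (Suc k)" using k by (intro decr) simp
    then have 1: "M (x [^] p) i j - M \<one> i j - of_nat p * (M x i j - M \<one> i j) \<in> I (Suc k)"
      using \<Gamma>_power_expansion[OF x ij] by blast
    have "M x i j - M \<one> i j \<in> I k" using x ij by (simp add: \<Gamma>_def cg_def)
    then have "of_nat p * (M x i j - M \<one> i j) \<in> I (Suc k)" using mult[OF p] by force
    from add[OF 1 this] show ?thesis by simp
  qed
  then show ?thesis using xG by (simp add: \<Gamma>_def cg_def)
qed

lemma \<Gamma>_prime_power: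
  assumes p: "of_nat p \<in> I 1" and x: "x \<in> \<Gamma> 1"
  shows "x [^] (p ^ k) \<in> \<Gamma> (Suc k)"
proof (induction k)
  case 0
  then show ?case using x by (simp add: \<Gamma>_def)
next
  case (Suc k)
  have "x \<in> carrier G" using x by (simp add: \<Gamma>_def)
  then have "x [^] (p ^ Suc k) = (x [^] (p ^ k)) [^] p"
    by (simp add: nat_pow_pow mult.commute)
  then show ?case using \<Gamma>_power[OF p Suc] by simp
qed

lemma \<Gamma>_Inter: "(\<And>k. x \<in> \<Gamma> k) \<Longrightarrow> x \<in> rep_kernel"
proof -
  assume x: "\<And>k. x \<in> \<Gamma> k"
  have "M x i j - M \<one> i j = 0" if "i < n" "j < n" for i j
    by (rule Inter) (use x that in \<open>auto simp: \<Gamma>_def cg_def\<close>)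
  then show ?thesis using x[of 0] by (auto simp: rep_kernel_def \<Gamma>_def)
qed

lemma \<Gamma>_dec: "\<Gamma> (Suc k) \<subseteq> \<Gamma> k"
  using dec unfolding \<Gamma>_def cg_def by blast

end

section \<open>Supplements for linear groups in characteristic 0\<close>

lemma (in mat_rep) rep_kernel_subgroup: "subgroup rep_kernel G"
proof (rule subgroupI)
  have M1: "M (g \<otimes> h) i j = M h i j" if "g \<in> rep_kernel" "h \<in> carrier G" "i < n" "j < n" for g h i j
  proof -
    have "M (g \<otimes> h) i j = (\<Sum>l<n. M \<one> i l * M h l j)"
      using that by (simp add: rep_kernel_def M_mult)
    also have "\<dots> = M (\<one> \<otimes> h) i j" using that by (subst M_mult) auto
    finally show ?thesis using that by simp
  qed
  show "rep_kernel \<subseteq> carrier G" by (auto simp: rep_kernel_def)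
  have "\<one> \<in> rep_kernel" by (simp add: rep_kernel_def)
  then show "rep_kernel \<noteq> {}" by blast
  show "a \<otimes> b \<in> rep_kernel" if "a \<in> rep_kernel" "b \<in> rep_kernel" for a b
    using that M1[of a b] by (auto simp: rep_kernel_def)
  show "inv a \<in> rep_kernel" if a: "a \<in> rep_kernel" for a
  proof -
    have aG: "a \<in> carrier G" using a by (simp add: rep_kernel_def)
    have "M (inv a) i j = M \<one> i j" if "i < n" "j < n" for i j
      using M1[OF a, of "inv a" i j] that aG by simp
    then show ?thesis using aG by (simp add: rep_kernel_def)
  qed
qed

text \<open>Inverses of generators are listed because a ring containing a matrix need not contain
  its inverse. \<open>ys\<close> may be longer than \<open>xs\<close>: coordinates of an eigenvector
  will also be adjoined.\<close>

lemma (in mat_rep) entries_in_adj_list: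
  assumes S: "finite S" "S \<subseteq> carrier G" "generate G S = carrier G" and B: "is_subring B"
    and xs: "set xs = insert 0 ((\<lambda>(g, i, j). M g i j) ` ((S \<union> (\<lambda>s. inv s) ` S) \<times> {..<n} \<times> {..<n}))"
    and sub: "set xs \<subseteq> set ys"
    and g: "g \<in> carrier G" and ij: "i < n" "j < n"
  shows "M g i j \<in> adj_list B ys"
proof -
  note A = is_subringD[OF adj_list_subring[OF B, of ys]]
  have gen: "M g i j \<in> adj_list B ys" if "g \<in> S \<union> (\<lambda>s. inv s) ` S" "i < n" "j < n" for g i j
  proof -
    have "M g i j \<in> set xs"
      unfolding xs by (intro insertI2 image_eqI[of _ _ "(g, i, j)"]) (use that in auto)
    then show ?thesis using subsetD[OF sub] subsetD[OF adj_list_gen[OF B, of ys]] by simp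
  qed
  have "g \<in> generate G S" using g S(3) by simp
  then have "\<forall>i<n. \<forall>j<n. M g i j \<in> adj_list B ys"
  proof induction
    case one
    then show ?case using A by (simp add: M_one)
  next
    case (eng h1 h2)
    have "h1 \<in> carrier G" "h2 \<in> carrier G" using eng(1,2) S(3) by auto
    moreover have "(\<Sum>l<n. M h1 i l * M h2 l j) \<in> adj_list B ys" if "i < n" "j < n" for i j
    proof (rule sum_closed_set)
      show "M h1 i l * M h2 l j \<in> adj_list B ys" if "l \<in> {..<n}" for l
        using A(3) eng(3,4) that \<open>i < n\<close> \<open>j < n\<close> by simp
    qed (use A(4,6) in auto)
    ultimately show ?case by (simp add: M_mult)
  qed (use gen in auto)
  then show ?thesis using ij by blast
qed

text \<open>The prime \<open>p\<close> is chosen after \<open>D\<close>. The intersection of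
  \<open>D\<close> with \<open>\<Gamma> 1\<close> has finite index, hence is not contained in the
  kernel; any of its elements outside the kernel has nontrivial \<open>p\<close>-power order modulo
  some \<open>\<Gamma> k\<close>.\<close>

lemma (in mat_rep) supplements_char_0:
  assumes ch: "CHAR('k) = 0" and fg: "finite_generating_sets G \<noteq> {}" and inf: "infinite (rcosets rep_kernel)"
  shows "has_supplements G"
  unfolding has_supplements_def
proof (intro allI impI, elim conjE)
  fix D assume D: "D \<lhd> G" "finite (rcosets D)"
  obtain S where S: "finite S" "S \<subseteq> carrier G" "generate G S = carrier G"
    using fg by (auto simp: finite_generating_sets_def)
  have "finite (insert 0 ((\<lambda>(g, i, j). M g i j) ` ((S \<union> (\<lambda>s. inv s) ` S) \<times> {..<n} \<times> {..<n})))"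
    using S(1) by auto
  from finite_list[OF this]
  obtain xs where xs: "set xs = insert 0 ((\<lambda>(g, i, j). M g i j) ` ((S \<union> (\<lambda>s. inv s) ` S) \<times> {..<n} \<times> {..<n}))"
    by (elim exE)
  have "card (rcosets D) > 0"
    using D(2) subgroup.subgroup_in_rcosets[OF normal_imp_subgroup[OF D(1)] is_group] by (auto simp: card_gt_0_iff)
  from filtration_char_0[OF ch this, of xs]
  obtain p I where p: "prime p" "\<not> p dvd card (rcosets D)" "ring_filtration (adj_list prime_ring xs) I" "of_nat p \<in> I 1"
    by (elim exE conjE)
  interpret F: ring_filtration "adj_list prime_ring xs" I by (rule p(3))
  interpret mat_filtration G M n "adj_list prime_ring xs" I
    by unfold_locales (rule entries_in_adj_list[OF S prime_ring_subring xs subset_refl])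
  have "\<not> D \<inter> \<Gamma> 1 \<subseteq> rep_kernel"
  proof
    assume "D \<inter> \<Gamma> 1 \<subseteq> rep_kernel"
    then have "finite (rcosets rep_kernel)"
      using finite_rcosets_mono[OF subgroups_Inter_pair[OF normal_imp_subgroup[OF D(1)] \<Gamma>_subgroup] rep_kernel_subgroup]
        finite_rcosets_Int[OF normal_imp_subgroup[OF D(1)] D(2) \<Gamma>_subgroup \<Gamma>_finite_index] by blast
    then show False using inf by blast
  qed
  then obtain x where x: "x \<in> D" "x \<in> \<Gamma> 1" "x \<notin> rep_kernel" by blast
  then obtain k where k: "x \<notin> \<Gamma> k" using \<Gamma>_Inter by blast
  have "x [^] (p ^ k) \<in> \<Gamma> k" using \<Gamma>_prime_power[OF p(4) x(2), of k] \<Gamma>_dec by blast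
  then show "\<exists>H M. M \<lhd> G \<and> finite (rcosets M) \<and> M \<subseteq> H \<and> subgroup H G \<and> H \<noteq> carrier G \<and>
      (\<forall>g\<in>carrier G. \<exists>d\<in>D. \<exists>h\<in>H. g = d \<otimes> h)"
    by (rule coprime_supplement[OF D p(1,2) \<Gamma>_normal \<Gamma>_finite_index x(1) _ k])
qed

section \<open>Eigenvalues and finite order\<close>

text \<open>Vectors are functions on the natural numbers with support below \<open>n\<close>; the
  cut-off keeps the product in this class.\<close>

definition mv :: "nat \<Rightarrow> (nat \<Rightarrow> nat \<Rightarrow> 'k::comm_ring_1) \<Rightarrow> (nat \<Rightarrow> 'k) \<Rightarrow> nat \<Rightarrow> 'k" where
  "mv n B w = (\<lambda>i. if i < n then \<Sum>j<n. B i j * w j else 0)"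

lemma mv_linear:
  "mv n B (\<lambda>i. v i + w i) = (\<lambda>i. mv n B v i + mv n B w i)"
  "mv n B (\<lambda>i. v i - w i) = (\<lambda>i. mv n B v i - mv n B w i)"
  "mv n B (\<lambda>i. c * w i) = (\<lambda>i. c * mv n B w i)"
  "mv n B (\<lambda>_. 0) = (\<lambda>_. 0)"
  by (auto simp: mv_def fun_eq_iff sum.distrib sum_subtractf sum_distrib_left algebra_simps intro!: sum.cong)

text \<open>The polynomial \<open>q\<close> evaluated at the matrix \<open>B\<close> and applied to
  \<open>w\<close>, by Horner's scheme, without powers of matrices.\<close>

definition papp :: "nat \<Rightarrow> (nat \<Rightarrow> nat \<Rightarrow> 'k::comm_ring_1) \<Rightarrow> 'k poly \<Rightarrow> (nat \<Rightarrow> 'k) \<Rightarrow> nat \<Rightarrow> 'k" where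
  "papp n B q w = fold_coeffs (\<lambda>a v. (\<lambda>i. a * w i + mv n B v i)) q (\<lambda>_. 0)"

lemma papp_0 [simp]: "papp n B 0 w = (\<lambda>_. 0)"
  by (simp add: papp_def)

lemma papp_pCons: "papp n B (pCons a q) w = (\<lambda>i. a * w i + mv n B (papp n B q w) i)"
  by (cases "a = 0 \<and> q = 0") (auto simp: papp_def mv_linear)

lemma papp_add: "papp n B (p + q) w = (\<lambda>i. papp n B p w i + papp n B q w i)"
  by (induction p q rule: poly_induct2) (simp_all add: papp_pCons mv_linear algebra_simps)

lemma papp_smult: "papp n B (Polynomial.smult c q) w = (\<lambda>i. c * papp n B q w i)"
  by (induction q) (simp_all add: papp_pCons mv_linear algebra_simps)

lemma papp_mult: "papp n B (p * q) w = papp n B p (papp n B q w)"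
  by (induction p) (simp_all add: papp_pCons papp_add papp_smult)

lemma papp_zero_vec: "papp n B q (\<lambda>_. 0) = (\<lambda>_. 0)"
  by (induction q) (simp_all add: papp_pCons mv_linear)

lemma papp_vec_add: "papp n B q (\<lambda>i. v i + w i) = (\<lambda>i. papp n B q v i + papp n B q w i)"
  by (induction q) (simp_all add: papp_pCons mv_linear algebra_simps)

lemma papp_vec_scale: "papp n B q (\<lambda>i. c * w i) = (\<lambda>i. c * papp n B q w i)"
  by (induction q) (simp_all add: papp_pCons mv_linear algebra_simps)

lemma papp_vec_sum: "papp n B q (\<lambda>i. \<Sum>j\<in>J. c j * w j i) = (\<lambda>i. \<Sum>j\<in>J. c j * papp n B q (w j) i)"
  by (induction J rule: infinite_finite_induct)
    (simp_all add: papp_zero_vec papp_vec_add papp_vec_scale)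

lemma papp_monom: "papp n B (Polynomial.monom c k) w = (\<lambda>i. c * (mv n B ^^ k) w i)"
  by (induction k) (simp_all add: monom_0 monom_Suc papp_pCons mv_linear)

lemma papp_sum: "papp n B (\<Sum>k\<in>K. q k) w = (\<lambda>i. \<Sum>k\<in>K. papp n B (q k) w i)"
  by (induction K rule: infinite_finite_induct) (simp_all add: papp_add)

definition supp_lt :: "nat \<Rightarrow> (nat \<Rightarrow> 'k::zero) \<Rightarrow> bool" where
  "supp_lt n w \<longleftrightarrow> (\<forall>i\<ge>n. w i = 0)"

lemma supp_mv: "supp_lt n (mv n B w)"
  by (simp add: supp_lt_def mv_def)

lemma supp_papp: "supp_lt n w \<Longrightarrow> supp_lt n (papp n B q w)"
proof (induction q)
  case (pCons a q)
  then show ?case using supp_mv[of n B] by (simp add: papp_pCons supp_lt_def)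
qed (simp add: supp_lt_def)

text \<open>The vectors obtained from \<open>w\<close> by 0 to \<open>n\<close> applications of
  \<open>B\<close> are \<open>n + 1\<close> vectors in dimension \<open>n\<close>. A zero row makes
  their matrix square, and its vanishing determinant yields a linear relation.\<close>

lemma annihilating_poly_vec:
  fixes B :: "nat \<Rightarrow> nat \<Rightarrow> 'k::field"
  assumes w: "supp_lt n w"
  shows "\<exists>q. q \<noteq> 0 \<and> papp n B q w = (\<lambda>_. 0)"
proof -
  define A where "A = mat (Suc n) (Suc n) (\<lambda>(i, k). if i < n then (mv n B ^^ k) w i else 0)"
  have A: "A \<in> carrier_mat (Suc n) (Suc n)" by (simp add: A_def)
  have "Determinant.det A = (\<Sum>j<Suc n. A $$ (n, j) * cofactor A n j)"
    by (rule laplace_expansion_row[OF A]) simp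
  also have "\<dots> = 0" by (intro sum.neutral) (simp add: A_def)
  finally obtain v where v: "v \<in> carrier_vec (Suc n)" "v \<noteq> 0\<^sub>v (Suc n)" "A *\<^sub>v v = 0\<^sub>v (Suc n)"
    using det_0_iff_vec_prod_zero[OF A] by blast
  define q where "q = (\<Sum>k<Suc n. Polynomial.monom (v $ k) k)"
  have "q \<noteq> 0"
  proof
    assume "q = 0"
    then have "v $ k = 0" if "k < Suc n" for k
      using that coeff_combination[of "\<lambda>k. v $ k" "Suc n" k] by (simp add: q_def)
    then show False using v(1,2) by (auto simp: vec_eq_iff)
  qed
  moreover have "papp n B q w i = 0" for i
  proof (cases "i < n")
    case True
    have "papp n B q w i = (\<Sum>k<Suc n. v $ k * (mv n B ^^ k) w i)"
      unfolding q_def papp_sum papp_monom ..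
    also have "\<dots> = (A *\<^sub>v v) $ i"
      using True v(1) by (simp add: A_def scalar_prod_def lessThan_atLeast0 mult.commute del: sum.op_ivl_Suc)
    also have "\<dots> = 0" using v(3) True by simp
    finally show ?thesis .
  next
    case False
    then show ?thesis using supp_papp[OF w, of B q] by (simp add: supp_lt_def)
  qed
  ultimately show ?thesis by blast
qed

text \<open>Annihilating polynomials of the unit vectors are multiplied; polynomials in one matrix
  commute, so each factor can be applied first.\<close>

lemma annihilating_poly:
  fixes B :: "nat \<Rightarrow> nat \<Rightarrow> 'k::field"
  shows "\<exists>q. q \<noteq> 0 \<and> (\<forall>w. supp_lt n w \<longrightarrow> papp n B q w = (\<lambda>_. 0))"
proof -
  define e where "e j = (\<lambda>i. if i = j then 1 else 0 :: 'k)" for j :: nat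
  have "\<forall>j. \<exists>q. j < n \<longrightarrow> q \<noteq> 0 \<and> papp n B q (e j) = (\<lambda>_. 0)"
  proof
    fix j
    show "\<exists>q. j < n \<longrightarrow> q \<noteq> 0 \<and> papp n B q (e j) = (\<lambda>_. 0)"
      using annihilating_poly_vec[of n "e j" B] by (cases "j < n") (auto simp: supp_lt_def e_def)
  qed
  then obtain q where q: "\<And>j. j < n \<Longrightarrow> q j \<noteq> 0 \<and> papp n B (q j) (e j) = (\<lambda>_. 0)" by metis
  define Q where "Q = (\<Prod>j<n. q j)"
  have Qe: "papp n B Q (e j) = (\<lambda>_. 0)" if "j < n" for j
  proof -
    have "Q = (\<Prod>i\<in>{..<n} - {j}. q i) * q j"
      unfolding Q_def using that by (subst prod.remove[of _ j]) (auto simp: mult.commute)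
    then show ?thesis using q[OF that] by (simp add: papp_mult papp_zero_vec)
  qed
  have "papp n B Q w = (\<lambda>_. 0)" if w: "supp_lt n w" for w
  proof -
    have w': "w = (\<lambda>i. \<Sum>j<n. w j * e j i)"
    proof
      fix i
      have "(\<Sum>j<n. w j * e j i) = (\<Sum>j<n. if j = i then w j else 0)"
        by (intro sum.cong) (auto simp: e_def)
      also have "\<dots> = w i" using w by (simp add: supp_lt_def)
      finally show "w i = (\<Sum>j<n. w j * e j i)" ..
    qed
    show ?thesis by (subst w', subst papp_vec_sum) (simp add: Qe)
  qed
  moreover have "Q \<noteq> 0" using q by (simp add: Q_def)
  ultimately show ?thesis by blast
qed

definition eigen :: "nat \<Rightarrow> (nat \<Rightarrow> nat \<Rightarrow> 'k::comm_ring_1) \<Rightarrow> 'k \<Rightarrow> (nat \<Rightarrow> 'k) \<Rightarrow> bool" where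
  "eigen n B a w \<longleftrightarrow> supp_lt n w \<and> w \<noteq> (\<lambda>_. 0) \<and> mv n B w = (\<lambda>i. a * w i)"

lemma annihilating_eigenvalues:
  fixes B :: "nat \<Rightarrow> nat \<Rightarrow> 'k::alg_closed_field"
  shows "\<exists>A. (\<forall>a\<in>#A. \<exists>w. eigen n B a w) \<and>
    (\<forall>w. supp_lt n w \<longrightarrow> papp n B (\<Prod>a\<in>#A. [:- a, 1:]) w = (\<lambda>_. 0))"
proof -
  have red: "\<exists>A'. (\<forall>a\<in>#A'. \<exists>w. eigen n B a w) \<and>
      (\<forall>w. supp_lt n w \<longrightarrow> papp n B (\<Prod>a\<in>#A'. [:- a, 1:]) w = (\<lambda>_. 0))"
    if "\<forall>w. supp_lt n w \<longrightarrow> papp n B (\<Prod>a\<in>#A. [:- a, 1:]) w = (\<lambda>_. 0)" for A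
    using that
  proof (induction "size A" arbitrary: A)
    case 0
    then show ?case by (intro exI[of _ A]) auto
  next
    case (Suc m)
    show ?case
    proof (cases "\<forall>a\<in>#A. \<exists>w. eigen n B a w")
      case True
      then show ?thesis using Suc.prems by blast
    next
      case False
      then obtain a where a: "a \<in># A" "\<not> (\<exists>w. eigen n B a w)" by blast
      define A1 where "A1 = A - {#a#}"
      have A1: "A = add_mset a A1" using a(1) by (simp add: A1_def)
      have "papp n B (\<Prod>a\<in>#A1. [:- a, 1:]) w = (\<lambda>_. 0)" if w: "supp_lt n w" for w
      proof -
        let ?v = "papp n B (\<Prod>a\<in>#A1. [:- a, 1:]) w"
        have "papp n B [:- a, 1:] ?v = (\<lambda>_. 0)"
          using Suc.prems w unfolding A1 by (simp add: papp_mult del: mult_pCons_left)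
        then have "(\<lambda>i. - a * ?v i + mv n B ?v i) = (\<lambda>_. 0)"
          by (simp add: papp_pCons mv_linear)
        then have "mv n B ?v i = a * ?v i" for i using fun_cong[of _ _ i] by fastforce
        then have "mv n B ?v = (\<lambda>i. a * ?v i)" by blast
        then show ?thesis using a(2) supp_papp[OF w] unfolding eigen_def by blast
      qed
      moreover have "m = size A1" using Suc.hyps(2) A1 by simp
      ultimately show ?thesis using Suc.hyps(1) by blast
    qed
  qed
  obtain q where q: "q \<noteq> 0" "\<forall>w. supp_lt n w \<longrightarrow> papp n B q w = (\<lambda>_. 0)"
    using annihilating_poly by blast
  obtain A where A: "q = Polynomial.smult (lead_coeff q) (\<Prod>x\<in>#A. [:- x, 1:])"
    using alg_closed_imp_factorization[OF q(1)] by blast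
  have "papp n B (\<Prod>x\<in>#A. [:- x, 1:]) w = (\<lambda>_. 0)" if w: "supp_lt n w" for w
  proof -
    have "papp n B (\<Prod>x\<in>#A. [:- x, 1:]) w = papp n B (Polynomial.smult (inverse (lead_coeff q)) q) w"
      by (subst (2) A) (use q(1) in simp)
    also have "\<dots> = (\<lambda>_. 0)" using q(2) w by (simp add: papp_smult)
    finally show ?thesis .
  qed
  then have "\<forall>w. supp_lt n w \<longrightarrow> papp n B (\<Prod>a\<in>#A. [:- a, 1:]) w = (\<lambda>_. 0)" by simp
  then show ?thesis by (rule red)
qed

lemma diff_power_char:
  fixes a b :: "'a::comm_ring_1"
  assumes p: "prime p" "p = CHAR('a)"
  shows "(a - b) ^ p ^ k = a ^ p ^ k - b ^ p ^ k"
proof -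
  have "((a - b) + b) ^ p ^ k = (a - b) ^ p ^ k + b ^ p ^ k"
    using p by (intro freshmans_dream') auto
  then show ?thesis by simp
qed

text \<open>Let \<open>r\<close> be a common exponent of the eigenvalues and \<open>s\<close> the
  number of factors. The annihilating product divides \<open>(X^r - 1)^s\<close>, hence also
  \<open>(X^r - 1)^(p^s)\<close>, as \<open>s < p^s\<close>; in characteristic \<open>p\<close> the
  latter is \<open>X^(r p^s) - 1\<close>.\<close>

lemma finite_order_of_eigenvalues:
  fixes B :: "nat \<Rightarrow> nat \<Rightarrow> 'k::alg_closed_field"
  assumes ch: "CHAR('k) > 0" and root: "\<And>a w. eigen n B a w \<Longrightarrow> \<exists>r>0. a ^ r = 1"
  shows "\<exists>r>0. \<forall>w. supp_lt n w \<longrightarrow> (mv n B ^^ r) w = w"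
proof -
  obtain A where A: "\<forall>a\<in>#A. \<exists>w. eigen n B a w"
    "\<forall>w. supp_lt n w \<longrightarrow> papp n B (\<Prod>a\<in>#A. [:- a, 1:]) w = (\<lambda>_. 0)"
    using annihilating_eigenvalues[of n B] by (elim exE conjE)
  have "\<forall>a\<in>#A. \<exists>r>0. a ^ r = 1" using A(1) root by blast
  then have "\<exists>r>0. \<forall>a\<in>#A. a ^ r = 1"
  proof (induction A)
    case (add a A)
    then obtain r s where "r > 0" "a ^ r = 1" "s > 0" "\<forall>b\<in>#A. b ^ s = 1" by auto
    then show ?case
      by (intro exI[of _ "r * s"]) (auto simp: power_mult, metis mult.commute power_mult power_one)
  qed auto
  then obtain r where r: "r > 0" "\<forall>a\<in>#A. a ^ r = 1" by blast
  let ?X = "Polynomial.monom 1 r - 1 :: 'k poly"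
  have "(\<Prod>a\<in>#A. [:- a, 1:]) dvd ?X ^ size A"
    using r(2)
  proof (induction A)
    case (add a A)
    have "poly ?X a = 0" using add.prems by (simp add: poly_monom)
    then have "[:- a, 1:] dvd ?X" by (simp only: poly_eq_0_iff_dvd)
    then show ?case using add by (simp add: mult_dvd_mono del: mult_pCons_left)
  qed simp
  moreover define p where "p = CHAR('k)"
  have p: "prime p" unfolding p_def using ch by (intro prime_CHAR_semidom)
  have "size A < p ^ size A" using p by (intro power_gt_expt prime_gt_Suc_0_nat)
  then have "?X ^ size A dvd ?X ^ (p ^ size A)" by (intro le_imp_power_dvd) simp
  ultimately have "(\<Prod>a\<in>#A. [:- a, 1:]) dvd ?X ^ (p ^ size A)" using dvd_trans by blast
  moreover have "?X ^ (p ^ size A) = Polynomial.monom 1 (r * p ^ size A) - 1"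
    by (subst diff_power_char[OF p]) (simp_all add: p_def monom_power)
  ultimately have "(\<Prod>a\<in>#A. [:- a, 1:]) dvd Polynomial.monom 1 (r * p ^ size A) - 1" by (simp only:)
  then obtain s where s: "Polynomial.monom 1 (r * p ^ size A) - 1 = s * (\<Prod>a\<in>#A. [:- a, 1:])"
    by (elim dvdE) (simp only: mult.commute)
  have "(mv n B ^^ (r * p ^ size A)) w = w" if w: "supp_lt n w" for w
  proof -
    have "papp n B (Polynomial.monom 1 (r * p ^ size A) + Polynomial.monom (- 1) 0) w = (\<lambda>_. 0)"
    proof -
      have "Polynomial.monom 1 (r * p ^ size A) + Polynomial.monom (- 1) 0 = s * (\<Prod>a\<in>#A. [:- a, 1:])"
        unfolding s[symmetric] by (simp add: monom_0 one_pCons)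
      then show ?thesis using A(2) w by (simp add: papp_mult papp_zero_vec)
    qed
    then show ?thesis by (auto simp: papp_add papp_monom fun_eq_iff)
  qed
  moreover have "r * p ^ size A > 0" using r(1) p by (simp add: prime_gt_0_nat)
  ultimately show ?thesis by blast
qed

section \<open>Algebraic elements over a finite ring\<close>

text \<open>Pseudo-division writes each element as \<open>poly t x / c\<close> with \<open>t\<close>
  of bounded degree over \<open>R\<close> and \<open>c\<close> in \<open>R\<close>, which leaves
  finitely many.\<close>

lemma finite_adj_algebraic:
  assumes R: "is_subring R" "finite R" and x: "\<not> trans_over R x"
  shows "finite (adj R x)"
proof -
  obtain h where h: "min_poly_over R x h" using min_poly_exists[OF x] by blast
  have hD: "h \<noteq> 0" "\<And>i. coeff h i \<in> R" "poly h x = 0" using h unfolding min_poly_over_def by blast+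
  define P where "P = (\<lambda>t. \<Sum>i<degree h. Polynomial.monom (t i) i) ` (PiE {..<degree h} (\<lambda>_. R))"
  have "finite P" unfolding P_def by (rule finite_imageI, rule finite_PiE) (simp_all add: R(2))
  moreover have "adj R x \<subseteq> (\<lambda>(t, c). poly t x / c) ` (P \<times> R)"
  proof
    fix u assume "u \<in> adj R x"
    then obtain p where p: "u = poly p x" "\<And>i. coeff p i \<in> R" by (auto simp: adj_def)
    have "\<exists>m s t. Polynomial.smult (lead_coeff h ^ m) p = h * s + t \<and> (t = 0 \<or> degree t < degree h) \<and>
      (\<forall>i. coeff s i \<in> R) \<and> (\<forall>i. coeff t i \<in> R)"
      by (rule pseudo_division[OF R(1) hD(1,2) p(2)])
    then obtain m s t where st: "Polynomial.smult (lead_coeff h ^ m) p = h * s + t" "t = 0 \<or> degree t < degree h"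
      "\<forall>i. coeff t i \<in> R" by (elim exE conjE)
    have "lead_coeff h ^ m * u = poly t x"
      using arg_cong[OF st(1), of "\<lambda>q. poly q x"] hD(3) p(1) by simp
    then have u: "u = poly t x / lead_coeff h ^ m" using hD(1) by (simp add: field_simps)
    define t' where "t' = restrict (coeff t) {..<degree h}"
    have "t' \<in> PiE {..<degree h} (\<lambda>_. R)" using st(3) by (auto simp: t'_def)
    moreover have "t = (\<Sum>i<degree h. Polynomial.monom (t' i) i)"
      by (rule poly_eqI) (use st(2) in \<open>auto simp: coeff_combination t'_def coeff_eq_0\<close>)
    ultimately have "t \<in> P" unfolding P_def by blast
    moreover have "lead_coeff h ^ m \<in> R" using is_subringD(7)[OF R(1)] hD(2) by blast
    ultimately show "u \<in> (\<lambda>(t, c). poly t x / c) ` (P \<times> R)" using u by (intro image_eqI[of _ _ "(t, lead_coeff h ^ m)"]) auto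
  qed
  ultimately show ?thesis using R(2) by (meson finite_SigmaI finite_imageI finite_subset)
qed

lemma trans_over_mono: "R \<subseteq> S \<Longrightarrow> trans_over S x \<Longrightarrow> trans_over R x"
  unfolding trans_over_def by blast

lemma finite_adj_list_algebraic:
  assumes R: "is_subring R" "finite R" and x: "\<And>x. x \<in> set xs \<Longrightarrow> \<not> trans_over R x"
  shows "finite (adj_list R xs)"
  using x
proof (induction xs)
  case (Cons x xs)
  have "\<not> trans_over (adj_list R xs) x"
    using Cons.prems[of x] trans_over_mono[OF adj_list_superset[OF R(1)]] by auto
  then show ?case using Cons finite_adj_algebraic[OF adj_list_subring[OF R(1)]] by simp
qed (simp add: R(2))

text \<open>Two powers of \<open>a\<close> coincide, because \<open>a\<close> generates a finite
  ring over the finite prime ring.\<close>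

lemma root_of_unity_algebraic:
  fixes a :: "'k::field"
  assumes "CHAR('k) > 0" "\<not> trans_over prime_ring a" "a \<noteq> 0"
  shows "\<exists>r>0. a ^ r = 1"
proof -
  have fin: "finite (adj prime_ring a)"
    by (rule finite_adj_algebraic[OF prime_ring_subring finite_prime_ring_char_p[OF assms(1)] assms(2)])
  have "range (\<lambda>i::nat. a ^ i) \<subseteq> adj prime_ring a"
    using is_subringD(7)[OF adj_subring[OF prime_ring_subring] adj_gen[OF prime_ring_subring]] by blast
  then have "\<not> inj (\<lambda>i::nat. a ^ i)"
    using fin by (meson finite_imageD finite_subset infinite_UNIV_nat)
  then obtain i l where il: "i < l" "a ^ i = a ^ l"
    unfolding inj_def by (metis linorder_neqE_nat)
  have "a ^ i * a ^ (l - i) = a ^ l" using il(1) by (simp flip: power_add)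
  then have "a ^ i * a ^ (l - i) = a ^ i * 1" using il(2) by (simp only: mult_1_right)
  then have "a ^ (l - i) = 1" using assms(3) by simp
  then show ?thesis using il(1) by (intro exI[of _ "l - i"]) simp
qed

section \<open>Linear groups in positive characteristic\<close>

text \<open>Schreier's lemma: the products of \<open>generate G T\<close> with the transversal
  \<open>R\<close> are stable under right multiplication by generators and their inverses, hence
  exhaust \<open>G\<close>.\<close>

lemma (in group) finite_index_finitely_generated:
  assumes S: "finite S" "S \<subseteq> carrier G" "generate G S = carrier G"
    and H: "subgroup H G" "finite (rcosets H)"
  shows "\<exists>T. finite T \<and> T \<subseteq> H \<and> H \<subseteq> generate G T"
proof -
  define r where "r C = (SOME x. x \<in> C)" for C :: "'a set"
  define R where "R = insert \<one> (r ` (rcosets H))"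
  have finR: "finite R" using H(2) by (simp add: R_def)
  have r: "r (H #> g) \<in> carrier G \<and> g \<otimes> inv (r (H #> g)) \<in> H" if g: "g \<in> carrier G" for g
  proof -
    have "g \<in> H #> g" by (rule rcos_self[OF g H(1)])
    then have rc: "r (H #> g) \<in> H #> g" unfolding r_def by (rule someI)
    then have rG: "r (H #> g) \<in> carrier G"
      using subgroup.elemrcos_carrier[OF H(1) is_group g] by blast
    have "g \<in> H #> r (H #> g)"
      using repr_independence[OF rc g H(1)] \<open>g \<in> H #> g\<close> by simp
    then show ?thesis using subgroup.rcos_module_imp[OF H(1) is_group rG] rG by blast
  qed
  have RG: "R \<subseteq> carrier G"
    using r by (auto simp: R_def RCOSETS_def)
  have rR: "\<exists>t\<in>R. g \<otimes> inv t \<in> H" if "g \<in> carrier G" for g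
    using r[OF that] that by (intro bexI[of _ "r (H #> g)"]) (auto simp: R_def RCOSETS_def)
  define S' where "S' = S \<union> (\<lambda>s. inv s) ` S"
  \<comment> \<open>The elements of \<open>R\<close> in \<open>H\<close> join the Schreier
    generators because the argument ends with \<open>h = u \<otimes> t\<close>, where
    \<open>t\<close> lies in both \<open>R\<close> and \<open>H\<close>.\<close>
  define T where "T = ((\<lambda>(t, s, t'). t \<otimes> s \<otimes> inv t') ` (R \<times> S' \<times> R) \<union> R) \<inter> H"
  have finT: "finite T" using finR S(1) by (simp add: T_def S'_def)
  have TG: "T \<subseteq> carrier G" using subgroup.subset[OF H(1)] by (auto simp: T_def)
  define D where "D = {u \<otimes> t | u t. u \<in> generate G T \<and> t \<in> R}"
  have S'G: "S' \<subseteq> carrier G" using S(2) by (auto simp: S'_def)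
  have step: "d \<otimes> s \<in> D" if d: "d \<in> D" and s: "s \<in> S'" for d s
  proof -
    obtain u t where u: "u \<in> generate G T" "t \<in> R" "d = u \<otimes> t" using d unfolding D_def by blast
    have tG: "t \<in> carrier G" "s \<in> carrier G" "u \<in> carrier G"
      using u RG S'G s generate_in_carrier[OF TG] by auto
    obtain t' where t': "t' \<in> R" "(t \<otimes> s) \<otimes> inv t' \<in> H" using rR[of "t \<otimes> s"] tG by auto
    have t'G: "t' \<in> carrier G" using t' RG by blast
    have "(t \<otimes> s) \<otimes> inv t' \<in> T"
      unfolding T_def using u(2) s t' by (intro IntI UnI1 image_eqI[of _ _ "(t, s, t')"]) auto
    then have "u \<otimes> (t \<otimes> s \<otimes> inv t') \<in> generate G T" by (intro generate.eng u(1) generate.incl)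
    moreover have "d \<otimes> s = (u \<otimes> (t \<otimes> s \<otimes> inv t')) \<otimes> t'"
      unfolding u(3) using tG t'G by (simp add: m_assoc)
    ultimately show ?thesis using t'(1) unfolding D_def by blast
  qed
  have DG: "D \<subseteq> carrier G"
    unfolding D_def using RG generate_in_carrier[OF TG] by blast
  have mult: "\<forall>d\<in>D. d \<otimes> g \<in> D" if "g \<in> generate G S" for g
    using that
  proof induction
    case one
    then show ?case using DG by auto
  next
    case (incl h)
    then show ?case using step by (auto simp: S'_def)
  next
    case (inv h)
    then show ?case using step by (auto simp: S'_def)
  next
    case (eng h1 h2)
    have "h1 \<in> carrier G" "h2 \<in> carrier G" using eng(1,2) S(3) by auto
    then show ?case using eng(3,4) DG by (metis m_assoc subsetD)
  qed
  have "\<one> \<in> D"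
    unfolding D_def by (rule CollectI, rule exI[of _ \<one>], rule exI[of _ \<one>]) (simp add: generate.one R_def)
  have "h \<in> generate G T" if h: "h \<in> H" for h
  proof -
    have hG: "h \<in> carrier G" using h subgroup.mem_carrier[OF H(1)] by blast
    then have "\<one> \<otimes> h \<in> D" using mult[of h] S(3) \<open>\<one> \<in> D\<close> by blast
    then obtain u t where u: "u \<in> generate G T" "t \<in> R" "h = u \<otimes> t" using hG unfolding D_def by auto
    have "generate G T \<subseteq> H"
      by (rule generate_subgroup_incl[OF _ H(1)]) (auto simp: T_def)
    then have uH: "u \<in> H" using u(1) by blast
    have uG: "u \<in> carrier G" "t \<in> carrier G" using uH subgroup.mem_carrier[OF H(1)] u(2) RG by auto
    have "inv u \<otimes> h \<in> H" by (intro subgroup.m_closed[OF H(1)] subgroup.m_inv_closed[OF H(1)] uH h)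
    moreover have "inv u \<otimes> h = t" unfolding u(3) using uG by (simp add: inv_cancel)
    ultimately have "t \<in> T" using u(2) by (simp add: T_def)
    then show ?thesis unfolding u(3) by (intro generate.eng u(1) generate.incl)
  qed
  then show ?thesis using finT by (intro exI[of _ T]) (auto simp: T_def)
qed

text \<open>Counting in the finite group \<open>W / V\<close>: translation by \<open>w0\<close> has
  order \<open>p\<close> and no fixed point, so \<open>p\<close> divides the number of classes,
  hence also the number of classes fixed by \<open>K\<close>. The zero class is fixed, so there is
  another one. No vector space over a residue field is formed.\<close>

lemma p_group_fixed_vector:
  fixes L :: "'g \<Rightarrow> (nat \<Rightarrow> 'k::comm_ring_1) \<Rightarrow> nat \<Rightarrow> 'k" and K (structure)
  assumes K: "group K" and p: "prime p" "of_nat p = (0 :: 'k)"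
    and W: "(\<lambda>_. 0) \<in> W" "\<And>v w. v \<in> W \<Longrightarrow> w \<in> W \<Longrightarrow> (\<lambda>i. v i - w i) \<in> W"
    and V: "V \<subseteq> W" "(\<lambda>_. 0) \<in> V" "\<And>v w. v \<in> V \<Longrightarrow> w \<in> V \<Longrightarrow> (\<lambda>i. v i - w i) \<in> V"
    and LW: "\<And>g w. g \<in> carrier K \<Longrightarrow> w \<in> W \<Longrightarrow> L g w \<in> W"
    and LV: "\<And>g w. g \<in> carrier K \<Longrightarrow> w \<in> V \<Longrightarrow> L g w \<in> V"
    and Ld: "\<And>g v w. L g (\<lambda>i. v i - w i) = (\<lambda>i. L g v i - L g w i)"
    and Lm: "\<And>g h w. g \<in> carrier K \<Longrightarrow> h \<in> carrier K \<Longrightarrow> w \<in> W \<Longrightarrow> L (g \<otimes> h) w = L g (L h w)"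
    and L1: "\<And>w. w \<in> W \<Longrightarrow> L \<one> w = w"
    and fin: "finite T" "\<And>w. w \<in> W \<Longrightarrow> \<exists>t\<in>T. (\<lambda>i. w i - t i) \<in> V"
    and pw: "\<And>g. g \<in> carrier K \<Longrightarrow> \<exists>k. \<forall>w\<in>W. L (g [^] (p ^ k)) w = w"
    and w0: "w0 \<in> W" "w0 \<notin> V"
  shows "\<exists>u\<in>W. u \<notin> V \<and> (\<forall>g\<in>carrier K. (\<lambda>i. L g u i - u i) \<in> V)"
proof -
  define E where "E v w \<longleftrightarrow> (\<lambda>i. v i - w i) \<in> V" for v w
  have Erefl: "E v v" for v using V(2) by (simp add: E_def)
  have Etrans: "E u w" if "E u v" "E v w" for u v w
  proof -
    have "(\<lambda>i. 0 - (v i - w i)) \<in> V" using V(3)[OF V(2)] that(2) unfolding E_def by blast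
    from V(3)[OF that(1)[unfolded E_def] this] show ?thesis by (simp add: E_def)
  qed
  have Esym: "E w v" if "E v w" for v w
    using V(3)[OF V(2) that[unfolded E_def]] by (simp add: E_def)
  \<comment> \<open>One representative per class turns the quotient into a finite set
    \<open>Y\<close> of vectors.\<close>
  define rep where "rep v = (SOME u. u \<in> W \<and> E u v)" for v
  have rep: "rep v \<in> W" "E (rep v) v" if "v \<in> W" for v
  proof -
    have "rep v \<in> W \<and> E (rep v) v" unfolding rep_def by (rule someI[where x = v]) (simp add: that Erefl)
    then show "rep v \<in> W" "E (rep v) v" by simp_all
  qed
  have rep_eq: "rep v = rep w" if "E v w" for v w
  proof -
    have "E u v \<longleftrightarrow> E u w" for u using Etrans Esym that by metis
    then show ?thesis by (simp add: rep_def)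
  qed
  define Y where "Y = rep ` W"
  have YW: "x \<in> W" "rep x = x" if "x \<in> Y" for x
    using that rep rep_eq unfolding Y_def by auto
  have finY: "finite Y"
  proof -
    have "Y \<subseteq> (\<lambda>t. SOME u. u \<in> W \<and> E u t) ` T"
    proof
      fix x assume "x \<in> Y"
      then obtain w where w: "w \<in> W" "x = rep w" unfolding Y_def by blast
      obtain t where t: "t \<in> T" "(\<lambda>i. w i - t i) \<in> V" using fin(2)[OF w(1)] by (elim bexE)
      have "x = rep t" using rep_eq[of w t] t(2) w(2) by (simp add: E_def)
      then show "x \<in> (\<lambda>t. SOME u. u \<in> W \<and> E u t) ` T" using t(1) unfolding rep_def by (rule image_eqI)
    qed
    then show ?thesis using fin(1) finite_subset by blast
  qed
  have EL: "E (L g v) (L g w)" if "g \<in> carrier K" "E v w" for g v w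
    using LV[OF that(1) that(2)[unfolded E_def]] by (simp add: E_def Ld)
  have Wadd: "(\<lambda>i. v i + w i) \<in> W" if "v \<in> W" "w \<in> W" for v w
    using W(2)[OF that(1) W(2)[OF W(1) that(2)]] by simp
  have Wint: "(\<lambda>i. of_int k * w i) \<in> W" if w: "w \<in> W" for k :: int and w
  proof (induction k rule: int_induct[where k = 0])
    case base
    then show ?case using W(1) by simp
  next
    case (step1 k)
    then show ?case using Wadd[OF step1(2) w] by (simp add: algebra_simps)
  next
    case (step2 k)
    then show ?case using W(2)[OF step2(2) w] by (simp add: algebra_simps)
  qed
  \<comment> \<open>The integers act through residues modulo \<open>p\<close>, as \<open>p\<close>
    is 0 in the ring of scalars.\<close>
  have cong0: "[card Y = card {x \<in> Y. \<forall>k\<in>carrier integer_group. rep (\<lambda>i. x i + of_int k * w0 i) = x}] (mod p)"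
  proof (rule fixed_points_cong[OF group_integer_group finY p(1)])
    show "rep (\<lambda>i. x i + of_int k * w0 i) \<in> Y" if "x \<in> Y" for k x
      unfolding Y_def using Wadd[OF YW(1)[OF that] Wint[OF w0(1)]] by (rule imageI)
    show "rep (\<lambda>i. x i + of_int (k \<otimes>\<^bsub>integer_group\<^esub> l) * w0 i)
        = rep (\<lambda>i. rep (\<lambda>i. x i + of_int l * w0 i) i + of_int k * w0 i)" if "x \<in> Y" for k l x
    proof (rule rep_eq)
      have "E (rep (\<lambda>i. x i + of_int l * w0 i)) (\<lambda>i. x i + of_int l * w0 i)"
        by (rule rep(2)[OF Wadd[OF YW(1)[OF that] Wint[OF w0(1)]]])
      then show "E (\<lambda>i. x i + of_int (k \<otimes>\<^bsub>integer_group\<^esub> l) * w0 i)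
          (\<lambda>i. rep (\<lambda>i. x i + of_int l * w0 i) i + of_int k * w0 i)"
        using Esym unfolding E_def by (simp add: algebra_simps)
    qed
    show "rep (\<lambda>i. x i + of_int \<one>\<^bsub>integer_group\<^esub> * w0 i) = x" if "x \<in> Y" for x
      using YW(2)[OF that] by simp
    show "\<exists>k. \<forall>x\<in>Y. rep (\<lambda>i. x i + of_int (l [^]\<^bsub>integer_group\<^esub> (p ^ k)) * w0 i) = x" for l
      using YW(2) p(2) by (intro exI[of _ 1]) simp
  qed
  have empty: "{x \<in> Y. \<forall>k\<in>carrier integer_group. rep (\<lambda>i. x i + of_int k * w0 i) = x} = {}"
  proof -
    have False if x: "x \<in> Y" "rep (\<lambda>i. x i + of_int 1 * w0 i) = x" for x
    proof -
      have "E x (\<lambda>i. x i + of_int 1 * w0 i)"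
        using rep(2)[OF Wadd[OF YW(1)[OF x(1)] Wint[OF w0(1), of 1]]] x(2) by simp
      then have "E (\<lambda>i. x i + of_int 1 * w0 i) x" by (rule Esym)
      then show False using w0(2) by (simp add: E_def)
    qed
    then show ?thesis by fastforce
  qed
  have c0: "[card Y = 0] (mod p)" using cong0 unfolding empty card.empty .
  have "[card Y = card {x \<in> Y. \<forall>g\<in>carrier K. rep (L g x) = x}] (mod p)"
  proof (rule fixed_points_cong[OF K finY p(1)])
    show "rep (L g x) \<in> Y" if "g \<in> carrier K" "x \<in> Y" for g x
      unfolding Y_def by (rule imageI[OF LW[OF that(1) YW(1)[OF that(2)]]])
    show "rep (L (g \<otimes> h) x) = rep (L g (rep (L h x)))" if "g \<in> carrier K" "h \<in> carrier K" "x \<in> Y" for g h x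
    proof (rule rep_eq)
      have "E (L g (rep (L h x))) (L g (L h x))"
        by (rule EL[OF that(1) rep(2)[OF LW[OF that(2) YW(1)[OF that(3)]]]])
      then show "E (L (g \<otimes> h) x) (L g (rep (L h x)))"
        unfolding Lm[OF that(1,2) YW(1)[OF that(3)]] by (rule Esym)
    qed
    show "rep (L \<one> x) = x" if "x \<in> Y" for x
      using YW[OF that] L1 by simp
    show "\<exists>k. \<forall>x\<in>Y. rep (L (g [^] (p ^ k)) x) = x" if "g \<in> carrier K" for g
    proof -
      from pw[OF \<open>g \<in> carrier K\<close>] obtain k where "\<forall>w\<in>W. L (g [^] (p ^ k)) w = w" by (elim exE)
      then show ?thesis using YW by (intro exI[of _ k]) simp
    qed
  qed
  then have c1: "p dvd card {x \<in> Y. \<forall>g\<in>carrier K. rep (L g x) = x}"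
    using c0 by (meson cong_0_iff cong_sym cong_trans)
  let ?F = "{x \<in> Y. \<forall>g\<in>carrier K. rep (L g x) = x}"
  have L0: "L g (\<lambda>_. 0) = (\<lambda>_. 0)" for g using Ld[of g "\<lambda>_. 0" "\<lambda>_. 0"] by simp
  have z: "rep (\<lambda>_. 0) \<in> ?F"
  proof -
    have "rep (L g (rep (\<lambda>_. 0))) = rep (\<lambda>_. 0)" if "g \<in> carrier K" for g
    proof (rule rep_eq)
      show "E (L g (rep (\<lambda>_. 0))) (\<lambda>_. 0)" using EL[OF that rep(2)[OF W(1)]] by (simp add: L0)
    qed
    then show ?thesis using W(1) by (simp add: Y_def)
  qed
  have "?F \<noteq> {rep (\<lambda>_. 0)}"
  proof
    assume "?F = {rep (\<lambda>_. 0)}"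
    then have "p dvd 1" using c1 by simp
    then show False using p(1) by simp
  qed
  then obtain u where u: "u \<in> ?F" "u \<noteq> rep (\<lambda>_. 0)" using z by blast
  have uY: "u \<in> Y" and uF: "\<And>g. g \<in> carrier K \<Longrightarrow> rep (L g u) = u" using u(1) by auto
  have "u \<notin> V"
  proof
    assume "u \<in> V"
    then have "E u (\<lambda>_. 0)" by (simp add: E_def)
    then show False using rep_eq YW(2)[OF uY] u(2) by metis
  qed
  moreover have "(\<lambda>i. L g u i - u i) \<in> V" if "g \<in> carrier K" for g
    using Esym[OF rep(2)[OF LW[OF that YW(1)[OF uY]]]] uF[OF that] by (simp add: E_def)
  ultimately show ?thesis using YW(1)[OF uY] by blast
qed

definition ideal_of :: "'k::comm_ring_1 set \<Rightarrow> 'k set \<Rightarrow> bool" where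
  "ideal_of R J \<longleftrightarrow> J \<subseteq> R \<and> 0 \<in> J \<and> (\<forall>a\<in>J. \<forall>b\<in>J. a - b \<in> J) \<and> (\<forall>a\<in>R. \<forall>b\<in>J. a * b \<in> J)"

lemma ideal_ofD:
  assumes "ideal_of R J"
  shows "J \<subseteq> R" "0 \<in> J" "a \<in> J \<Longrightarrow> b \<in> J \<Longrightarrow> a - b \<in> J" "c \<in> R \<Longrightarrow> b \<in> J \<Longrightarrow> c * b \<in> J"
    "a \<in> J \<Longrightarrow> b \<in> J \<Longrightarrow> a + b \<in> J"
proof -
  show 1: "J \<subseteq> R" "0 \<in> J" "\<And>a b. a \<in> J \<Longrightarrow> b \<in> J \<Longrightarrow> a - b \<in> J" "c \<in> R \<Longrightarrow> b \<in> J \<Longrightarrow> c * b \<in> J"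
    using assms by (auto simp: ideal_of_def)
  show "a \<in> J \<Longrightarrow> b \<in> J \<Longrightarrow> a + b \<in> J" using 1(3)[of a "0 - b"] 1(3)[OF 1(2), of b] by simp
qed

text \<open>An ideal containing \<open>I 1\<close> is determined by the elements of the finite set
  \<open>T\<close> in it, so there are finitely many and a maximal one exists. The condition on
  inverses says that the residue ring is a field, without forming it.\<close>

lemma (in ring_filtration) maximal_ideal_exists:
  "\<exists>m. ideal_of R m \<and> I 1 \<subseteq> m \<and> 1 \<notin> m \<and> (\<forall>a\<in>R. a \<notin> m \<longrightarrow> (\<exists>d\<in>R. a * d - 1 \<in> m))"
proof -
  define C where "C = {J. ideal_of R J \<and> I 1 \<subseteq> J \<and> 1 \<notin> J}"
  obtain T where T: "finite T" "\<forall>a\<in>R. \<exists>t\<in>T. a - t \<in> I 1" using finite_index by blast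
  have "inj_on (\<lambda>J. J \<inter> T) C"
  proof (rule inj_onI)
    have sub: "J \<subseteq> J'" if J: "J \<in> C" "J' \<in> C" "J \<inter> T = J' \<inter> T" for J J'
    proof
      fix a assume a: "a \<in> J"
      have i: "ideal_of R J" "ideal_of R J'" "I 1 \<subseteq> J" "I 1 \<subseteq> J'" using J by (auto simp: C_def)
      have "a \<in> R" using a ideal_ofD(1)[OF i(1)] by blast
      then obtain t where t: "t \<in> T" "a - t \<in> I 1" using T(2) by blast
      have "a - (a - t) \<in> J" using ideal_ofD(3)[OF i(1) a] t(2) i(3) by blast
      then have "t \<in> J'" using J(3) t(1) by auto
      then have "t + (a - t) \<in> J'" using ideal_ofD(5)[OF i(2)] t(2) i(4) by blast
      then show "a \<in> J'" by simp
    qed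
    then show "J = J'" if "J \<in> C" "J' \<in> C" "J \<inter> T = J' \<inter> T" for J J'
      using that sub[OF that(1,2,3)] sub[OF that(2,1)] by auto
  qed
  moreover have "(\<lambda>J. J \<inter> T) ` C \<subseteq> Pow T" by blast
  ultimately have finC: "finite C" using T(1) by (meson finite_Pow_iff finite_imageD finite_subset)
  have "I 1 \<in> C"
    using zero diff multR(1) IR one_notin by (auto simp: C_def ideal_of_def)
  then obtain m where m: "m \<in> C" "\<And>J. J \<in> C \<Longrightarrow> m \<subseteq> J \<Longrightarrow> J = m"
    using finite_has_maximal[OF finC] by (metis empty_iff)
  have i: "ideal_of R m" "I 1 \<subseteq> m" "1 \<notin> m" using m(1) by (auto simp: C_def)
  have "\<exists>d\<in>R. a * d - 1 \<in> m" if a: "a \<in> R" "a \<notin> m" for a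
  proof -
    define J where "J = {x + a * d | x d. x \<in> m \<and> d \<in> R}"
    have JI: "x + a * d \<in> J" if "x \<in> m" "d \<in> R" for x d using that unfolding J_def by blast
    have mJ: "m \<subseteq> J" using JI[of _ 0] is_subringD(4)[OF sub] by auto
    have "a \<in> J" using JI[of 0 1] ideal_ofD(2)[OF i(1)] is_subringD(1)[OF sub] by simp
    have "ideal_of R J" unfolding ideal_of_def
    proof (intro conjI ballI)
      show "J \<subseteq> R" unfolding J_def using ideal_ofD(1)[OF i(1)] is_subringD(3,6)[OF sub] a(1) by blast
      show "0 \<in> J" using mJ ideal_ofD(2)[OF i(1)] by blast
      show "u - v \<in> J" if uv: "u \<in> J" "v \<in> J" for u v
      proof -
        obtain x d y e where *: "u = x + a * d" "x \<in> m" "d \<in> R" "v = y + a * e" "y \<in> m" "e \<in> R"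
          using uv unfolding J_def by blast
        have "(x - y) + a * (d - e) \<in> J"
          by (rule JI[OF ideal_ofD(3)[OF i(1) *(2,5)] is_subringD(2)[OF sub *(3,6)]])
        then show ?thesis unfolding * by (simp add: algebra_simps)
      qed
      show "c * u \<in> J" if cu: "c \<in> R" "u \<in> J" for c u
      proof -
        obtain x d where *: "u = x + a * d" "x \<in> m" "d \<in> R" using cu unfolding J_def by blast
        have "c * x + a * (c * d) \<in> J"
          by (rule JI[OF ideal_ofD(4)[OF i(1) cu(1) *(2)] is_subringD(3)[OF sub cu(1) *(3)]])
        then show ?thesis unfolding * by (simp add: algebra_simps)
      qed
    qed
    have "1 \<in> J"
    proof (rule ccontr)
      assume "1 \<notin> J"
      then have "J \<in> C" using \<open>ideal_of R J\<close> mJ i(2) by (auto simp: C_def)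
      then have "J = m" using m(2) mJ by blast
      then show False using \<open>a \<in> J\<close> a(2) by simp
    qed
    then obtain x d where *: "1 = x + a * d" "x \<in> m" "d \<in> R" unfolding J_def by blast
    have "0 - x \<in> m" by (rule ideal_ofD(3)[OF i(1) ideal_ofD(2)[OF i(1)] *(2)])
    moreover have "0 - x = a * d - 1" using *(1) by (simp add: algebra_simps)
    ultimately show ?thesis using *(3) by auto
  qed
  then show ?thesis using i by blast
qed

lemma (in group) subgroup_nat_pow:
  assumes H: "subgroup H G" and x: "x \<in> H" shows "x [^] (k::nat) \<in> H"
proof (induction k)
  case 0
  then show ?case using subgroup.one_closed[OF H] by simp
next
  case (Suc k)
  then show ?case using subgroup.m_closed[OF H Suc x] by simp
qed

lemma (in group) coprime_powers_mem:
  assumes H: "subgroup H G" and y: "y \<in> carrier G" and r: "y [^] (r::nat) \<in> H" and s: "y [^] (s::nat) \<in> H"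
    and rs: "coprime r s"
  shows "y \<in> H"
proof (cases "s = 1")
  case True
  then show ?thesis using s y by simp
next
  case False
  then obtain u v where uv: "r * u = s * v + 1" using coprime_bezout_strong[OF rs] by blast
  have 1: "y [^] (r * u) \<in> H" "y [^] (s * v) \<in> H"
    using subgroup.m_closed[OF H] subgroup_nat_pow[OF H r, of u] subgroup_nat_pow[OF H s, of v] y
    by (simp_all add: nat_pow_pow)
  have "y [^] (r * u) = y [^] (s * v) \<otimes> y" unfolding uv using y by simp
  then have "y = inv (y [^] (s * v)) \<otimes> y [^] (r * u)" using y by (simp add: inv_cancel)
  also have "\<dots> \<in> H" using 1 subgroup.m_closed[OF H] subgroup.m_inv_closed[OF H] by blast
  finally show ?thesis .
qed

section \<open>The representation on vectors and its kernel\<close>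

context mat_rep
begin

lemma mv_mult:
  assumes "g \<in> carrier G" "h \<in> carrier G"
  shows "mv n (M (g \<otimes> h)) w = mv n (M g) (mv n (M h) w)"
proof
  fix i
  have "(\<Sum>j<n. (\<Sum>l<n. M g i l * M h l j) * w j) = (\<Sum>l<n. M g i l * (\<Sum>j<n. M h l j * w j))"
    unfolding sum_distrib_left sum_distrib_right by (subst sum.swap) (simp add: mult.assoc)
  then show "mv n (M (g \<otimes> h)) w i = mv n (M g) (mv n (M h) w) i"
    using assms by (simp add: mv_def M_mult)
qed

lemma mv_one: "supp_lt n w \<Longrightarrow> mv n (M \<one>) w = w"
proof
  fix i assume w: "supp_lt n w"
  have "(\<Sum>j<n. M \<one> i j * w j) = (\<Sum>j<n. if j = i then w j else 0)" if "i < n"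
    using that by (intro sum.cong) (auto simp: M_one)
  then show "mv n (M \<one>) w i = w i" using w by (simp add: mv_def supp_lt_def)
qed

lemma mv_pow:
  assumes "g \<in> carrier G" "supp_lt n w"
  shows "mv n (M (g [^] (k::nat))) w = (mv n (M g) ^^ k) w"
  using assms(2)
proof (induction k arbitrary: w)
  case (Suc k)
  have "mv n (M (g [^] Suc k)) w = mv n (M (g [^] k)) (mv n (M g) w)" using assms(1) by (simp add: mv_mult)
  also have "\<dots> = (mv n (M g) ^^ k) (mv n (M g) w)" by (rule Suc.IH[OF supp_mv])
  finally show ?case by (simp add: funpow_swap1)
qed (simp add: mv_one)

lemma mv_eigen_pow:
  assumes "g \<in> carrier G" "eigen n (M g) a w"
  shows "mv n (M (g [^] (k::nat))) w = (\<lambda>i. a ^ k * w i)"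
proof -
  have "(mv n (M g) ^^ k) w = (\<lambda>i. a ^ k * w i)"
    using assms(2) by (induction k) (auto simp: eigen_def mv_linear mult.assoc mult.left_commute)
  then show ?thesis using assms mv_pow by (simp add: eigen_def)
qed

lemma eigenvalue_nonzero:
  assumes "g \<in> carrier G" "eigen n (M g) a w"
  shows "a \<noteq> 0"
proof
  assume "a = 0"
  then have "mv n (M g) w = (\<lambda>_. 0)" using assms(2) by (simp add: eigen_def)
  moreover have "mv n (M (inv g)) (mv n (M g) w) = w"
    using assms mv_mult[of "inv g" g w] by (simp add: mv_one eigen_def)
  ultimately show False using assms(2) by (simp add: mv_linear eigen_def)
qed

abbreviation unit_vec :: "nat \<Rightarrow> nat \<Rightarrow> 'k" where
  "unit_vec j \<equiv> (\<lambda>i. if i = j then 1 else 0)"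

lemma supp_unit_vec: "j < n \<Longrightarrow> supp_lt n (unit_vec j)"
  by (auto simp: supp_lt_def)

lemma mv_unit_vec:
  assumes "i < n" "j < n" shows "mv n (M g) (unit_vec j) i = M g i j"
proof -
  have "(\<Sum>l<n. M g i l * unit_vec j l) = (\<Sum>l<n. if l = j then M g i l else 0)" by (intro sum.cong) auto
  then show ?thesis using assms by (simp add: mv_def)
qed

lemma mem_rep_kernel:
  "g \<in> rep_kernel \<longleftrightarrow> g \<in> carrier G \<and> (\<forall>w. supp_lt n w \<longrightarrow> mv n (M g) w = w)"
proof
  assume g: "g \<in> rep_kernel"
  have "mv n (M g) w = mv n (M \<one>) w" for w
    using g by (intro ext) (simp add: mv_def rep_kernel_def)
  then show "g \<in> carrier G \<and> (\<forall>w. supp_lt n w \<longrightarrow> mv n (M g) w = w)"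
    using g mv_one by (simp add: rep_kernel_def)
next
  assume g: "g \<in> carrier G \<and> (\<forall>w. supp_lt n w \<longrightarrow> mv n (M g) w = w)"
  have "M g i j = M \<one> i j" if "i < n" "j < n" for i j
    using g mv_unit_vec[OF that, of g] supp_unit_vec[OF that(2)] that by (simp add: M_one)
  then show "g \<in> rep_kernel" using g by (simp add: rep_kernel_def)
qed

text \<open>Extensional outside the index square, so that finiteness of the image group becomes
  finiteness of a set of functions.\<close>

definition mat_of :: "'a \<Rightarrow> nat \<times> nat \<Rightarrow> 'k" where
  "mat_of g = (\<lambda>x\<in>{..<n} \<times> {..<n}. M g (fst x) (snd x))"

lemma mat_of_eq:
  assumes "mat_of g = mat_of h" "i < n" "j < n" shows "M g i j = M h i j"
  using fun_cong[OF assms(1), of "(i, j)"] assms(2,3) by (simp add: mat_of_def)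

lemma finite_rcosets_rep_kernel:
  assumes fin: "finite (mat_of ` carrier G)"
  shows "finite (rcosets rep_kernel)"
proof -
  have eq: "rep_kernel #> g = rep_kernel #> h"
    if g: "g \<in> carrier G" "h \<in> carrier G" and F: "mat_of g = mat_of h" for g h
  proof -
    have "M (g \<otimes> inv h) i j = M (h \<otimes> inv h) i j" if "i < n" "j < n" for i j
    proof -
      have "(\<Sum>l<n. M g i l * M (inv h) l j) = (\<Sum>l<n. M h i l * M (inv h) l j)"
        using mat_of_eq[OF F \<open>i < n\<close>] by (intro sum.cong) auto
      then show ?thesis using g that by (simp only: M_mult inv_closed)
    qed
    then have "g \<otimes> inv h \<in> rep_kernel" using g by (simp add: rep_kernel_def)
    then have "g \<in> rep_kernel #> h"
      using subgroup.rcos_module_rev[OF rep_kernel_subgroup is_group g(2,1)] by blast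
    then show ?thesis using repr_independence[OF _ g(2) rep_kernel_subgroup] by simp
  qed
  have "rcosets rep_kernel \<subseteq> (\<lambda>\<phi>. rep_kernel #> (SOME g. g \<in> carrier G \<and> mat_of g = \<phi>)) ` (mat_of ` carrier G)"
  proof
    fix C assume "C \<in> rcosets rep_kernel"
    then obtain g where g: "g \<in> carrier G" "C = rep_kernel #> g" by (auto simp: RCOSETS_def)
    let ?h = "SOME h. h \<in> carrier G \<and> mat_of h = mat_of g"
    have "?h \<in> carrier G \<and> mat_of ?h = mat_of g" by (rule someI[where x = g]) (simp add: g(1))
    then have "C = rep_kernel #> ?h" using eq g by metis
    then show "C \<in> (\<lambda>\<phi>. rep_kernel #> (SOME g. g \<in> carrier G \<and> mat_of g = \<phi>)) ` (mat_of ` carrier G)"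
      using g(1) by blast
  qed
  then show ?thesis using fin finite_subset by blast
qed

lemma finite_rcosets_rep_kernel_subgroup:
  assumes E: "subgroup E G" "finite (rcosets E)" and fin: "finite (mat_of ` E)"
  shows "finite (rcosets rep_kernel)"
proof (rule finite_rcosets_rep_kernel)
  define r where "r C = (SOME x. x \<in> C)" for C :: "'a set"
  define P where "P f h = (\<lambda>x\<in>{..<n} \<times> {..<n}. \<Sum>l<n. f (fst x, l) * M h l (snd x))" for f h
  have "mat_of ` carrier G \<subseteq> (\<lambda>(f, C). P f (r C)) ` ((mat_of ` E) \<times> (rcosets E))"
  proof (rule image_subsetI)
    fix g assume g: "g \<in> carrier G"
    have "g \<in> E #> g" by (rule rcos_self[OF g E(1)])
    then have rc: "r (E #> g) \<in> E #> g" unfolding r_def by (rule someI)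
    then have rG: "r (E #> g) \<in> carrier G"
      using subgroup.elemrcos_carrier[OF E(1) is_group g] by blast
    have "g \<in> E #> r (E #> g)"
      using repr_independence[OF rc g E(1)] \<open>g \<in> E #> g\<close> by simp
    then obtain e where e: "e \<in> E" "g = e \<otimes> r (E #> g)" unfolding r_coset_def by blast
    have eG: "e \<in> carrier G" using e(1) subgroup.mem_carrier[OF E(1)] by blast
    have "mat_of (e \<otimes> r (E #> g)) = P (mat_of e) (r (E #> g))"
      unfolding mat_of_def P_def using eG rG by (intro restrict_ext) (auto simp: M_mult)
    then have "mat_of g = (\<lambda>(f, C). P f (r C)) (mat_of e, E #> g)" using e(2) by simp
    moreover have "E #> g \<in> rcosets E" using g by (auto simp: RCOSETS_def)
    ultimately show "mat_of g \<in> (\<lambda>(f, C). P f (r C)) ` ((mat_of ` E) \<times> (rcosets E))"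
      using e(1) by (intro image_eqI[of _ _ "(mat_of e, E #> g)"]) auto
  qed
  then show "finite (mat_of ` carrier G)" using fin E(2) finite_subset by blast
qed

end

section \<open>Elements with a transcendental eigenvalue\<close>

text \<open>The filtration makes \<open>a\<close> a root of unity of prime order \<open>l\<close>
  modulo \<open>I 1\<close>, with \<open>l\<close> prime to the index of \<open>D\<close> and to the
  characteristic. Then \<open>l\<close> divides the order of \<open>x\<close> modulo
  \<open>\<Gamma> 1\<close>, and a power of \<open>x\<close> is nontrivial of \<open>l\<close>-power
  order there.\<close>

lemma supplement_of_transcendental_eigenvalue:
  fixes G (structure) and M :: "'a \<Rightarrow> nat \<Rightarrow> nat \<Rightarrow> 'k::alg_closed_field"
  assumes "mat_rep G M n" and ch: "CHAR('k) > 0" and fg: "finite_generating_sets G \<noteq> {}"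
    and D: "D \<lhd> G" "finite (rcosets D)" and x: "x \<in> D" and w: "eigen n (M x) a w" and a: "trans_over prime_ring a"
  shows "\<exists>H M. M \<lhd> G \<and> finite (rcosets M) \<and> M \<subseteq> H \<and> subgroup H G \<and> H \<noteq> carrier G \<and>
      (\<forall>g\<in>carrier G. \<exists>d\<in>D. \<exists>h\<in>H. g = d \<otimes> h)"
proof -
  interpret mat_rep G M n by fact
  let ?p = "CHAR('k)"
  obtain S where S: "finite S" "S \<subseteq> carrier G" "generate G S = carrier G"
    using fg by (auto simp: finite_generating_sets_def)
  have "finite (insert 0 ((\<lambda>(g, i, j). M g i j) ` ((S \<union> (\<lambda>s. inv s) ` S) \<times> {..<n} \<times> {..<n})))"
    using S(1) by auto
  from finite_list[OF this]
  obtain xs where xs: "set xs = insert 0 ((\<lambda>(g, i, j). M g i j) ` ((S \<union> (\<lambda>s. inv s) ` S) \<times> {..<n} \<times> {..<n}))"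
    by (elim exE)
  obtain i0 where i0: "w i0 \<noteq> 0" using w by (auto simp: eigen_def)
  then have i0n: "i0 < n" using w by (auto simp: eigen_def supp_lt_def not_le[symmetric])
  \<comment> \<open>The eigenvector is scaled to have a coordinate 1 and its coordinates are
    adjoined to the ring; then \<open>x [^] e \<in> \<Gamma> 1\<close> implies that
    \<open>a ^ e\<close> is 1 modulo \<open>I 1\<close>.\<close>
  define v where "v = (\<lambda>i. (1 / w i0) * w i)"
  have v: "eigen n (M x) a v" "v i0 = 1"
    using w i0 unfolding v_def eigen_def mv_linear by (auto simp: supp_lt_def fun_eq_iff)
  define ys where "ys = xs @ map v [0..<n]"
  let ?B = "adj prime_ring a"
  let ?A = "adj_list ?B ys"
  have B: "is_subring ?B" by (rule adj_subring[OF prime_ring_subring])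
  note A = is_subringD[OF adj_list_subring[OF B, of ys]]
  have aA: "a \<in> ?A" using adj_list_superset[OF B, of ys] adj_gen[OF prime_ring_subring, of a] by blast
  have vA: "v i \<in> ?A" if "i < n" for i
  proof -
    have "v i \<in> set ys" using that by (auto simp: ys_def)
    then show ?thesis using adj_list_gen[OF B, of ys] by blast
  qed
  have "card (rcosets D) > 0"
    using D(2) subgroup.subgroup_in_rcosets[OF normal_imp_subgroup[OF D(1)] is_group] by (auto simp: card_gt_0_iff)
  \<comment> \<open>The factor \<open>?p\<close> keeps \<open>l\<close> different from the
    characteristic.\<close>
  then have N: "card (rcosets D) * ?p > 0" using ch by simp
  from filtration_char_p[OF ch a N A(1) one_neq_zero]
  obtain l I where l: "prime l" "\<not> l dvd card (rcosets D) * ?p" "ring_filtration ?A I" "(\<Sum>i<l. a ^ i) \<in> I 1"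
    by (elim exE conjE)
  interpret F: ring_filtration ?A I by (rule l(3))
  have xsys: "set xs \<subseteq> set ys" by (simp add: ys_def)
  interpret mat_filtration G M n ?A I
    by unfold_locales (rule entries_in_adj_list[OF S B xs xsys])
  have xG: "x \<in> carrier G" using x normal_imp_subgroup[OF D(1)] by (simp add: subgroup.mem_carrier)
  have pow: "a ^ e - 1 \<in> I 1" if e: "x [^] e \<in> \<Gamma> 1" for e :: nat
  proof -
    have 1: "mv n (M (x [^] e)) v i0 = a ^ e" using mv_eigen_pow[OF xG v(1)] v(2) by simp
    have 2: "mv n (M \<one>) v i0 = 1" using mv_one v by (simp add: eigen_def)
    have "a ^ e - 1 = (\<Sum>j<n. (M (x [^] e) i0 j - M \<one> i0 j) * v j)"
      unfolding 1[symmetric] 2[symmetric] using i0n by (simp add: mv_def algebra_simps sum_subtractf)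
    also have "\<dots> \<in> I 1"
      using e i0n by (intro F.sum_in F.multR(2)) (auto simp: \<Gamma>_def cg_def vA)
    finally show ?thesis .
  qed
  let ?e = "card (rcosets (\<Gamma> 1))"
  have e: "x [^] ?e \<in> \<Gamma> 1" by (rule pow_index_mem[OF \<Gamma>_normal xG \<Gamma>_finite_index])
  have "?e \<noteq> 0"
    using \<Gamma>_finite_index subgroup.subgroup_in_rcosets[OF \<Gamma>_subgroup is_group] by (auto simp: card_eq_0_iff)
  then obtain s where s: "?e = l ^ multiplicity l ?e * s" "\<not> l dvd s"
    using multiplicity_decompose'[of ?e l] l(1) by (metis not_prime_unit)
  define y where "y = x [^] s"
  have yD: "y \<in> D" unfolding y_def by (rule subgroup_nat_pow[OF normal_imp_subgroup[OF D(1)] x])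
  have "y [^] (l ^ multiplicity l ?e) \<in> \<Gamma> 1"
    using e s(1) xG unfolding y_def by (simp add: nat_pow_pow mult.commute)
  \<comment> \<open>Otherwise \<open>a ^ s\<close> and \<open>a ^ l\<close> are 1 modulo
    \<open>I 1\<close>, hence so is \<open>a\<close>, and the geometric sum becomes
    \<open>l\<close>; but \<open>l\<close> is invertible, being prime to the characteristic.\<close>
  moreover have "y \<notin> \<Gamma> 1"
  proof
    assume "y \<in> \<Gamma> 1"
    then have 1: "a ^ s - 1 \<in> I 1" unfolding y_def by (rule pow)
    have "a ^ l - 1 = (a - 1) * (\<Sum>i<l. a ^ i)" by (rule power_diff_1_eq)
    also have "\<dots> \<in> I 1" by (rule F.multR(1)[OF A(2)[OF aA A(1)] l(4)])
    finally have 2: "a ^ l - 1 \<in> I 1" .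
    have "coprime s l" using s(2) l(1) by (simp add: prime_imp_coprime_nat coprime_commute)
    moreover have "l \<noteq> 1" using l(1) by auto
    ultimately obtain u v where uv: "s * u = l * v + 1" using coprime_bezout_strong by blast
    have 3: "a ^ (s * u) - 1 \<in> I 1" using F.cong_power[OF 1 A(7)[OF aA] A(1), of u] by (simp add: power_mult)
    have "a ^ (l * v) - 1 \<in> I 1" using F.cong_power[OF 2 A(7)[OF aA] A(1), of v] by (simp add: power_mult)
    from F.multR(2)[OF this aA] have "a ^ (s * u) - a \<in> I 1" unfolding uv by (simp add: algebra_simps)
    then have "a - 1 \<in> I 1" using F.cong_trans[OF F.cong_sym 3] by blast
    then have "a ^ i - 1 ^ i \<in> I 1" for i by (rule F.cong_power[OF _ aA A(1)])
    then have "(\<Sum>i<l. a ^ i - 1 ^ i) \<in> I 1" by (intro F.sum_in)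
    then have "(\<Sum>i<l. a ^ i) - of_nat l \<in> I 1" by (simp add: sum_subtractf)
    from F.diff[OF l(4) this] have 4: "of_nat l \<in> I 1" by simp
    have pp: "prime ?p" using ch by (rule prime_CHAR_semidom)
    have "l \<noteq> ?p" using l(2) by (metis dvd_triv_right)
    then have "coprime l ?p" using primes_coprime[OF l(1) pp] by blast
    moreover have "?p \<noteq> 1" using pp by auto
    ultimately obtain u v where "l * u = ?p * v + 1" using coprime_bezout_strong by blast
    then have "of_nat l * of_nat u = (of_nat (?p * v + 1) :: 'k)" by (metis of_nat_mult)
    then have "of_nat l * of_nat u = (1 :: 'k)" by simp
    moreover have "of_nat u \<in> ?A" by (induction u) (auto intro: A)
    ultimately have "1 \<in> I 1" using F.multR(2)[OF 4, of "of_nat u"] by simp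
    then show False using F.one_notin by blast
  qed
  moreover have "\<not> l dvd card (rcosets D)" using l(2) dvd_mult2 by blast
  ultimately show ?thesis
    by (intro coprime_supplement[OF D l(1) _ \<Gamma>_normal \<Gamma>_finite_index yD])
qed

lemma torsion_of_algebraic_eigenvalues:
  fixes G (structure) and M :: "'a \<Rightarrow> nat \<Rightarrow> nat \<Rightarrow> 'k::alg_closed_field"
  assumes "mat_rep G M n" and ch: "CHAR('k) > 0" and x: "x \<in> carrier G"
    and alg: "\<And>a w. eigen n (M x) a w \<Longrightarrow> \<not> trans_over prime_ring a"
  shows "\<exists>r>0. x [^] (r::nat) \<in> mat_rep.rep_kernel G M n"
proof -
  interpret mat_rep G M n by fact
  have root: "\<exists>r>0. a ^ r = 1" if "eigen n (M x) a w" for a w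
    by (rule root_of_unity_algebraic[OF ch alg[OF that] eigenvalue_nonzero[OF x that]])
  have "\<exists>r>0. \<forall>w. supp_lt n w \<longrightarrow> (mv n (M x) ^^ r) w = w"
    by (rule finite_order_of_eigenvalues[OF ch]) (rule root)
  then
  obtain r where r: "r > 0" "\<forall>w. supp_lt n w \<longrightarrow> (mv n (M x) ^^ r) w = w"
    by (elim exE conjE)
  have "x [^] r \<in> rep_kernel"
    unfolding mem_rep_kernel
    by (intro conjI allI impI nat_pow_closed x) (simp only: mv_pow[OF x] mp[OF spec[OF r(2)]])
  then show ?thesis using r(1) by (intro exI[of _ r] conjI)
qed

lemma finite_rcosets_of_algebraic_entries:
  fixes G (structure) and M :: "'a \<Rightarrow> nat \<Rightarrow> nat \<Rightarrow> 'k::alg_closed_field"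
  assumes "mat_rep G M n" and R: "is_subring R" "finite R" and entries: "\<And>g i j. g \<in> carrier G \<Longrightarrow> i < n \<Longrightarrow> j < n \<Longrightarrow> M g i j \<in> R"
  shows "finite (rcosets (mat_rep.rep_kernel G M n))"
proof -
  interpret mat_rep G M n by fact
  have "mat_of ` carrier G \<subseteq> PiE ({..<n} \<times> {..<n}) (\<lambda>_. R)"
    unfolding mat_of_def by (intro image_subsetI restrict_PiE_iff[THEN iffD2] ballI entries) auto
  moreover have "finite (PiE ({..<n} \<times> {..<n}) (\<lambda>_. R))" using R(2) by (intro finite_PiE) auto
  ultimately have "finite (mat_of ` carrier G)" by (rule finite_subset)
  then show ?thesis by (rule finite_rcosets_rep_kernel)
qed

section \<open>Unipotent subgroups\<close>

context mat_rep
begin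

text \<open>The operator \<open>g - 1\<close>. Unipotence of a group is expressed through
  \<open>fold disp ss\<close>: by Kolchin, all products of \<open>n\<close> such operators
  vanish.\<close>

definition disp :: "'a \<Rightarrow> (nat \<Rightarrow> 'k) \<Rightarrow> nat \<Rightarrow> 'k" where
  "disp g w = (\<lambda>i. mv n (M g) w i - w i)"

lemma disp_linear:
  "disp g (\<lambda>i. v i - w i) = (\<lambda>i. disp g v i - disp g w i)"
  "disp g (\<lambda>i. v i + w i) = (\<lambda>i. disp g v i + disp g w i)"
  "disp g (\<lambda>i. c * w i) = (\<lambda>i. c * disp g w i)"
  "disp g (\<lambda>_. 0) = (\<lambda>_. 0)"
  by (auto simp: disp_def mv_linear algebra_simps)

lemma disp_sum: "disp g (\<lambda>i. \<Sum>j\<in>J. c j * w j i) = (\<lambda>i. \<Sum>j\<in>J. c j * disp g (w j) i)"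
  by (induction J rule: infinite_finite_induct) (simp_all add: disp_linear)

lemma supp_disp: "supp_lt n w \<Longrightarrow> supp_lt n (disp g w)"
  using supp_mv[of n "M g" w] by (auto simp: disp_def supp_lt_def)

text \<open>The identity \<open>(s - 1) g = g (g^-1 s g - 1)\<close>, which makes spaces of vectors
  defined by displacements invariant under the group.\<close>

lemma mv_disp_conj:
  assumes "g \<in> carrier G" "s \<in> carrier G"
  shows "disp s (mv n (M g) w) = mv n (M g) (disp (inv g \<otimes> s \<otimes> g) w)"
proof -
  have "g \<otimes> (inv g \<otimes> s \<otimes> g) = s \<otimes> g" using assms by (simp add: m_assoc[symmetric])
  then have "mv n (M g) (mv n (M (inv g \<otimes> s \<otimes> g)) w) = mv n (M s) (mv n (M g) w)"
    using assms mv_mult[of g "inv g \<otimes> s \<otimes> g" w] mv_mult[of s g w] by simp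
  then show ?thesis by (simp add: disp_def mv_linear)
qed

lemma supp_fold_disp: "supp_lt n w \<Longrightarrow> supp_lt n (fold disp ss w)"
  by (induction ss arbitrary: w) (auto simp: supp_disp)

end

text \<open>Kolchin's theorem modulo \<open>m\<close> without residue fields: as long as \<open>V j \<noteq> W\<close>, the group \<open>E\<close> fixes a
  nonzero vector of \<open>W / V j\<close>, and a strictly increasing chain of length \<open>n + 1\<close> is too long for the
  \<open>n\<close>-dimensional space \<open>W / V 0\<close>.\<close>

lemma (in mat_filtration) fold_disp_in_maximal_ideal:
  assumes m: "ideal_of A m" "I 1 \<subseteq> m" "1 \<notin> m" "\<forall>a\<in>A. a \<notin> m \<longrightarrow> (\<exists>d\<in>A. a * d - 1 \<in> m)"
    and p: "prime p" "of_nat p = (0 :: 'k)"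
    and E: "subgroup E G" "\<And>x. x \<in> E \<Longrightarrow> \<exists>k. x [^] (p ^ k) \<in> rep_kernel"
    and w: "supp_lt n w" "\<And>i. w i \<in> A" and ss: "set ss \<subseteq> E" "length ss = n"
  shows "fold disp ss w i \<in> m"
proof -
  note A = is_subringD[OF sub] and mD = ideal_ofD[OF m(1)]
  have EG: "E \<subseteq> carrier G" by (rule subgroup.subset[OF E(1)])
  define W where "W = {w. supp_lt n w \<and> (\<forall>i. w i \<in> A)}"
  \<comment> \<open>\<open>V 0\<close> consists of the vectors with entries in \<open>m\<close>;
    \<open>V (Suc j)\<close> collects those fixed by \<open>E\<close> modulo \<open>V j\<close>. So
    \<open>V n = W\<close> says that \<open>n\<close> displacements always lead into
    \<open>V 0\<close>.\<close>
  define V where "V = rec_nat {w \<in> W. \<forall>i. w i \<in> m} (\<lambda>_ V. {w \<in> W. \<forall>s\<in>E. disp s w \<in> V})"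
  have V0: "V 0 = {w \<in> W. \<forall>i. w i \<in> m}" and VS: "V (Suc j) = {w \<in> W. \<forall>s\<in>E. disp s w \<in> V j}" for j
    by (simp_all add: V_def)
  have Wz: "(\<lambda>_. 0) \<in> W" using A(4) by (simp add: W_def supp_lt_def)
  have Wd: "(\<lambda>i. v i - w i) \<in> W" if "v \<in> W" "w \<in> W" for v w
    using that A(2) by (simp add: W_def supp_lt_def)
  have Wa: "(\<lambda>i. v i + w i) \<in> W" if "v \<in> W" "w \<in> W" for v w
    using that A(6) by (simp add: W_def supp_lt_def)
  have Wc: "(\<lambda>i. c * w i) \<in> W" if "c \<in> A" "w \<in> W" for c w
    using that A(3) by (simp add: W_def supp_lt_def)
  have WL: "mv n (M g) w \<in> W" if "g \<in> E" "w \<in> W" for g w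
  proof -
    have "(\<Sum>j<n. M g i j * w j) \<in> A" if "i < n" for i
      by (rule sum_closed_set[OF A(4,6) A(3)[OF entries]])
        (use EG \<open>g \<in> E\<close> \<open>w \<in> W\<close> that in \<open>auto simp: W_def\<close>)
    then show ?thesis using A(4) supp_mv by (auto simp: W_def mv_def supp_lt_def)
  qed
  have Wdisp: "disp g w \<in> W" if "g \<in> E" "w \<in> W" for g w
    unfolding disp_def by (rule Wd[OF WL[OF that] that(2)])
  have VW: "V j \<subseteq> W" for j by (cases j) (auto simp: V0 VS)
  have Vz: "(\<lambda>_. 0) \<in> V j" for j
    by (induction j) (simp_all add: V0 VS Wz mD(2) disp_linear)
  have Vd: "(\<lambda>i. v i - w i) \<in> V j" if "v \<in> V j" "w \<in> V j" for v w j
    using that by (induction j arbitrary: v w) (simp_all add: V0 VS Wd mD(3) disp_linear)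
  have Va: "(\<lambda>i. v i + w i) \<in> V j" if "v \<in> V j" "w \<in> V j" for v w j
    using Vd[OF that(1) Vd[OF Vz that(2)]] by simp
  have Vc: "(\<lambda>i. c * w i) \<in> V j" if "c \<in> A" "w \<in> V j" for c w j
    using that(2) by (induction j arbitrary: w) (simp_all add: V0 VS Wc that(1) mD(4) disp_linear)
  have VL: "mv n (M g) w \<in> V j" if g: "g \<in> E" and "w \<in> V j" for g w j
    using that(2)
  proof (induction j arbitrary: w)
    case 0
    have "(\<Sum>j<n. M g i j * w j) \<in> m" if "i < n" for i
    proof (rule sum_closed_set[OF mD(2,5)])
      show "M g i j * w j \<in> m" if "j \<in> {..<n}" for j
        by (rule mD(4)[OF entries]) (use EG g 0 that \<open>i < n\<close> in \<open>auto simp: V0\<close>)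
    qed
    then show ?case using WL[OF g] 0 mD(2) by (simp add: V0 mv_def)
  next
    case (Suc j)
    have "disp s (mv n (M g) w) \<in> V j" if s: "s \<in> E" for s
    proof -
      have "inv g \<otimes> s \<otimes> g \<in> E"
        by (intro subgroup.m_closed[OF E(1)] subgroup.m_inv_closed[OF E(1)] g s)
      then have "disp (inv g \<otimes> s \<otimes> g) w \<in> V j" using Suc.prems by (simp add: VS)
      from Suc.IH[OF this] show ?thesis
        unfolding mv_disp_conj[OF subsetD[OF EG g] subsetD[OF EG s]] .
    qed
    then show ?case using WL[OF g] Suc.prems by (simp add: VS)
  qed
  have Vmono1: "V j \<subseteq> V (Suc j)" for j
  proof
    fix w assume w: "w \<in> V j"
    have "disp s w \<in> V j" if "s \<in> E" for s
      unfolding disp_def by (rule Vd[OF VL[OF that w] w])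
    then show "w \<in> V (Suc j)" using w VW by (auto simp: VS)
  qed
  have Vmono: "V j \<subseteq> V k" if "j \<le> k" for j k
    by (rule lift_Suc_mono_le[of V, OF Vmono1 that])
  obtain T where T: "finite T" "\<forall>a\<in>A. \<exists>t\<in>T. a - t \<in> I 1" using finite_index by blast
  have fixed: "\<exists>u\<in>V (Suc j). u \<notin> V j" if "w0 \<in> W" "w0 \<notin> V j" for w0 j
  proof -
    let ?K = "G\<lparr>carrier := E\<rparr>"
    have "\<exists>u\<in>W. u \<notin> V j \<and> (\<forall>g\<in>carrier ?K. (\<lambda>i. mv n (M g) u i - u i) \<in> V j)"
    proof (rule p_group_fixed_vector[where T = "(\<lambda>c i. if i < n then c i else 0) ` PiE {..<n} (\<lambda>_. T)"])
      show "group ?K" by (rule subgroup.subgroup_is_group[OF E(1) is_group])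
      show "finite ((\<lambda>c i. if i < n then c i else 0) ` PiE {..<n} (\<lambda>_. T))"
        using T(1) by (intro finite_imageI finite_PiE) auto
      show "\<exists>t\<in>(\<lambda>c i. if i < n then c i else 0) ` PiE {..<n} (\<lambda>_. T). (\<lambda>i. w i - t i) \<in> V j" if w: "w \<in> W" for w
      proof -
        have wA: "w i \<in> A" for i using w by (simp add: W_def)
        have "\<exists>t. t \<in> T \<and> w i - t \<in> I 1" for i using bspec[OF T(2) wA[of i]] by blast
        then obtain c where c: "\<And>i. c i \<in> T \<and> w i - c i \<in> I 1" by metis
        have d: "(\<lambda>i. w i - (if i < n then restrict c {..<n} i else 0)) \<in> V 0"
        proof -
          have 1: "w i - (if i < n then restrict c {..<n} i else 0) \<in> m" for i
            using c[of i] m(2) w mD(2) by (auto simp: W_def supp_lt_def)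
          then have "w i - (if i < n then restrict c {..<n} i else 0) \<in> A" for i using mD(1) by blast
          then show ?thesis using 1 w by (auto simp: V0 W_def supp_lt_def)
        qed
        have "restrict c {..<n} \<in> PiE {..<n} (\<lambda>_. T)" using c by simp
        then have "(\<lambda>i. if i < n then restrict c {..<n} i else 0) \<in> (\<lambda>c i. if i < n then c i else 0) ` PiE {..<n} (\<lambda>_. T)"
          by (rule imageI)
        with subsetD[OF Vmono[OF le0] d] show ?thesis by (rule bexI)
      qed
      show "\<exists>k. \<forall>w\<in>W. mv n (M (g [^]\<^bsub>?K\<^esub> (p ^ k))) w = w" if g: "g \<in> carrier ?K" for g
      proof -
        have "\<exists>k. g [^] (p ^ k) \<in> rep_kernel" using g by (intro E(2)) simp
        then obtain k where "g [^] (p ^ k) \<in> rep_kernel" by (elim exE)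
        then have "\<forall>w\<in>W. mv n (M (g [^] (p ^ k))) w = w" by (simp add: mem_rep_kernel W_def)
        then show ?thesis by (intro exI[of _ k]) (simp add: nat_pow_consistent[symmetric])
      qed
      show "mv n (M (g \<otimes>\<^bsub>?K\<^esub> h)) w = mv n (M g) (mv n (M h) w)"
        if "g \<in> carrier ?K" "h \<in> carrier ?K" "w \<in> W" for g h w
        using mv_mult that EG by auto
      show "mv n (M \<one>\<^bsub>?K\<^esub>) w = w" if "w \<in> W" for w using mv_one that by (simp add: W_def)
      show "mv n (M g) (\<lambda>i. v i - w i) = (\<lambda>i. mv n (M g) v i - mv n (M g) w i)" for g v w
        by (rule mv_linear)
    qed (use p Wz Wd VW Vz Vd WL VL that in auto)
    then show ?thesis by (auto simp: VS disp_def)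
  qed
  have "V n = W"
  proof (rule ccontr)
    assume "V n \<noteq> W"
    then obtain w0 where w0: "w0 \<in> W" "w0 \<notin> V n" using VW by blast
    have ex: "\<exists>u. j \<le> n \<longrightarrow> u \<in> V (Suc j) \<and> u \<notin> V j" for j
    proof (cases "j \<le> n")
      case True
      then have "w0 \<notin> V j" using Vmono[OF True] w0(2) by blast
      from fixed[OF w0(1) this] show ?thesis by blast
    qed simp
    have "\<exists>u. \<forall>j. j \<le> n \<longrightarrow> u j \<in> V (Suc j) \<and> u j \<notin> V j"
      by (rule choice) (intro allI ex)
    then obtain u where u: "\<forall>j. j \<le> n \<longrightarrow> u j \<in> V (Suc j) \<and> u j \<notin> V j" by (elim exE)
    have uW: "u j \<in> W" if "j \<le> n" for j using u that VW by blast
    \<comment> \<open>\<open>\<tau> a\<close> depends only on \<open>a\<close> modulo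
      \<open>m\<close>, and its values \<open>Q\<close> represent the residue field. The
      intermediate \<open>b\<close> absorbs \<open>m\<close>, since \<open>T\<close> represents
      classes modulo the smaller \<open>I 1\<close>.\<close>
    define \<tau> where "\<tau> a = (SOME t. t \<in> T \<and> (\<exists>b\<in>A. b - t \<in> I 1 \<and> a - b \<in> m))" for a
    have \<tau>: "\<tau> a \<in> T" "\<exists>b\<in>A. b - \<tau> a \<in> I 1 \<and> a - b \<in> m" if "a \<in> A" for a
    proof -
      obtain t where "t \<in> T" "a - t \<in> I 1" using bspec[OF T(2) \<open>a \<in> A\<close>] by (elim bexE)
      then have "t \<in> T \<and> (\<exists>b\<in>A. b - t \<in> I 1 \<and> a - b \<in> m)" using that mD(2) by auto
      then have "\<tau> a \<in> T \<and> (\<exists>b\<in>A. b - \<tau> a \<in> I 1 \<and> a - b \<in> m)" unfolding \<tau>_def by (rule someI)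
      then show "\<tau> a \<in> T" "\<exists>b\<in>A. b - \<tau> a \<in> I 1 \<and> a - b \<in> m" by simp_all
    qed
    have \<tau>m: "a - \<tau> a \<in> m" if "a \<in> A" for a
    proof -
      obtain b where b: "b \<in> A" "b - \<tau> a \<in> I 1" "a - b \<in> m" using \<tau>(2)[OF \<open>a \<in> A\<close>] by blast
      have "(a - b) + (b - \<tau> a) \<in> m" by (rule mD(5)[OF b(3) subsetD[OF m(2) b(2)]])
      then show ?thesis by simp
    qed
    have \<tau>_eq: "\<tau> a = \<tau> b" if ab: "a \<in> A" "b \<in> A" "a - b \<in> m" for a b
    proof -
      have "a - x \<in> m \<longleftrightarrow> b - x \<in> m" for x
        using mD(3)[of "a - x" "a - b"] mD(5)[of "b - x" "a - b"] ab(3) by auto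
      then show ?thesis by (simp add: \<tau>_def)
    qed
    define Q where "Q = \<tau> ` A"
    have finQ: "finite Q" using T(1) \<tau>(1) unfolding Q_def by (meson finite_subset image_subsetI)
    have QA: "q \<in> A" if "q \<in> Q" for q
    proof -
      obtain a where a: "a \<in> A" "q = \<tau> a" using \<open>q \<in> Q\<close> by (auto simp: Q_def)
      have "a - (a - \<tau> a) \<in> A" by (rule A(2)[OF a(1) subsetD[OF mD(1) \<tau>m[OF a(1)]]])
      then show ?thesis using a(2) by simp
    qed
    have Q_sep: "q = q'" if "q \<in> Q" "q' \<in> Q" "q - q' \<in> m" for q q'
    proof -
      obtain a a' where a: "a \<in> A" "q = \<tau> a" "a' \<in> A" "q' = \<tau> a'"
        using \<open>q \<in> Q\<close> \<open>q' \<in> Q\<close> by (auto simp: Q_def)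
      have "(a - \<tau> a) + (q - q') \<in> m" by (rule mD(5)[OF \<tau>m[OF a(1)] that(3)])
      from mD(3)[OF this \<tau>m[OF a(3)]] have "a - a' \<in> m" using a by (simp add: algebra_simps)
      then show ?thesis using \<tau>_eq a by blast
    qed
    have "\<tau> 0 \<noteq> \<tau> 1"
    proof
      assume "\<tau> 0 = \<tau> 1"
      then have "(1 - \<tau> 1) - (0 - \<tau> 0) = 1" by simp
      moreover have "(1 - \<tau> 1) - (0 - \<tau> 0) \<in> m" by (rule mD(3)[OF \<tau>m[OF A(1)] \<tau>m[OF A(4)]])
      ultimately show False using m(3) by simp
    qed
    then have "card {\<tau> 0, \<tau> 1} = 2" by simp
    moreover have "{\<tau> 0, \<tau> 1} \<subseteq> Q" using A(1,4) by (auto simp: Q_def)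
    ultimately have cardQ: "card Q \<ge> 2" using card_mono[OF finQ] by metis
    \<comment> \<open>Linear independence of \<open>n + 1\<close> vectors is refuted by counting:
      coefficient families of length \<open>n + 1\<close> over \<open>Q\<close> would inject into
      residues in \<open>n\<close> coordinates, although \<open>Q\<close> has at least two
      elements.\<close>
    define C where "C c = (\<lambda>i. \<Sum>j\<in>{..n}. c j * u j i)" for c :: "nat \<Rightarrow> 'k"
    have CW: "C c i \<in> A" if "c \<in> PiE {..n} (\<lambda>_. Q)" for c i
      unfolding C_def
    proof (rule sum_closed_set[OF A(4,6)])
      show "c j * u j i \<in> A" if "j \<in> {..n}" for j
        using A(3)[OF QA[OF PiE_mem[OF \<open>c \<in> PiE {..n} (\<lambda>_. Q)\<close> that]], of "u j i"] uW[of j] that by (simp add: W_def)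
    qed
    define F where "F c = (\<lambda>i\<in>{..<n}. \<tau> (C c i))" for c
    have "inj_on F (PiE {..n} (\<lambda>_. Q))"
    proof (rule inj_onI, rule ccontr)
      fix c d assume c: "c \<in> PiE {..n} (\<lambda>_. Q)" and d: "d \<in> PiE {..n} (\<lambda>_. Q)" and F: "F c = F d" and cd: "c \<noteq> d"
      have cdA: "c j - d j \<in> A" if "j \<le> n" for j
        by (rule A(2)[OF QA[OF PiE_mem[OF c]] QA[OF PiE_mem[OF d]]]) (use that in auto)
      define D where "D = (\<lambda>i. \<Sum>j\<in>{..n}. (c j - d j) * u j i)"
      have Dm: "D i \<in> m" for i
      proof (cases "i < n")
        case True
        have "\<tau> (C c i) = \<tau> (C d i)" using fun_cong[OF F, of i] True by (simp add: F_def)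
        then have "(C c i - \<tau> (C c i)) - (C d i - \<tau> (C d i)) = D i"
          by (simp add: C_def D_def algebra_simps sum_subtractf)
        then show ?thesis using mD(3)[OF \<tau>m[OF CW[OF c]] \<tau>m[OF CW[OF d]]] by metis
      next
        case False
        then have "D i = 0" unfolding D_def using uW by (intro sum.neutral) (auto simp: W_def supp_lt_def)
        then show ?thesis using mD(2) by simp
      qed
      have sumV: "(\<lambda>i. \<Sum>j\<in>J. (c j - d j) * u j i) \<in> V k" if "finite J" "\<And>j. j \<in> J \<Longrightarrow> (\<lambda>i. (c j - d j) * u j i) \<in> V k" for J k
        using that by (induction J rule: finite_induct) (simp_all add: Vz Va)
      have DW: "D \<in> V 0"
      proof -
        have "D i \<in> A" for i using Dm mD(1) by blast
        moreover have "D i = 0" if "i \<ge> n" for i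
          unfolding D_def using uW that by (intro sum.neutral) (auto simp: W_def supp_lt_def)
        ultimately show ?thesis using Dm by (simp add: V0 W_def supp_lt_def)
      qed
      define J where "J = {j. j \<le> n \<and> c j \<noteq> d j}"
      have "J \<noteq> {}"
      proof
        assume "J = {}"
        then have "c = d" using c d by (intro PiE_ext[OF c d]) (auto simp: J_def)
        then show False using cd by simp
      qed
      \<comment> \<open>At the largest index where \<open>c\<close> and \<open>d\<close> differ the
        coefficient is invertible modulo \<open>m\<close> and all other terms lie in
        \<open>V j0\<close>; this would put \<open>u j0\<close> into \<open>V j0\<close>.\<close>
      define j0 where "j0 = Max J"
      have "finite J" by (simp add: J_def)
      then have j0: "j0 \<in> J" "\<And>j. j \<in> J \<Longrightarrow> j \<le> j0" using \<open>J \<noteq> {}\<close> by (auto simp: j0_def)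
      have j0n: "j0 \<le> n" "c j0 \<noteq> d j0" using j0(1) by (auto simp: J_def)
      have "c j0 - d j0 \<notin> m" using Q_sep[OF PiE_mem[OF c] PiE_mem[OF d]] j0n by auto
      then obtain e where e: "e \<in> A" "(c j0 - d j0) * e - 1 \<in> m" using m(4) cdA[OF j0n(1)] by blast
      have "(\<lambda>i. \<Sum>j\<in>{..n} - {j0}. (c j - d j) * u j i) \<in> V j0"
      proof (rule sumV)
        fix j assume j: "j \<in> {..n} - {j0}"
        show "(\<lambda>i. (c j - d j) * u j i) \<in> V j0"
        proof (cases "j \<in> J")
          case True
          then have "Suc j \<le> j0" using j0(2)[OF True] j by simp
          then have "u j \<in> V j0" using u j Vmono by auto
          then show ?thesis using j by (intro Vc cdA) auto
        next
          case False
          then show ?thesis using j by (simp add: J_def Vz)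
        qed
      qed simp
      from Vd[OF subsetD[OF Vmono[of 0 j0] DW] this]
      have "(\<lambda>i. (c j0 - d j0) * u j0 i) \<in> V j0"
        using j0n(1) unfolding D_def by (simp add: sum.remove[of "{..n}" j0])
      from Vc[OF e(1) this] have 1: "(\<lambda>i. e * ((c j0 - d j0) * u j0 i)) \<in> V j0" .
      have "(\<lambda>i. ((c j0 - d j0) * e - 1) * u j0 i) \<in> V 0"
      proof -
        have ua: "u j0 i \<in> A" for i using uW[OF j0n(1)] by (simp add: W_def)
        have "((c j0 - d j0) * e - 1) * u j0 i \<in> m" for i
          using mD(4)[OF ua e(2)] by (simp add: mult.commute)
        moreover have "(\<lambda>i. ((c j0 - d j0) * e - 1) * u j0 i) \<in> W"
          by (rule Wc[OF subsetD[OF mD(1) e(2)] uW[OF j0n(1)]])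
        ultimately show ?thesis by (simp add: V0)
      qed
      from Vd[OF 1 subsetD[OF Vmono[of 0 j0] this]] have "u j0 \<in> V j0" by (simp add: algebra_simps)
      then show False using u j0n(1) by blast
    qed
    moreover have "F ` (PiE {..n} (\<lambda>_. Q)) \<subseteq> PiE {..<n} (\<lambda>_. Q)"
      unfolding F_def by (intro image_subsetI restrict_PiE_iff[THEN iffD2] ballI) (auto simp: Q_def CW)
    ultimately have "card (PiE {..n} (\<lambda>_. Q)) \<le> card (PiE {..<n} (\<lambda>_. Q))"
      using finQ by (intro card_inj_on_le finite_PiE) auto
    then have "card Q ^ Suc n \<le> card Q ^ n" by (simp add: card_PiE)
    moreover have "card Q ^ n < card Q ^ Suc n" using cardQ by (intro power_strict_increasing) auto
    ultimately show False by simp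
  qed
  have "fold disp ss w \<in> V 0" if "w \<in> V (length ss)" "set ss \<subseteq> E" for ss w
    using that by (induction ss arbitrary: w) (auto simp: VS)
  from this[of w ss] have "fold disp ss w \<in> V 0" using \<open>V n = W\<close> w ss by (simp add: W_def)
  then show ?thesis by (simp add: V0)
qed

text \<open>The finitely many vectors obtained from a basis vector by fewer than \<open>n\<close> displacements by
  generators span a finite invariant group.\<close>

lemma (in mat_rep) finite_image_of_unipotent:
  assumes fin: "finite (prime_ring :: 'k set)" and E: "subgroup E G" and T: "finite T" "T \<subseteq> E" "E \<subseteq> generate G T"
    and uni: "\<And>ss j. set ss \<subseteq> E \<Longrightarrow> length ss = n \<Longrightarrow> j < n \<Longrightarrow> fold disp ss (unit_vec j) = (\<lambda>_. 0)"
  shows "finite (mat_of ` E)"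
proof -
  note P = is_subringD[OF prime_ring_subring[where 'k = 'k]]
  define T' where "T' = T \<union> (\<lambda>s. inv s) ` T"
  have T'E: "T' \<subseteq> E" using T(2) subgroup.m_inv_closed[OF E] by (auto simp: T'_def)
  have finT': "finite T'" using T(1) by (simp add: T'_def)
  \<comment> \<open>Lists of length \<open>n\<close> are included; by \<open>uni\<close> they give
    zero, so a further displacement does not leave the span.\<close>
  define B where "B j = (\<lambda>ss. fold disp ss (unit_vec j)) ` {ss. set ss \<subseteq> T' \<and> length ss \<le> n}" for j
  have finB: "finite (B j)" for j
    unfolding B_def by (intro finite_imageI finite_lists_length_le finT')
  define Z where "Z j = (\<lambda>c i. \<Sum>b\<in>B j. c b * b i) ` (B j \<rightarrow>\<^sub>E prime_ring)" for j
  have finZ: "finite (Z j)" for j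
    unfolding Z_def by (intro finite_imageI finite_PiE finB fin)
  have ZI: "(\<lambda>i. \<Sum>b\<in>B j. c b * b i) \<in> Z j" if "\<And>b. b \<in> B j \<Longrightarrow> c b \<in> prime_ring" for c j
  proof -
    have "(\<lambda>i. \<Sum>b\<in>B j. c b * b i) = (\<lambda>i. \<Sum>b\<in>B j. restrict c (B j) b * b i)"
      by (intro ext sum.cong) auto
    then show ?thesis unfolding Z_def using that by (intro image_eqI[of _ _ "restrict c (B j)"]) auto
  qed
  have Z0: "(\<lambda>_. 0) \<in> Z j" for j using ZI[of j "\<lambda>_. 0"] P(4) by simp
  have Zadd: "(\<lambda>i. v i + w i) \<in> Z j" if "v \<in> Z j" "w \<in> Z j" for v w j
  proof -
    obtain c d where c: "c \<in> B j \<rightarrow>\<^sub>E prime_ring" "v = (\<lambda>i. \<Sum>b\<in>B j. c b * b i)"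
      and d: "d \<in> B j \<rightarrow>\<^sub>E prime_ring" "w = (\<lambda>i. \<Sum>b\<in>B j. d b * b i)"
      using \<open>v \<in> Z j\<close> \<open>w \<in> Z j\<close> by (auto simp: Z_def)
    have "(\<lambda>i. \<Sum>b\<in>B j. (c b + d b) * b i) \<in> Z j"
      by (rule ZI, rule P(6)[OF PiE_mem[OF c(1)] PiE_mem[OF d(1)]])
    then show ?thesis unfolding c(2) d(2) by (simp add: sum.distrib distrib_right)
  qed
  have Zscale: "(\<lambda>i. a * w i) \<in> Z j" if "a \<in> prime_ring" "w \<in> Z j" for a w j
  proof -
    obtain c where c: "c \<in> B j \<rightarrow>\<^sub>E prime_ring" "w = (\<lambda>i. \<Sum>b\<in>B j. c b * b i)"
      using \<open>w \<in> Z j\<close> by (auto simp: Z_def)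
    have "(\<lambda>i. \<Sum>b\<in>B j. (a * c b) * b i) \<in> Z j" by (rule ZI, rule P(3)[OF that(1) PiE_mem[OF c(1)]])
    then show ?thesis unfolding c(2) by (simp add: sum_distrib_left mult.assoc)
  qed
  have Zsum: "(\<lambda>i. \<Sum>b\<in>J. c b * f b i) \<in> Z j"
    if "finite J" "\<And>b. b \<in> J \<Longrightarrow> c b \<in> prime_ring" "\<And>b. b \<in> J \<Longrightarrow> f b \<in> Z j"
    for J j and c :: "(nat \<Rightarrow> 'k) \<Rightarrow> 'k" and f :: "(nat \<Rightarrow> 'k) \<Rightarrow> nat \<Rightarrow> 'k"
    using that by (induction J rule: finite_induct) (simp_all add: Z0 Zadd Zscale)
  have BZ: "b \<in> Z j" if "b \<in> B j" for b j
  proof -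
    have "(\<lambda>i. \<Sum>b'\<in>B j. (if b' = b then 1 else 0) * b' i) \<in> Z j" by (rule ZI) (simp add: P(1,4))
    moreover have "(\<Sum>b'\<in>B j. (if b' = b then 1 else 0) * b' i) = (\<Sum>b'\<in>B j. if b' = b then b' i else 0)" for i
      by (intro sum.cong) auto
    ultimately show ?thesis using that finB by simp
  qed
  have dispB: "disp s b \<in> Z j" if "s \<in> T'" "b \<in> B j" "j < n" for s b j
  proof -
    obtain ss where ss: "set ss \<subseteq> T'" "length ss \<le> n" "b = fold disp ss (unit_vec j)"
      using \<open>b \<in> B j\<close> by (auto simp: B_def)
    show ?thesis
    proof (cases "length ss = n")
      case True
      then have "b = (\<lambda>_. 0)" using uni[of ss j] ss T'E \<open>j < n\<close> by auto
      then show ?thesis using Z0 by (simp add: disp_linear)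
    next
      case False
      then have "fold disp (ss @ [s]) (unit_vec j) \<in> B j"
        unfolding B_def using ss that(1) by (intro imageI) auto
      then show ?thesis using ss(3) BZ by simp
    qed
  qed
  have mvZ: "mv n (M s) w \<in> Z j" if s: "s \<in> T'" and w: "w \<in> Z j" and j: "j < n" for s w j
  proof -
    obtain c where c: "c \<in> B j \<rightarrow>\<^sub>E prime_ring" "w = (\<lambda>i. \<Sum>b\<in>B j. c b * b i)" using w by (auto simp: Z_def)
    have "disp s w \<in> Z j"
      unfolding c(2) disp_sum using PiE_mem[OF c(1)] by (intro Zsum finB dispB s j)
    from Zadd[OF this w] show ?thesis by (simp add: disp_def)
  qed
  have gen: "\<forall>w\<in>Z j. mv n (M g) w \<in> Z j" if g: "g \<in> generate G T" and j: "j < n" for g j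
    using g
  proof induction
    case one
    have "supp_lt n w" if w: "w \<in> Z j" for w
    proof -
      obtain c where c: "w = (\<lambda>i. \<Sum>b\<in>B j. c b * b i)" using w by (auto simp: Z_def)
      have "b i = 0" if "b \<in> B j" "i \<ge> n" for b i
        using that supp_fold_disp[OF supp_unit_vec[OF j]] by (auto simp: B_def supp_lt_def)
      then show ?thesis unfolding c supp_lt_def by (intro allI impI sum.neutral ballI) simp
    qed
    then show ?case by (simp add: mv_one)
  next
    case (incl h)
    then show ?case using mvZ j by (simp add: T'_def)
  next
    case (inv h)
    then show ?case using mvZ j by (simp add: T'_def)
  next
    case (eng h1 h2)
    have TG: "T \<subseteq> carrier G" using T(2) subgroup.subset[OF E] by blast
    show ?case using eng(3,4) by (simp add: mv_mult generate_in_carrier[OF TG eng(1)] generate_in_carrier[OF TG eng(2)])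
  qed
  have unitZ: "unit_vec j \<in> Z j" for j
    by (rule BZ) (auto simp: B_def intro!: image_eqI[of _ _ "[]"])
  define N where "N = (\<Union>j<n. Z j)"
  have "mat_of ` E \<subseteq> (\<lambda>f. \<lambda>x\<in>{..<n} \<times> {..<n}. f (snd x) (fst x)) ` ({..<n} \<rightarrow>\<^sub>E N)"
  proof (rule image_subsetI)
    fix g assume g: "g \<in> E"
    let ?f = "\<lambda>j\<in>{..<n}. mv n (M g) (unit_vec j)"
    have "mat_of g = (\<lambda>x\<in>{..<n} \<times> {..<n}. ?f (snd x) (fst x))"
      unfolding mat_of_def by (intro restrict_ext) (auto simp: mv_unit_vec)
    moreover have "?f \<in> {..<n} \<rightarrow>\<^sub>E N"
      using gen[OF subsetD[OF T(3) g]] unitZ by (auto simp: N_def)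
    ultimately show "mat_of g \<in> (\<lambda>f. \<lambda>x\<in>{..<n} \<times> {..<n}. f (snd x) (fst x)) ` ({..<n} \<rightarrow>\<^sub>E N)"
      by (rule image_eqI)
  qed
  moreover have "finite ({..<n} \<rightarrow>\<^sub>E N)" using finZ by (intro finite_PiE) (auto simp: N_def)
  ultimately show ?thesis using finite_subset by blast
qed

text \<open>Here \<open>p\<close> is 0 and so lies in \<open>I 1\<close>, whence \<open>x\<close>
  has \<open>p\<close>-power order modulo every \<open>\<Gamma> k\<close>. The power of
  \<open>x\<close> that removes the \<open>p\<close>-part of \<open>r\<close> also has order prime
  to \<open>p\<close> there, hence lies in all \<open>\<Gamma> k\<close>.\<close>

lemma (in mat_filtration) unipotent_of_finite_order:
  assumes p: "prime p" "of_nat p = (0 :: 'k)" and x: "x \<in> \<Gamma> 1" and r: "r > 0" "x [^] (r::nat) \<in> rep_kernel"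
  shows "\<exists>k. x [^] (p ^ k) \<in> rep_kernel"
proof -
  have xG: "x \<in> carrier G" using x by (simp add: \<Gamma>_def)
  obtain s where s: "r = p ^ multiplicity p r * s" "\<not> p dvd s"
    using multiplicity_decompose'[of r p] p(1) r(1) by (metis not_prime_unit less_not_refl)
  let ?y = "x [^] (p ^ multiplicity p r)"
  have yG: "?y \<in> carrier G" using xG by simp
  have yK: "?y [^] s \<in> rep_kernel" using r(2) s(1) xG by (simp add: nat_pow_pow)
  have "?y \<in> \<Gamma> k" for k
  proof (rule coprime_powers_mem[OF \<Gamma>_subgroup yG])
    show "?y [^] s \<in> \<Gamma> k" using yK by (simp add: \<Gamma>_def cg_def rep_kernel_def zero)
    have "of_nat p \<in> I 1" using p(2) zero by simp
    then have "x [^] (p ^ k) \<in> \<Gamma> k" using \<Gamma>_prime_power[OF _ x, of p k] \<Gamma>_dec by blast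
    from subgroup_nat_pow[OF \<Gamma>_subgroup this, of "p ^ multiplicity p r"]
    show "?y [^] (p ^ k) \<in> \<Gamma> k" using xG by (simp add: nat_pow_pow mult.commute)
    show "coprime s (p ^ k)" using s(2) p(1) by (simp add: prime_imp_coprime_nat coprime_commute)
  qed
  then show ?thesis using \<Gamma>_Inter by blast
qed

text \<open>If all eigenvalues on \<open>D\<close> are algebraic, infinite image is contradicted.
  The elements of \<open>E\<close> have \<open>p\<close>-power order modulo the kernel, so the
  coefficients of products of \<open>n\<close> displacements lie in every maximal ideal that
  contains some \<open>J 1\<close>. A nonzero coefficient could be kept invertible by a suitable
  \<open>J\<close>, so all of them vanish.\<close>

theorem supplements_char_p:
  fixes G (structure) and M :: "'a \<Rightarrow> nat \<Rightarrow> nat \<Rightarrow> 'k::alg_closed_field"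
  assumes rep: "mat_rep G M n" and ch: "CHAR('k) > 0" and fg: "finite_generating_sets G \<noteq> {}"
    and inf: "infinite (rcosets (mat_rep.rep_kernel G M n))"
  shows "has_supplements G"
  unfolding has_supplements_def
proof (intro allI impI, elim conjE)
  fix D assume D: "D \<lhd> G" "finite (rcosets D)"
  interpret mat_rep G M n by fact
  let ?p = "CHAR('k)"
  have p: "prime ?p" "of_nat ?p = (0 :: 'k)" using ch by (auto intro: prime_CHAR_semidom)
  show "\<exists>H M. M \<lhd> G \<and> finite (rcosets M) \<and> M \<subseteq> H \<and> subgroup H G \<and> H \<noteq> carrier G \<and>
      (\<forall>g\<in>carrier G. \<exists>d\<in>D. \<exists>h\<in>H. g = d \<otimes> h)"
  proof (cases "\<exists>x\<in>D. \<exists>a w. eigen n (M x) a w \<and> trans_over prime_ring a")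
    case True
    then obtain x a w where "x \<in> D" "eigen n (M x) a w" "trans_over prime_ring a" by (elim bexE exE conjE)
    then show ?thesis by (rule supplement_of_transcendental_eigenvalue[OF rep ch fg D])
  next
    case False
    obtain S where S: "finite S" "S \<subseteq> carrier G" "generate G S = carrier G"
      using fg by (auto simp: finite_generating_sets_def)
    have "finite (insert 0 ((\<lambda>(g, i, j). M g i j) ` ((S \<union> (\<lambda>s. inv s) ` S) \<times> {..<n} \<times> {..<n})))"
      using S(1) by auto
    from finite_list[OF this]
    obtain xs where xs: "set xs = insert 0 ((\<lambda>(g, i, j). M g i j) ` ((S \<union> (\<lambda>s. inv s) ` S) \<times> {..<n} \<times> {..<n}))"
      by (elim exE)
    have "\<exists>t\<in>set xs. trans_over prime_ring t"
    proof (rule ccontr)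
      assume "\<not> ?thesis"
      then have "finite (adj_list prime_ring xs)"
        by (intro finite_adj_list_algebraic prime_ring_subring finite_prime_ring_char_p ch) blast
      then have "finite (rcosets rep_kernel)"
        by (rule finite_rcosets_of_algebraic_entries[OF rep adj_list_subring[OF prime_ring_subring]])
          (rule entries_in_adj_list[OF S prime_ring_subring xs subset_refl])
      then show False using inf by contradiction
    qed
    \<comment> \<open>A transcendental entry supplies the infinite base ring from which filtrations
      are lifted.\<close>
    then obtain t :: 'k where t: "trans_over prime_ring t" by blast
    let ?B = "adj prime_ring t"
    let ?A = "adj_list ?B xs"
    have B: "is_subring ?B" by (rule adj_subring[OF prime_ring_subring])
    note A = is_subringD[OF adj_list_subring[OF B, of xs]]
    have filt: "\<exists>I. ring_filtration ?A I \<and> ring_filtration.punit I f" if "f \<in> ?A" "f \<noteq> 0" for f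
    proof -
      from filtration_char_p[where N = 1, OF ch t _ that] show ?thesis by auto
    qed
    have mfilt: "mat_filtration G M n ?A I" if "ring_filtration ?A I" for I
    proof -
      interpret F: ring_filtration ?A I by (rule that)
      show ?thesis by unfold_locales (rule entries_in_adj_list[OF S B xs subset_refl])
    qed
    obtain I where I: "ring_filtration ?A I" using filt[OF A(1) one_neq_zero] by blast
    interpret I: mat_filtration G M n ?A I by (rule mfilt[OF I])
    define E where "E = D \<inter> I.\<Gamma> 1"
    have E: "subgroup E G" "finite (rcosets E)"
      unfolding E_def
      by (rule subgroups_Inter_pair[OF normal_imp_subgroup[OF D(1)] I.\<Gamma>_subgroup])
        (rule finite_rcosets_Int[OF normal_imp_subgroup[OF D(1)] D(2) I.\<Gamma>_subgroup I.\<Gamma>_finite_index])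
    have pow: "\<exists>k. x [^] (?p ^ k) \<in> rep_kernel" if "x \<in> E" for x
    proof -
      have xD: "x \<in> D" "x \<in> I.\<Gamma> 1" using that by (auto simp: E_def)
      have xG: "x \<in> carrier G" using xD(1) subgroup.mem_carrier[OF normal_imp_subgroup[OF D(1)]] by blast
      have "\<exists>r>0. x [^] (r::nat) \<in> rep_kernel"
      proof (rule torsion_of_algebraic_eigenvalues[OF rep ch xG])
        show "\<not> trans_over prime_ring a" if "eigen n (M x) a w" for a w using False xD(1) that by blast
      qed
      then obtain r where "r > 0" "x [^] (r::nat) \<in> rep_kernel" by (elim exE conjE)
      then show ?thesis by (rule I.unipotent_of_finite_order[OF p xD(2)])
    qed
    have uni: "fold disp ss (unit_vec j) = (\<lambda>_. 0)" if ss: "set ss \<subseteq> E" "length ss = n" and j: "j < n" for ss j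
    proof (rule ccontr)
      assume "fold disp ss (unit_vec j) \<noteq> (\<lambda>_. 0)"
      then obtain i where i: "fold disp ss (unit_vec j) i \<noteq> 0" by auto
      let ?f = "fold disp ss (unit_vec j) i"
      have WA: "\<forall>i. fold disp ss w i \<in> ?A" if "set ss \<subseteq> carrier G" "\<forall>i. w i \<in> ?A" for ss w
        using that
      proof (induction ss arbitrary: w)
        case (Cons s ss)
        have "(\<Sum>j<n. M s i j * w j) \<in> ?A" if "i < n" for i
          by (rule sum_closed_set[OF A(4,6) A(3)[OF I.entries]]) (use Cons.prems that in auto)
        then have "\<forall>i. disp s w i \<in> ?A" using A(2,4) Cons.prems by (simp add: disp_def mv_def)
        then show ?case using Cons by simp
      qed simp
      have "set ss \<subseteq> carrier G" using ss(1) subgroup.subset[OF E(1)] by blast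
      then have fA: "?f \<in> ?A" using WA[of ss "unit_vec j"] A(1,4) by auto
      \<comment> \<open>This second filtration depends on the coefficient \<open>?f\<close>, while
        \<open>E\<close> remains the group defined by the first one.\<close>
      obtain J where J: "ring_filtration ?A J" "ring_filtration.punit J ?f" using filt[OF fA i] by blast
      interpret J: mat_filtration G M n ?A J by (rule mfilt[OF J(1)])
      obtain m where m: "ideal_of ?A m" "J 1 \<subseteq> m" "1 \<notin> m" "\<forall>a\<in>?A. a \<notin> m \<longrightarrow> (\<exists>d\<in>?A. a * d - 1 \<in> m)"
        using J.maximal_ideal_exists by (elim exE conjE)
      have fm: "?f \<in> m"
        by (rule J.fold_disp_in_maximal_ideal[OF m p E(1) pow supp_unit_vec[OF j] _ ss]) (use A(1,4) in auto)
      obtain e where e: "e > 0" "?f ^ e - 1 \<in> J 1" using J(2) unfolding J.punit_def by blast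
      have "?f ^ (e - 1) * ?f \<in> m" by (rule ideal_ofD(4)[OF m(1) A(7)[OF fA] fm])
      then have "?f ^ e \<in> m" using power_minus_mult[OF e(1), of ?f] by simp
      from ideal_ofD(3)[OF m(1) this subsetD[OF m(2) e(2)]] show False using m(3) by simp
    qed
    obtain T where T: "finite T" "T \<subseteq> E" "E \<subseteq> generate G T"
      using finite_index_finitely_generated[OF S E] by (elim exE conjE)
    have "finite (mat_of ` E)"
      by (rule finite_image_of_unipotent[OF finite_prime_ring_char_p[OF ch] E(1) T uni])
    then have "finite (rcosets rep_kernel)" by (rule finite_rcosets_rep_kernel_subgroup[OF E])
    then show ?thesis using inf by contradiction
  qed
qed

section \<open>Nielsen reduction\<close>

fun lcp :: "'a list \<Rightarrow> 'a list \<Rightarrow> nat" where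
  "lcp (x # u) (y # v) = (if x = y then Suc (lcp u v) else 0)"
| "lcp _ _ = 0"

lemma le_lcp_iff: "m \<le> lcp u v \<longleftrightarrow> m \<le> length u \<and> m \<le> length v \<and> take m u = take m v"
proof (induction u v arbitrary: m rule: lcp.induct)
  case (1 x u y v)
  then show ?case by (cases m) auto
qed auto

lemma lcp_le: "lcp u v \<le> length u" "lcp u v \<le> length v" "take (lcp u v) u = take (lcp u v) v"
  using le_lcp_iff[of "lcp u v" u v] by auto

lemma lcp_commute: "lcp u v = lcp v u"
  by (induction u v rule: lcp.induct) auto

lemma lcp_ultrametric: "min (lcp u v) (lcp v w) \<le> lcp u w"
proof -
  let ?m = "min (lcp u v) (lcp v w)"
  have "?m \<le> lcp u v" "?m \<le> lcp v w" by simp_all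
  then show ?thesis unfolding le_lcp_iff by simp
qed

definition winv :: "(nat \<times> bool) list \<Rightarrow> (nat \<times> bool) list" where
  "winv w = rev (map inv_letter w)"

lemma winv_simps: "winv (winv w) = w" "length (winv w) = length w" "winv [] = []" "winv (u @ v) = winv v @ winv u"
  "winv w = [] \<longleftrightarrow> w = []" "winv [x] = [inv_letter x]"
  by (simp_all add: winv_def rev_map[symmetric] comp_def)

lemma reduced_successively: "reduced w \<longleftrightarrow> successively (\<lambda>x y. y \<noteq> inv_letter x) w"
  by (induction w rule: reduced.induct) auto

lemma reduced_winv: "reduced w \<Longrightarrow> reduced (winv w)"
  unfolding reduced_successively winv_def successively_rev successively_map
  by (erule successively_mono) auto

lemma foldr_push_reduced_append: "reduced (u @ v) \<Longrightarrow> foldr push u v = u @ v"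
proof (induction u)
  case (Cons x u)
  then show ?case using push_reduced[of x "u @ v"] reduced_tl[of x "u @ v"] by simp
qed simp

text \<open>In the product of the inverse of \<open>g\<close> with \<open>h\<close> exactly the
  common prefix cancels, once in each factor.\<close>

lemma length_winv_push:
  assumes "reduced g" "reduced h"
  shows "length (foldr push (winv g) h) + 2 * lcp g h = length g + length h"
  using assms
proof (induction g h rule: lcp.induct)
  case (1 x u y v)
  show ?case
  proof (cases "x = y")
    case True
    have "foldr push (winv (x # u)) (y # v) = foldr push (winv u) v" using True by (simp add: winv_def)
    then show ?thesis using 1(1)[OF True] 1(2,3) reduced_tl True by auto
  next
    case False
    have "reduced (winv (x # u) @ (y # v))"
      using reduced_winv[OF 1(2)] 1(3) False
      unfolding reduced_successively successively_append_iff by (simp add: winv_def)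
    from foldr_push_reduced_append[OF this] False show ?thesis by (simp add: winv_simps)
  qed
next
  case ("2_1" v)
  then show ?case by (simp add: winv_def)
next
  case ("2_2" u)
  then show ?case using foldr_push_Nil[OF reduced_winv[of u]] by (simp add: winv_simps)
qed

lemma length_foldr_push:
  "length (foldr push u v) \<le> length u + length v \<and>
    (length (foldr push u v) = length u + length v \<longrightarrow> foldr push u v = u @ v)"
proof (induction u)
  case (Cons x u)
  show ?case
  proof (cases "foldr push u v")
    case Nil
    then show ?thesis using Cons by auto
  next
    case (Cons y w)
    then show ?thesis using Cons.IH by auto
  qed
qed simp

text \<open>A letter is never its own inverse, so the two halves of a reduced word cannot cancel.\<close>

lemma lcp_winv_self:
  assumes "reduced w" "w \<noteq> []"
  shows "2 * lcp (winv w) w < length w"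
proof (rule ccontr)
  assume neg: "\<not> 2 * lcp (winv w) w < length w"
  \<comment> \<open>The middle position, or the left one of the two middle positions.\<close>
  define c where "c = (length w - 1) div 2"
  have L: "length w > 0" using assms(2) by simp
  have c: "c < lcp (winv w) w" "c < length w"
    using neg L unfolding c_def by linarith+
  have "take (lcp (winv w) w) (winv w) ! c = take (lcp (winv w) w) w ! c" using lcp_le(3) by metis
  then have "winv w ! c = w ! c" using c by simp
  moreover have "winv w ! c = inv_letter (w ! (length w - 1 - c))"
    using c unfolding winv_def by (simp add: rev_nth)
  ultimately have eq: "w ! c = inv_letter (w ! (length w - 1 - c))" by simp
  show False
  proof (cases "even (length w)")
    case True
    then obtain m where m: "length w = 2 * m" by (elim evenE)
    then have "c = m - 1" "m > 0" using L unfolding c_def by presburger+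
    then have *: "length w - 1 - c = Suc c" "Suc c < length w" unfolding m by arith+
    have "w ! Suc c \<noteq> inv_letter (w ! c)"
      using assms(1) *(2) unfolding reduced_successively successively_conv_nth by simp
    then show False using eq *(1) by simp
  next
    case False
    then obtain m where m: "length w = 2 * m + 1" by (elim oddE)
    then have "c = m" unfolding c_def by simp
    then have "length w - 1 - c = c" unfolding m by simp
    then show False using eq by simp
  qed
qed

section \<open>Nielsen's order on words\<close>

text \<open>Rounded up, so that for odd length the middle letter counts for the word as well as for
  its inverse.\<close>

definition half :: "'a list \<Rightarrow> 'a list" where
  "half w = take (Suc (length w) div 2) w"

text \<open>Letters are digits in base \<open>2 * n\<close>: a numerical form of the lexicographic
  order on words of equal length.\<close>

definition weight :: "nat \<Rightarrow> (nat \<times> bool) list \<Rightarrow> nat" where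
  "weight n w = foldl (\<lambda>s x. s * (2 * n) + (2 * fst x + of_bool (snd x))) 0 w"

lemma weight_append_less:
  assumes "weight n p < weight n q" "fst ` set d \<subseteq> {..<n}"
  shows "weight n (p @ d) < weight n (q @ d)"
  using assms(2)
proof (induction d rule: rev_induct)
  case Nil
  then show ?case using assms(1) by simp
next
  case (snoc x d)
  then have "weight n (p @ d) < weight n (q @ d)" "n > 0" by auto
  then have "weight n (p @ d) * (2 * n) < weight n (q @ d) * (2 * n)" by simp
  then show ?case by (simp add: weight_def)
qed

lemma weight_inj:
  assumes "weight n p = weight n q" "length p = length q" "fst ` set p \<subseteq> {..<n}" "fst ` set q \<subseteq> {..<n}"
  shows "p = q"
  using assms
proof (induction p arbitrary: q rule: rev_induct)
  case Nil
  then show ?case by simp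
next
  case (snoc x xs)
  obtain ys y where q: "q = ys @ [y]" using snoc.prems(2) by (cases q rule: rev_cases) simp_all
  let ?d = "\<lambda>x :: nat \<times> bool. 2 * fst x + of_bool (snd x) :: nat"
  have "fst x < n" "fst y < n" using snoc.prems(3,4) by (simp_all add: q)
  then have d: "?d x < 2 * n" "?d y < 2 * n" by (cases "snd x"; cases "snd y"; simp)+
  have eq: "weight n xs * (2 * n) + ?d x = weight n ys * (2 * n) + ?d y"
    using snoc.prems(1) by (simp add: q weight_def)
  have "(weight n xs * (2 * n) + ?d x) div (2 * n) = weight n xs" using d(1) by (subst div_mult_self3) simp_all
  moreover have "(weight n ys * (2 * n) + ?d y) div (2 * n) = weight n ys" using d(2) by (subst div_mult_self3) simp_all
  ultimately have w: "weight n xs = weight n ys" using eq by simp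
  then have e: "?d x = ?d y" using eq by simp
  have "snd x = snd y"
  proof -
    have "odd (?d x) = snd x" "odd (?d y) = snd y" by simp_all
    then show ?thesis using e by simp
  qed
  then have "x = y" using e by (simp add: prod_eq_iff)
  moreover have "xs = ys" using snoc.IH[OF w] snoc.prems by (simp add: q)
  ultimately show ?case by (simp add: q)
qed

locale free_group_rank = fixes n :: nat
begin

abbreviation "F \<equiv> free_group n"

sublocale group F by (rule group_free_group)

lemma mem_F: "w \<in> carrier F \<longleftrightarrow> reduced w \<and> fst ` set w \<subseteq> {..<n}"
  by (simp add: free_group_def)

lemma mult_F: "u \<otimes>\<^bsub>F\<^esub> v = foldr push u v" and one_F: "\<one>\<^bsub>F\<^esub> = []"
  unfolding free_group_def by simp_all

lemma fst_set_winv: "fst ` set (winv w) = fst ` set w"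
  by (simp add: winv_def image_image)

lemma winv_closed: "w \<in> carrier F \<Longrightarrow> winv w \<in> carrier F"
  by (simp add: mem_F reduced_winv fst_set_winv)

lemma inv_F: "w \<in> carrier F \<Longrightarrow> inv\<^bsub>F\<^esub> w = winv w"
proof (rule inv_equality)
  assume w: "w \<in> carrier F"
  have "foldr push (winv w) (foldr push w []) = []"
    unfolding winv_def by (rule foldr_push_left_inverse) simp
  then show "winv w \<otimes>\<^bsub>F\<^esub> w = \<one>\<^bsub>F\<^esub>" using w by (simp add: mult_F one_F mem_F foldr_push_Nil)
qed (auto intro: winv_closed)

lemma length_mult:
  assumes "g \<in> carrier F" "h \<in> carrier F"
  shows "length (g \<otimes>\<^bsub>F\<^esub> h) + 2 * lcp (winv g) h = length g + length h"
  using length_winv_push[of "winv g" h] assms winv_closed[of g] by (simp add: mult_F mem_F winv_simps)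

lemma letter_closed: "fst x < n \<Longrightarrow> [x] \<in> carrier F"
  by (simp add: mem_F)

lemma letter_mult_closed: "fst x < n \<Longrightarrow> fst y < n \<Longrightarrow> fst x \<noteq> fst y \<Longrightarrow> [x, y] \<in> carrier F"
  by (auto simp: mem_F inv_letter_def)

lemma Cons_F: "x # w \<in> carrier F \<Longrightarrow> x # w = [x] \<otimes>\<^bsub>F\<^esub> w \<and> [x] \<in> carrier F \<and> w \<in> carrier F"
  by (auto simp: mem_F mult_F push_reduced dest: reduced_tl)

lemma hom_letter:
  assumes "group_hom F K \<phi>" "fst x < n"
  shows "\<phi> [x] = (if snd x then \<phi> [(fst x, True)] else inv\<^bsub>K\<^esub> \<phi> [(fst x, True)])"
proof (cases "snd x")
  case True
  then show ?thesis by (cases x) simp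
next
  case False
  have "[x] = inv\<^bsub>F\<^esub> [(fst x, True)]"
    using inv_F[OF letter_closed, of "(fst x, True)"] assms(2) False
    by (cases x) (simp add: winv_simps inv_letter_def)
  then show ?thesis using group_hom.hom_inv[OF assms(1) letter_closed[of "(fst x, True)"]] assms(2) False by simp
qed

lemma hom_eqI:
  assumes \<phi>: "\<phi> \<in> hom F K" and \<psi>: "\<psi> \<in> hom F K" and K: "group K"
    and eq: "\<And>i. i < n \<Longrightarrow> \<phi> [(i, True)] = \<psi> [(i, True)]" and w: "w \<in> carrier F"
  shows "\<phi> w = \<psi> w"
proof -
  interpret K: group K by fact
  interpret \<phi>: group_hom F K \<phi> by (rule group_hom.intro[OF is_group K group_hom_axioms.intro[OF \<phi>]])
  interpret \<psi>: group_hom F K \<psi> by (rule group_hom.intro[OF is_group K group_hom_axioms.intro[OF \<psi>]])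
  have letter: "\<phi> [x] = \<psi> [x]" if "fst x < n" for x
    using hom_letter[OF \<phi>.group_hom_axioms that] hom_letter[OF \<psi>.group_hom_axioms that] eq[OF that] by simp
  show ?thesis using w
  proof (induction w)
    case Nil
    then show ?case using \<phi>.hom_one \<psi>.hom_one by (simp add: one_F)
  next
    case (Cons x w)
    note c = Cons_F[OF Cons.prems]
    then have "fst x < n" by (simp add: mem_F)
    then have "\<phi> ([x] \<otimes>\<^bsub>F\<^esub> w) = \<psi> ([x] \<otimes>\<^bsub>F\<^esub> w)"
      using c Cons.IH letter \<phi>.hom_mult[of "[x]" w] \<psi>.hom_mult[of "[x]" w] by simp
    then show ?case using c by simp
  qed
qed

end

section \<open>Cancellation under automorphisms without descent\<close>

context free_group_rank
begin

text \<open>What survives of \<open>g\<close> in the product is their common prefix; the rest of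
  \<open>g\<close> is what cancels against \<open>h\<close>.\<close>

lemma lcp_mult:
  assumes g: "g \<in> carrier F" and h: "h \<in> carrier F"
  shows "lcp g (g \<otimes>\<^bsub>F\<^esub> h) + lcp (winv g) h = length g"
proof -
  have "inv\<^bsub>F\<^esub> g \<otimes>\<^bsub>F\<^esub> (g \<otimes>\<^bsub>F\<^esub> h) = h" using g h by (simp add: inv_cancel)
  then have "winv g \<otimes>\<^bsub>F\<^esub> (g \<otimes>\<^bsub>F\<^esub> h) = h" using inv_F[OF g] by simp
  then show ?thesis
    using length_mult[OF winv_closed[OF g] m_closed[OF g h]] length_mult[OF g h] by (simp add: winv_simps)
qed

lemma autoD:
  assumes "\<phi> \<in> auto F"
  shows "group_hom F F \<phi>" "bij_betw \<phi> (carrier F) (carrier F)" "\<phi> \<in> extensional (carrier F)" "\<phi> \<in> hom F F"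
    "w \<in> carrier F \<Longrightarrow> \<phi> w \<in> carrier F"
proof -
  show 1: "bij_betw \<phi> (carrier F) (carrier F)" "\<phi> \<in> extensional (carrier F)" "\<phi> \<in> hom F F"
    using assms by (simp_all add: auto_def Bij_def)
  show "group_hom F F \<phi>" by (rule group_hom.intro[OF is_group is_group group_hom_axioms.intro[OF 1(3)]])
  show "\<phi> w \<in> carrier F" if "w \<in> carrier F" using hom_in_carrier[OF 1(3) that] .
qed

lemma auto_letter:
  assumes "\<phi> \<in> auto F" "fst x < n"
  shows "\<phi> [x] \<in> carrier F" "\<phi> [inv_letter x] = winv (\<phi> [x])" "\<phi> [x] \<noteq> []"
proof -
  note xF = letter_closed[OF assms(2)]
  interpret h: group_hom F F \<phi> by (rule autoD(1)[OF assms(1)])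
  show c: "\<phi> [x] \<in> carrier F" by (rule autoD(5)[OF assms(1) xF])
  have "[inv_letter x] = inv\<^bsub>F\<^esub> [x]" using inv_F[OF xF] by (simp add: winv_simps)
  then show "\<phi> [inv_letter x] = winv (\<phi> [x])" using h.hom_inv[OF xF] inv_F[OF c] by simp
  show "\<phi> [x] \<noteq> []"
  proof
    assume "\<phi> [x] = []"
    then have "\<phi> [x] = \<phi> []" using h.hom_one by (simp add: one_F)
    moreover have "[] \<in> carrier F" using one_closed by (simp add: one_F)
    ultimately have "[x] = []"
      using bij_betw_imp_inj_on[OF autoD(2)[OF assms(1)]] xF by (simp add: inj_on_eq_iff)
    then show False by simp
  qed
qed

text \<open>Nielsen's order compares the initial halves of a word and of its inverse. The sum of
  both weights is invariant under inversion and drops when one half drops and the other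
  stays.\<close>

definition wt :: "(nat \<times> bool) list \<Rightarrow> nat" where
  "wt w = weight n (half w) + weight n (half (winv w))"

lemma wt_winv: "wt (winv w) = wt w"
  by (simp add: wt_def winv_simps add.commute)

text \<open>\<open>a\<close> and \<open>b\<close> range over basis letters and their inverses, so
  left multiplications of basis images are covered as well as right ones.\<close>

definition no_descent :: "((nat \<times> bool) list \<Rightarrow> (nat \<times> bool) list) \<Rightarrow> bool" where
  "no_descent \<phi> \<longleftrightarrow> (\<forall>a b. fst a < n \<longrightarrow> fst b < n \<longrightarrow> fst a \<noteq> fst b \<longrightarrow>
    \<not> (length (\<phi> [a] \<otimes>\<^bsub>F\<^esub> \<phi> [b]) < length (\<phi> [a]) \<or>
       length (\<phi> [a] \<otimes>\<^bsub>F\<^esub> \<phi> [b]) = length (\<phi> [a]) \<and> wt (\<phi> [a] \<otimes>\<^bsub>F\<^esub> \<phi> [b]) < wt (\<phi> [a])))"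

text \<open>If no product is shorter than its left factor, at most half of the right factor cancels;
  inverse letters give the same for the left factor. For \<open>a = b\<close> the bound is strict,
  since less than half of a nonempty reduced word cancels in its square.\<close>

lemma no_descent_lcp:
  assumes \<phi>: "\<phi> \<in> auto F" and nd: "no_descent \<phi>" and ab: "fst a < n" "fst b < n" "b \<noteq> inv_letter a"
  shows "2 * lcp (winv (\<phi> [a])) (\<phi> [b]) \<le> length (\<phi> [b])"
    and "2 * lcp (winv (\<phi> [a])) (\<phi> [b]) \<le> length (\<phi> [a])"
    and "a = b \<Longrightarrow> 2 * lcp (winv (\<phi> [a])) (\<phi> [b]) < length (\<phi> [b])"
proof -
  have main: "2 * lcp (winv (\<phi> [a])) (\<phi> [b]) \<le> length (\<phi> [b])" if "fst a < n" "fst b < n" "fst a \<noteq> fst b" for a b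
  proof -
    have "length (\<phi> [a]) \<le> length (\<phi> [a] \<otimes>\<^bsub>F\<^esub> \<phi> [b])"
      using nd that unfolding no_descent_def by (metis not_le)
    then show ?thesis
      using length_mult[OF auto_letter(1)[OF \<phi> that(1)] auto_letter(1)[OF \<phi> that(2)]] by simp
  qed
  have self: "2 * lcp (winv (\<phi> [a])) (\<phi> [a]) < length (\<phi> [a])"
    using auto_letter[OF \<phi> ab(1)] by (intro lcp_winv_self) (simp_all add: mem_F)
  show "2 * lcp (winv (\<phi> [a])) (\<phi> [b]) < length (\<phi> [b])" if "a = b" using self that by simp
  have "2 * lcp (winv (\<phi> [a])) (\<phi> [b]) \<le> length (\<phi> [b]) \<and> 2 * lcp (winv (\<phi> [a])) (\<phi> [b]) \<le> length (\<phi> [a])"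
  proof (cases "fst a = fst b")
    case True
    then have "a = b" using ab(3) by (auto simp: inv_letter_def prod_eq_iff)
    then show ?thesis using self by simp
  next
    case False
    then have "2 * lcp (winv (\<phi> [inv_letter b])) (\<phi> [inv_letter a]) \<le> length (\<phi> [inv_letter a])"
      using ab by (intro main) auto
    then have "2 * lcp (winv (\<phi> [a])) (\<phi> [b]) \<le> length (\<phi> [a])"
      using auto_letter(2)[OF \<phi>] ab by (simp add: winv_simps lcp_commute)
    then show ?thesis using main[OF ab(1,2) False] by simp
  qed
  then show "2 * lcp (winv (\<phi> [a])) (\<phi> [b]) \<le> length (\<phi> [b])" "2 * lcp (winv (\<phi> [a])) (\<phi> [b]) \<le> length (\<phi> [a])"
    by simp_all
qed

text \<open>The exchanged prefix fits into the initial half of the word, so the initial half of the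
  inverse does not change.\<close>

lemma wt_less:
  assumes "weight n p < weight n q" "length p = length q" "2 * length p \<le> length (q @ d)" "fst ` set d \<subseteq> {..<n}"
  shows "wt (p @ d) < wt (q @ d)"
proof -
  let ?h = "Suc (length q + length d) div 2"
  have h: "length q \<le> ?h" "?h \<le> length d" using assms(2,3) by simp_all
  have "fst ` set (take (?h - length q) d) \<subseteq> {..<n}" using assms(4) set_take_subset[of _ d] by blast
  from weight_append_less[OF assms(1) this] have "weight n (half (p @ d)) < weight n (half (q @ d))"
    using h assms(2) by (simp add: half_def)
  moreover have "half (winv (p @ d)) = half (winv (q @ d))"
    using h assms(2) by (simp add: half_def winv_simps)
  ultimately show ?thesis by (simp add: wt_def)
qed

text \<open>If the first half \<open>p\<close> of \<open>\<phi> b = p q\<inverse>\<close> has smaller weight than \<open>q\<close>, then replacing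
  \<open>\<phi> c = q d\<close> by \<open>\<phi> b \<phi> c = p d\<close> keeps the length and lowers the weight.\<close>

lemma no_descent_tie:
  assumes \<phi>: "\<phi> \<in> auto F" and nd: "no_descent \<phi>" and bc: "fst b < n" "fst c < n" "fst b \<noteq> fst c"
    and m: "m = lcp (winv (\<phi> [b])) (\<phi> [c])" "length (\<phi> [b]) = 2 * m"
  shows "\<not> weight n (take m (\<phi> [b])) < weight n (take m (winv (\<phi> [b])))"
proof
  assume less: "weight n (take m (\<phi> [b])) < weight n (take m (winv (\<phi> [b])))"
  define p q d where "p = take m (\<phi> [b])" and "q = take m (winv (\<phi> [b]))" and "d = drop m (\<phi> [c])"
  note B = auto_letter[OF \<phi> bc(1)] and C = auto_letter[OF \<phi> bc(2)]
  have "c \<noteq> inv_letter b" using bc(3) by auto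
  note mc = no_descent_lcp(1)[OF \<phi> nd bc(1,2) this, folded m(1)]
  have qc: "q = take m (\<phi> [c])" unfolding q_def m(1) by (rule lcp_le(3))
  have c: "\<phi> [c] = q @ d" by (simp add: qc d_def)
  have len: "length p = m" "length q = m" using m(2) by (simp_all add: p_def q_def winv_simps)
  have "winv q = drop m (\<phi> [b])" unfolding q_def winv_def using m(2)
    by (simp add: take_rev rev_map[symmetric] drop_map comp_def)
  then have b: "\<phi> [b] = p @ winv q" by (simp add: p_def)
  have red: "reduced (q @ d)" using C(1) c by (simp add: mem_F)
  then have "foldr push q d = q @ d" by (rule foldr_push_reduced_append)
  moreover have "reduced d" using red unfolding reduced_successively successively_append_iff by simp
  ultimately have "foldr push (winv q) (q @ d) = d"
    using foldr_push_left_inverse[of d q] by (simp add: winv_def)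
  then have pd: "\<phi> [b] \<otimes>\<^bsub>F\<^esub> \<phi> [c] = foldr push p d" unfolding mult_F b c by simp
  have "length (\<phi> [b] \<otimes>\<^bsub>F\<^esub> \<phi> [c]) + 2 * m = 2 * m + length (\<phi> [c])"
    using length_mult[OF B(1) C(1)] m by simp
  then have "length (foldr push p d) = length p + length d" unfolding pd by (simp add: len c)
  then have eq: "\<phi> [b] \<otimes>\<^bsub>F\<^esub> \<phi> [c] = p @ d" using length_foldr_push[of p d] pd by simp
  \<comment> \<open>Descent is defined for multiplication on the right, so the replacement of
    \<open>\<phi> [c]\<close> is read through inverses.\<close>
  have "\<phi> [inv_letter c] \<otimes>\<^bsub>F\<^esub> \<phi> [inv_letter b] = inv\<^bsub>F\<^esub> (\<phi> [b] \<otimes>\<^bsub>F\<^esub> \<phi> [c])"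
    unfolding inv_mult_group[OF B(1) C(1)] B(2) C(2) inv_F[OF B(1)] inv_F[OF C(1)] ..
  also have "\<dots> = winv (p @ d)" using inv_F[OF m_closed[OF B(1) C(1)]] eq by simp
  finally have prod: "\<phi> [inv_letter c] \<otimes>\<^bsub>F\<^esub> \<phi> [inv_letter b] = winv (p @ d)" .
  have ic: "\<phi> [inv_letter c] = winv (q @ d)" using C(2) c by simp
  have "length (winv (p @ d)) = length (winv (q @ d))" by (simp add: winv_simps len)
  moreover have "wt (winv (p @ d)) < wt (winv (q @ d))"
    unfolding wt_winv
  proof (rule wt_less)
    show "fst ` set d \<subseteq> {..<n}" using C(1) c by (auto simp: mem_F)
  qed (use less mc len c in \<open>simp_all add: p_def[symmetric] q_def[symmetric]\<close>)
  ultimately show False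
    using nd bc unfolding no_descent_def
    by (metis prod ic inv_letter_simps(2))
qed

text \<open>The middle word could only be used up if its two halves cancel to either side. Comparing
  weights from both sides shows that its first half equals the first half of its inverse, which no
  nonempty reduced word allows.\<close>

lemma no_descent_lcp_sum:
  assumes \<phi>: "\<phi> \<in> auto F" and nd: "no_descent \<phi>" and abc: "fst a < n" "fst b < n" "fst c < n"
    and ne: "b \<noteq> inv_letter a" "c \<noteq> inv_letter b"
  shows "lcp (winv (\<phi> [a])) (\<phi> [b]) + lcp (winv (\<phi> [b])) (\<phi> [c]) < length (\<phi> [b])"
proof (rule ccontr)
  let ?V = "\<lambda>x. \<phi> [x]"
  define m where "m = lcp (winv (?V b)) (?V c)"
  assume neg: "\<not> ?thesis"
  note ab = no_descent_lcp[OF \<phi> nd abc(1,2) ne(1)] and bc = no_descent_lcp[OF \<phi> nd abc(2,3) ne(2)]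
  have m: "length (?V b) = 2 * m" "lcp (winv (?V a)) (?V b) = m" using neg ab(1) bc(2) unfolding m_def by linarith+
  have "a \<noteq> b" using ab(3) m by auto
  then have fab: "fst a \<noteq> fst b" using ne(1) by (auto simp: inv_letter_def prod_eq_iff)
  have "b \<noteq> c" using bc(3) m m_def by auto
  then have fbc: "fst b \<noteq> fst c" using ne(2) by (auto simp: inv_letter_def prod_eq_iff)
  have 1: "\<not> weight n (take m (?V b)) < weight n (take m (winv (?V b)))"
    by (rule no_descent_tie[OF \<phi> nd abc(2,3) fbc m_def m(1)])
  note A = auto_letter[OF \<phi> abc(1)] and B = auto_letter[OF \<phi> abc(2)]
  have "\<not> weight n (take m (?V (inv_letter b))) < weight n (take m (winv (?V (inv_letter b))))"
    by (rule no_descent_tie[OF \<phi> nd, of "inv_letter b" "inv_letter a"])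
      (use abc fab m in \<open>simp_all add: A(2) B(2) winv_simps lcp_commute\<close>)
  then have 2: "\<not> weight n (take m (winv (?V b))) < weight n (take m (?V b))" by (simp add: B(2) winv_simps)
  have Bn: "fst ` set (?V b) \<subseteq> {..<n}" using B(1) by (simp add: mem_F)
  have "take m (?V b) = take m (winv (?V b))"
  proof (rule weight_inj)
    show "fst ` set (take m (?V b)) \<subseteq> {..<n}" using Bn set_take_subset[of m "?V b"] by blast
    show "fst ` set (take m (winv (?V b))) \<subseteq> {..<n}"
      using Bn set_take_subset[of m "winv (?V b)"] fst_set_winv[of "?V b"] by blast
  qed (use 1 2 in \<open>simp_all add: winv_simps\<close>)
  then have "m \<le> lcp (winv (?V b)) (?V b)" using m(1) by (simp add: le_lcp_iff winv_simps)
  moreover have "2 * lcp (winv (?V b)) (?V b) < length (?V b)"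
    using B by (intro lcp_winv_self) (simp_all add: mem_F)
  ultimately show False using m(1) by simp
qed

text \<open>Cancellation on the two sides of each image \<open>\<phi> [x]\<close> leaves at least
  one letter of it, so every letter of \<open>w\<close> contributes.\<close>

lemma no_descent_length:
  assumes \<phi>: "\<phi> \<in> auto F" and nd: "no_descent \<phi>" and w: "w \<in> carrier F"
  shows "length w \<le> length (\<phi> w)"
proof (cases w)
  case (Cons x w')
  interpret h: group_hom F F \<phi> by (rule autoD(1)[OF \<phi>])
  let ?V = "\<lambda>x. \<phi> [x]"
  have Nil: "\<phi> [] = []" using h.hom_one by (simp add: one_F)
  \<comment> \<open>Strengthened for the induction: the last conjunct says that cancellation with a
    preceding letter and with the rest together do not use up \<open>\<phi> [x]\<close>.\<close>
  have "2 * lcp (winv (?V x)) (\<phi> w) \<le> length (?V x) \<and>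
      length w + length (?V x) \<le> length (\<phi> (x # w)) + lcp (winv (?V x)) (\<phi> w) \<and>
      (\<forall>a. fst a < n \<longrightarrow> x \<noteq> inv_letter a \<longrightarrow> lcp (winv (?V a)) (?V x) + lcp (winv (?V x)) (\<phi> w) < length (?V x))"
    if "x # w \<in> carrier F" for x w
    using that
  proof (induction w arbitrary: x)
    case Nil
    then have x: "fst x < n" by (simp add: mem_F)
    have "lcp (winv (?V a)) (?V x) < length (?V x)" if "fst a < n" "x \<noteq> inv_letter a" for a
      using no_descent_lcp(1)[OF \<phi> nd that(1) x that(2)] auto_letter(3)[OF \<phi> x] by (cases "?V x") auto
    then show ?case using \<open>\<phi> [] = []\<close> by simp
  next
    case (Cons y w)
    let ?t = "lcp (winv (?V y)) (\<phi> w)" and ?c = "lcp (winv (?V x)) (?V y)"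
    note cx = Cons_F[OF Cons.prems]
    then have yw: "y # w \<in> carrier F" by simp
    note cy = Cons_F[OF yw]
    have x: "fst x < n" and y: "fst y < n" and xy: "y \<noteq> inv_letter x" using Cons.prems by (simp_all add: mem_F)
    note IH = Cons.IH[OF yw]
    have ct: "?c + ?t < length (?V y)" using IH x xy by blast
    have wF: "\<phi> w \<in> carrier F" "\<phi> (y # w) \<in> carrier F" using cy yw autoD(5)[OF \<phi>] by auto
    have e: "\<phi> (y # w) = ?V y \<otimes>\<^bsub>F\<^esub> \<phi> w" using cy h.hom_mult[of "[y]" w] by simp
    have k: "lcp (?V y) (\<phi> (y # w)) + ?t = length (?V y)"
      unfolding e by (rule lcp_mult[OF auto_letter(1)[OF \<phi> y] wF(1)])
    \<comment> \<open>More of \<open>\<phi> [y]\<close> survives in \<open>\<phi> (y # w)\<close>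
      than cancels against \<open>\<phi> [x]\<close>, so by the ultrametric inequality
      \<open>\<phi> (y # w)\<close> cancels like \<open>\<phi> [y]\<close>.\<close>
    have t: "lcp (winv (?V x)) (\<phi> (y # w)) = ?c"
      using lcp_ultrametric[of "winv (?V x)" "?V y" "\<phi> (y # w)"]
        lcp_ultrametric[of "winv (?V x)" "\<phi> (y # w)" "?V y"] lcp_commute[of "\<phi> (y # w)" "?V y"] k ct by linarith
    have "\<phi> (x # y # w) = ?V x \<otimes>\<^bsub>F\<^esub> \<phi> (y # w)" using cx h.hom_mult[of "[x]" "y # w"] by simp
    then have len: "length (\<phi> (x # y # w)) + 2 * ?c = length (?V x) + length (\<phi> (y # w))"
      using length_mult[OF auto_letter(1)[OF \<phi> x] wF(2)] t by simp
    show ?case unfolding t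
    proof (intro conjI allI impI)
      show "2 * ?c \<le> length (?V x)" by (rule no_descent_lcp(2)[OF \<phi> nd x y xy])
      have "length w + length (?V y) \<le> length (\<phi> (y # w)) + ?t" using IH by blast
      then show "length (y # w) + length (?V x) \<le> length (\<phi> (x # y # w)) + ?c"
        using len ct by simp
      show "lcp (winv (?V a)) (?V x) + ?c < length (?V x)" if "fst a < n" "x \<noteq> inv_letter a" for a
        by (rule no_descent_lcp_sum[OF \<phi> nd that(1) x y that(2) xy])
    qed
  qed
  from this[of x w'] have *: "2 * lcp (winv (?V x)) (\<phi> w') \<le> length (?V x)"
    "length w' + length (?V x) \<le> length (\<phi> w) + lcp (winv (?V x)) (\<phi> w')" using w Cons by simp_all
  have "fst x < n" using w Cons by (simp add: mem_F)
  then have "length (?V x) > 0" using auto_letter(3)[OF \<phi>] by simp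
  then have "Suc (length w') \<le> length (\<phi> w)" using * by linarith
  then show ?thesis using Cons by simp
qed simp

end

section \<open>Transvections and finite generation of the automorphism group\<close>

context free_group_rank
begin

lemma hom_comp: "f \<in> hom F F \<Longrightarrow> g \<in> hom F F \<Longrightarrow> (\<lambda>w. g (f w)) \<in> hom F F"
  by (auto simp: hom_def Pi_iff)

lemma auto_restrict:
  assumes f: "f \<in> hom F F" and g: "g \<in> hom F F"
    and fg: "\<And>i. i < n \<Longrightarrow> f (g [(i, True)]) = [(i, True)]" and gf: "\<And>i. i < n \<Longrightarrow> g (f [(i, True)]) = [(i, True)]"
  shows "restrict f (carrier F) \<in> auto F"
proof -
  have id: "(\<lambda>w. w) \<in> hom F F" by (auto simp: hom_def)
  have fg': "f (g w) = w" if "w \<in> carrier F" for w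
    using hom_eqI[OF hom_comp[OF g f] id is_group fg that] .
  have gf': "g (f w) = w" if "w \<in> carrier F" for w
    using hom_eqI[OF hom_comp[OF f g] id is_group gf that] .
  have "bij_betw f (carrier F) (carrier F)"
    using hom_in_carrier[OF f] hom_in_carrier[OF g] fg' gf' by (intro bij_betw_byWitness[where f' = g]) auto
  then have "bij_betw (restrict f (carrier F)) (carrier F) (carrier F)"
    by (rule iffD1[OF bij_betw_cong, rotated]) simp
  moreover have "restrict f (carrier F) \<in> hom F F" using f by (auto simp: hom_def Pi_iff)
  ultimately show ?thesis by (simp add: auto_def Bij_def)
qed

text \<open>The image of the basis element belonging to the signed letter \<open>a\<close> when
  \<open>a\<close> is sent to \<open>[a, c]\<close>; for an inverse letter this word is
  inverted.\<close>

definition transvection_word :: "nat \<times> bool \<Rightarrow> nat \<times> bool \<Rightarrow> (nat \<times> bool) list" where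
  "transvection_word a c = (if snd a then [a, c] else [inv_letter c, inv_letter a])"

lemma transvection:
  assumes a: "fst a < n" "fst b < n" "fst a \<noteq> fst b"
  shows "\<exists>\<nu>\<in>auto F. (\<forall>k<n. k \<noteq> fst a \<longrightarrow> \<nu> [(k, True)] = [(k, True)]) \<and>
    \<nu> [a] = [a, b] \<and> \<nu> [(fst a, True)] = transvection_word a b"
proof -
  have tF: "transvection_word a c \<in> carrier F" if "fst c < n" "fst c \<noteq> fst a" for c
  proof -
    have "fst (inv_letter c) \<noteq> fst (inv_letter a)" using that by simp
    then show ?thesis using that a(1) letter_mult_closed[of a c] letter_mult_closed[of "inv_letter c" "inv_letter a"]
      by (simp add: transvection_word_def)
  qed
  have ex: "\<exists>h\<in>hom F F. (\<forall>k<n. k \<noteq> fst a \<longrightarrow> h [(k, True)] = [(k, True)]) \<and> h [a] = [a, c] \<and>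
      (\<forall>x. fst x < n \<longrightarrow> fst x \<noteq> fst a \<longrightarrow> h [x] = [x]) \<and> h [(fst a, True)] = transvection_word a c"
    if c: "fst c < n" "fst c \<noteq> fst a" for c
  proof -
    have "(\<lambda>k. if k = fst a then transvection_word a c else [(k, True)]) \<in> {..<n} \<rightarrow> carrier F"
      by (intro Pi_I) (simp add: tF[OF c] letter_closed)
    from free_group_universal[OF is_group this]
    obtain h where h: "h \<in> hom F F" "\<forall>k<n. h [(k, True)] = (if k = fst a then transvection_word a c else [(k, True)])"
      by blast
    have gh: "group_hom F F h" by (rule group_hom.intro[OF is_group is_group group_hom_axioms.intro[OF h(1)]])
    have ha: "h [(fst a, True)] = transvection_word a c" using h(2) a(1) by simp
    have "h [a] = [a, c]"
    proof (cases "snd a")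
      case True
      then show ?thesis using ha by (cases a) (simp add: transvection_word_def)
    next
      case False
      then have "h [a] = inv\<^bsub>F\<^esub> transvection_word a c" using hom_letter[OF gh a(1)] ha by simp
      also have "\<dots> = [a, c]" unfolding inv_F[OF tF[OF c]] using False by (simp add: transvection_word_def winv_def)
      finally show ?thesis .
    qed
    moreover have "h [x] = [x]" if x: "fst x < n" "fst x \<noteq> fst a" for x
    proof (cases "snd x")
      case True
      then show ?thesis using h(2) x by (cases x) simp
    next
      case False
      then have "h [x] = inv\<^bsub>F\<^esub> [(fst x, True)]" using hom_letter[OF gh x(1)] h(2) x by simp
      also have "\<dots> = [x]" using inv_F[OF letter_closed, of "(fst x, True)"] x False
        by (cases x) (simp add: winv_simps inv_letter_def)
      finally show ?thesis .
    qed
    ultimately show ?thesis using h ha by (intro bexI[OF _ h(1)]) simp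
  qed
  have b: "fst b < n" "fst b \<noteq> fst a" and b': "fst (inv_letter b) < n" "fst (inv_letter b) \<noteq> fst a" using a by auto
  \<comment> \<open>The maps for \<open>c\<close> and for its inverse undo each other. This is
    checked on \<open>[a]\<close> and carried over to the basis element when \<open>a\<close> is an
    inverse letter.\<close>
  have inverse: "h (h' [(i, True)]) = [(i, True)]"
    if h: "h \<in> hom F F" "\<forall>k<n. k \<noteq> fst a \<longrightarrow> h [(k, True)] = [(k, True)]" "h [a] = [a, c]"
        "\<forall>x. fst x < n \<longrightarrow> fst x \<noteq> fst a \<longrightarrow> h [x] = [x]"
      and h': "h' \<in> hom F F" "\<forall>k<n. k \<noteq> fst a \<longrightarrow> h' [(k, True)] = [(k, True)]" "h' [a] = [a, inv_letter c]"
      and c: "fst c < n" "fst c \<noteq> fst a" and i: "i < n" for h h' c i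
  proof (cases "i = fst a")
    case False
    then show ?thesis using h(2) h'(2) i by simp
  next
    case True
    have "[a, inv_letter c] \<in> carrier F" using letter_mult_closed[of a "inv_letter c"] a(1) c by simp
    note e = Cons_F[OF this]
    have "h (h' [a]) = h [a] \<otimes>\<^bsub>F\<^esub> h [inv_letter c]"
      using h'(3) e hom_mult[OF h(1), of "[a]" "[inv_letter c]"] by simp
    also have "h [inv_letter c] = [inv_letter c]" using spec[OF h(4), of "inv_letter c"] c by simp
    also have "h [a] \<otimes>\<^bsub>F\<^esub> [inv_letter c] = [a]" using h(3) by (simp add: mult_F)
    finally have ha: "h (h' [a]) = [a]" .
    show ?thesis
    proof (cases "snd a")
      case True
      then show ?thesis using ha \<open>i = fst a\<close> by (cases a) simp
    next
      case False
      have gh: "group_hom F F (\<lambda>w. h (h' w))"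
        by (rule group_hom.intro[OF is_group is_group group_hom_axioms.intro[OF hom_comp[OF h'(1) h(1)]]])
      have ia: "[(i, True)] = inv\<^bsub>F\<^esub> [a]"
        using inv_F[OF letter_closed[OF a(1)]] False True by (cases a) (simp add: winv_simps inv_letter_def)
      show ?thesis
        unfolding ia using group_hom.hom_inv[OF gh letter_closed[OF a(1)]] ha by simp
    qed
  qed
  obtain h where h: "h \<in> hom F F" "\<forall>k<n. k \<noteq> fst a \<longrightarrow> h [(k, True)] = [(k, True)]" "h [a] = [a, b]"
    "\<forall>x. fst x < n \<longrightarrow> fst x \<noteq> fst a \<longrightarrow> h [x] = [x]" "h [(fst a, True)] = transvection_word a b"
    using ex[OF b] by blast
  obtain h' where h': "h' \<in> hom F F" "\<forall>k<n. k \<noteq> fst a \<longrightarrow> h' [(k, True)] = [(k, True)]" "h' [a] = [a, inv_letter b]"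
    "\<forall>x. fst x < n \<longrightarrow> fst x \<noteq> fst a \<longrightarrow> h' [x] = [x]"
    using ex[OF b'] by blast
  have "restrict h (carrier F) \<in> auto F"
    by (rule auto_restrict[OF h(1) h'(1) inverse[OF h(1-4) h'(1-3) b] inverse[OF h'(1-4) h(1,2) _ b']])
      (simp_all add: h(3))
  then show ?thesis
    using h letter_closed a(1) by (intro bexI[of _ "restrict h (carrier F)"]) auto
qed

abbreviation "Aut \<equiv> AutoGroup F"

lemma group_Aut: "group Aut"
  by (rule AutoGroup)

lemma carrier_Aut: "carrier Aut = auto F"
  by (simp add: AutoGroup_def)

lemma mult_Aut: "\<phi> \<in> auto F \<Longrightarrow> \<psi> \<in> auto F \<Longrightarrow> \<phi> \<otimes>\<^bsub>Aut\<^esub> \<psi> = compose (carrier F) \<phi> \<psi>"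
  by (simp add: AutoGroup_def BijGroup_def auto_def)

lemma one_Aut: "\<one>\<^bsub>Aut\<^esub> = (\<lambda>w\<in>carrier F. w)"
  by (simp add: AutoGroup_def BijGroup_def)

text \<open>Length 2 admits the transvections; signed permutations of the basis, with images of
  length 1, are included too.\<close>

definition short_autos :: "((nat \<times> bool) list \<Rightarrow> (nat \<times> bool) list) set" where
  "short_autos = {\<phi> \<in> auto F. \<forall>i<n. length (\<phi> [(i, True)]) \<le> 2}"

lemma finite_short_autos: "finite short_autos"
proof -
  let ?W = "{w. set w \<subseteq> {..<n} \<times> UNIV \<and> length w \<le> 2} :: (nat \<times> bool) list set"
  have "(\<lambda>\<phi>. \<lambda>i\<in>{..<n}. \<phi> [(i, True)]) ` short_autos \<subseteq> {..<n} \<rightarrow>\<^sub>E ?W"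
  proof (intro image_subsetI restrict_PiE_iff[THEN iffD2] ballI)
    fix \<phi> i assume \<phi>: "\<phi> \<in> short_autos" and i: "i \<in> {..<n}"
    then have "\<phi> [(i, True)] \<in> carrier F" using autoD(5)[OF _ letter_closed[of "(i, True)"]] by (simp add: short_autos_def)
    then show "\<phi> [(i, True)] \<in> ?W" using \<phi> i by (auto simp: short_autos_def mem_F)
  qed
  moreover have "finite ({..<n} \<rightarrow>\<^sub>E ?W)" by (intro finite_PiE finite_lists_length_le) auto
  ultimately have "finite ((\<lambda>\<phi>. \<lambda>i\<in>{..<n}. \<phi> [(i, True)]) ` short_autos)" using finite_subset by blast
  moreover have "inj_on (\<lambda>\<phi>. \<lambda>i\<in>{..<n}. \<phi> [(i, True)]) short_autos"
  proof (rule inj_onI)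
    fix \<phi> \<psi> assume \<phi>: "\<phi> \<in> short_autos" and \<psi>: "\<psi> \<in> short_autos"
      and eq: "(\<lambda>i\<in>{..<n}. \<phi> [(i, True)]) = (\<lambda>i\<in>{..<n}. \<psi> [(i, True)])"
    have a: "\<phi> \<in> auto F" "\<psi> \<in> auto F" using \<phi> \<psi> by (simp_all add: short_autos_def)
    have "\<phi> [(i, True)] = \<psi> [(i, True)]" if "i < n" for i using fun_cong[OF eq, of i] that by simp
    from hom_eqI[OF autoD(4)[OF a(1)] autoD(4)[OF a(2)] is_group this]
    show "\<phi> = \<psi>" by (rule extensionalityI[OF autoD(3)[OF a(1)] autoD(3)[OF a(2)]])
  qed
  ultimately show ?thesis by (rule finite_imageD)
qed

text \<open>An automorphism without descent does not shorten words, so its inverse sends basis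
  elements to words of length at most 1.\<close>

lemma auto_of_no_descent:
  assumes \<phi>: "\<phi> \<in> auto F" and nd: "no_descent \<phi>"
  shows "\<phi> \<in> generate Aut short_autos"
proof -
  interpret A: group Aut by (rule group_Aut)
  have \<phi>A: "\<phi> \<in> carrier Aut" using \<phi> by (simp add: carrier_Aut)
  let ?\<psi> = "inv\<^bsub>Aut\<^esub> \<phi>"
  have \<psi>: "?\<psi> \<in> auto F" using A.inv_closed[OF \<phi>A] by (simp add: carrier_Aut)
  have "\<phi> \<otimes>\<^bsub>Aut\<^esub> ?\<psi> = \<one>\<^bsub>Aut\<^esub>" using \<phi>A by simp
  then have c: "compose (carrier F) \<phi> ?\<psi> = (\<lambda>w\<in>carrier F. w)" unfolding mult_Aut[OF \<phi> \<psi>] one_Aut .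
  have "length (?\<psi> [(i, True)]) \<le> 2" if "i < n" for i
  proof -
    have x: "[(i, True)] \<in> carrier F" using that by (simp add: letter_closed)
    have "\<phi> (?\<psi> [(i, True)]) = [(i, True)]" using fun_cong[OF c, of "[(i, True)]"] x by (simp add: compose_def)
    then show ?thesis using no_descent_length[OF \<phi> nd autoD(5)[OF \<psi> x]] by simp
  qed
  then have "?\<psi> \<in> short_autos" using \<psi> by (simp add: short_autos_def)
  then have "inv\<^bsub>Aut\<^esub> ?\<psi> \<in> generate Aut short_autos" by (rule generate.inv)
  then show ?thesis using \<phi>A by simp
qed

text \<open>Lexicographic descent: first the total length, then the total weight of the initial halves.\<close>

lemma generate_short_autos:
  assumes "\<phi> \<in> auto F"
  shows "\<phi> \<in> generate Aut short_autos"
  using assms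
proof (induction \<phi> rule: wf_induct_rule[OF wf_measures, of "[\<lambda>\<phi>. \<Sum>k<n. length (\<phi> [(k, True)]), \<lambda>\<phi>. \<Sum>k<n. wt (\<phi> [(k, True)])]", case_names less])
  case (less \<phi>)
  interpret A: group Aut by (rule group_Aut)
  note \<phi> = less.prems
  show ?case
  proof (cases "no_descent \<phi>")
    case True
    then show ?thesis by (rule auto_of_no_descent[OF \<phi>])
  next
    case False
    then obtain a b where ab: "fst a < n" "fst b < n" "fst a \<noteq> fst b"
      and desc: "length (\<phi> [a] \<otimes>\<^bsub>F\<^esub> \<phi> [b]) < length (\<phi> [a]) \<or>
       length (\<phi> [a] \<otimes>\<^bsub>F\<^esub> \<phi> [b]) = length (\<phi> [a]) \<and> wt (\<phi> [a] \<otimes>\<^bsub>F\<^esub> \<phi> [b]) < wt (\<phi> [a])"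
      unfolding no_descent_def by blast
    obtain \<nu> where \<nu>: "\<nu> \<in> auto F" "\<forall>k<n. k \<noteq> fst a \<longrightarrow> \<nu> [(k, True)] = [(k, True)]" "\<nu> [a] = [a, b]"
      "\<nu> [(fst a, True)] = transvection_word a b"
      using transvection[OF ab] by blast
    define \<psi> where "\<psi> = \<phi> \<otimes>\<^bsub>Aut\<^esub> \<nu>"
    have \<psi>: "\<psi> \<in> auto F" using A.m_closed[of \<phi> \<nu>] \<phi> \<nu>(1) by (simp add: \<psi>_def carrier_Aut)
    have \<psi>_eq: "\<psi> w = \<phi> (\<nu> w)" if "w \<in> carrier F" for w
      using that by (simp add: \<psi>_def mult_Aut[OF \<phi> \<nu>(1)] compose_def)
    have "\<psi> [a] = \<phi> ([a] \<otimes>\<^bsub>F\<^esub> [b])"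
      using \<psi>_eq[OF letter_closed[OF ab(1)]] \<nu>(3) Cons_F[OF letter_mult_closed[OF ab]] by simp
    also have "\<dots> = \<phi> [a] \<otimes>\<^bsub>F\<^esub> \<phi> [b]"
      by (rule hom_mult[OF autoD(4)[OF \<phi>] letter_closed[OF ab(1)] letter_closed[OF ab(2)]])
    finally have \<psi>a: "\<psi> [a] = \<phi> [a] \<otimes>\<^bsub>F\<^esub> \<phi> [b]" .
    \<comment> \<open>The descent is stated for the signed letter \<open>a\<close>, the measures for
      basis elements; inversion changes neither length nor weight.\<close>
    have sign: "length (\<theta> [(fst a, True)]) = length (\<theta> [a]) \<and> wt (\<theta> [(fst a, True)]) = wt (\<theta> [a])"
      if "\<theta> \<in> auto F" for \<theta>
    proof (cases "snd a")
      case True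
      then show ?thesis by (cases a) simp
    next
      case False
      then have "(fst a, True) = inv_letter a" by (simp add: inv_letter_def)
      then show ?thesis using auto_letter(2)[OF that ab(1)] by (simp add: winv_simps wt_winv)
    qed
    have split: "(\<Sum>k<n. f (\<theta> [(k, True)])) = f (\<theta> [(fst a, True)]) + (\<Sum>k\<in>{..<n} - {fst a}. f (\<theta> [(k, True)]))"
      for f :: "(nat \<times> bool) list \<Rightarrow> nat" and \<theta> :: "(nat \<times> bool) list \<Rightarrow> (nat \<times> bool) list"
      using ab(1) by (intro sum.remove) auto
    have rest: "(\<Sum>k\<in>{..<n} - {fst a}. f (\<psi> [(k, True)])) = (\<Sum>k\<in>{..<n} - {fst a}. f (\<phi> [(k, True)]))"
      for f :: "(nat \<times> bool) list \<Rightarrow> nat"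
      using \<nu>(2) \<psi>_eq letter_closed by (intro sum.cong) auto
    have "(\<psi>, \<phi>) \<in> measures [\<lambda>\<phi>. \<Sum>k<n. length (\<phi> [(k, True)]), \<lambda>\<phi>. \<Sum>k<n. wt (\<phi> [(k, True)])]"
      using desc unfolding \<psi>a[symmetric] by (auto simp: split rest sign[OF \<phi>] sign[OF \<psi>])
    then have \<psi>g: "\<psi> \<in> generate Aut short_autos" by (rule less.IH) (rule \<psi>)
    have "length (\<nu> [(i, True)]) \<le> 2" if "i < n" for i
      using \<nu>(2,4) that by (cases "i = fst a") (simp_all add: transvection_word_def)
    then have "\<nu> \<in> short_autos" using \<nu>(1) by (simp add: short_autos_def)
    then have "\<psi> \<otimes>\<^bsub>Aut\<^esub> inv\<^bsub>Aut\<^esub> \<nu> \<in> generate Aut short_autos" by (intro generate.eng \<psi>g generate.inv)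
    moreover have "\<psi> \<otimes>\<^bsub>Aut\<^esub> inv\<^bsub>Aut\<^esub> \<nu> = \<phi>"
    proof -
      have "\<phi> \<in> carrier Aut" "\<nu> \<in> carrier Aut" using \<phi> \<nu>(1) unfolding carrier_Aut by blast+
      then show ?thesis unfolding \<psi>_def by (simp add: A.m_assoc)
    qed
    ultimately show ?thesis by simp
  qed
qed

theorem Aut_finitely_generated: "finite_generating_sets Aut \<noteq> {}"
proof -
  interpret A: group Aut by (rule group_Aut)
  have "short_autos \<subseteq> carrier Aut" by (auto simp: short_autos_def carrier_Aut)
  moreover from A.generate_incl[OF this] have "generate Aut short_autos = carrier Aut"
    using generate_short_autos by (auto simp: carrier_Aut)
  ultimately show ?thesis using finite_short_autos by (auto simp: finite_generating_sets_def)
qed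

end

section \<open>Proof of the theorem\<close>

lemma (in mat_rep) rep_kernel_coset_eq:
  assumes g: "g \<in> carrier G" "h \<in> carrier G" and eq: "rep_kernel #> g = rep_kernel #> h" and ij: "i < n" "j < n"
  shows "M g i j = M h i j"
proof -
  have "g \<in> rep_kernel #> h" using rcos_self[OF g(1) rep_kernel_subgroup] eq by simp
  then obtain k where k: "k \<in> rep_kernel" "g = k \<otimes> h" unfolding r_coset_def by blast
  then have kG: "k \<in> carrier G" by (simp add: rep_kernel_def)
  have "M g i j = (\<Sum>l<n. M \<one> i l * M h l j)" using k kG g(2) ij by (simp add: M_mult rep_kernel_def)
  also have "\<dots> = M (\<one> \<otimes> h) i j" using g(2) ij by (subst M_mult) auto
  finally show ?thesis using g(2) by simp
qed

text \<open>The entries are moved to the algebraic closure, where eigenvalues exist; the embedding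
  is injective, so the image stays infinite.\<close>

theorem linear_group_constants:
  fixes G (structure) and \<rho> :: "'g \<Rightarrow> 'f::field mat"
  assumes "group G" and fg: "finite_generating_sets G \<noteq> {}"
    and \<rho>: "\<rho> \<in> hom G (GL TYPE('f) n)" and inf: "infinite (\<rho> ` carrier G)"
  shows "uniform_kazhdan_const TYPE('i \<Rightarrow> complex) G = 0 \<and> uniform_tau_const TYPE('i \<Rightarrow> complex) G = 0"
proof -
  interpret group G by fact
  let ?R = "ring_mat TYPE('f) n ()"
  interpret R: semiring ?R by (rule semiring_mat)
  have GLgroup: "group (GL TYPE('f) n)" unfolding GL_def by (rule R.units_group)
  have \<rho>C: "\<rho> g \<in> carrier_mat n n" if "g \<in> carrier G" for g
  proof -
    have "\<rho> g \<in> Units ?R" using hom_in_carrier[OF \<rho> that] by (simp add: GL_def units_of_carrier)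
    then have "\<rho> g \<in> carrier ?R" by (rule R.Units_closed)
    then show ?thesis by (simp add: ring_mat_simps)
  qed
  have \<rho>m: "\<rho> (g \<otimes> h) = \<rho> g * \<rho> h" if "g \<in> carrier G" "h \<in> carrier G" for g h
    using hom_mult[OF \<rho> that] by (simp add: GL_def units_of_mult ring_mat_simps)
  interpret \<rho>: group_hom G "GL TYPE('f) n" \<rho>
    by (rule group_hom.intro[OF is_group GLgroup group_hom_axioms.intro[OF \<rho>]])
  have \<rho>1: "\<rho> \<one> = 1\<^sub>m n" using \<rho>.hom_one by (simp add: GL_def units_of_one ring_mat_simps)
  define M where "M g i j = to_ac (\<rho> g $$ (i, j))" for g i j
  have rep: "mat_rep G M n"
  proof
    fix g h i j assume gh: "g \<in> carrier G" "h \<in> carrier G" "i < n" "j < n"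
    have "(\<rho> g * \<rho> h) $$ (i, j) = (\<Sum>l<n. \<rho> g $$ (i, l) * \<rho> h $$ (l, j))"
      using \<rho>C[OF gh(1)] \<rho>C[OF gh(2)] gh(3,4) by (simp add: scalar_prod_def lessThan_atLeast0)
    then show "M (g \<otimes> h) i j = (\<Sum>l<n. M g i l * M h l j)"
      unfolding M_def \<rho>m[OF gh(1,2)] by (simp add: to_ac_sum)
  next
    fix i j assume "i < n" "j < n"
    then show "M \<one> i j = (if i = j then 1 else 0)" unfolding M_def \<rho>1 by simp
  qed
  interpret mat_rep G M n by (rule rep)
  have "infinite (rcosets rep_kernel)"
  proof
    assume fin: "finite (rcosets rep_kernel)"
    have "\<rho> ` carrier G \<subseteq> (\<lambda>C. \<rho> (SOME h. h \<in> carrier G \<and> C = rep_kernel #> h)) ` (rcosets rep_kernel)"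
    proof (rule image_subsetI)
      fix g assume g: "g \<in> carrier G"
      let ?h = "SOME h. h \<in> carrier G \<and> rep_kernel #> g = rep_kernel #> h"
      have "?h \<in> carrier G \<and> rep_kernel #> g = rep_kernel #> ?h" by (rule someI[where x = g]) (simp add: g)
      then have h: "?h \<in> carrier G" "rep_kernel #> g = rep_kernel #> ?h" by blast+
      have "\<rho> g = \<rho> ?h"
      proof (rule eq_matI)
        show "\<rho> g $$ (i, j) = \<rho> ?h $$ (i, j)" if "i < dim_row (\<rho> ?h)" "j < dim_col (\<rho> ?h)" for i j
          using rep_kernel_coset_eq[OF g h, of i j] that \<rho>C[OF h(1)] by (simp add: M_def)
      qed (use \<rho>C[OF g] \<rho>C[OF h(1)] in auto)
      then show "\<rho> g \<in> (\<lambda>C. \<rho> (SOME h. h \<in> carrier G \<and> C = rep_kernel #> h)) ` (rcosets rep_kernel)"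
        by (rule image_eqI) (use g in \<open>auto simp: RCOSETS_def\<close>)
    qed
    then show False using fin inf finite_subset by blast
  qed
  then have "has_supplements G"
    using supplements_char_0[OF _ fg] supplements_char_p[OF rep _ fg] by (cases "CHAR('f alg_closure) = 0") auto
  then show ?thesis by (rule uniform_constants_zero[OF is_group fg])
qed

section \<open>Exponent sums and the action on the abelianisation\<close>

context free_group_rank
begin

text \<open>The \<open>i\<close>-th coordinate in the abelianisation, with values in the rationals
  to have a field of characteristic 0.\<close>

definition expo :: "nat \<Rightarrow> (nat \<times> bool) list \<Rightarrow> rat" where
  "expo i w = (\<Sum>x\<leftarrow>w. if fst x = i then (if snd x then 1 else - 1) else 0)"

lemma expo_push: "expo i (push x w) = expo i [x] + expo i w"
  by (cases w) (auto simp: expo_def inv_letter_def)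

lemma expo_mult: "expo i (u \<otimes>\<^bsub>F\<^esub> v) = expo i u + expo i v"
  unfolding mult_F
proof (induction u)
  case (Cons x u)
  then show ?case using expo_push[of i x "foldr push u v"] by (simp add: expo_def)
qed (simp add: expo_def)

lemma expo_winv: "expo i (winv w) = - expo i w"
  by (induction w) (auto simp: expo_def winv_def inv_letter_def)

text \<open>The exponent sums of the images of the basis form the matrix of \<open>\<phi>\<close> on
  the abelianisation.\<close>

lemma expo_auto:
  assumes \<phi>: "\<phi> \<in> auto F" and w: "w \<in> carrier F"
  shows "expo i (\<phi> w) = (\<Sum>l<n. expo i (\<phi> [(l, True)]) * expo l w)"
  using w
proof (induction w)
  case Nil
  interpret h: group_hom F F \<phi> by (rule autoD(1)[OF \<phi>])
  show ?case using h.hom_one by (simp add: one_F expo_def)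
next
  case (Cons x w)
  note c = Cons_F[OF Cons.prems]
  have x: "fst x < n" using Cons.prems by (simp add: mem_F)
  have "expo i (\<phi> [x]) = (if snd x then 1 else - 1) * expo i (\<phi> [(fst x, True)])"
  proof (cases "snd x")
    case True
    then show ?thesis by (cases x) simp
  next
    case False
    then have "x = inv_letter (fst x, True)" by (cases x) (simp add: inv_letter_def)
    then have "\<phi> [x] = winv (\<phi> [(fst x, True)])" using auto_letter(2)[OF \<phi>, of "(fst x, True)"] x by simp
    then show ?thesis using False by (simp add: expo_winv)
  qed
  also have "\<dots> = (\<Sum>l<n. if l = fst x then (if snd x then 1 else - 1) * expo i (\<phi> [(l, True)]) else 0)"
    using x by simp
  also have "\<dots> = (\<Sum>l<n. expo i (\<phi> [(l, True)]) * expo l [x])"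
    by (intro sum.cong) (auto simp: expo_def)
  finally have 1: "expo i (\<phi> [x]) = (\<Sum>l<n. expo i (\<phi> [(l, True)]) * expo l [x])" .
  have "\<phi> (x # w) = \<phi> [x] \<otimes>\<^bsub>F\<^esub> \<phi> w" using hom_mult[OF autoD(4)[OF \<phi>], of "[x]" w] c by simp
  moreover have "expo l (x # w) = expo l [x] + expo l w" for l by (simp add: expo_def)
  ultimately show ?case using 1 Cons.IH c by (simp add: expo_mult distrib_left sum.distrib)
qed

text \<open>A transvection acts on the abelianisation as an elementary matrix of infinite order; two
  basis elements are needed to have one.\<close>

theorem Aut_constants:
  assumes n: "n \<ge> 2"
  shows "uniform_kazhdan_const TYPE('i \<Rightarrow> complex) Aut = 0 \<and> uniform_tau_const TYPE('i \<Rightarrow> complex) Aut = 0"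
proof -
  interpret A: group Aut by (rule group_Aut)
  define M where "M \<phi> i j = expo i (\<phi> [(j, True)])" for \<phi> :: "(nat \<times> bool) list \<Rightarrow> (nat \<times> bool) list" and i j
  interpret M: mat_rep Aut M n
  proof
    fix \<phi> \<psi> i j assume *: "\<phi> \<in> carrier Aut" "\<psi> \<in> carrier Aut" "i < n" "j < n"
    then have a: "\<phi> \<in> auto F" "\<psi> \<in> auto F" by (simp_all add: carrier_Aut)
    have j: "[(j, True)] \<in> carrier F" using *(4) by (simp add: letter_closed)
    have "(\<phi> \<otimes>\<^bsub>Aut\<^esub> \<psi>) [(j, True)] = \<phi> (\<psi> [(j, True)])"
      unfolding mult_Aut[OF a] using j by (simp add: compose_def)
    then show "M (\<phi> \<otimes>\<^bsub>Aut\<^esub> \<psi>) i j = (\<Sum>l<n. M \<phi> i l * M \<psi> l j)"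
      unfolding M_def using expo_auto[OF a(1) autoD(5)[OF a(2) j]] by simp
  next
    fix i j assume "i < n" "j < n"
    then show "M \<one>\<^bsub>Aut\<^esub> i j = (if i = j then 1 else 0)"
      by (simp add: M_def one_Aut letter_closed expo_def)
  qed
  have "\<exists>\<nu>\<in>auto F. (\<forall>k<n. k \<noteq> fst (0::nat, True) \<longrightarrow> \<nu> [(k, True)] = [(k, True)]) \<and>
    \<nu> [(0, True)] = [(0, True), (1, True)] \<and> \<nu> [(fst (0::nat, True), True)] = transvection_word (0, True) (1, True)"
    by (rule transvection) (use n in auto)
  then obtain \<nu> where \<nu>: "\<nu> \<in> auto F" "\<forall>k<n. k \<noteq> 0 \<longrightarrow> \<nu> [(k, True)] = [(k, True)]" "\<nu> [(0, True)] = [(0, True), (1, True)]"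
    by auto
  have \<nu>A: "\<nu> \<in> carrier Aut" using \<nu>(1) by (simp add: carrier_Aut)
  have \<nu>1: "M \<nu> l 1 = (if l = 1 then 1 else 0)" and \<nu>0: "M \<nu> l 0 = (if l = 0 then 1 else 0) + (if l = 1 then 1 else 0)" for l
    using \<nu> n by (simp_all add: M_def expo_def)
  \<comment> \<open>Only row 1 of the powers is followed; its entry in column 0 counts the
    exponent.\<close>
  have M1: "M (\<nu> [^]\<^bsub>Aut\<^esub> k) 1 1 = 1" and M0: "M (\<nu> [^]\<^bsub>Aut\<^esub> k) 1 0 = of_nat k" for k :: nat
  proof (induction k)
    case 0
    show "M (\<nu> [^]\<^bsub>Aut\<^esub> (0::nat)) 1 1 = 1" "M (\<nu> [^]\<^bsub>Aut\<^esub> (0::nat)) 1 0 = of_nat 0"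
      using n by (simp_all add: M.M_one)
  next
    case (Suc k)
    have e: "M (\<nu> [^]\<^bsub>Aut\<^esub> Suc k) 1 j = (\<Sum>l<n. M (\<nu> [^]\<^bsub>Aut\<^esub> k) 1 l * M \<nu> l j)" if "j < n" for j
      using n that \<nu>A by (simp add: M.M_mult)
    have s: "(\<Sum>l<n. M (\<nu> [^]\<^bsub>Aut\<^esub> k) 1 l * (if l = r then 1 else 0)) = M (\<nu> [^]\<^bsub>Aut\<^esub> k) 1 r" if "r < n" for r
      using that by (simp add: if_distrib cong: if_cong)
    have one: "1 < n" using n by simp
    show "M (\<nu> [^]\<^bsub>Aut\<^esub> Suc k) 1 1 = 1" 
      unfolding e[OF one] \<nu>1 s[OF one] by (rule Suc(1))
    show "M (\<nu> [^]\<^bsub>Aut\<^esub> Suc k) 1 0 = of_nat (Suc k)"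
      using e[of 0] s[of 0] s[of 1] Suc n unfolding \<nu>0 distrib_left sum.distrib by simp
  qed
  have "infinite (rcosets\<^bsub>Aut\<^esub> M.rep_kernel)"
  proof
    assume fin: "finite (rcosets\<^bsub>Aut\<^esub> M.rep_kernel)"
    have "inj (\<lambda>k::nat. M.rep_kernel #>\<^bsub>Aut\<^esub> (\<nu> [^]\<^bsub>Aut\<^esub> k))"
    proof (rule injI)
      fix k l :: nat assume "M.rep_kernel #>\<^bsub>Aut\<^esub> (\<nu> [^]\<^bsub>Aut\<^esub> k) = M.rep_kernel #>\<^bsub>Aut\<^esub> (\<nu> [^]\<^bsub>Aut\<^esub> l)"
      from M.rep_kernel_coset_eq[OF _ _ this, of 1 0] show "k = l" using \<nu>A n unfolding M0 by simp
    qed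
    moreover have "range (\<lambda>k::nat. M.rep_kernel #>\<^bsub>Aut\<^esub> (\<nu> [^]\<^bsub>Aut\<^esub> k)) \<subseteq> rcosets\<^bsub>Aut\<^esub> M.rep_kernel"
      using \<nu>A by (auto simp: RCOSETS_def)
    ultimately show False using fin finite_subset finite_imageD infinite_UNIV_nat by blast
  qed
  then have "has_supplements Aut" by (intro M.supplements_char_0 Aut_finitely_generated) simp_all
  then show ?thesis by (rule uniform_constants_zero[OF group_Aut Aut_finitely_generated])
qed

end

theorem mainTheorem3:
  fixes G :: "('g, 'm) monoid_scheme"
  shows
    "(group G \<and> finite_generating_sets G \<noteq> {} \<and>
      (\<exists>n\<ge>1. \<exists>\<rho>\<in>hom G (GL TYPE('f::field) n). infinite (\<rho> ` carrier G))
      \<longrightarrow> uniform_kazhdan_const TYPE('i \<Rightarrow> complex) G = 0 \<and>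
          uniform_tau_const TYPE('i \<Rightarrow> complex) G = 0)
     \<and> (\<forall>n\<ge>4. uniform_tau_const TYPE('i \<Rightarrow> complex) (AutoGroup (free_group n)) = 0 \<and>
          uniform_kazhdan_const TYPE('i \<Rightarrow> complex) (AutoGroup (free_group n)) = 0)"
proof (intro conjI impI allI)
  assume "group G \<and> finite_generating_sets G \<noteq> {} \<and>
      (\<exists>n\<ge>1. \<exists>\<rho>\<in>hom G (GL TYPE('f) n). infinite (\<rho> ` carrier G))"
  then obtain n \<rho> where "group G" "finite_generating_sets G \<noteq> {}" "\<rho> \<in> hom G (GL TYPE('f) n)" "infinite (\<rho> ` carrier G)"
    by blast
  from linear_group_constants[where 'i = 'i, OF this]
  show "uniform_kazhdan_const TYPE('i \<Rightarrow> complex) G = 0" "uniform_tau_const TYPE('i \<Rightarrow> complex) G = 0" by simp_all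
next
  fix n :: nat assume "4 \<le> n"
  then have "2 \<le> n" by simp
  from free_group_rank.Aut_constants[where 'i = 'i, OF this]
  show "uniform_tau_const TYPE('i \<Rightarrow> complex) (AutoGroup (free_group n)) = 0"
    "uniform_kazhdan_const TYPE('i \<Rightarrow> complex) (AutoGroup (free_group n)) = 0" by simp_all
qed

end
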